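(* Let $\mu_0,\mu_1\in\mathcal P_2(\mathbb R^d)$ with $\operatorname{var}(\mu_i)>0$ for $i=0,1$. Then $\mathcal W^{\mathrm{var}}(\mu_0,\mu_1)<\infty$ and $$\mathcal W^{\mathrm{var}}(\mu_0,\mu_1)^2=\mathcal D^{\mathrm{var}}(\mu_0,\mu_1)^2+\mathcal W^{\mathrm{var}}_{0,1}(\overline\mu_0,\overline\mu_1)^2,$$ where $\overline\mu_0,\overline\mu_1$ are the variance-normalizations of $\mu_0,\mu_1$.
   Context: $\mathcal P_2(\mathbb R^d)$: Borel probability measures with finite second moment; $\mathrm M(\mu)=\int x\,d\mu$; $\operatorname{var}(\mu)=\int|x-\mathrm M(\mu)|^2d\mu$. Variance-normalization of $\mu$ with $\mathrm M(\mu)=m$, $\operatorname{var}(\mu)=\sigma^2>0$: $\overline\mu=T_\#\mu$, $T(x)=(x-m)/\sigma$. $\mathrm{CE}(\mu_0,\mu_1)$: pairs $(\mu,V)$ where $(\mu_t)_{t\in[0,1]}$ is a weakly continuous curve in $\mathcal P_2(\mathbb R^d)$ from $\mu_0$ to $\mu_1$ and $(V_t)$ is a Borel family of vector fields with $\partial_t\mu_t+\nabla\cdot(\mu_tV_t)=0$ in the sense of distributions. $\mathcal W^{\mathrm{var}}(\mu_0,\mu_1)^2=\inf\{\int_0^1\frac1{2\operatorname{var}(\mu_t)}\int|V_t|^2d\mu_tdt:(\mu,V)\in\mathrm{CE}(\mu_0,\mu_1)\}$. $\mathcal W^{\mathrm{var}}_{0,1}(\mu_0,\mu_1)^2=\inf\{\int_0^1\int\frac12|V_t|^2d\mu_tdt:(\mu,V)\in\mathrm{CE}(\mu_0,\mu_1),\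 \mathrm M(\mu_t)=0,\ \operatorname{var}(\mu_t)=1\ \forall t\in[0,1]\}$. $\mathcal D^{\mathrm{var}}(\mu_0,\mu_1)^2=\inf\int_0^1\frac{|\dot m_t|^2+|\dot\sigma_t|^2}{2\sigma_t^2}dt$ over absolutely continuous $m:[0,1]\to\mathbb R^d$, $\sigma:[0,1]\to[0,\infty)$ with $m_i=\mathrm M(\mu_i)$, $\sigma_i^2=\operatorname{var}(\mu_i)$, $i=0,1$. *)

theory Defs
  imports "HOL-Probability.Probability"
begin

text \<open>
  The space \<open>\<real>\<^sup>d\<close> is an arbitrary type of class \<open>euclidean_space\<close>. Curves indexed by \<open>[0,1]\<close> are
  total functions on \<open>real\<close>; no definition below looks at their values outside \<open>{0..1}\<close>.
\<close>

section \<open>Probability measures with finite second moment\<close>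

definition P2 :: "'a::euclidean_space measure set" where
  "P2 = {\<mu>. prob_space \<mu> \<and> sets \<mu> = sets borel \<and> integrable \<mu> (\<lambda>x. (norm x)\<^sup>2)}"

definition barycenter :: "'a::euclidean_space measure \<Rightarrow> 'a" where
  "barycenter \<mu> = (\<integral>x. x \<partial>\<mu>)"

definition var :: "'a::euclidean_space measure \<Rightarrow> real" where
  "var \<mu> = (\<integral>x. (norm (x - barycenter \<mu>))\<^sup>2 \<partial>\<mu>)"

definition variance_normalization :: "'a::euclidean_space measure \<Rightarrow> 'a measure" where
  "variance_normalization \<mu> = distr \<mu> borel (\<lambda>x. (x - barycenter \<mu>) /\<^sub>R sqrt (var \<mu>))"

section \<open>The continuity equation\<close>

definition weakly_continuous_curve :: "(real \<Rightarrow> 'a::euclidean_space measure) \<Rightarrow> bool" where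
  "weakly_continuous_curve \<mu> \<longleftrightarrow>
     (\<forall>f :: 'a \<Rightarrow> real. continuous_on UNIV f \<and> bounded (range f) \<longrightarrow>
        continuous_on {0..1} (\<lambda>t. \<integral>x. f x \<partial>\<mu> t))"

primrec C_diff :: "nat \<Rightarrow> ('b::euclidean_space \<Rightarrow> real) \<Rightarrow> bool" where
  "C_diff 0 f \<longleftrightarrow> continuous_on UNIV f"
| "C_diff (Suc k) f \<longleftrightarrow>
     (\<forall>x. f differentiable (at x)) \<and>
     (\<forall>b\<in>Basis. C_diff k (\<lambda>x. frechet_derivative f (at x) b))"

definition test_functions :: "(real \<times> 'a::euclidean_space \<Rightarrow> real) set" where
  "test_functions = {\<phi>. (\<forall>k. C_diff k \<phi>) \<and>
     compact (closure {p. \<phi> p \<noteq> 0}) \<and> closure {p. \<phi> p \<noteq> 0} \<subseteq> {0<..<1} \<times> UNIV}"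

text \<open>
  The first conjunct says that \<open>\<mu>\<^sub>t V\<^sub>t dt\<close> is a locally finite vector measure on \<open>(0,1) \<times> \<real>\<^sup>d\<close>, so
  that it is a distribution; without it the Bochner integrals in the second conjunct could be \<open>0\<close>
  for want of integrability. The integrand of the second conjunct is
  \<open>\<partial>\<^sub>t \<phi> (t, x) + \<nabla>\<^sub>x \<phi> (t, x) \<bullet> V\<^sub>t x\<close>, the derivative of \<open>\<phi>\<close> at \<open>(t, x)\<close> in the
  direction \<open>(1, V\<^sub>t x)\<close>.
\<close>

definition continuity_equation ::
    "(real \<Rightarrow> 'a::euclidean_space measure) \<Rightarrow> (real \<Rightarrow> 'a \<Rightarrow> 'a) \<Rightarrow> bool" where
  "continuity_equation \<mu> V \<longleftrightarrow>
     (\<forall>K. compact K \<and> K \<subseteq> {0<..<1} \<times> UNIV \<longrightarrow>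
        (\<integral>\<^sup>+t\<in>{0..1}. (\<integral>\<^sup>+x. ennreal (norm (V t x)) * indicator K (t, x) \<partial>\<mu> t) \<partial>lborel) < \<infinity>) \<and>
     (\<forall>\<phi>\<in>test_functions.
        (LINT t:{0..1}|lborel. (\<integral>x. frechet_derivative \<phi> (at (t, x)) (1, V t x) \<partial>\<mu> t)) = 0)"

definition CE :: "'a::euclidean_space measure \<Rightarrow> 'a measure \<Rightarrow>
    ((real \<Rightarrow> 'a measure) \<times> (real \<Rightarrow> 'a \<Rightarrow> 'a)) set" where
  "CE \<mu>\<^sub>0 \<mu>\<^sub>1 = {(\<mu>, V).
     (\<forall>t\<in>{0..1}. \<mu> t \<in> P2) \<and> weakly_continuous_curve \<mu> \<and> \<mu> 0 = \<mu>\<^sub>0 \<and> \<mu> 1 = \<mu>\<^sub>1 \<and>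
     (\<lambda>(t, x). V t x) \<in> borel_measurable (restrict_space borel {0..1} \<Otimes>\<^sub>M borel) \<and>
     continuity_equation \<mu> V}"

section \<open>Absolutely continuous curves\<close>

definition absolutely_continuous_on_unit :: "(real \<Rightarrow> 'b::real_normed_vector) \<Rightarrow> bool" where
  "absolutely_continuous_on_unit f \<longleftrightarrow>
     (\<forall>\<epsilon>>0. \<exists>\<delta>>0. \<forall>(n::nat) u v.
        (\<forall>i<n. 0 \<le> u i \<and> u i \<le> v i \<and> v i \<le> 1) \<and>
        (\<forall>i<n. \<forall>j<n. i \<noteq> j \<longrightarrow> {u i<..<v i} \<inter> {u j<..<v j} = {}) \<and>
        (\<Sum>i<n. v i - u i) < \<delta> \<longrightarrow>
        (\<Sum>i<n. norm (f (v i) - f (u i))) < \<epsilon>)"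

section \<open>The three transport costs\<close>

text \<open>
  An infimum over the empty set is \<open>\<infinity>\<close>. Quotients are taken in \<open>ennreal\<close>, where
  \<open>a / 0 = \<infinity>\<close> for \<open>a > 0\<close> and \<open>0 / 0 = 0\<close>.
\<close>

definition esqrt :: "ennreal \<Rightarrow> ennreal" where
  "esqrt x = (if x = \<infinity> then \<infinity> else ennreal (sqrt (enn2real x)))"

lemma esqrt_power2: "(esqrt x)\<^sup>2 = x"
  by (cases x) (auto simp: esqrt_def ennreal_power)

definition W_var :: "'a::euclidean_space measure \<Rightarrow> 'a measure \<Rightarrow> ennreal" where
  "W_var \<mu>\<^sub>0 \<mu>\<^sub>1 = esqrt (INF (\<mu>, V) \<in> CE \<mu>\<^sub>0 \<mu>\<^sub>1.
     \<integral>\<^sup>+t\<in>{0..1}. (\<integral>\<^sup>+x. ennreal ((norm (V t x))\<^sup>2) \<partial>\<mu> t) / ennreal (2 * var (\<mu> t)) \<partial>lborel)"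

definition W_var01 :: "'a::euclidean_space measure \<Rightarrow> 'a measure \<Rightarrow> ennreal" where
  "W_var01 \<mu>\<^sub>0 \<mu>\<^sub>1 = esqrt (INF (\<mu>, V) \<in> {(\<mu>, V). (\<mu>, V) \<in> CE \<mu>\<^sub>0 \<mu>\<^sub>1 \<and>
       (\<forall>t\<in>{0..1}. barycenter (\<mu> t) = 0 \<and> var (\<mu> t) = 1)}.
     \<integral>\<^sup>+t\<in>{0..1}. (\<integral>\<^sup>+x. ennreal ((norm (V t x))\<^sup>2 / 2) \<partial>\<mu> t) \<partial>lborel)"

text \<open>
  The derivatives exist at almost every \<open>t\<close>, and \<open>vector_derivative\<close> has an arbitrary value
  on the remaining null set, which does not affect the integral.
\<close>

definition D_var :: "'a::euclidean_space measure \<Rightarrow> 'a measure \<Rightarrow> ennreal" where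
  "D_var \<mu>\<^sub>0 \<mu>\<^sub>1 = esqrt (INF (m, \<sigma>) \<in> {(m :: real \<Rightarrow> 'a, \<sigma> :: real \<Rightarrow> real).
       absolutely_continuous_on_unit m \<and> absolutely_continuous_on_unit \<sigma> \<and>
       (\<forall>t\<in>{0..1}. 0 \<le> \<sigma> t) \<and>
       m 0 = barycenter \<mu>\<^sub>0 \<and> m 1 = barycenter \<mu>\<^sub>1 \<and>
       (\<sigma> 0)\<^sup>2 = var \<mu>\<^sub>0 \<and> (\<sigma> 1)\<^sup>2 = var \<mu>\<^sub>1}.
     \<integral>\<^sup>+t\<in>{0..1}. ennreal ((norm (vector_derivative m (at t within {0..1})))\<^sup>2
                        + \<bar>vector_derivative \<sigma> (at t within {0..1})\<bar>\<^sup>2)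
               / ennreal (2 * (\<sigma> t)\<^sup>2) \<partial>lborel)"

end

(*
  Write V_t(m_t + s_t y) = m_t' + s_t' y + s_t W_t(y), where m_t and s_t^2 are the mean and the
  variance of mu_t. The field W drives the normalized curve, for which the evolution of the first
  two moments forces the orthogonality relations int W_t = 0 and int y . W_t(y) = 0. Hence the
  cross terms vanish and, for almost every t,

    int |V_t|^2 dmu_t / (2 s_t^2) = (|m_t'|^2 + |s_t'|^2) / (2 s_t^2) + 1/2 int |W_t|^2.

  Reading this identity in the two directions (normalizing a curve, or transporting a normalized
  curve by y |-> m_t + s_t y) gives the two inequalities. The analytic input is the following.
  A push-forward by time-dependent affine maps with absolutely continuous coefficients preserves
  solutions of the continuity equation: freeze the maps on the intervals of a uniform grid and let
  the mesh tend to 0. A curve of finite cost has bounded second moments and never loses its variance: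
  for each p, f(t) = int |x - p|^2 dmu_t satisfies |f'| <= k f with k integrable; since f is at first
  only lower semicontinuous, its local boundedness on some interval comes from Baire's theorem.
  Finally, the cost is finite because the independent coupling of mu_0 and mu_1, interpolated
  linearly and with velocity the conditional expectation of X_1 - X_0 given X_t, has finite energy
  and variance bounded below.
*)

theory Submission
  imports Defs
begin

section \<open>Absolutely continuous functions\<close>

text \<open>The cost weights the energy by 1/var, so a bound on it does not at once bound the energy
  or the second moments: testing the continuity equation with |x - p|^2 requires finite energy, this
  requires a bounded variance, and that is what the test should deliver. Hence the estimates are
  first stated conditionally, on intervals where the moment is bounded. The rate \<open>k\<close> is
  the same for every p, so p may be the barycenter at a supposed time of collapse. The velocity is
  merely measurable, so there is no flow to transport, and the affine maps are merely absolutely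
  continuous in time, so a test function composed with them is no test function; this forces the
  freezing of the maps. \<open>D_var\<close> integrates pointwise derivatives of functions given by
  the epsilon-delta condition. The link is Lebesgue differentiation together with a density for
  every absolutely continuous function. Independence of the coupling serves the lower bound on the
  variance: given one endpoint, the interpolant is an affine image of the other. Finiteness is used
  in the splitting as well, to subtract in \<open>ennreal\<close>.\<close>

lemma set_integral_Icc_split:
  fixes g :: "real \<Rightarrow> 'b::{banach, second_countable_topology}"
  assumes g: "set_integrable lborel {s..u} g" and "s \<le> t" "t \<le> u"
  shows "(LINT r:{s..u}|lborel. g r) = (LINT r:{s..t}|lborel. g r) + (LINT r:{t..u}|lborel. g r)"
proof -
  have "{s..u} = {s..t} \<union> {t<..u}"
    using assms by auto
  then have "(LINT r:{s..u}|lborel. g r) = (LINT r:{s..t}|lborel. g r) + (LINT r:{t<..u}|lborel. g r)"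
    using assms by (auto intro!: set_integral_Un set_integrable_subset[OF g])
  also have "(LINT r:{t<..u}|lborel. g r) = (LINT r:{t..u}|lborel. g r)"
    unfolding set_lebesgue_integral_def
  proof (rule integral_cong_AE)
    have 1: "set_integrable lborel {t<..u} g" "set_integrable lborel {t..u} g"
      using assms by (auto intro!: set_integrable_subset[OF g])
    show "(\<lambda>x. indicat_real {t<..u} x *\<^sub>R g x) \<in> borel_measurable lborel"
      "(\<lambda>x. indicat_real {t..u} x *\<^sub>R g x) \<in> borel_measurable lborel"
      using 1 unfolding set_integrable_def by (auto dest: borel_measurable_integrable)
    show "AE x in lborel. indicat_real {t<..u} x *\<^sub>R g x = indicat_real {t..u} x *\<^sub>R g x"
      using AE_lborel_singleton[of t] by eventually_elim (auto simp: indicator_def)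
  qed
  finally show ?thesis .
qed

text \<open>Vitali covering argument. Inside an open set around {g < q} where the positive part of g
  - q has little mass, disjoint intervals on which g has mean above q' must have small total length,
  because each carries mass at least q' - q per unit length.\<close>

lemma negligible_large_slopes:
  fixes g :: "real \<Rightarrow> real"
  assumes int: "integrable lborel g" and q: "q < q'"
  defines "E \<equiv> {x\<in>{0<..<1}. g x < q \<and>
    (\<forall>d>0. \<exists>u v. u \<le> x \<and> x \<le> v \<and> u < v \<and> v - u < d \<and> q' * (v - u) < (LINT r:{u..v}|lborel. g r))}"
  shows "negligible E"
  unfolding negligible_outer_le
proof (intro allI impI)
  fix e :: real assume e: "e > 0"
  have [measurable]: "g \<in> borel_measurable borel"
    using borel_measurable_integrable[OF int] by simp
  \<comment> \<open>Cutting g - q off at 0 and outside [0, 1] gives a finite measure, to which outer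
    regularity applies, and one that vanishes on {g < q}.\<close>
  define p where "p r = max 0 (g r - q) * indicator {0..1} r" for r
  have p0: "0 \<le> p r" for r by (simp add: p_def)
  have pint: "integrable lborel p"
  proof (rule Bochner_Integration.integrable_bound)
    show "integrable lborel (\<lambda>r. \<bar>g r\<bar> + \<bar>q\<bar> * indicator {0..1::real} r)"
      by (intro Bochner_Integration.integrable_add integrable_abs int
          integrable_mult_right integrable_real_indicator) auto
    show "p \<in> borel_measurable lborel"
      unfolding p_def by measurable
    show "AE x in lborel. norm (p x) \<le> norm (\<bar>g x\<bar> + \<bar>q\<bar> * indicator {0..1} x)"
      by (intro AE_I2) (auto simp: p_def indicator_def)
  qed
  define \<nu> where "\<nu> = density lborel (\<lambda>r. ennreal (p r))"
  have [measurable]: "p \<in> borel_measurable borel"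
    using borel_measurable_integrable[OF pint] by simp
  have \<nu>_fin: "emeasure \<nu> (space \<nu>) \<noteq> \<infinity>"
    using pint p0 unfolding \<nu>_def by (simp add: emeasure_density nn_integral_eq_integral)
  define A where "A = {x\<in>{0<..<1}. g x < q}"
  have A: "A \<in> sets borel"
    unfolding A_def by measurable
  have "emeasure \<nu> A = (\<integral>\<^sup>+x. ennreal (p x) * indicator A x \<partial>lborel)"
    unfolding \<nu>_def using A by (subst emeasure_density) auto
  also have "\<dots> = (\<integral>\<^sup>+x. 0 \<partial>(lborel::real measure))"
    by (rule nn_integral_cong) (auto simp: p_def A_def indicator_def)
  finally have "emeasure \<nu> A = 0" by simp
  moreover have "emeasure \<nu> A = (INF U \<in> {U. A \<subseteq> U \<and> open U}. emeasure \<nu> U)"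
    by (rule outer_regular) (use \<nu>_fin A in \<open>auto simp: \<nu>_def\<close>)
  moreover have "0 < ennreal (e * (q' - q))"
    using e q by simp
  ultimately have "(INF U \<in> {U. A \<subseteq> U \<and> open U}. emeasure \<nu> U) < ennreal (e * (q' - q))"
    by simp
  then obtain U where U: "A \<subseteq> U" "open U" "emeasure \<nu> U < ennreal (e * (q' - q))"
    unfolding INF_less_iff by auto
  define W where "W = U \<inter> {0<..<1}"
  have W: "open W" "A \<subseteq> W" "W \<subseteq> {0<..<1}" "W \<subseteq> U"
    using U by (auto simp: W_def A_def)
  \<comment> \<open>Pairs of midpoint and radius. The intervals in \<open>E\<close> contain x at an
    arbitrary place, and Vitali's theorem admits balls not centred at the covered point.\<close>
  define K where "K = {(c, r). 0 < r \<and> cball c r \<subseteq> W \<and> q' * (2 * r) < (LINT x:{c - r..c + r}|lborel. g x)}"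
  have K: "0 < snd i" if "i \<in> K" for i using that by (auto simp: K_def)
  obtain C where C: "countable C" "C \<subseteq> K"
     "pairwise (\<lambda>i j. disjnt (cball (fst i) (snd i)) (cball (fst j) (snd j))) C"
     "negligible (E - (\<Union>i \<in> C. cball (fst i) (snd i)))"
  proof (rule Vitali_covering_theorem_cballs[of K snd E fst])
    show "0 < snd i" if "i \<in> K" for i using K that .
    fix x d :: real assume x: "x \<in> E" and d: "0 < d"
    then have "x \<in> W" using W by (auto simp: E_def A_def)
    then obtain \<rho> where \<rho>: "\<rho> > 0" "ball x \<rho> \<subseteq> W"
      using W(1) openE by blast
    obtain u v where uv: "u \<le> x" "x \<le> v" "u < v" "v - u < min d \<rho>"
      "q' * (v - u) < (LINT r:{u..v}|lborel. g r)"
      using x d \<rho> unfolding E_def by (auto dest!: spec[of _ "min d \<rho>"])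
    have cb: "cball ((u + v) / 2) ((v - u) / 2) = {u..v}"
      unfolding cball_eq_atLeastAtMost by (simp add: field_simps)
    have "{u..v} \<subseteq> ball x \<rho>" using uv by (auto simp: dist_real_def)
    then have "((u + v) / 2, (v - u) / 2) \<in> K"
      using uv \<rho> cb unfolding K_def by (auto simp: field_simps)
    with uv d cb show "\<exists>i. i \<in> K \<and> x \<in> cball (fst i) (snd i) \<and> snd i < d"
      by (intro exI[of _ "((u + v) / 2, (v - u) / 2)"]) auto
  qed
  define T where "T = (\<Union>i \<in> C. cball (fst i) (snd i))"
  have disj: "disjoint_family_on (\<lambda>i. cball (fst i) (snd i)) C"
    using C(3) by (auto simp: disjoint_family_on_def pairwise_def disjnt_def)
  have slope: "ennreal (q' - q) * emeasure lborel (cball (fst i) (snd i)) \<le> emeasure \<nu> (cball (fst i) (snd i))"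
    if "i \<in> C" for i
  proof -
    obtain c r where i: "i = (c, r)" by (cases i)
    then have r: "0 < r" "cball c r \<subseteq> W" "q' * (2 * r) < (LINT x:{c - r..c + r}|lborel. g x)"
      using that C(2) by (auto simp: K_def)
    have sub: "{c - r..c + r} \<subseteq> {0..1}"
      using r(2) W(3) by (force simp: cball_eq_atLeastAtMost)
    have gi: "set_integrable lborel {c - r..c + r} g"
      using int unfolding set_integrable_def by (intro integrable_mult_indicator) auto
    have pi: "set_integrable lborel {c - r..c + r} p"
      using pint unfolding set_integrable_def by (intro integrable_mult_indicator) auto
    have ci: "set_integrable lborel {c - r..c + r} (\<lambda>_. q)"
      unfolding set_integrable_def by (intro borel_integrable_compact) auto
    have "(q' - q) * (2 * r) \<le> (LINT x:{c - r..c + r}|lborel. g x) - (LINT x:{c - r..c + r}|lborel. q)"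
      using r by (simp add: algebra_simps set_lebesgue_integral_def)
    also have "\<dots> = (LINT x:{c - r..c + r}|lborel. g x - q)"
      using gi ci by (simp add: set_integral_diff)
    also have "\<dots> \<le> (LINT x:{c - r..c + r}|lborel. p x)"
    proof (rule set_integral_mono)
      show "set_integrable lborel {c - r..c + r} (\<lambda>x. g x - q)"
        using gi ci by (rule set_integral_diff)
      show "set_integrable lborel {c - r..c + r} p" by (rule pi)
    qed (use sub in \<open>auto simp: p_def\<close>)
    finally have "ennreal ((q' - q) * (2 * r)) \<le> ennreal (LINT x:{c - r..c + r}|lborel. p x)"
      by (rule ennreal_leI)
    also have "\<dots> = emeasure \<nu> (cball c r)"
    proof -
      have "emeasure \<nu> (cball c r) = (\<integral>\<^sup>+x. ennreal (indicator {c - r..c + r} x *\<^sub>R p x) \<partial>lborel)"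
        unfolding \<nu>_def by (subst emeasure_density)
          (auto intro!: nn_integral_cong simp: cball_eq_atLeastAtMost indicator_def)
      also have "\<dots> = ennreal (LINT x:{c - r..c + r}|lborel. p x)"
        unfolding set_lebesgue_integral_def
        by (rule nn_integral_eq_integral) (use pi p0 in \<open>auto simp: set_integrable_def\<close>)
      finally show ?thesis by simp
    qed
    finally show ?thesis
      using r q by (simp add: i cball_eq_atLeastAtMost ennreal_mult)
  qed
  have "ennreal (q' - q) * emeasure lborel T =
      (\<integral>\<^sup>+i. ennreal (q' - q) * emeasure lborel (cball (fst i) (snd i)) \<partial>count_space C)"
    unfolding T_def by (subst emeasure_UN_countable)
      (use C(1) disj in \<open>auto simp: nn_integral_cmult\<close>)
  also have "\<dots> \<le> (\<integral>\<^sup>+i. emeasure \<nu> (cball (fst i) (snd i)) \<partial>count_space C)"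
    by (intro nn_integral_mono) (use slope in auto)
  also have "\<dots> = emeasure \<nu> T"
    unfolding T_def by (subst emeasure_UN_countable) (use C(1) disj in \<open>auto simp: \<nu>_def\<close>)
  also have "\<dots> \<le> emeasure \<nu> U"
    using C(2) W U(2) by (intro emeasure_mono) (fastforce simp: T_def K_def \<nu>_def)+
  also have "\<dots> \<le> ennreal (q' - q) * ennreal e"
    using U(3) e q by (simp add: ennreal_mult[symmetric] mult.commute less_imp_le)
  finally have T: "emeasure lborel T \<le> ennreal e"
    using q by (subst (asm) ennreal_mult_le_mult_iff) auto
  have Tb: "T \<in> sets borel"
    unfolding T_def using C(1) by (intro sets.countable_UN') auto
  then have "T \<in> lmeasurable"
    using le_less_trans[OF T ennreal_less_top] by (simp add: fmeasurable_def emeasure_completion)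
  moreover have "measure lebesgue T \<le> e"
    using T Tb e by (simp add: measure_def emeasure_completion enn2real_leI)
  moreover have neg: "negligible (E - T)" using C(4) by (simp add: T_def)
  ultimately have "T \<union> (E - T) \<in> lmeasurable" "measure lebesgue (T \<union> (E - T)) \<le> e"
    using fmeasurable.Un[OF _ negligible_imp_measurable[OF neg], of T]
      measure_Un_null_set[of T lebesgue "E - T"] negligible_iff_null_sets[of "E - T"]
    by (auto simp del: Un_Diff_cancel)
  then show "\<exists>T. E \<subseteq> T \<and> T \<in> lmeasurable \<and> measure lebesgue T \<le> e"
    by (intro exI[of _ "T \<union> (E - T)"]) auto
qed

text \<open>An exceptional point lies in \<open>E q q'\<close> for some rational q < q' strictly
  between g x and g x + e, so countably many negligible sets suffice.\<close>

lemma AE_slopes_le: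
  fixes g :: "real \<Rightarrow> real"
  assumes int: "integrable lborel g"
  shows "AE x in lborel. x \<in> {0<..<1} \<longrightarrow> (\<forall>e>0. \<exists>d>0. \<forall>u v. u \<le> x \<and> x \<le> v \<and> u < v \<and> v - u < d \<longrightarrow>
     (LINT r:{u..v}|lborel. g r) \<le> (g x + e) * (v - u))"
proof -
  define E where "E q q' = {x\<in>{0<..<1}. g x < q \<and>
    (\<forall>d>0. \<exists>u v. u \<le> x \<and> x \<le> v \<and> u < v \<and> v - u < d \<and> q' * (v - u) < (LINT r:{u..v}|lborel. g r))}" for q q'
  have "AE x in lebesgue. x \<notin> E q q'" if "q < q'" for q q'
    using negligible_large_slopes[OF int that] unfolding E_def[symmetric] negligible_iff_null_sets
    by (rule AE_not_in)
  then have "AE x in lebesgue. \<forall>q\<in>\<rat>. \<forall>q'\<in>\<rat>. q < q' \<longrightarrow> x \<notin> E q q'"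
    by (simp add: AE_ball_countable countable_rat)
  then have "AE x in lborel. \<forall>q\<in>\<rat>. \<forall>q'\<in>\<rat>. q < q' \<longrightarrow> x \<notin> E q q'"
    by (simp add: AE_completion_iff)
  then show ?thesis
  proof eventually_elim
    case (elim x)
    show ?case
    proof (intro impI allI)
      fix e :: real assume x: "x \<in> {0<..<1}" and e: "e > 0"
      obtain q where q: "q \<in> \<rat>" "g x < q" "q < g x + e"
        using Rats_dense_in_real[of "g x" "g x + e"] e by auto
      obtain q' where q': "q' \<in> \<rat>" "q < q'" "q' < g x + e"
        using Rats_dense_in_real[of q "g x + e"] q by auto
      have "x \<notin> E q q'" using elim q q' by blast
      then obtain d where d: "d > 0" "\<And>u v. u \<le> x \<and> x \<le> v \<and> u < v \<and> v - u < d \<Longrightarrow>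
         (LINT r:{u..v}|lborel. g r) \<le> q' * (v - u)"
        using x q unfolding E_def by force
      have "q' * (v - u) \<le> (g x + e) * (v - u)" if "u < v" for u v
        using q' that by (intro mult_right_mono) auto
      then show "\<exists>d>0. \<forall>u v. u \<le> x \<and> x \<le> v \<and> u < v \<and> v - u < d \<longrightarrow>
          (LINT r:{u..v}|lborel. g r) \<le> (g x + e) * (v - u)"
        using d by (intro exI[of _ d]) (meson order_trans)
    qed
  qed
qed

text \<open>The upper slope bound for g and for -g bounds the slopes from both sides. The intervals
  in \<open>AE_slopes_le\<close> may have x as an endpoint, so left and right difference quotients
  are covered.\<close>

lemma lebesgue_differentiation_real:
  fixes g :: "real \<Rightarrow> real"
  assumes int: "integrable lborel g"
  shows "AE x in lborel. x \<in> {0<..<1} \<longrightarrow>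
     ((\<lambda>t. LINT r:{0..t}|lborel. g r) has_vector_derivative g x) (at x)"
proof -
  have gi: "set_integrable lborel A g" if "A \<in> sets borel" for A
    using int that unfolding set_integrable_def by (intro integrable_mult_indicator) auto
  have int': "integrable lborel (\<lambda>x. - g x)" using int by simp
  show ?thesis
    using AE_slopes_le[OF int] AE_slopes_le[OF int']
  proof eventually_elim
    case (elim x)
    show ?case
    proof
      assume x: "x \<in> {0<..<1}"
      let ?F = "\<lambda>t. LINT r:{0..t}|lborel. g r"
      have slope: "\<exists>d>0. \<forall>u v. 0 \<le> u \<and> u \<le> x \<and> x \<le> v \<and> u < v \<and> v - u < d \<longrightarrow>
          \<bar>?F v - ?F u - g x * (v - u)\<bar> \<le> e * (v - u)" if e: "e > 0" for e
      proof -
        obtain d1 where d1: "d1 > 0" "\<And>u v. u \<le> x \<and> x \<le> v \<and> u < v \<and> v - u < d1 \<Longrightarrow>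
           (LINT r:{u..v}|lborel. g r) \<le> (g x + e) * (v - u)"
          using elim(1) x e by blast
        obtain d2 where d2: "d2 > 0" "\<And>u v. u \<le> x \<and> x \<le> v \<and> u < v \<and> v - u < d2 \<Longrightarrow>
           (LINT r:{u..v}|lborel. - g r) \<le> (- g x + e) * (v - u)"
          using elim(2) x e by blast
        show ?thesis
        proof (intro exI[of _ "min d1 d2"] conjI allI impI)
          show "min d1 d2 > 0" using d1 d2 by simp
          fix u v assume uv: "0 \<le> u \<and> u \<le> x \<and> x \<le> v \<and> u < v \<and> v - u < min d1 d2"
          have "?F v - ?F u = (LINT r:{u..v}|lborel. g r)"
            using set_integral_Icc_split[of 0 v g u] gi uv by simp
          moreover have "(LINT r:{u..v}|lborel. g r) \<le> (g x + e) * (v - u)"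
            using d1(2)[of u v] uv by simp
          moreover have "- (LINT r:{u..v}|lborel. g r) \<le> (- g x + e) * (v - u)"
            using d2(2)[of u v] uv gi by (simp add: set_integral_uminus)
          ultimately show "\<bar>?F v - ?F u - g x * (v - u)\<bar> \<le> e * (v - u)"
            by (simp add: abs_le_iff algebra_simps)
        qed
      qed
      show "(?F has_vector_derivative g x) (at x)"
        unfolding has_vector_derivative_def has_derivative_at_alt
      proof (intro conjI allI impI bounded_linear_scaleR_left)
        fix e :: real assume "e > 0"
        then obtain d where d: "d > 0" "\<And>u v. 0 \<le> u \<and> u \<le> x \<and> x \<le> v \<and> u < v \<and> v - u < d \<Longrightarrow>
          \<bar>?F v - ?F u - g x * (v - u)\<bar> \<le> e * (v - u)"
          using slope by meson
        show "\<exists>d>0. \<forall>y. norm (y - x) < d \<longrightarrow> norm (?F y - ?F x - (y - x) *\<^sub>R g x) \<le> e * norm (y - x)"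
        proof (intro exI[of _ "min d x"] conjI allI impI)
          show "min d x > 0" using d x by simp
          fix y assume y: "norm (y - x) < min d x"
          then have "0 \<le> y" by (auto simp: abs_if split: if_splits)
          consider "y = x" | "y < x" | "x < y" by linarith
          then show "norm (?F y - ?F x - (y - x) *\<^sub>R g x) \<le> e * norm (y - x)"
          proof cases
            case 2
            have "\<bar>?F x - ?F y - g x * (x - y)\<bar> \<le> e * (x - y)"
              using d(2)[of y x] y 2 \<open>0 \<le> y\<close> by simp
            moreover have "?F x - ?F y - g x * (x - y) = - (?F y - ?F x - (y - x) *\<^sub>R g x)"
              by (simp add: algebra_simps)
            ultimately show ?thesis using 2 by simp
          next
            case 3
            then show ?thesis using d(2)[of x y] y x by (simp add: mult.commute)
          qed auto
        qed
      qed
    qed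
  qed
qed

section \<open>Finite families of non-overlapping intervals, and total variation\<close>

definition interval_family :: "real \<Rightarrow> real \<Rightarrow> 'i set \<Rightarrow> ('i \<Rightarrow> real) \<Rightarrow> ('i \<Rightarrow> real) \<Rightarrow> bool" where
  "interval_family a b I u v \<longleftrightarrow> finite I \<and> (\<forall>i\<in>I. a \<le> u i \<and> u i \<le> v i \<and> v i \<le> b) \<and>
     (\<forall>i\<in>I. \<forall>j\<in>I. i \<noteq> j \<longrightarrow> {u i<..<v i} \<inter> {u j<..<v j} = {})"

lemma interval_familyD:
  assumes "interval_family a b I u v"
  shows "finite I" "i \<in> I \<Longrightarrow> a \<le> u i" "i \<in> I \<Longrightarrow> u i \<le> v i" "i \<in> I \<Longrightarrow> v i \<le> b"
    "i \<in> I \<Longrightarrow> j \<in> I \<Longrightarrow> i \<noteq> j \<Longrightarrow> {u i<..<v i} \<inter> {u j<..<v j} = {}"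
  using assms unfolding interval_family_def by blast+

lemma interval_family_reindex:
  assumes "inj_on h J" and "interval_family a b (h ` J) u v"
  shows "interval_family a b J (u \<circ> h) (v \<circ> h)"
proof -
  have "finite J" using assms finite_imageD by (auto simp: interval_family_def)
  moreover have "{u (h i)<..<v (h i)} \<inter> {u (h j)<..<v (h j)} = {}" if "i \<in> J" "j \<in> J" "i \<noteq> j" for i j
    using interval_familyD(5)[OF assms(2), of "h i" "h j"] that assms(1) by (auto dest: inj_onD)
  ultimately show ?thesis
    using interval_familyD(2-4)[OF assms(2)] unfolding interval_family_def by auto
qed

text \<open>The definition indexes families by an initial segment of the naturals, but the families
  built later are indexed by pairs, by sets of reals or by a single point; hence the free index
  type.\<close>

lemma absolutely_continuous_on_unitD:
  fixes f :: "real \<Rightarrow> 'b::real_normed_vector"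
  assumes "absolutely_continuous_on_unit f" and "\<epsilon> > 0"
  obtains \<delta> where "\<delta> > 0" "\<And>(I :: 'i set) u v. interval_family 0 1 I u v \<Longrightarrow>
    (\<Sum>i\<in>I. v i - u i) < \<delta> \<Longrightarrow> (\<Sum>i\<in>I. norm (f (v i) - f (u i))) < \<epsilon>"
proof -
  from assms obtain \<delta> where \<delta>: "\<delta> > 0" "\<And>(n::nat) u v.
        (\<forall>i<n. 0 \<le> u i \<and> u i \<le> v i \<and> v i \<le> 1) \<and>
        (\<forall>i<n. \<forall>j<n. i \<noteq> j \<longrightarrow> {u i<..<v i} \<inter> {u j<..<v j} = {}) \<and>
        (\<Sum>i<n. v i - u i) < \<delta> \<Longrightarrow> (\<Sum>i<n. norm (f (v i) - f (u i))) < \<epsilon>"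
    unfolding absolutely_continuous_on_unit_def by meson
  show ?thesis
  proof (rule that[OF \<delta>(1)])
    fix I :: "'i set" and u v
    assume fam: "interval_family 0 1 I u v" and less: "(\<Sum>i\<in>I. v i - u i) < \<delta>"
    obtain h where h: "bij_betw h {..<card I} I"
      using ex_bij_betw_nat_finite[OF interval_familyD(1)[OF fam]] by (auto simp: atLeast0LessThan)
    then have hI: "h ` {..<card I} = I" "inj_on h {..<card I}" by (auto simp: bij_betw_def)
    have fam': "interval_family 0 1 {..<card I} (u \<circ> h) (v \<circ> h)"
      using interval_family_reindex[OF hI(2)] fam hI(1) by simp
    have "(\<Sum>i<card I. (v \<circ> h) i - (u \<circ> h) i) < \<delta>"
      using less sum.reindex_bij_betw[OF h, of "\<lambda>i. v i - u i"] by simp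
    moreover have "\<forall>i<card I. 0 \<le> (u \<circ> h) i \<and> (u \<circ> h) i \<le> (v \<circ> h) i \<and> (v \<circ> h) i \<le> 1"
      "\<forall>i<card I. \<forall>j<card I. i \<noteq> j \<longrightarrow>
         {(u \<circ> h) i<..<(v \<circ> h) i} \<inter> {(u \<circ> h) j<..<(v \<circ> h) j} = {}"
      using fam' unfolding interval_family_def Ball_def lessThan_iff by blast+
    ultimately have "(\<Sum>i<card I. norm (f ((v \<circ> h) i) - f ((u \<circ> h) i))) < \<epsilon>"
      by (intro \<delta>(2)) blast
    then show "(\<Sum>i\<in>I. norm (f (v i) - f (u i))) < \<epsilon>"
      using sum.reindex_bij_betw[OF h, of "\<lambda>i. norm (f (v i) - f (u i))"] by simp
  qed
qed

lemma sum_interval_lengths_le: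
  assumes fam: "interval_family a b I u v" and "a \<le> b"
  shows "(\<Sum>i\<in>I. v i - u i) \<le> b - a"
proof -
  have "ennreal (\<Sum>i\<in>I. v i - u i) = (\<Sum>i\<in>I. emeasure lborel {u i<..<v i})"
    using interval_familyD[OF fam] by (subst sum_ennreal[symmetric]) auto
  also have "\<dots> = emeasure lborel (\<Union>i\<in>I. {u i<..<v i})"
    using interval_familyD[OF fam]
    by (intro sum_emeasure) (auto simp: disjoint_family_on_def)
  also have "\<dots> \<le> emeasure lborel {a..b}"
    using interval_familyD[OF fam] by (intro emeasure_mono) force+
  also have "\<dots> = ennreal (b - a)" using \<open>a \<le> b\<close> by simp
  finally show ?thesis using \<open>a \<le> b\<close> by simp
qed

text \<open>The families need not exhaust [a, b], as a gap contributes nothing. The supremum is that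
  over partitions, but families can be restricted and joined without refinement.\<close>

definition variation_sums :: "(real \<Rightarrow> real) \<Rightarrow> real \<Rightarrow> real \<Rightarrow> real set" where
  "variation_sums f a b = {(\<Sum>i\<in>I. \<bar>f (v i) - f (u i)\<bar>) | (I :: nat set) u v. interval_family a b I u v}"

definition total_variation :: "(real \<Rightarrow> real) \<Rightarrow> real \<Rightarrow> real \<Rightarrow> real" where
  "total_variation f a b = Sup (variation_sums f a b)"

lemma variation_sumsI:
  fixes I :: "'i set"
  assumes "interval_family a b I u v"
  shows "(\<Sum>i\<in>I. \<bar>f (v i) - f (u i)\<bar>) \<in> variation_sums f a b"
proof -
  obtain h where h: "bij_betw h {..<card I} I"
    using ex_bij_betw_nat_finite[OF interval_familyD(1)[OF assms]] by (auto simp: atLeast0LessThan)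
  then have hI: "h ` {..<card I} = I" "inj_on h {..<card I}" by (auto simp: bij_betw_def)
  have fam': "interval_family a b {..<card I} (u \<circ> h) (v \<circ> h)"
    using interval_family_reindex[OF hI(2)] assms hI(1) by simp
  have "(\<Sum>i\<in>I. \<bar>f (v i) - f (u i)\<bar>) = (\<Sum>i<card I. \<bar>f ((v \<circ> h) i) - f ((u \<circ> h) i)\<bar>)"
    using sum.reindex_bij_betw[OF h, of "\<lambda>i. \<bar>f (v i) - f (u i)\<bar>"] by simp
  with fam' show ?thesis unfolding variation_sums_def by blast
qed

lemma variation_sums_zero: "0 \<in> variation_sums f a b"
  using variation_sumsI[of a b "{} :: nat set" "\<lambda>_. 0" "\<lambda>_. 0" f] by (simp add: interval_family_def)

text \<open>Each interval is cut at c by \<open>min\<close> and \<open>max\<close>; on the side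
  where it does not reach, it degenerates to the point c and adds 0.\<close>

lemma variation_sums_split:
  assumes x: "x \<in> variation_sums f a b" and c: "a \<le> c" "c \<le> b"
  obtains y z where "y \<in> variation_sums f a c" "z \<in> variation_sums f c b" "x \<le> y + z"
proof -
  obtain I :: "nat set" and u v where fam: "interval_family a b I u v"
    and xeq: "x = (\<Sum>i\<in>I. \<bar>f (v i) - f (u i)\<bar>)"
    using x unfolding variation_sums_def by auto
  have l: "interval_family a c I (\<lambda>i. min (u i) c) (\<lambda>i. min (v i) c)"
    unfolding interval_family_def
  proof (intro conjI ballI impI)
    fix i j assume "i \<in> I" "j \<in> I" "i \<noteq> j"
    then have "{u i<..<v i} \<inter> {u j<..<v j} = {}" using interval_familyD(5)[OF fam] by blast
    then show "{min (u i) c<..<min (v i) c} \<inter> {min (u j) c<..<min (v j) c} = {}"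
      by (auto simp: disjoint_iff min_def split: if_splits)
  qed (use interval_familyD(1)[OF fam] interval_familyD(2-4)[OF fam] c in \<open>fastforce+\<close>)
  have r: "interval_family c b I (\<lambda>i. max (u i) c) (\<lambda>i. max (v i) c)"
    unfolding interval_family_def
  proof (intro conjI ballI impI)
    fix i j assume "i \<in> I" "j \<in> I" "i \<noteq> j"
    then have "{u i<..<v i} \<inter> {u j<..<v j} = {}" using interval_familyD(5)[OF fam] by blast
    then show "{max (u i) c<..<max (v i) c} \<inter> {max (u j) c<..<max (v j) c} = {}"
      by (auto simp: disjoint_iff max_def split: if_splits)
  qed (use interval_familyD(1)[OF fam] interval_familyD(2-4)[OF fam] c in \<open>fastforce+\<close>)
  have "\<bar>f (v i) - f (u i)\<bar> \<le> \<bar>f (min (v i) c) - f (min (u i) c)\<bar> + \<bar>f (max (v i) c) - f (max (u i) c)\<bar>"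
    if "i \<in> I" for i
    using interval_familyD(3)[OF fam that] by (auto simp: min_def max_def)
  then have "x \<le> (\<Sum>i\<in>I. \<bar>f (min (v i) c) - f (min (u i) c)\<bar>) + (\<Sum>i\<in>I. \<bar>f (max (v i) c) - f (max (u i) c)\<bar>)"
    unfolding xeq sum.distrib[symmetric] by (rule sum_mono)
  then show ?thesis
    using that variation_sumsI[OF l, of f] variation_sumsI[OF r, of f] by blast
qed

lemma variation_sums_mono:
  assumes "a' \<le> a" "b \<le> b'"
  shows "variation_sums f a b \<subseteq> variation_sums f a' b'"
proof -
  have "interval_family a' b' I u v" if "interval_family a b I u v" for I :: "nat set" and u v
    using that assms unfolding interval_family_def by (meson order_trans)
  then show ?thesis unfolding variation_sums_def by blast
qed

context
  fixes f :: "real \<Rightarrow> real"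
  assumes f: "absolutely_continuous_on_unit f"
begin

text \<open>On a grid of mesh below the delta that belongs to epsilon = 1, each cell contributes
  less than 1, so the number N of cells bounds every sum.\<close>

lemma variation_sums_bdd_above:
  assumes "0 \<le> a" "b \<le> 1"
  shows "bdd_above (variation_sums f a b)"
proof -
  obtain \<delta> where \<delta>: "\<delta> > 0" "\<And>(I :: nat set) u v. interval_family 0 1 I u v \<Longrightarrow>
    (\<Sum>i\<in>I. v i - u i) < \<delta> \<Longrightarrow> (\<Sum>i\<in>I. norm (f (v i) - f (u i))) < 1"
    using absolutely_continuous_on_unitD[OF f zero_less_one] by blast
  obtain N :: nat where N: "N > 0" "1 / real N < \<delta>"
    using \<delta>(1) by (metis nat_approx_posE zero_less_Suc)
  have le: "x \<le> real k" if "k \<le> N" "x \<in> variation_sums f 0 (real k / real N)" for k x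
    using that
  proof (induction k arbitrary: x)
    case 0
    then obtain I :: "nat set" and u v where fam: "interval_family 0 0 I u v"
      and x: "x = (\<Sum>i\<in>I. \<bar>f (v i) - f (u i)\<bar>)"
      unfolding variation_sums_def by auto
    have "v i = u i" if "i \<in> I" for i using interval_familyD(2-4)[OF fam that] by simp
    with x show ?case by simp
  next
    case (Suc k)
    obtain y z where yz: "y \<in> variation_sums f 0 (real k / real N)"
      "z \<in> variation_sums f (real k / real N) (real (Suc k) / real N)" "x \<le> y + z"
      using variation_sums_split[OF Suc.prems(2), of "real k / real N"]
      by (auto simp: divide_right_mono)
    obtain I :: "nat set" and u v where fam: "interval_family (real k / real N) (real (Suc k) / real N) I u v"
      and z: "z = (\<Sum>i\<in>I. \<bar>f (v i) - f (u i)\<bar>)"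
      using yz(2) unfolding variation_sums_def by auto
    have b1: "real (Suc k) / real N \<le> 1" "0 \<le> real k / real N" using Suc.prems(1) N by auto
    have "interval_family 0 1 I u v"
      using fam b1 unfolding interval_family_def by (meson order_trans)
    moreover have "(\<Sum>i\<in>I. v i - u i) \<le> real (Suc k) / real N - real k / real N"
      using sum_interval_lengths_le[OF fam] by (simp add: divide_right_mono)
    then have "(\<Sum>i\<in>I. v i - u i) < \<delta>"
      using N by (simp add: diff_divide_distrib[symmetric])
    ultimately have "z < 1" using \<delta>(2) z by simp
    then show ?case using yz Suc.IH Suc.prems(1) by fastforce
  qed
  have "x \<le> real N" if "x \<in> variation_sums f a b" for x
    using le[of N x] variation_sums_mono[of 0 a b 1 f] that assms N by auto
  then show ?thesis by (rule bdd_aboveI)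
qed

lemma total_variation_upper:
  assumes "0 \<le> a" "b \<le> 1" "x \<in> variation_sums f a b"
  shows "x \<le> total_variation f a b"
  unfolding total_variation_def using assms variation_sums_bdd_above by (intro cSup_upper) auto

lemma total_variation_split_le:
  assumes "0 \<le> a" "b \<le> 1" "a \<le> c" "c \<le> b"
  shows "total_variation f a b \<le> total_variation f a c + total_variation f c b"
  unfolding total_variation_def[of f a b]
proof (rule cSup_least)
  show "variation_sums f a b \<noteq> {}" using variation_sums_zero by blast
  fix x assume "x \<in> variation_sums f a b"
  then obtain y z where "y \<in> variation_sums f a c" "z \<in> variation_sums f c b" "x \<le> y + z"
    using variation_sums_split assms by metis
  then show "x \<le> total_variation f a c + total_variation f c b"
    using total_variation_upper[of a c y] total_variation_upper[of c b z] assms by simp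
qed

text \<open>The interval [s, t], under the new index \<open>None\<close>, can be added to any family
  in [0, s].\<close>

lemma total_variation_increment:
  assumes "0 \<le> s" "s \<le> t" "t \<le> 1"
  shows "\<bar>f t - f s\<bar> \<le> total_variation f 0 t - total_variation f 0 s"
proof -
  have "total_variation f 0 s \<le> total_variation f 0 t - \<bar>f t - f s\<bar>"
    unfolding total_variation_def[of f 0 s]
  proof (rule cSup_least)
    show "variation_sums f 0 s \<noteq> {}" using variation_sums_zero by blast
    fix x assume "x \<in> variation_sums f 0 s"
    then obtain I :: "nat set" and u v where fam: "interval_family 0 s I u v"
      and x: "x = (\<Sum>i\<in>I. \<bar>f (v i) - f (u i)\<bar>)"
      unfolding variation_sums_def by auto
    let ?J = "insert None (Some ` I)"
    let ?u = "case_option s u" and ?v = "case_option t v"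
    have "{s<..<t} \<inter> {u i<..<v i} = {}" if "i \<in> I" for i
      using interval_familyD(4)[OF fam that] by auto
    moreover have "v i \<le> t" if "i \<in> I" for i
      using interval_familyD(4)[OF fam that] assms by simp
    ultimately have "interval_family 0 t ?J ?u ?v"
      using interval_familyD(1)[OF fam] interval_familyD(2,3,5)[OF fam] assms
      unfolding interval_family_def by (simp add: Int_commute max.commute)
    from variation_sumsI[OF this, of f]
    have "\<bar>f t - f s\<bar> + x \<in> variation_sums f 0 t"
      using interval_familyD(1)[OF fam] by (simp add: x sum.reindex)
    then show "x \<le> total_variation f 0 t - \<bar>f t - f s\<bar>"
      using total_variation_upper[of 0 t] assms by fastforce
  qed
  then show ?thesis by simp
qed

text \<open>Each [u i, v i] is replaced by a family whose sum nearly attains the variation there;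
  the union of these families is no longer than the original one and is controlled by the delta of
  f.\<close>

lemma absolutely_continuous_total_variation:
  "absolutely_continuous_on_unit (total_variation f 0)"
  unfolding absolutely_continuous_on_unit_def
proof (intro allI impI)
  fix \<epsilon> :: real assume "\<epsilon> > 0"
  then have e3: "\<epsilon> / 3 > 0" by simp
  obtain \<delta> where \<delta>: "\<delta> > 0" "\<And>(I :: (nat \<times> nat) set) u v. interval_family 0 1 I u v \<Longrightarrow>
    (\<Sum>i\<in>I. v i - u i) < \<delta> \<Longrightarrow> (\<Sum>i\<in>I. norm (f (v i) - f (u i))) < \<epsilon> / 3"
    using absolutely_continuous_on_unitD[OF f e3] by blast
  show "\<exists>\<delta>>0. \<forall>(n::nat) u v. (\<forall>i<n. 0 \<le> u i \<and> u i \<le> v i \<and> v i \<le> 1) \<and>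
           (\<forall>i<n. \<forall>j<n. i \<noteq> j \<longrightarrow> {u i<..<v i} \<inter> {u j<..<v j} = {}) \<and>
           (\<Sum>i<n. v i - u i) < \<delta> \<longrightarrow>
           (\<Sum>i<n. norm (total_variation f 0 (v i) - total_variation f 0 (u i))) < \<epsilon>"
  proof (rule exI[of _ \<delta>], rule conjI[OF \<delta>(1)], intro allI, rule impI)
    fix n :: nat and u v :: "nat \<Rightarrow> real"
    assume "(\<forall>i<n. 0 \<le> u i \<and> u i \<le> v i \<and> v i \<le> 1) \<and>
      (\<forall>i<n. \<forall>j<n. i \<noteq> j \<longrightarrow> {u i<..<v i} \<inter> {u j<..<v j} = {}) \<and> (\<Sum>i<n. v i - u i) < \<delta>"
    then have uv: "\<forall>i<n. 0 \<le> u i \<and> u i \<le> v i \<and> v i \<le> 1"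
      and disj: "\<forall>i<n. \<forall>j<n. i \<noteq> j \<longrightarrow> {u i<..<v i} \<inter> {u j<..<v j} = {}"
      and less: "(\<Sum>i<n. v i - u i) < \<delta>" by blast+
    \<comment> \<open>The n errors together stay below a third of \<epsilon>.\<close>
    define \<eta> where "\<eta> = \<epsilon> / (3 * (real n + 1))"
    have \<eta>: "\<eta> > 0" "real n * \<eta> \<le> \<epsilon> / 3" using \<open>\<epsilon> > 0\<close> by (auto simp: \<eta>_def field_simps)
    have "\<exists>(I :: nat set) a b. interval_family (u i) (v i) I a b \<and>
        total_variation f (u i) (v i) - \<eta> < (\<Sum>j\<in>I. \<bar>f (b j) - f (a j)\<bar>)" if "i < n" for i
    proof -
      have "total_variation f (u i) (v i) - \<eta> < Sup (variation_sums f (u i) (v i))"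
        using \<eta> by (simp add: total_variation_def)
      then obtain x where "x \<in> variation_sums f (u i) (v i)" "total_variation f (u i) (v i) - \<eta> < x"
        using less_cSupE variation_sums_zero by (metis empty_iff)
      then show ?thesis unfolding variation_sums_def by auto
    qed
    then obtain I :: "nat \<Rightarrow> nat set" and a b where
      fam: "\<And>i. i < n \<Longrightarrow> interval_family (u i) (v i) (I i) (a i) (b i)" and
      big: "\<And>i. i < n \<Longrightarrow> total_variation f (u i) (v i) - \<eta> < (\<Sum>j\<in>I i. \<bar>f (b i j) - f (a i j)\<bar>)"
      by metis
    let ?J = "SIGMA i:{..<n}. I i"
    have famJ: "interval_family 0 1 ?J (\<lambda>(i, j). a i j) (\<lambda>(i, j). b i j)"
      unfolding interval_family_def
    proof (intro conjI ballI impI)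
      show "finite ?J" using interval_familyD(1)[OF fam] by auto
      fix p assume "p \<in> ?J"
      then obtain i j where p: "p = (i, j)" "i < n" "j \<in> I i" by auto
      note F = interval_familyD[OF fam[OF p(2)]]
      show "0 \<le> (case p of (i, j) \<Rightarrow> a i j)" using F(2)[OF p(3)] uv p by force
      show "(case p of (i, j) \<Rightarrow> a i j) \<le> (case p of (i, j) \<Rightarrow> b i j)" using F(3)[OF p(3)] p by simp
      show "(case p of (i, j) \<Rightarrow> b i j) \<le> 1" using F(4)[OF p(3)] uv p by force
      fix p' assume "p' \<in> ?J" and ne: "p \<noteq> p'"
      then obtain i' j' where p': "p' = (i', j')" "i' < n" "j' \<in> I i'" by auto
      note F' = interval_familyD[OF fam[OF p'(2)]]
      have "{a i j<..<b i j} \<inter> {a i' j'<..<b i' j'} = {}"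
      proof (cases "i = i'")
        case True
        then show ?thesis using F(5)[OF p(3), of j'] p p' ne by auto
      next
        case False
        then have "{u i<..<v i} \<inter> {u i'<..<v i'} = {}" using disj p p' by blast
        moreover have "{a i j<..<b i j} \<subseteq> {u i<..<v i}" "{a i' j'<..<b i' j'} \<subseteq> {u i'<..<v i'}"
          using F(2,4)[OF p(3)] F'(2,4)[OF p'(3)] by auto
        ultimately show ?thesis by blast
      qed
      then show "{case p of (i, j) \<Rightarrow> a i j<..<case p of (i, j) \<Rightarrow> b i j} \<inter>
          {case p' of (i, j) \<Rightarrow> a i j<..<case p' of (i, j) \<Rightarrow> b i j} = {}"
        using p p' by simp
    qed
    have finI: "finite (I i)" if "i < n" for i using interval_familyD(1)[OF fam[OF that]] .
    have "(\<Sum>p\<in>?J. (case p of (i, j) \<Rightarrow> b i j) - (case p of (i, j) \<Rightarrow> a i j)) = (\<Sum>i<n. \<Sum>j\<in>I i. b i j - a i j)"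
      using finI by (subst sum.Sigma) (auto simp: case_prod_beta)
    also have "\<dots> \<le> (\<Sum>i<n. v i - u i)"
      using sum_interval_lengths_le[OF fam] uv by (intro sum_mono) auto
    finally have "(\<Sum>p\<in>?J. norm (f (case p of (i, j) \<Rightarrow> b i j) - f (case p of (i, j) \<Rightarrow> a i j))) < \<epsilon> / 3"
      using less by (intro \<delta>(2)[OF famJ]) simp
    also have "(\<Sum>p\<in>?J. norm (f (case p of (i, j) \<Rightarrow> b i j) - f (case p of (i, j) \<Rightarrow> a i j))) =
        (\<Sum>i<n. \<Sum>j\<in>I i. \<bar>f (b i j) - f (a i j)\<bar>)"
      using finI by (subst sum.Sigma) (auto simp: case_prod_beta)
    finally have small: "(\<Sum>i<n. \<Sum>j\<in>I i. \<bar>f (b i j) - f (a i j)\<bar>) < \<epsilon> / 3" .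
    have "(\<Sum>i<n. norm (total_variation f 0 (v i) - total_variation f 0 (u i))) \<le>
        (\<Sum>i<n. (\<Sum>j\<in>I i. \<bar>f (b i j) - f (a i j)\<bar>) + \<eta>)"
    proof (rule sum_mono)
      fix i assume "i \<in> {..<n}"
      then have i: "i < n" by simp
      have uvi: "0 \<le> u i" "u i \<le> v i" "v i \<le> 1" using uv i by auto
      have 1: "0 \<le> total_variation f 0 (v i) - total_variation f 0 (u i)"
        using total_variation_increment[OF uvi] abs_ge_zero order_trans by blast
      have 2: "total_variation f 0 (v i) \<le> total_variation f 0 (u i) + total_variation f (u i) (v i)"
        using uvi by (intro total_variation_split_le) auto
      show "norm (total_variation f 0 (v i) - total_variation f 0 (u i)) \<le> (\<Sum>j\<in>I i. \<bar>f (b i j) - f (a i j)\<bar>) + \<eta>"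
        unfolding real_norm_def abs_of_nonneg[OF 1] using 2 big[OF i] by linarith
    qed
    also have "\<dots> = (\<Sum>i<n. \<Sum>j\<in>I i. \<bar>f (b i j) - f (a i j)\<bar>) + real n * \<eta>"
      by (simp only: sum.distrib sum_constant card_lessThan)
    also have "\<dots> < \<epsilon> / 3 + \<epsilon> / 3"
      by (rule add_less_le_mono[OF small \<eta>(2)])
    also have "\<dots> \<le> \<epsilon>" using \<open>\<epsilon> > 0\<close> by simp
    finally show "(\<Sum>i<n. norm (total_variation f 0 (v i) - total_variation f 0 (u i))) < \<epsilon>" .
  qed
qed

end

lemma absolutely_continuous_on_unitI:
  fixes f :: "real \<Rightarrow> 'b::real_normed_vector"
  assumes "\<And>\<epsilon>. \<epsilon> > 0 \<Longrightarrow> \<exists>\<delta>>0. \<forall>(n::nat) u v. interval_family 0 1 {..<n} u v \<longrightarrow>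
    (\<Sum>i<n. v i - u i) < \<delta> \<longrightarrow> (\<Sum>i<n. norm (f (v i) - f (u i))) < \<epsilon>"
  shows "absolutely_continuous_on_unit f"
  unfolding absolutely_continuous_on_unit_def
proof (intro allI impI)
  fix \<epsilon> :: real assume "\<epsilon> > 0"
  from assms[OF this] obtain \<delta> where \<delta>: "\<delta> > 0"
    "\<And>(n::nat) u v. interval_family 0 1 {..<n} u v \<Longrightarrow>
      (\<Sum>i<n. v i - u i) < \<delta> \<Longrightarrow> (\<Sum>i<n. norm (f (v i) - f (u i))) < \<epsilon>"
    by auto
  have fam: "interval_family 0 1 {..<n} u v" if "\<forall>i<n. 0 \<le> u i \<and> u i \<le> v i \<and> v i \<le> 1"
    "\<forall>i<n. \<forall>j<n. i \<noteq> j \<longrightarrow> {u i<..<v i} \<inter> {u j<..<v j} = {}" for n :: nat and u v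
    using that unfolding interval_family_def Ball_def lessThan_iff by simp
  show "\<exists>\<delta>>0. \<forall>(n::nat) u v. (\<forall>i<n. 0 \<le> u i \<and> u i \<le> v i \<and> v i \<le> 1) \<and>
           (\<forall>i<n. \<forall>j<n. i \<noteq> j \<longrightarrow> {u i<..<v i} \<inter> {u j<..<v j} = {}) \<and>
           (\<Sum>i<n. v i - u i) < \<delta> \<longrightarrow> (\<Sum>i<n. norm (f (v i) - f (u i))) < \<epsilon>"
    by (rule exI[of _ \<delta>], rule conjI[OF \<delta>(1)], intro allI, rule impI, elim conjE, rule \<delta>(2), rule fam)
qed

text \<open>The single closure rule from which coordinates, differences, products and compositions
  are obtained. Two dominating functions suffice even for a product, whose increment involves both
  factors.\<close>

lemma AC_increments_le:
  fixes f :: "real \<Rightarrow> 'b::real_normed_vector" and g :: "real \<Rightarrow> 'c::real_normed_vector"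
    and h :: "real \<Rightarrow> 'd::real_normed_vector"
  assumes f: "absolutely_continuous_on_unit f" and g: "absolutely_continuous_on_unit g"
    and le: "\<And>s t. 0 \<le> s \<Longrightarrow> s \<le> t \<Longrightarrow> t \<le> 1 \<Longrightarrow>
      norm (h t - h s) \<le> C * (norm (f t - f s) + norm (g t - g s))"
  shows "absolutely_continuous_on_unit h"
proof (rule absolutely_continuous_on_unitI)
  fix \<epsilon> :: real assume "\<epsilon> > 0"
  define D where "D = \<bar>C\<bar> + 1"
  have D: "D > 0" "C \<le> D" by (auto simp: D_def)
  have e: "\<epsilon> / (2 * D) > 0" using \<open>\<epsilon> > 0\<close> D by simp
  obtain \<delta>1 where \<delta>1: "\<delta>1 > 0" "\<And>(I::nat set) u v. interval_family 0 1 I u v \<Longrightarrow>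
    (\<Sum>i\<in>I. v i - u i) < \<delta>1 \<Longrightarrow> (\<Sum>i\<in>I. norm (f (v i) - f (u i))) < \<epsilon> / (2 * D)"
    using absolutely_continuous_on_unitD[OF f e] by blast
  obtain \<delta>2 where \<delta>2: "\<delta>2 > 0" "\<And>(I::nat set) u v. interval_family 0 1 I u v \<Longrightarrow>
    (\<Sum>i\<in>I. v i - u i) < \<delta>2 \<Longrightarrow> (\<Sum>i\<in>I. norm (g (v i) - g (u i))) < \<epsilon> / (2 * D)"
    using absolutely_continuous_on_unitD[OF g e] by blast
  show "\<exists>\<delta>>0. \<forall>(n::nat) u v. interval_family 0 1 {..<n} u v \<longrightarrow>
    (\<Sum>i<n. v i - u i) < \<delta> \<longrightarrow> (\<Sum>i<n. norm (h (v i) - h (u i))) < \<epsilon>"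
  proof (rule exI[of _ "min \<delta>1 \<delta>2"], rule conjI, use \<delta>1(1) \<delta>2(1) in simp, intro allI impI)
    fix n :: nat and u v :: "nat \<Rightarrow> real"
    assume fam: "interval_family 0 1 {..<n} u v" and less: "(\<Sum>i<n. v i - u i) < min \<delta>1 \<delta>2"
    have a: "(\<Sum>i<n. norm (f (v i) - f (u i))) < \<epsilon> / (2 * D)"
      using less by (intro \<delta>1(2)[OF fam]) (simp only: min_less_iff_conj)
    have b: "(\<Sum>i<n. norm (g (v i) - g (u i))) < \<epsilon> / (2 * D)"
      using less by (intro \<delta>2(2)[OF fam]) (simp only: min_less_iff_conj)
    have "(\<Sum>i<n. norm (h (v i) - h (u i))) \<le> (\<Sum>i<n. D * (norm (f (v i) - f (u i)) + norm (g (v i) - g (u i))))"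
    proof (rule sum_mono)
      fix i assume "i \<in> {..<n}"
      then have "norm (h (v i) - h (u i)) \<le> C * (norm (f (v i) - f (u i)) + norm (g (v i) - g (u i)))"
        by (intro le interval_familyD(2-4)[OF fam])
      also have "\<dots> \<le> D * (norm (f (v i) - f (u i)) + norm (g (v i) - g (u i)))"
        using D by (intro mult_right_mono) auto
      finally show "norm (h (v i) - h (u i)) \<le> D * (norm (f (v i) - f (u i)) + norm (g (v i) - g (u i)))" .
    qed
    also have "\<dots> = D * ((\<Sum>i<n. norm (f (v i) - f (u i))) + (\<Sum>i<n. norm (g (v i) - g (u i))))"
      by (simp only: sum_distrib_left[symmetric] sum.distrib)
    also have "\<dots> < D * (\<epsilon> / (2 * D) + \<epsilon> / (2 * D))"
      by (rule mult_strict_left_mono[OF add_strict_mono[OF a b] D(1)])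
    also have "\<dots> = \<epsilon>" using D(1) by (simp add: field_simps)
    finally show "(\<Sum>i<n. norm (h (v i) - h (u i))) < \<epsilon>" .
  qed
qed

section \<open>Absolutely continuous functions as integrals of a density\<close>

lemma AC_imp_continuous_on:
  fixes f :: "real \<Rightarrow> 'b::real_normed_vector"
  assumes f: "absolutely_continuous_on_unit f"
  shows "continuous_on {0..1} f"
  unfolding continuous_on_iff
proof (intro ballI allI impI)
  fix x e :: real assume x: "x \<in> {0..1}" and e: "e > 0"
  obtain \<delta> where \<delta>: "\<delta> > 0" "\<And>(I :: unit set) u v. interval_family 0 1 I u v \<Longrightarrow>
    (\<Sum>i\<in>I. v i - u i) < \<delta> \<Longrightarrow> (\<Sum>i\<in>I. norm (f (v i) - f (u i))) < e"
    using absolutely_continuous_on_unitD[OF f e] by blast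
  have *: "norm (f t - f s) < e" if "0 \<le> s" "s \<le> t" "t \<le> 1" "t - s < \<delta>" for s t
    using \<delta>(2)[of "{()}" "\<lambda>_. s" "\<lambda>_. t"] that by (simp add: interval_family_def)
  show "\<exists>d>0. \<forall>x'\<in>{0..1}. dist x' x < d \<longrightarrow> dist (f x') (f x) < e"
  proof (intro exI[of _ \<delta>] conjI ballI impI \<delta>(1))
    fix y assume y: "y \<in> {0..1}" "dist y x < \<delta>"
    show "dist (f y) (f x) < e"
    proof (cases "y \<le> x")
      case True
      then show ?thesis using *[of y x] x y by (simp add: dist_norm norm_minus_commute abs_if split: if_splits)
    next
      case False
      then show ?thesis using *[of x y] x y by (simp add: dist_norm)
    qed
  qed
qed

text \<open>A null set is covered by countably many non-overlapping closed intervals inside an open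
  set of length below delta. Absolute continuity bounds the Stieltjes measure of every finite
  subfamily by epsilon, and continuity from below extends this to the whole cover.\<close>

lemma emeasure_interval_measure_null:
  fixes G :: "real \<Rightarrow> real"
  assumes mono: "\<And>x y. x \<le> y \<Longrightarrow> G x \<le> G y" and cont: "continuous_on UNIV G"
    and ac: "absolutely_continuous_on_unit G"
    and S: "S \<subseteq> {0..1}" "S \<in> null_sets lborel"
  shows "emeasure (interval_measure G) S = 0"
proof -
  let ?\<nu> = "interval_measure G"
  have le: "emeasure ?\<nu> S \<le> ennreal \<epsilon>" if \<epsilon>: "\<epsilon> > 0" for \<epsilon>
  proof -
    obtain \<delta> where \<delta>: "\<delta> > 0" "\<And>(I :: real set set) u v. interval_family 0 1 I u v \<Longrightarrow>
        (\<Sum>i\<in>I. v i - u i) < \<delta> \<Longrightarrow> (\<Sum>i\<in>I. norm (G (v i) - G (u i))) < \<epsilon>"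
      using absolutely_continuous_on_unitD[OF ac \<epsilon>] by blast
    have Sb: "S \<in> sets borel" "emeasure lborel S = 0" using S(2) by auto
    obtain U where U: "open U" "S \<subseteq> U" "emeasure lborel (U - S) < ennreal \<delta>"
      using outer_regular_lborel[OF Sb(1) \<delta>(1)] .
    have "emeasure lborel U \<le> emeasure lborel (U - S) + emeasure lborel S"
      using emeasure_subadditive[of "U - S" lborel S] U Sb by (auto simp: Un_absorb2)
    then have Uless: "emeasure lborel U < ennreal \<delta>" using U Sb by simp
    \<comment> \<open>The gauge assigns U to every point of U, so all it enforces is that each
      covering interval stays in U.\<close>
    obtain \<D> where \<D>: "countable \<D>" "\<Union>\<D> \<subseteq> cbox 0 (1::real)"
      "\<And>K. K \<in> \<D> \<Longrightarrow> interior K \<noteq> {} \<and> (\<exists>c d. K = cbox c d)"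
      "pairwise (\<lambda>A B. interior A \<inter> interior B = {}) \<D>"
      "\<And>K. K \<in> \<D> \<Longrightarrow> \<exists>x \<in> S \<inter> K. K \<subseteq> (if x \<in> U then U else UNIV)"
      "S \<subseteq> \<Union>\<D>"
    proof (rule covering_lemma[of S 0 "1::real" "\<lambda>x. if x \<in> U then U else UNIV"])
      show "S \<subseteq> cbox 0 (1::real)" using S by simp
      show "gauge (\<lambda>x. if x \<in> U then U else UNIV)" using U(1) by (auto simp: gauge_def)
    qed auto
    have DU: "K \<subseteq> U" if K: "K \<in> \<D>" for K
    proof -
      obtain x where x: "x \<in> S" "K \<subseteq> (if x \<in> U then U else UNIV)" using \<D>(5)[OF K] by auto
      moreover have "x \<in> U" using x(1) U(2) by blast
      ultimately show ?thesis by simp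
    qed
    have Dform: "K = {Inf K..Sup K}" "Inf K < Sup K" "0 \<le> Inf K" "Sup K \<le> 1" if KD: "K \<in> \<D>" for K
    proof -
      obtain c d where K: "K = {c..d}" "c < d"
        using \<D>(3)[OF KD] by (auto simp: interior_atLeastAtMost_real)
      have "K \<subseteq> cbox 0 1" by (rule order_trans[OF Union_upper[OF KD] \<D>(2)])
      then have "0 \<le> c" "d \<le> 1" using K by auto
      then show "K = {Inf K..Sup K}" "Inf K < Sup K" "0 \<le> Inf K" "Sup K \<le> 1"
        using K(2) unfolding K(1) by simp_all
    qed
    have Db: "K \<in> sets borel" if "K \<in> \<D>" for K
      by (subst Dform(1)[OF that]) simp
    have fin: "emeasure ?\<nu> (\<Union>\<F>) \<le> ennreal \<epsilon>" if \<F>: "finite \<F>" "\<F> \<subseteq> \<D>" for \<F>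
    proof -
      have int: "interior K = {Inf K<..<Sup K}" if "K \<in> \<F>" for K
        using Dform(1)[of K] \<F> that by (metis interior_atLeastAtMost_real subsetD)
      have fam: "interval_family 0 1 \<F> Inf Sup"
        unfolding interval_family_def
      proof (intro conjI ballI impI \<F>(1))
        fix K L assume "K \<in> \<F>" "L \<in> \<F>" "K \<noteq> L"
        then have "interior K \<inter> interior L = {}" using \<D>(4) \<F>(2) by (auto simp: pairwise_def)
        then show "{Inf K<..<Sup K} \<inter> {Inf L<..<Sup L} = {}"
          using int \<open>K \<in> \<F>\<close> \<open>L \<in> \<F>\<close> by simp
      qed (use Dform(2-4) \<F>(2) in \<open>auto intro!: less_imp_le[of "Inf _" "Sup _"]\<close>)
      have "ennreal (\<Sum>K\<in>\<F>. Sup K - Inf K) = (\<Sum>K\<in>\<F>. emeasure lborel {Inf K<..<Sup K})"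
        using interval_familyD[OF fam] by (subst sum_ennreal[symmetric]) auto
      also have "\<dots> = emeasure lborel (\<Union>K\<in>\<F>. {Inf K<..<Sup K})"
        using interval_familyD(1,5)[OF fam] by (intro sum_emeasure) (auto simp: disjoint_family_on_def)
      also have "\<dots> \<le> emeasure lborel U"
      proof (rule emeasure_mono)
        show "(\<Union>K\<in>\<F>. {Inf K<..<Sup K}) \<subseteq> U"
          using int DU \<F>(2) interior_subset by (metis (no_types, lifting) UN_least order_trans subsetD)
      qed (use U in auto)
      also note Uless
      finally have "(\<Sum>K\<in>\<F>. Sup K - Inf K) < \<delta>"
        using \<delta>(1) by (simp add: ennreal_less_iff sum_nonneg interval_familyD[OF fam])
      then have small: "(\<Sum>K\<in>\<F>. norm (G (Sup K) - G (Inf K))) < \<epsilon>" using \<delta>(2)[OF fam] by simp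
      have "K \<in> sets ?\<nu>" if "K \<in> \<F>" for K
        using Db[of K] that \<F>(2) by auto
      then have "emeasure ?\<nu> (\<Union>K\<in>\<F>. K) \<le> (\<Sum>K\<in>\<F>. emeasure ?\<nu> K)"
        using \<F>(1) by (intro emeasure_subadditive_finite) auto
      then have "emeasure ?\<nu> (\<Union>\<F>) \<le> (\<Sum>K\<in>\<F>. emeasure ?\<nu> K)" by simp
      also have "\<dots> = (\<Sum>K\<in>\<F>. ennreal (norm (G (Sup K) - G (Inf K))))"
      proof (rule sum.cong[OF refl])
        fix K assume "K \<in> \<F>"
        then have K: "K = {Inf K..Sup K}" "Inf K < Sup K" using Dform \<F>(2) by blast+
        have "emeasure ?\<nu> {Inf K..Sup K} = ennreal (G (Sup K) - G (Inf K))"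
          using K(2) mono cont by (intro emeasure_interval_measure_Icc) auto
        then show "emeasure ?\<nu> K = ennreal (norm (G (Sup K) - G (Inf K)))"
          using K mono[of "Inf K" "Sup K"] by simp
      qed
      also have "\<dots> = ennreal (\<Sum>K\<in>\<F>. norm (G (Sup K) - G (Inf K)))"
        by (rule sum_ennreal) simp
      also have "\<dots> \<le> ennreal \<epsilon>" using small by (intro ennreal_leI) simp
      finally show ?thesis .
    qed
    have "emeasure ?\<nu> (\<Union>\<D>) \<le> ennreal \<epsilon>"
    proof (cases "\<D> = {}")
      case False
      define A where "A n = (\<Union>(from_nat_into \<D> ` {..<n}))" for n :: nat
      have Dn: "from_nat_into \<D> n \<in> \<D>" for n using False by (rule from_nat_into)
      have "(\<Union>n. A n) = \<Union>(range (from_nat_into \<D>))"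
        unfolding A_def using lessThan_iff lessI by blast
      then have "(\<Union>n. A n) = \<Union>\<D>"
        by (simp only: range_from_nat_into[OF False \<D>(1)])
      moreover have "(SUP n. emeasure ?\<nu> (A n)) = emeasure ?\<nu> (\<Union>n. A n)"
      proof (rule SUP_emeasure_incseq)
        have "from_nat_into \<D> n \<in> sets borel" for n
          by (rule Db[OF Dn])
        then show "range A \<subseteq> sets ?\<nu>" by (auto simp: A_def)
        show "incseq A" by (force simp: A_def incseq_def)
      qed
      moreover have "(SUP n. emeasure ?\<nu> (A n)) \<le> ennreal \<epsilon>"
        unfolding A_def using Dn by (intro SUP_least fin) auto
      ultimately show ?thesis by simp
    qed simp
    moreover have "emeasure ?\<nu> S \<le> emeasure ?\<nu> (\<Union>\<D>)"
    proof (rule emeasure_mono[OF \<D>(6)])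
      have "\<Union>\<D> \<in> sets borel"
        using \<D>(1) Db by (intro sets.countable_Union) auto
      then show "\<Union>\<D> \<in> sets ?\<nu>" by simp
    qed
    ultimately show ?thesis by simp
  qed
  have "emeasure ?\<nu> S \<le> 0"
    by (rule ennreal_le_epsilon) (use le in simp)
  then show ?thesis by simp
qed

text \<open>The Stieltjes measure of F is absolutely continuous with respect to Lebesgue measure,
  and its Radon-Nikodym derivative is the density sought.\<close>

lemma monotone_AC_density:
  fixes F :: "real \<Rightarrow> real"
  assumes mono: "\<And>s t. 0 \<le> s \<Longrightarrow> s \<le> t \<Longrightarrow> t \<le> 1 \<Longrightarrow> F s \<le> F t"
    and ac: "absolutely_continuous_on_unit F"
  obtains g where "integrable lborel g" "\<And>t. t \<in> {0..1} \<Longrightarrow> F t - F 0 = (LINT r:{0..t}|lborel. g r)"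
proof -
  \<comment> \<open>F is extended constantly beyond [0, 1], as the Stieltjes measure is formed from
    a monotone function on the whole line.\<close>
  define G where "G t = F (max 0 (min 1 t))" for t
  have G: "G t = F t" if "t \<in> {0..1}" for t using that by (simp add: G_def)
  have Gmono: "G x \<le> G y" if "x \<le> y" for x y
    unfolding G_def using that by (intro mono) auto
  have Gcont: "continuous_on UNIV G"
    unfolding G_def
    by (rule continuous_on_compose2[OF AC_imp_continuous_on[OF ac]]) (auto intro!: continuous_intros)
  have Gac: "absolutely_continuous_on_unit G"
    using G by (intro AC_increments_le[OF ac ac, of _ 1]) auto
  let ?\<nu> = "density (interval_measure G) (indicator {0..1})"
  have em: "emeasure ?\<nu> A = emeasure (interval_measure G) ({0..1} \<inter> A)" if "A \<in> sets borel" for A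
    using that by (intro emeasure_restricted) auto
  have "absolutely_continuous lborel ?\<nu>"
    unfolding absolutely_continuous_def
  proof
    fix N :: "real set" assume N: "N \<in> null_sets lborel"
    then have "{0..1} \<inter> N \<in> null_sets lborel" by (rule null_set_Int1) auto
    then have "emeasure ?\<nu> N = 0"
      using N emeasure_interval_measure_null[OF Gmono Gcont Gac, of "{0..1} \<inter> N"] em[of N] by auto
    then show "N \<in> null_sets ?\<nu>" using N by (intro null_setsI) auto
  qed
  then obtain p where p: "p \<in> borel_measurable lborel" "density lborel p = ?\<nu>"
    using sigma_finite_measure.Radon_Nikodym[OF sigma_finite_lborel, of ?\<nu>] by auto
  have pI: "(\<integral>\<^sup>+x. p x * indicator {0..t} x \<partial>lborel) = ennreal (F t - F 0)" if "t \<in> {0..1}" for t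
  proof -
    have "(\<integral>\<^sup>+x. p x * indicator {0..t} x \<partial>lborel) = emeasure ?\<nu> {0..t}"
      unfolding p(2)[symmetric] using p(1) by (subst emeasure_density) auto
    also have "\<dots> = emeasure (interval_measure G) {0..t}"
      using that by (subst em) (auto intro!: arg_cong2[where f=emeasure])
    also have "\<dots> = ennreal (G t - G 0)"
      using that Gmono Gcont by (intro emeasure_interval_measure_Icc) auto
    finally show ?thesis using that G by simp
  qed
  \<comment> \<open>The derivative p has values in \<open>ennreal\<close>; its integral over [0, 1]
    is finite, so it is real there almost everywhere.\<close>
  define g where "g x = enn2real (p x * indicator {0..1} x)" for x
  have "(\<integral>\<^sup>+x. p x * indicator {0..1} x \<partial>lborel) \<noteq> \<infinity>" using pI[of 1] by simp
  then have fin: "AE x in lborel. p x * indicator {0..1} x \<noteq> \<infinity>"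
    using p(1) by (intro nn_integral_noteq_infinite) auto
  have gp: "AE x in lborel. ennreal (g x) = p x * indicator {0..1} x"
    using fin by eventually_elim (auto simp: g_def less_top)
  have gm [measurable]: "g \<in> borel_measurable borel"
    using p(1) unfolding g_def by measurable
  have g0: "0 \<le> g x" for x by (simp add: g_def)
  have "(\<integral>\<^sup>+x. ennreal (g x) \<partial>lborel) = (\<integral>\<^sup>+x. p x * indicator {0..1} x \<partial>lborel)"
    using gp by (rule nn_integral_cong_AE)
  then have gint: "integrable lborel g"
    using pI[of 1] g0 by (intro integrableI_nonneg) auto
  have "F t - F 0 = (LINT r:{0..t}|lborel. g r)" if t: "t \<in> {0..1}" for t
  proof -
    have "ennreal (LINT r:{0..t}|lborel. g r) = (\<integral>\<^sup>+x. ennreal (indicator {0..t} x *\<^sub>R g x) \<partial>lborel)"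
      unfolding set_lebesgue_integral_def using gint g0
      by (intro nn_integral_eq_integral[symmetric] integrable_mult_indicator) auto
    also have "\<dots> = (\<integral>\<^sup>+x. p x * indicator {0..t} x \<partial>lborel)"
    proof (rule nn_integral_cong_AE)
      show "AE x in lborel. ennreal (indicator {0..t} x *\<^sub>R g x) = p x * indicator {0..t} x"
        using gp by eventually_elim (use t in \<open>auto simp: indicator_def split: if_splits\<close>)
    qed
    also have "\<dots> = ennreal (F t - F 0)" by (rule pI[OF t])
    finally show ?thesis
      using mono[of 0 t] t g0 by (subst (asm) ennreal_inj) (auto simp: set_lebesgue_integral_def)
  qed
  with gint show ?thesis by (rule that)
qed

text \<open>The working form of absolute continuity: the derivative is carried along as an explicit
  function, so that it can be transformed and compared. \<open>AC_density\<close> and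
  \<open>ac_density_imp_AC\<close> translate from and to the epsilon-delta form.\<close>

definition ac_density :: "(real \<Rightarrow> 'b::euclidean_space) \<Rightarrow> (real \<Rightarrow> 'b) \<Rightarrow> bool" where
  "ac_density f g \<longleftrightarrow> integrable lborel g \<and> (\<forall>t\<in>{0..1}. f t - f 0 = (LINT r:{0..t}|lborel. g r))"

lemma set_integrable_integrable:
  fixes g :: "real \<Rightarrow> 'b::euclidean_space"
  shows "integrable lborel g \<Longrightarrow> A \<in> sets borel \<Longrightarrow> set_integrable lborel A g"
  unfolding set_integrable_def by (intro integrable_mult_indicator) auto

lemma ac_densityD:
  assumes "ac_density f g"
  shows "integrable lborel g" "g \<in> borel_measurable borel"
    "\<And>s t. 0 \<le> s \<Longrightarrow> s \<le> t \<Longrightarrow> t \<le> 1 \<Longrightarrow> f t - f s = (LINT r:{s..t}|lborel. g r)"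
proof -
  show int: "integrable lborel g" using assms by (simp add: ac_density_def)
  then show "g \<in> borel_measurable borel" using borel_measurable_integrable by fastforce
  fix s t :: real assume st: "0 \<le> s" "s \<le> t" "t \<le> 1"
  have "(LINT r:{0..t}|lborel. g r) = (LINT r:{0..s}|lborel. g r) + (LINT r:{s..t}|lborel. g r)"
    using st by (intro set_integral_Icc_split set_integrable_integrable int) auto
  moreover have "f t - f 0 = (LINT r:{0..t}|lborel. g r)" "f s - f 0 = (LINT r:{0..s}|lborel. g r)"
    using assms st by (auto simp: ac_density_def)
  ultimately show "f t - f s = (LINT r:{s..t}|lborel. g r)"
    by (metis add_diff_cancel_left' diff_diff_eq2 diff_add_cancel)
qed

lemma ac_density_component:
  assumes "ac_density f g"
  shows "ac_density (\<lambda>t. f t \<bullet> b) (\<lambda>t. g t \<bullet> b)"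
proof -
  have int: "integrable lborel g" using ac_densityD(1)[OF assms] .
  have "(f t - f 0) \<bullet> b = (LINT r:{0..t}|lborel. g r \<bullet> b)" if "t \<in> {0..1}" for t
  proof -
    have "(LINT r:{0..t}|lborel. g r) \<bullet> b = (LINT r:{0..t}|lborel. g r \<bullet> b)"
      unfolding set_lebesgue_integral_def
      using set_integrable_integrable[OF int, of "{0..t}"]
      by (subst integral_inner_left[symmetric]) (auto simp: set_integrable_def)
    then show ?thesis using assms that by (simp add: ac_density_def)
  qed
  then show ?thesis using int by (auto simp: ac_density_def inner_diff_left)
qed

text \<open>Jordan decomposition: f is its variation function minus the difference of that function
  and f. Both are nondecreasing and absolutely continuous on [0, 1].\<close>

lemma AC_real_density:
  fixes f :: "real \<Rightarrow> real"
  assumes f: "absolutely_continuous_on_unit f"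
  obtains g where "ac_density f g"
proof -
  let ?V = "total_variation f 0"
  note inc = total_variation_increment[OF f]
  have V: "absolutely_continuous_on_unit ?V" by (rule absolutely_continuous_total_variation[OF f])
  have Vf: "absolutely_continuous_on_unit (\<lambda>t. ?V t - f t)"
    by (rule AC_increments_le[OF V f, of _ 1]) (simp add: abs_if)
  have Vm: "?V s \<le> ?V t" if "0 \<le> s" "s \<le> t" "t \<le> 1" for s t
    using inc[OF that] by linarith
  have Vfm: "?V s - f s \<le> ?V t - f t" if "0 \<le> s" "s \<le> t" "t \<le> 1" for s t
    using inc[OF that] by linarith
  obtain g1 where g1: "integrable lborel g1" "\<And>t. t \<in> {0..1} \<Longrightarrow> ?V t - ?V 0 = (LINT r:{0..t}|lborel. g1 r)"
    using monotone_AC_density[of ?V, OF Vm V] by blast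
  obtain g2 where g2: "integrable lborel g2"
    "\<And>t. t \<in> {0..1} \<Longrightarrow> (?V t - f t) - (?V 0 - f 0) = (LINT r:{0..t}|lborel. g2 r)"
    using monotone_AC_density[of "\<lambda>t. ?V t - f t", OF Vfm Vf] by blast
  have "ac_density f (\<lambda>r. g1 r - g2 r)"
    unfolding ac_density_def
  proof (intro conjI ballI)
    show "integrable lborel (\<lambda>r. g1 r - g2 r)" using g1(1) g2(1) by simp
    fix t :: real assume t: "t \<in> {0..1}"
    have "(LINT r:{0..t}|lborel. g1 r - g2 r) = (LINT r:{0..t}|lborel. g1 r) - (LINT r:{0..t}|lborel. g2 r)"
      using set_integrable_integrable[OF g1(1)] set_integrable_integrable[OF g2(1)]
      by (intro set_integral_diff) auto
    then show "f t - f 0 = (LINT r:{0..t}|lborel. g1 r - g2 r)"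
      using g1(2)[OF t] g2(2)[OF t] by linarith
  qed
  then show ?thesis by (rule that)
qed

lemma AC_density:
  fixes f :: "real \<Rightarrow> 'b::euclidean_space"
  assumes f: "absolutely_continuous_on_unit f"
  obtains g where "ac_density f g"
proof -
  have "absolutely_continuous_on_unit (\<lambda>t. f t \<bullet> b)" if "b \<in> Basis" for b
  proof (rule AC_increments_le[OF f f, of _ 1])
    show "norm (f t \<bullet> b - f s \<bullet> b) \<le> 1 * (norm (f t - f s) + norm (f t - f s))" for s t
      using Basis_le_norm[OF that, of "f t - f s"] by (simp add: inner_diff_left)
  qed
  then have "\<exists>g. ac_density (\<lambda>t. f t \<bullet> b) g" if "b \<in> Basis" for b
    using AC_real_density that by metis
  then obtain g where g: "\<And>b. b \<in> Basis \<Longrightarrow> ac_density (\<lambda>t. f t \<bullet> b) (g b)"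
    by metis
  have int: "integrable lborel (\<lambda>r. g b r *\<^sub>R b)" if "b \<in> Basis" for b
    using ac_densityD(1)[OF g[OF that]] by simp
  have "ac_density f (\<lambda>r. \<Sum>b\<in>Basis. g b r *\<^sub>R b)"
    unfolding ac_density_def
  proof (intro conjI ballI)
    show "integrable lborel (\<lambda>r. \<Sum>b\<in>Basis. g b r *\<^sub>R b)"
      using int by (rule Bochner_Integration.integrable_sum)
    fix t :: real assume t: "t \<in> {0..1}"
    have "(LINT r:{0..t}|lborel. \<Sum>b\<in>Basis. g b r *\<^sub>R b) = (\<Sum>b\<in>Basis. (LINT r:{0..t}|lborel. g b r *\<^sub>R b))"
      unfolding set_lebesgue_integral_def scaleR_sum_right
      using int by (intro Bochner_Integration.integral_sum integrable_mult_indicator) auto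
    also have "\<dots> = (\<Sum>b\<in>Basis. ((f t - f 0) \<bullet> b) *\<^sub>R b)"
    proof (rule sum.cong[OF refl])
      fix b :: 'b assume b: "b \<in> Basis"
      have "(LINT r:{0..t}|lborel. g b r *\<^sub>R b) = (LINT r:{0..t}|lborel. g b r) *\<^sub>R b"
        unfolding set_lebesgue_integral_def
        using set_integrable_integrable[OF ac_densityD(1)[OF g[OF b]], of "{0..t}"]
        by (subst integral_scaleR_left[symmetric]) (auto simp: set_integrable_def)
      then show "(LINT r:{0..t}|lborel. g b r *\<^sub>R b) = ((f t - f 0) \<bullet> b) *\<^sub>R b"
        using g[OF b] t by (simp add: ac_density_def inner_diff_left)
    qed
    also have "\<dots> = f t - f 0" by (rule euclidean_representation)
    finally show "f t - f 0 = (LINT r:{0..t}|lborel. \<Sum>b\<in>Basis. g b r *\<^sub>R b)" by simp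
  qed
  then show ?thesis by (rule that)
qed

lemma ac_density_has_vector_derivative:
  fixes f :: "real \<Rightarrow> 'b::euclidean_space"
  assumes "ac_density f g"
  shows "AE x in lborel. x \<in> {0<..<1} \<longrightarrow> (f has_vector_derivative g x) (at x)"
proof -
  have "AE x in lborel. x \<in> {0<..<1} \<longrightarrow> ((\<lambda>t. f t \<bullet> b) has_vector_derivative g x \<bullet> b) (at x)" for b
  proof -
    have d: "ac_density (\<lambda>t. f t \<bullet> b) (\<lambda>t. g t \<bullet> b)" using assms by (rule ac_density_component)
    show ?thesis
      using lebesgue_differentiation_real[OF ac_densityD(1)[OF d]]
    proof eventually_elim
      case (elim x)
      show ?case
      proof
        assume x: "x \<in> {0<..<1}"
        with elim have "((\<lambda>t. LINT r:{0..t}|lborel. g r \<bullet> b) has_vector_derivative g x \<bullet> b) (at x)" by simp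
        then have "((\<lambda>t. f 0 \<bullet> b + (LINT r:{0..t}|lborel. g r \<bullet> b)) has_vector_derivative g x \<bullet> b) (at x)"
          using has_vector_derivative_add[OF has_vector_derivative_const] by fastforce
        then show "((\<lambda>t. f t \<bullet> b) has_vector_derivative g x \<bullet> b) (at x)"
        proof (rule has_vector_derivative_transform_within_open[where S="{0<..<1}"])
          show "f 0 \<bullet> b + (LINT r:{0..y}|lborel. g r \<bullet> b) = f y \<bullet> b" if "y \<in> {0<..<1}" for y
            using ac_densityD(3)[OF d, of 0 y] that by simp
        qed (use x in auto)
      qed
    qed
  qed
  then have "AE x in lborel. \<forall>b\<in>Basis. x \<in> {0<..<1} \<longrightarrow> ((\<lambda>t. f t \<bullet> b) has_vector_derivative g x \<bullet> b) (at x)"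
    by (intro AE_finite_allI) auto
  then show ?thesis
  proof eventually_elim
    case (elim x)
    then show ?case
      unfolding has_vector_derivative_def
      by (subst has_derivative_componentwise_within) (auto simp: inner_scaleR_left)
  qed
qed

text \<open>For a composite function the derivative is computed by the chain rule almost everywhere.
  Absolute continuity supplies some density, and uniqueness of derivatives identifies the two; since
  g vanishes off [0, 1], it inherits integrability on the whole line.\<close>

lemma ac_densityI_AE:
  fixes f :: "real \<Rightarrow> 'b::euclidean_space"
  assumes f: "absolutely_continuous_on_unit f" and g: "g \<in> borel_measurable borel"
    and der: "AE x in lborel. x \<in> {0<..<1} \<longrightarrow> (f has_vector_derivative g x) (at x)"
    and zero: "\<And>x. x \<notin> {0..1} \<Longrightarrow> g x = 0"
  shows "ac_density f g"
proof -
  obtain h where h: "ac_density f h" using AC_density[OF f] .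
  have eq: "AE x in lborel. g x = indicator {0..1} x *\<^sub>R h x"
    using der ac_density_has_vector_derivative[OF h] AE_lborel_singleton[of 0] AE_lborel_singleton[of 1]
  proof eventually_elim
    case (elim x)
    show ?case
    proof (cases "x \<in> {0<..<1}")
      case True
      then show ?thesis using elim vector_derivative_unique_at by auto
    next
      case False
      then show ?thesis using elim zero[of x] by (auto simp: indicator_def)
    qed
  qed
  have hm: "h \<in> borel_measurable borel" using ac_densityD(2)[OF h] .
  show ?thesis
    unfolding ac_density_def
  proof (intro conjI ballI)
    have "integrable lborel (\<lambda>x. indicator {0..1} x *\<^sub>R h x)"
      using ac_densityD(1)[OF h] by (intro integrable_mult_indicator) auto
    then show "integrable lborel g"
      using eq g hm by (subst integrable_cong_AE[of g _ "\<lambda>x. indicator {0..1} x *\<^sub>R h x"]) auto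
    fix t :: real assume t: "t \<in> {0..1}"
    have "(LINT r:{0..t}|lborel. g r) = (LINT r:{0..t}|lborel. h r)"
      unfolding set_lebesgue_integral_def
    proof (rule integral_cong_AE)
      show "AE x in lborel. indicat_real {0..t} x *\<^sub>R g x = indicat_real {0..t} x *\<^sub>R h x"
        using eq by eventually_elim (use t in \<open>auto simp: indicator_def\<close>)
    qed (use g hm in measurable)
    then show "f t - f 0 = (LINT r:{0..t}|lborel. g r)"
      using h t by (simp add: ac_density_def)
  qed
qed

text \<open>Absolute continuity of the integral: g is at most n up to a remainder of integral below
  half of \<epsilon>, and the bounded part contributes at most n times the total length, hence at
  most the other half.\<close>

lemma integrable_interval_family_small:
  fixes g :: "real \<Rightarrow> real"
  assumes int: "integrable lborel g" and g0: "\<And>x. 0 \<le> g x" and e: "\<epsilon> > 0"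
  obtains \<delta> where "\<delta> > 0" "\<And>(I::nat set) u v. interval_family 0 1 I u v \<Longrightarrow>
    (\<Sum>i\<in>I. v i - u i) < \<delta> \<Longrightarrow> (\<Sum>i\<in>I. LINT r:{u i..v i}|lborel. g r) < \<epsilon>"
proof -
  have [measurable]: "g \<in> borel_measurable borel" using borel_measurable_integrable[OF int] by simp
  have "(\<lambda>n. LINT x|lborel. g x - min (g x) (real n)) \<longlonglongrightarrow> (LINT x::real|lborel. 0)"
  proof (rule integral_dominated_convergence[where w=g])
    show "AE x in lborel. (\<lambda>n. g x - min (g x) (real n)) \<longlonglongrightarrow> 0"
    proof (rule AE_I2)
      fix x
      have "\<forall>\<^sub>F n in sequentially. g x - min (g x) (real n) = 0"
        using eventually_ge_at_top[of "nat \<lceil>g x\<rceil>"] by eventually_elim linarith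
      then show "(\<lambda>n. g x - min (g x) (real n)) \<longlonglongrightarrow> 0" by (rule tendsto_eventually)
    qed
    show "AE x in lborel. norm (g x - min (g x) (real n)) \<le> g x" for n
      using g0 by (intro AE_I2) auto
  qed (use int in auto)
  then have "\<forall>\<^sub>F n in sequentially. (LINT x|lborel. g x - min (g x) (real n)) < \<epsilon> / 2"
    using e by (intro order_tendstoD(2)) auto
  then obtain n where n: "(LINT x|lborel. g x - min (g x) (real n)) < \<epsilon> / 2"
    by (auto simp: eventually_sequentially)
  define p where "p x = g x - min (g x) (real n)" for x
  have p0: "0 \<le> p x" for x by (simp add: p_def)
  have pint: "integrable lborel p"
    by (rule Bochner_Integration.integrable_bound[OF int]) (use g0 in \<open>auto simp: p_def[abs_def]\<close>)
  show ?thesis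
  proof (rule that[of "\<epsilon> / (2 * (real n + 1))"])
    show "\<epsilon> / (2 * (real n + 1)) > 0" using e by simp
    fix I :: "nat set" and u v
    assume fam: "interval_family 0 1 I u v" and less: "(\<Sum>i\<in>I. v i - u i) < \<epsilon> / (2 * (real n + 1))"
    have "(LINT r:{u i..v i}|lborel. g r) \<le> (LINT r:{u i<..<v i}|lborel. p r) + real n * (v i - u i)"
      if i: "i \<in> I" for i
    proof -
      have "(LINT r:{u i..v i}|lborel. g r) \<le> (LINT r:{u i..v i}|lborel. p r + real n)"
      proof (rule set_integral_mono)
        have "set_integrable lborel {u i..v i} (\<lambda>_. real n)"
          unfolding set_integrable_def by (intro borel_integrable_compact) auto
        then show "set_integrable lborel {u i..v i} (\<lambda>r. p r + real n)"
          using set_integrable_integrable[OF pint] by (intro set_integral_add) auto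
      qed (use set_integrable_integrable[OF int] in \<open>auto simp: p_def\<close>)
      also have "\<dots> = (LINT r:{u i..v i}|lborel. p r) + (LINT r:{u i..v i}|lborel. real n)"
      proof (rule set_integral_add)
        show "set_integrable lborel {u i..v i} (\<lambda>_. real n)"
          unfolding set_integrable_def by (intro borel_integrable_compact) auto
      qed (use set_integrable_integrable[OF pint] in auto)
      also have "(LINT r:{u i..v i}|lborel. real n) = real n * (v i - u i)"
        using interval_familyD(3)[OF fam i] by (simp add: set_lebesgue_integral_def)
      \<comment> \<open>Open intervals make the family disjoint, so that no point is counted twice
        in the sum below.\<close>
      also have "(LINT r:{u i..v i}|lborel. p r) = (LINT r:{u i<..<v i}|lborel. p r)"
        unfolding set_lebesgue_integral_def
      proof (rule integral_cong_AE)
        show "AE x in lborel. indicat_real {u i..v i} x *\<^sub>R p x = indicat_real {u i<..<v i} x *\<^sub>R p x"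
          using AE_lborel_singleton[of "u i"] AE_lborel_singleton[of "v i"]
          by eventually_elim (auto simp: indicator_def)
      qed (use pint in auto)
      finally show ?thesis .
    qed
    then have "(\<Sum>i\<in>I. LINT r:{u i..v i}|lborel. g r) \<le> (\<Sum>i\<in>I. (LINT r:{u i<..<v i}|lborel. p r) + real n * (v i - u i))"
      by (rule sum_mono)
    also have "\<dots> = (\<Sum>i\<in>I. LINT r:{u i<..<v i}|lborel. p r) + real n * (\<Sum>i\<in>I. v i - u i)"
      by (simp only: sum.distrib sum_distrib_left)
    finally have 1: "(\<Sum>i\<in>I. LINT r:{u i..v i}|lborel. g r) \<le>
      (\<Sum>i\<in>I. LINT r:{u i<..<v i}|lborel. p r) + real n * (\<Sum>i\<in>I. v i - u i)" .
    have "(\<Sum>i\<in>I. LINT r:{u i<..<v i}|lborel. p r) = (LINT r|lborel. (\<Sum>i\<in>I. indicator {u i<..<v i} r *\<^sub>R p r))"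
      unfolding set_lebesgue_integral_def using pint
      by (intro Bochner_Integration.integral_sum[symmetric] integrable_mult_indicator) auto
    also have "\<dots> \<le> (LINT r|lborel. p r)"
    proof (rule integral_mono)
      show "integrable lborel (\<lambda>r. \<Sum>i\<in>I. indicator {u i<..<v i} r *\<^sub>R p r)"
        using pint by (intro Bochner_Integration.integrable_sum integrable_mult_indicator) auto
      fix r
      show "(\<Sum>i\<in>I. indicator {u i<..<v i} r *\<^sub>R p r) \<le> p r"
      proof (cases "\<exists>i\<in>I. r \<in> {u i<..<v i}")
        case True
        then obtain i where i: "i \<in> I" "r \<in> {u i<..<v i}" by blast
        then have "indicator {u j<..<v j} r *\<^sub>R p r = 0" if "j \<in> I - {i}" for j
          using interval_familyD(5)[OF fam i(1), of j] that by (auto simp: indicator_def)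
        then have z: "(\<Sum>j\<in>I - {i}. indicator {u j<..<v j} r *\<^sub>R p r) = 0" by (intro sum.neutral ballI)
        have "(\<Sum>j\<in>I. indicator {u j<..<v j} r *\<^sub>R p r) =
            indicator {u i<..<v i} r *\<^sub>R p r + (\<Sum>j\<in>I - {i}. indicator {u j<..<v j} r *\<^sub>R p r)"
          by (rule sum.remove[OF interval_familyD(1)[OF fam] i(1)])
        also have "\<dots> = p r"
          by (simp only: z indicator_simps(1)[OF i(2)] scaleR_one add_0_right)
        finally show ?thesis by simp
      next
        case False
        then have "(\<Sum>i\<in>I. indicator {u i<..<v i} r *\<^sub>R p r) = 0" by (intro sum.neutral) auto
        then show ?thesis using p0 by simp
      qed
    qed (rule pint)
    also have "\<dots> < \<epsilon> / 2" using n by (simp add: p_def)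
    finally have 2: "(\<Sum>i\<in>I. LINT r:{u i<..<v i}|lborel. p r) < \<epsilon> / 2" .
    have "real n * (\<Sum>i\<in>I. v i - u i) \<le> real n * (\<epsilon> / (2 * (real n + 1)))"
      using less by (intro mult_left_mono) auto
    also have "\<dots> \<le> \<epsilon> / 2" using e by (simp add: field_simps)
    finally show "(\<Sum>i\<in>I. LINT r:{u i..v i}|lborel. g r) < \<epsilon>" using 1 2 by linarith
  qed
qed

lemma ac_density_imp_AC:
  fixes f :: "real \<Rightarrow> 'b::euclidean_space"
  assumes d: "ac_density f g"
  shows "absolutely_continuous_on_unit f"
proof (rule absolutely_continuous_on_unitI)
  fix \<epsilon> :: real assume e: "\<epsilon> > 0"
  have int: "integrable lborel (\<lambda>x. norm (g x))" using ac_densityD(1)[OF d] by simp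
  obtain \<delta> where \<delta>: "\<delta> > 0" "\<And>(I::nat set) u v. interval_family 0 1 I u v \<Longrightarrow>
    (\<Sum>i\<in>I. v i - u i) < \<delta> \<Longrightarrow> (\<Sum>i\<in>I. LINT r:{u i..v i}|lborel. norm (g r)) < \<epsilon>"
    using integrable_interval_family_small[OF int _ e] by auto
  show "\<exists>\<delta>>0. \<forall>(n::nat) u v. interval_family 0 1 {..<n} u v \<longrightarrow>
    (\<Sum>i<n. v i - u i) < \<delta> \<longrightarrow> (\<Sum>i<n. norm (f (v i) - f (u i))) < \<epsilon>"
  proof (intro exI[of _ \<delta>] conjI allI impI \<delta>(1))
    fix n :: nat and u v assume fam: "interval_family 0 1 {..<n} u v" and less: "(\<Sum>i<n. v i - u i) < \<delta>"
    have "(\<Sum>i<n. norm (f (v i) - f (u i))) \<le> (\<Sum>i<n. LINT r:{u i..v i}|lborel. norm (g r))"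
    proof (rule sum_mono)
      fix i assume i: "i \<in> {..<n}"
      have "f (v i) - f (u i) = (LINT r:{u i..v i}|lborel. g r)"
        using interval_familyD(2-4)[OF fam i] by (rule ac_densityD(3)[OF d])
      also have "norm \<dots> \<le> (LINT r:{u i..v i}|lborel. norm (g r))"
        using set_integral_norm_bound[OF set_integrable_integrable[OF ac_densityD(1)[OF d]], of "{u i..v i}"] by simp
      finally show "norm (f (v i) - f (u i)) \<le> (LINT r:{u i..v i}|lborel. norm (g r))" .
    qed
    also have "\<dots> < \<epsilon>" by (rule \<delta>(2)[OF fam less])
    finally show "(\<Sum>i<n. norm (f (v i) - f (u i))) < \<epsilon>" .
  qed
qed

section \<open>Smooth functions\<close>

lemma C_diff_SucI:
  assumes "\<And>x. (f has_derivative f' x) (at x)" and "\<And>b. b \<in> Basis \<Longrightarrow> C_diff k (\<lambda>x. f' x b)"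
  shows "C_diff (Suc k) f"
proof -
  have "frechet_derivative f (at x) = f' x" for x
    using frechet_derivative_at[OF assms(1)] by simp
  then show ?thesis using assms by (auto simp: differentiable_def)
qed

lemma C_diff_has_derivative:
  assumes "C_diff (Suc k) f"
  shows "(f has_derivative frechet_derivative f (at x)) (at x)"
  using assms by (simp add: frechet_derivative_works)

lemma C_diff_SucD: "C_diff (Suc k) f \<Longrightarrow> C_diff k f"
proof (induction k arbitrary: f)
  case 0
  then show ?case
    by (auto intro!: continuous_at_imp_continuous_on differentiable_imp_continuous_within)
next
  case (Suc k)
  then show ?case unfolding C_diff.simps(2)[of "Suc k"] by auto
qed

lemma C_diff_const: "C_diff k (\<lambda>_. c)"
proof (induction k arbitrary: c)
  case (Suc k)
  show ?case by (rule C_diff_SucI[where f'="\<lambda>_ _. 0"]) (auto intro: Suc)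
qed simp

lemma C_diff_add: "C_diff k f \<Longrightarrow> C_diff k g \<Longrightarrow> C_diff k (\<lambda>x. f x + g x)"
proof (induction k arbitrary: f g)
  case 0
  then show ?case by (auto intro!: continuous_intros)
next
  case (Suc k)
  show ?case
  proof (rule C_diff_SucI)
    show "((\<lambda>x. f x + g x) has_derivative (\<lambda>v. frechet_derivative f (at x) v + frechet_derivative g (at x) v)) (at x)" for x
      using Suc.prems by (intro has_derivative_add C_diff_has_derivative)
  qed (use Suc in auto)
qed

lemma C_diff_sum: "finite I \<Longrightarrow> (\<And>i. i \<in> I \<Longrightarrow> C_diff k (f i)) \<Longrightarrow> C_diff k (\<lambda>x. \<Sum>i\<in>I. f i x)"
proof (induction I rule: finite_induct)
  case (insert i I)
  then have "C_diff k (\<lambda>x. f i x + (\<Sum>i\<in>I. f i x))" by (intro C_diff_add) simp_all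
  then show ?case using insert.hyps by simp
qed (simp add: C_diff_const del: C_diff.simps)

lemma C_diff_mult: "C_diff k f \<Longrightarrow> C_diff k g \<Longrightarrow> C_diff k (\<lambda>x. f x * g x)"
proof (induction k arbitrary: f g)
  case 0
  then show ?case by (auto intro!: continuous_intros)
next
  case (Suc k)
  show ?case
  proof (rule C_diff_SucI)
    show "((\<lambda>x. f x * g x) has_derivative (\<lambda>v. f x * frechet_derivative g (at x) v + frechet_derivative f (at x) v * g x)) (at x)" for x
      using Suc.prems by (intro has_derivative_mult C_diff_has_derivative)
    have "C_diff k f" "C_diff k g" using Suc.prems C_diff_SucD by auto
    then show "C_diff k (\<lambda>x. f x * frechet_derivative g (at x) b + frechet_derivative f (at x) b * g x)"
      if "b \<in> Basis" for b
      using Suc.prems that by (intro C_diff_add Suc.IH) auto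
  qed
qed

lemma frechet_derivative_Basis_sum:
  fixes f :: "'b::euclidean_space \<Rightarrow> real"
  assumes "f differentiable (at x)"
  shows "frechet_derivative f (at x) v = (\<Sum>b\<in>Basis. (v \<bullet> b) * frechet_derivative f (at x) b)"
proof -
  interpret bounded_linear "frechet_derivative f (at x)"
    using assms frechet_derivative_works has_derivative_bounded_linear by blast
  have "frechet_derivative f (at x) v = frechet_derivative f (at x) (\<Sum>b\<in>Basis. (v \<bullet> b) *\<^sub>R b)"
    by (simp add: euclidean_representation)
  also have "\<dots> = (\<Sum>b\<in>Basis. (v \<bullet> b) * frechet_derivative f (at x) b)"
    by (simp add: sum scale)
  finally show ?thesis .
qed

text \<open>The induction varies f, since the derivative of the composite is a combination of
  partial derivatives of f composed with the same affine map.\<close>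

lemma C_diff_compose_affine:
  fixes f :: "'b::euclidean_space \<Rightarrow> real" and L :: "'c::euclidean_space \<Rightarrow> 'b"
  assumes "bounded_linear L"
  shows "C_diff k f \<Longrightarrow> C_diff k (\<lambda>x. f (p + L x))"
proof (induction k arbitrary: f)
  case 0
  have "continuous_on UNIV (\<lambda>x. p + L x)"
    using linear_continuous_on[OF assms] by (intro continuous_on_add continuous_on_const)
  then show ?case
    using 0 continuous_on_compose2[of UNIV f UNIV "\<lambda>x. p + L x"] by simp
next
  case (Suc k)
  have diff: "f differentiable (at y)" for y using Suc.prems by simp
  show ?case
  proof (rule C_diff_SucI)
    fix x
    have "((\<lambda>x. p + L x) has_derivative L) (at x)"
      using assms by (auto intro!: derivative_eq_intros bounded_linear_imp_has_derivative)
    then show "((\<lambda>x. f (p + L x)) has_derivative (\<lambda>v. frechet_derivative f (at (p + L x)) (L v))) (at x)"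
      by (rule has_derivative_compose[of "\<lambda>x. p + L x" L x UNIV f, simplified])
        (rule C_diff_has_derivative[OF Suc.prems])
  next
    fix b :: 'c assume "b \<in> Basis"
    have "C_diff k (\<lambda>x. \<Sum>c\<in>Basis. (L b \<bullet> c) * frechet_derivative f (at (p + L x)) c)"
      using Suc.prems by (intro C_diff_sum C_diff_mult C_diff_const Suc.IH) auto
    then show "C_diff k (\<lambda>x. frechet_derivative f (at (p + L x)) (L b))"
      by (subst frechet_derivative_Basis_sum[OF diff])
  qed
qed

lemma C_diff_real_compose:
  fixes g :: "real \<Rightarrow> real" and f :: "'b::euclidean_space \<Rightarrow> real"
  shows "C_diff k g \<Longrightarrow> C_diff k f \<Longrightarrow> C_diff k (\<lambda>x. g (f x))"
proof (induction k arbitrary: f g)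
  case 0
  then show ?case by (auto intro!: continuous_on_compose2[of UNIV g])
next
  case (Suc k)
  have diff: "g differentiable (at y)" for y using Suc.prems by simp
  show ?case
  proof (rule C_diff_SucI)
    fix x
    show "((\<lambda>x. g (f x)) has_derivative (\<lambda>v. frechet_derivative g (at (f x)) (frechet_derivative f (at x) v))) (at x)"
      using Suc.prems
      by (intro has_derivative_compose[of f _ x UNIV g, simplified] C_diff_has_derivative)
  next
    fix b :: 'b assume b: "b \<in> Basis"
    have "C_diff k (\<lambda>y. frechet_derivative g (at y) 1)" "C_diff k (\<lambda>x. frechet_derivative f (at x) b)"
      using Suc.prems b by auto
    then have "C_diff k (\<lambda>x. frechet_derivative f (at x) b * frechet_derivative g (at (f x)) 1)"
      using Suc.IH[OF _ C_diff_SucD[OF Suc.prems(2)]] by (intro C_diff_mult)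
    then show "C_diff k (\<lambda>x. frechet_derivative g (at (f x)) (frechet_derivative f (at x) b))"
      by (subst frechet_derivative_Basis_sum[OF diff]) simp
  qed
qed

section \<open>Infinitely differentiable functions\<close>

definition smooth :: "('b::euclidean_space \<Rightarrow> real) \<Rightarrow> bool" where
  "smooth f \<longleftrightarrow> (\<forall>k. C_diff k f)"

lemma smooth_const: "smooth (\<lambda>_. c)"
  unfolding smooth_def by (intro allI C_diff_const)

lemma smooth_add: "smooth f \<Longrightarrow> smooth g \<Longrightarrow> smooth (\<lambda>x. f x + g x)"
  unfolding smooth_def by (intro allI C_diff_add) simp_all

lemma smooth_mult: "smooth f \<Longrightarrow> smooth g \<Longrightarrow> smooth (\<lambda>x. f x * g x)"
  unfolding smooth_def by (intro allI C_diff_mult) simp_all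

lemma smooth_sum: "finite I \<Longrightarrow> (\<And>i. i \<in> I \<Longrightarrow> smooth (F i)) \<Longrightarrow> smooth (\<lambda>x. \<Sum>i\<in>I. F i x)"
  unfolding smooth_def by (intro allI C_diff_sum) simp_all

lemma smooth_compose_affine:
  "bounded_linear L \<Longrightarrow> smooth f \<Longrightarrow> smooth (\<lambda>x. f (p + L x))"
  unfolding smooth_def using C_diff_compose_affine[of L _ f p] by simp

lemma smooth_real_compose: "smooth g \<Longrightarrow> smooth f \<Longrightarrow> smooth (\<lambda>x. g (f x))"
  unfolding smooth_def using C_diff_real_compose[of _ g f] by simp

lemma smooth_diff:
  assumes "smooth f" "smooth g"
  shows "smooth (\<lambda>x. f x - g x)"
proof -
  have "smooth (\<lambda>x. f x + (- 1) * g x)"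
    by (rule smooth_add[OF assms(1) smooth_mult[OF smooth_const assms(2)]])
  then show ?thesis by simp
qed

lemma smooth_bounded_linear:
  assumes "bounded_linear f"
  shows "smooth f"
  unfolding smooth_def
proof
  fix k
  have "C_diff (Suc k) f"
    using assms
    by (intro C_diff_SucI[where f'="\<lambda>_. f"] C_diff_const bounded_linear_imp_has_derivative)
  then show "C_diff k f" by (rule C_diff_SucD)
qed

lemma smooth_inner: "smooth (\<lambda>x. x \<bullet> b)"
  by (intro smooth_bounded_linear bounded_linear_inner_left)

lemma smooth_norm_power2: "smooth (\<lambda>x::'b::euclidean_space. (norm x)\<^sup>2)"
proof -
  have "(\<lambda>x::'b. (norm x)\<^sup>2) = (\<lambda>x. \<Sum>b\<in>Basis. (x \<bullet> b) * (x \<bullet> b))"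
    by (simp add: power2_norm_eq_inner euclidean_inner[symmetric] fun_eq_iff)
  moreover have "smooth (\<lambda>x::'b. \<Sum>b\<in>Basis. (x \<bullet> b) * (x \<bullet> b))"
    by (rule smooth_sum[OF finite_Basis smooth_mult[OF smooth_inner smooth_inner]])
  ultimately show ?thesis by simp
qed

lemma smooth_differentiable: "smooth f \<Longrightarrow> f differentiable (at x)"
  using C_diff.simps(2)[of 0 f] unfolding smooth_def by blast

lemma smooth_has_derivative: "smooth f \<Longrightarrow> (f has_derivative frechet_derivative f (at x)) (at x)"
  using smooth_differentiable frechet_derivative_works by blast

lemma smooth_continuous_on: "smooth f \<Longrightarrow> continuous_on S f"
  using C_diff.simps(1)[of f] continuous_on_subset[OF _ subset_UNIV] unfolding smooth_def by blast

lemma smooth_partial: "smooth f \<Longrightarrow> b \<in> Basis \<Longrightarrow> smooth (\<lambda>x. frechet_derivative f (at x) b)"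
  using C_diff.simps(2)[of _ f] unfolding smooth_def by blast

lemma smooth_derivative_continuous_on:
  fixes f :: "'b::euclidean_space \<Rightarrow> real"
  assumes f: "smooth f" and "continuous_on S u" "continuous_on S v"
  shows "continuous_on S (\<lambda>s. frechet_derivative f (at (u s)) (v s))"
  unfolding frechet_derivative_Basis_sum[OF smooth_differentiable[OF f], of _ "v _"]
proof (intro continuous_on_sum continuous_on_mult continuous_on_inner continuous_on_const assms(3))
  fix b :: 'b assume "b \<in> Basis"
  from smooth_continuous_on[OF smooth_partial[OF f this], of UNIV] assms(2)
  show "continuous_on S (\<lambda>s. frechet_derivative f (at (u s)) b)"
    by (rule continuous_on_compose2) simp
qed

lemma smooth_derivative_measurable:
  fixes f :: "'b::euclidean_space \<Rightarrow> real"
  assumes f: "smooth f" and [measurable]: "u \<in> borel_measurable M" "v \<in> borel_measurable M"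
  shows "(\<lambda>s. frechet_derivative f (at (u s)) (v s)) \<in> borel_measurable M"
proof -
  have [measurable]: "(\<lambda>x. frechet_derivative f (at x) b) \<in> borel_measurable borel" if "b \<in> Basis" for b
    using smooth_continuous_on[OF smooth_partial[OF f that]] by (intro borel_measurable_continuous_onI)
  show ?thesis
    unfolding frechet_derivative_Basis_sum[OF smooth_differentiable[OF f], of _ "v _"]
    by (intro borel_measurable_sum borel_measurable_times) measurable
qed

lemma smooth_derivative_zero_outside:
  assumes "f differentiable (at x)" "x \<notin> closure {p. f p \<noteq> 0}"
  shows "frechet_derivative f (at x) v = (0::real)"
proof -
  have "(f has_derivative (\<lambda>_. 0)) (at x)"
  proof (rule has_derivative_transform_within_open[of "\<lambda>_. 0" "\<lambda>_. 0" x UNIV "- closure {p. f p \<noteq> 0}"])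
    show "0 = f y" if "y \<in> - closure {p. f p \<noteq> 0}" for y
      using that closure_subset[of "{p. f p \<noteq> 0}"] by auto
  qed (use assms in auto)
  then show ?thesis using frechet_derivative_at by metis
qed

lemma compact_continuous_bound:
  fixes f :: "'b::topological_space \<Rightarrow> real"
  assumes "compact K" "continuous_on K f"
  obtains B where "\<And>x. x \<in> K \<Longrightarrow> \<bar>f x\<bar> \<le> B"
proof -
  have "bounded (f ` K)"
    using compact_continuous_image[OF assms(2,1)] by (rule compact_imp_bounded)
  then show ?thesis using that unfolding bounded_iff by auto
qed

text \<open>The partial derivatives are bounded on the compact support and vanish off it. Being
  uniform in x, the bound later serves as a Lipschitz constant too.\<close>

lemma smooth_derivative_bound:
  fixes f :: "'b::euclidean_space \<Rightarrow> real"
  assumes f: "smooth f" and supp: "compact (closure {p. f p \<noteq> 0})"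
  obtains C where "C \<ge> 0" "\<And>x v. \<bar>frechet_derivative f (at x) v\<bar> \<le> C * norm v"
proof -
  have "\<exists>B. \<forall>x. \<bar>frechet_derivative f (at x) b\<bar> \<le> B" if b: "b \<in> Basis" for b
  proof -
    obtain B where B: "\<And>x. x \<in> closure {p. f p \<noteq> 0} \<Longrightarrow> \<bar>frechet_derivative f (at x) b\<bar> \<le> B"
      using compact_continuous_bound[OF supp smooth_continuous_on[OF smooth_partial[OF f b]]] by metis
    show ?thesis
    proof (intro exI[of _ "max B 0"] allI)
      fix x
      show "\<bar>frechet_derivative f (at x) b\<bar> \<le> max B 0"
        using B[of x] smooth_derivative_zero_outside[OF smooth_differentiable[OF f], of x b]
        by (cases "x \<in> closure {p. f p \<noteq> 0}") auto
    qed
  qed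
  then obtain B where B: "\<And>b x. b \<in> Basis \<Longrightarrow> \<bar>frechet_derivative f (at x) b\<bar> \<le> B b"
    by metis
  have B0: "0 \<le> B b" if "b \<in> Basis" for b using B[OF that] abs_ge_zero order_trans by blast
  show ?thesis
  proof (rule that[of "\<Sum>b\<in>Basis. B b"])
    show "0 \<le> sum B Basis" using B0 by (rule sum_nonneg)
    fix x v
    have "\<bar>frechet_derivative f (at x) v\<bar> \<le> (\<Sum>b\<in>Basis. \<bar>(v \<bullet> b) * frechet_derivative f (at x) b\<bar>)"
      by (subst frechet_derivative_Basis_sum[OF smooth_differentiable[OF f]]) (rule sum_abs)
    also have "\<dots> \<le> (\<Sum>b\<in>Basis. B b * norm v)"
    proof (rule sum_mono)
      fix b :: 'b assume b: "b \<in> Basis"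
      have "\<bar>v \<bullet> b\<bar> * \<bar>frechet_derivative f (at x) b\<bar> \<le> norm v * B b"
        using b B[OF b] Basis_le_norm[OF b] by (intro mult_mono) auto
      then show "\<bar>(v \<bullet> b) * frechet_derivative f (at x) b\<bar> \<le> B b * norm v"
        by (simp add: abs_mult mult.commute)
    qed
    finally show "\<bar>frechet_derivative f (at x) v\<bar> \<le> sum B Basis * norm v"
      by (simp add: sum_distrib_right)
  qed
qed

section \<open>A flat function, a smooth step and radial cutoffs\<close>

definition flat :: "real poly \<Rightarrow> real \<Rightarrow> real" where
  "flat p x = (if x > 0 then poly p (1 / x) * exp (- (1 / x)) else 0)"

lemma flat_tendsto_0: "(flat p \<longlongrightarrow> 0) (at 0)"
proof (rule filterlim_split_at)
  show "(flat p \<longlongrightarrow> 0) (at_left 0)"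
    by (rule tendsto_eventually) (auto simp: eventually_at_left_field flat_def intro!: exI[of _ "-1"])
  have "((\<lambda>y::real. poly p y * exp (- y)) \<longlongrightarrow> 0) at_top"
  proof -
    have "((\<lambda>y::real. \<Sum>i\<le>degree p. coeff p i * (y ^ i / exp y)) \<longlongrightarrow> (\<Sum>i\<le>degree p. coeff p i * 0)) at_top"
      by (intro tendsto_sum tendsto_mult tendsto_const tendsto_power_div_exp_0)
    moreover have "poly p y * exp (- y) = (\<Sum>i\<le>degree p. coeff p i * (y ^ i / exp y))" for y :: real
      by (simp add: poly_altdef exp_minus sum_distrib_right divide_inverse mult.assoc)
    ultimately show ?thesis by simp
  qed
  moreover have "filterlim (\<lambda>x::real. 1 / x) at_top (at_right 0)"
    using filterlim_inverse_at_top_right by (simp add: inverse_eq_divide)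
  ultimately have "((\<lambda>x. poly p (1 / x) * exp (- (1 / x))) \<longlongrightarrow> 0) (at_right (0::real))"
    by (rule filterlim_compose)
  then show "(flat p \<longlongrightarrow> 0) (at_right 0)"
    by (rule Lim_transform_eventually)
      (auto simp: eventually_at_right_field flat_def intro!: exI[of _ 1])
qed

text \<open>With y = 1/x, differentiation turns p(y) exp(-y) into (p - p')(y) y^2 exp(-y). The
  family is thus closed under differentiation, which is why the polynomial is a parameter of
  \<open>flat\<close>.\<close>

lemma flat_has_derivative:
  "(flat p has_real_derivative flat ((p - pderiv p) * [:0, 0, 1:]) x) (at x)"
proof -
  consider "x < 0" | "x = 0" | "x > 0" by linarith
  then show ?thesis
  proof cases
    case 1
    have "((\<lambda>_. 0) has_real_derivative 0) (at x)" by simp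
    then have "(flat p has_real_derivative 0) (at x)"
      by (rule has_field_derivative_transform_within_open[where S="{..<0}"]) (use 1 in \<open>auto simp: flat_def\<close>)
    then show ?thesis using 1 by (simp add: flat_def)
  next
    case 2
    \<comment> \<open>Dividing by h multiplies the polynomial by y = 1/h, which is what
      \<open>pCons 0\<close> does.\<close>
    have "((\<lambda>h. (flat p (0 + h) - flat p 0) / h) \<longlongrightarrow> 0) (at 0)"
    proof (rule Lim_transform_eventually[OF flat_tendsto_0[of "pCons 0 p"]])
      show "\<forall>\<^sub>F h in at 0. flat (pCons 0 p) h = (flat p (0 + h) - flat p 0) / h"
        by (auto simp: flat_def eventually_at_filter field_simps)
    qed
    then show ?thesis using 2 by (simp add: DERIV_def flat_def)
  next
    case 3
    have "((\<lambda>x. poly p (1 / x) * exp (- (1 / x))) has_real_derivative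
        (poly (pderiv p) (1 / x) * (- (1 / x^2))) * exp (- (1 / x)) + (exp (- (1 / x)) * (1 / x^2)) * poly p (1 / x)) (at x)"
      using 3 by (auto intro!: derivative_eq_intros simp: power2_eq_square)
    then have "(flat p has_real_derivative
        (poly (pderiv p) (1 / x) * (- (1 / x^2))) * exp (- (1 / x)) + (exp (- (1 / x)) * (1 / x^2)) * poly p (1 / x)) (at x)"
      by (rule has_field_derivative_transform_within_open[where S="{0<..}"]) (use 3 in \<open>auto simp: flat_def\<close>)
    also have "(poly (pderiv p) (1 / x) * (- (1 / x^2))) * exp (- (1 / x)) + (exp (- (1 / x)) * (1 / x^2)) * poly p (1 / x)
        = flat ((p - pderiv p) * [:0, 0, 1:]) x"
      using 3 by (simp add: flat_def power2_eq_square field_simps)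
    finally show ?thesis .
  qed
qed

lemma smooth_flat: "smooth (flat p)"
  unfolding smooth_def
proof
  fix k show "C_diff k (flat p)"
  proof (induction k arbitrary: p)
    case 0
    show ?case
      using flat_has_derivative by (auto intro!: continuous_at_imp_continuous_on DERIV_isCont)
  next
    case (Suc k)
    show ?case
    proof (rule C_diff_SucI)
      show "(flat p has_derivative (\<lambda>v. flat ((p - pderiv p) * [:0, 0, 1:]) x * v)) (at x)" for x
        using flat_has_derivative by (simp add: has_field_derivative_def)
    qed (use Suc in auto)
  qed
qed

lemma smooth_antiderivative:
  fixes F :: "real \<Rightarrow> real"
  assumes "\<And>x. (F has_real_derivative f x) (at x)" and f: "smooth f"
  shows "smooth F"
  unfolding smooth_def
proof
  fix k
  have "C_diff (Suc k) F"
  proof (rule C_diff_SucI)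
    show "(F has_derivative (\<lambda>v. f x * v)) (at x)" for x
      using assms(1) by (simp add: has_field_derivative_def)
  qed (use f in \<open>auto simp: smooth_def\<close>)
  then show "C_diff k F" by (rule C_diff_SucD)
qed

text \<open>H is the normalized primitive of the bump exp(-1/x) exp(-1/(1 - x)).\<close>

lemma smooth_step_exists:
  obtains H \<rho> :: "real \<Rightarrow> real" where
    "\<And>x. (H has_real_derivative \<rho> x) (at x)" "smooth H" "continuous_on UNIV \<rho>"
    "\<And>x. \<rho> x \<ge> 0" "\<And>x. x \<notin> {0<..<1} \<Longrightarrow> \<rho> x = 0"
    "\<And>x. x \<le> 0 \<Longrightarrow> H x = 0" "\<And>x. x \<ge> 1 \<Longrightarrow> H x = 1"
proof -
  define b where "b x = flat 1 x * flat 1 (1 + (- 1) * x)" for x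
  have b: "smooth b"
    unfolding b_def
    by (intro smooth_mult smooth_flat smooth_compose_affine[where L="\<lambda>x. (-1) * x"] bounded_linear_mult_right)
  have b0: "b x \<ge> 0" for x by (simp add: b_def flat_def)
  have bz: "b x = 0" if "x \<notin> {0<..<1}" for x using that by (auto simp: b_def flat_def)
  have bpos: "b x > 0" if "x \<in> {0<..<1}" for x using that by (auto simp: b_def flat_def)
  \<comment> \<open>Starting at -1 instead of 0 makes every x \<ge> 0 an interior point of an
    interval [-1, x + 1] on which the primitive is defined.\<close>
  define F where "F x = integral {-1..x} b" for x
  have Fz: "F x = 0" if "x \<le> 0" for x
    unfolding F_def using that bz by (intro integral_unique has_integral_is_0) auto
  have Fd: "(F has_real_derivative b x) (at x)" for x
  proof (cases "x < 0")
    case True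
    have "((\<lambda>_. 0) has_real_derivative 0) (at x)" by simp
    then have "(F has_real_derivative 0) (at x)"
      by (rule has_field_derivative_transform_within_open[where S="{..<0}"]) (use True Fz in auto)
    then show ?thesis using True bz by simp
  next
    case False
    have "(F has_real_derivative b x) (at x within {-1..x + 1})"
      unfolding F_def using False smooth_continuous_on[OF b]
      by (intro integral_has_real_derivative) auto
    then show ?thesis using False by (subst (asm) at_within_Icc_at) auto
  qed
  have Fc: "continuous_on S F" for S
    using Fd by (auto intro!: continuous_at_imp_continuous_on DERIV_isCont)
  have F1: "F 0 < F 1"
    by (rule DERIV_pos_imp_increasing_open[of 0 1]) (use Fd bpos Fc in auto)
  have Fx: "F x = F 1" if "x \<ge> 1" for x
  proof (cases "x = 1")
    case False
    have "F x = F 1"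
      by (rule DERIV_isconst2[of 1 x F x]) (use Fc that False in simp_all, metis Fd bz greaterThanLessThan_iff less_asym)
    then show ?thesis .
  qed simp
  define c where "c = F 1"
  have c: "c > 0" using F1 Fz[of 0] by (simp add: c_def)
  have Hd: "((\<lambda>x. F x / c) has_real_derivative b x / c) (at x)" for x
    using Fd by (rule DERIV_cdivide)
  show ?thesis
  proof (rule that[of "\<lambda>x. F x / c" "\<lambda>x. b x / c"])
    have "smooth (\<lambda>x. b x * (1 / c))" using b by (rule smooth_mult) (rule smooth_const)
    then have "smooth (\<lambda>x. b x / c)" by simp
    with Hd show "smooth (\<lambda>x. F x / c)" by (rule smooth_antiderivative)
    show "continuous_on UNIV (\<lambda>x. b x / c)"
      using smooth_continuous_on[OF b] c by (intro continuous_intros) auto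
    show "F x / c = 1" if "x \<ge> 1" for x
      using Fx[OF that] c by (simp add: c_def)
  qed (use Hd b0 bz Fz c in auto)
qed

text \<open>The cutoff is a step in |x|^2 / R^2, which keeps it smooth at the origin. Its transition
  lies in R^2 < |x|^2 < 2 R^2, where the derivative is of order 1/|x| uniformly in R; multiplied by
  a function of quadratic growth, this derivative leaves only linear growth.\<close>

lemma cutoff_exists:
  obtains \<kappa> :: "real \<Rightarrow> 'b::euclidean_space \<Rightarrow> real" and C where
    "\<And>R. R > 0 \<Longrightarrow> smooth (\<kappa> R)" "\<And>R. R > 0 \<Longrightarrow> compact (closure {x. \<kappa> R x \<noteq> 0})"
    "\<And>R x. \<bar>\<kappa> R x\<bar> \<le> 1" "\<And>R x. R > 0 \<Longrightarrow> norm x \<le> R \<Longrightarrow> \<kappa> R x = 1"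
    "\<And>R x v. R > 0 \<Longrightarrow> norm x < R \<Longrightarrow> frechet_derivative (\<kappa> R) (at x) v = 0"
    "\<And>R x v. R > 0 \<Longrightarrow> norm x * \<bar>frechet_derivative (\<kappa> R) (at x) v\<bar> \<le> C * norm v" "C \<ge> 0"
proof -
  obtain H \<rho> :: "real \<Rightarrow> real" where
    H: "\<And>x. (H has_real_derivative \<rho> x) (at x)" "smooth H" "continuous_on UNIV \<rho>"
    "\<And>x. \<rho> x \<ge> 0" "\<And>x. x \<notin> {0<..<1} \<Longrightarrow> \<rho> x = 0"
    "\<And>x. x \<le> 0 \<Longrightarrow> H x = 0" "\<And>x. x \<ge> 1 \<Longrightarrow> H x = 1"
    using smooth_step_exists by metis
  have Hmono: "H x \<le> H y" if "x \<le> y" for x y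
    using that H(1,4) by (intro DERIV_nonneg_imp_nondecreasing[of x y H]) blast+
  have H01: "0 \<le> H x" "H x \<le> 1" for x
    using Hmono[of "min x 0" x] H(6)[of "min x 0"] Hmono[of x "max x 1"] H(7)[of "max x 1"] by auto
  obtain B where B: "\<And>x. x \<in> {0..1} \<Longrightarrow> \<bar>\<rho> x\<bar> \<le> B"
    using compact_continuous_bound[of "{0..1}" \<rho>] H(3) continuous_on_subset by (metis compact_Icc subset_UNIV)
  have B0: "0 \<le> B" using B[of 0] by simp
  have B': "\<bar>\<rho> x\<bar> \<le> B" for x using B[of x] H(5)[of x] B0 by (cases "x \<in> {0..1}") auto
  define \<kappa> where "\<kappa> R x = 1 - H (- 1 + (1 / R\<^sup>2) * (norm (x::'b))\<^sup>2)" for R :: real and x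
  have sm: "smooth (\<kappa> R)" for R
    unfolding \<kappa>_def
    by (intro smooth_diff smooth_const smooth_real_compose[OF H(2)] smooth_add smooth_mult smooth_norm_power2)
  have der: "frechet_derivative (\<kappa> R) (at x) v = - (\<rho> (- 1 + (1 / R\<^sup>2) * (norm x)\<^sup>2) * ((1 / R\<^sup>2) * (2 * (x \<bullet> v))))" for R x v
  proof -
    have "((\<lambda>x::'b. x \<bullet> x) has_derivative (\<lambda>v. 2 * (x \<bullet> v))) (at x)"
      by (auto intro!: derivative_eq_intros simp: inner_commute)
    then have "((\<lambda>x::'b. c * (x \<bullet> x)) has_derivative (\<lambda>v. c * (2 * (x \<bullet> v)))) (at x)" for c
      by (rule has_derivative_mult_right)
    from has_derivative_add[OF has_derivative_const this, of "- 1" "1 / R\<^sup>2"]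
    have "((\<lambda>x::'b. - 1 + (1 / R\<^sup>2) * (norm x)\<^sup>2) has_derivative (\<lambda>v. (1 / R\<^sup>2) * (2 * (x \<bullet> v)))) (at x)"
      by (simp add: power2_norm_eq_inner)
    from has_derivative_compose[OF this, of H "\<lambda>v. \<rho> (- 1 + (1 / R\<^sup>2) * (norm x)\<^sup>2) * v"]
    have "((\<lambda>x::'b. H (- 1 + (1 / R\<^sup>2) * (norm x)\<^sup>2)) has_derivative
        (\<lambda>v. \<rho> (- 1 + (1 / R\<^sup>2) * (norm x)\<^sup>2) * ((1 / R\<^sup>2) * (2 * (x \<bullet> v))))) (at x)"
      using H(1) by (simp add: has_field_derivative_def)
    then have "(\<kappa> R has_derivative (\<lambda>v. - (\<rho> (- 1 + (1 / R\<^sup>2) * (norm x)\<^sup>2) * ((1 / R\<^sup>2) * (2 * (x \<bullet> v)))))) (at x)"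
      unfolding \<kappa>_def by (auto intro!: derivative_eq_intros)
    then show ?thesis using frechet_derivative_at by metis
  qed
  show ?thesis
  \<comment> \<open>The derivative carries the factor 2 / R^2, and |x|^2 is at most 2 R^2 where it
    does not vanish.\<close>
  proof (rule that[of \<kappa> "4 * B"])
    fix R :: real assume R: "R > 0"
    show "smooth (\<kappa> R)" by (rule sm)
    have "{x. \<kappa> R x \<noteq> 0} \<subseteq> cball 0 (2 * R)"
    proof
      fix x assume "x \<in> {x. \<kappa> R x \<noteq> 0}"
      then have "- 1 + (1 / R\<^sup>2) * (norm x)\<^sup>2 < 1" using H(7)[of "- 1 + (1 / R\<^sup>2) * (norm x)\<^sup>2"] unfolding \<kappa>_def mem_Collect_eq by linarith
      then have "(norm x)\<^sup>2 < 2 * R\<^sup>2" using R by (simp add: field_simps)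
      also have "\<dots> \<le> (2 * R)\<^sup>2" by (simp add: power_mult_distrib)
      finally have "norm x < 2 * R" by (rule power2_less_imp_less) (use R in simp)
      then show "x \<in> cball 0 (2 * R)" by simp
    qed
    then show "compact (closure {x. \<kappa> R x \<noteq> 0})"
      using bounded_subset[OF bounded_cball] by (simp add: compact_closure)
    fix x :: 'b
    show "\<kappa> R x = 1" if "norm x \<le> R"
      using that R power_mono[OF that, of 2] by (simp add: \<kappa>_def H(6) field_simps)
    fix v
    show "frechet_derivative (\<kappa> R) (at x) v = 0" if "norm x < R"
      using R power_strict_mono[of "norm x" R 2] that unfolding der
      by (subst H(5)) (auto simp: field_simps)
    show "norm x * \<bar>frechet_derivative (\<kappa> R) (at x) v\<bar> \<le> 4 * B * norm v"
    proof (cases "- 1 + (1 / R\<^sup>2) * (norm x)\<^sup>2 \<in> {0<..<1}")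
      case False
      then have "frechet_derivative (\<kappa> R) (at x) v = 0" unfolding der by (simp only: H(5)[OF False] mult_zero_left minus_zero)
      then show ?thesis using B0 by simp
    next
      case True
      then have le: "(norm x)\<^sup>2 \<le> 2 * R\<^sup>2" using R by (simp add: field_simps)
      have "norm x * \<bar>frechet_derivative (\<kappa> R) (at x) v\<bar> =
          \<bar>\<rho> (- 1 + (1 / R\<^sup>2) * (norm x)\<^sup>2)\<bar> * ((2 / R\<^sup>2) * (norm x * \<bar>x \<bullet> v\<bar>))"
        unfolding der by (simp add: abs_mult)
      also have "\<dots> \<le> B * ((2 / R\<^sup>2) * (norm x * (norm x * norm v)))"
        using B0 by (intro mult_mono[OF B'] mult_left_mono Cauchy_Schwarz_ineq2) auto
      also have "\<dots> = B * ((2 / R\<^sup>2) * ((norm x)\<^sup>2 * norm v))"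
        by (simp add: power2_eq_square)
      also have "\<dots> \<le> B * ((2 / R\<^sup>2) * ((2 * R\<^sup>2) * norm v))"
        using B0 le by (intro mult_left_mono mult_right_mono) auto
      also have "\<dots> = 4 * B * norm v" using R by simp
      finally show ?thesis .
    qed
  next
    show "\<bar>\<kappa> R x\<bar> \<le> 1" for R x
      unfolding \<kappa>_def using H01 by (simp add: abs_le_iff)
    show "0 \<le> 4 * B" using B0 by simp
  qed
qed

section \<open>Weak solutions of the continuity equation\<close>

locale kernel =
  fixes K :: "real \<Rightarrow> 'a::euclidean_space measure"
  assumes kernel: "K \<in> borel \<rightarrow>\<^sub>M prob_algebra borel"
begin

lemma kernel_sub [measurable]: "K \<in> borel \<rightarrow>\<^sub>M subprob_algebra borel"
  by (rule measurable_prob_algebraD[OF kernel])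

lemma prob_K: "prob_space (K t)" and sets_K [measurable_cong, simp]: "sets (K t) = sets borel"
  using measurable_space[OF kernel, of t] by (auto simp: space_prob_algebra)

lemma space_K [simp]: "space (K t) = UNIV"
  using sets_eq_imp_space_eq[OF sets_K] by simp

lemma measurable_section:
  assumes "(\<lambda>(t, x). F t x) \<in> borel \<Otimes>\<^sub>M borel \<rightarrow>\<^sub>M M"
  shows "F t \<in> K t \<rightarrow>\<^sub>M M"
proof -
  have "(\<lambda>x. (\<lambda>(t, x). F t x) (t, x)) \<in> borel \<rightarrow>\<^sub>M M"
    by (rule measurable_compose[OF measurable_Pair1' assms]) simp
  then show ?thesis by (simp cong: measurable_cong_sets)
qed

lemma nn_integral_K_measurable:
  fixes F :: "real \<Rightarrow> 'a \<Rightarrow> ennreal"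
  assumes "(\<lambda>(t, x). F t x) \<in> borel_measurable (borel \<Otimes>\<^sub>M borel)"
  shows "(\<lambda>t. \<integral>\<^sup>+x. F t x \<partial>K t) \<in> borel_measurable borel"
  by (rule nn_integral_measurable_subprob_algebra2[OF assms kernel_sub])

text \<open>Pushing K t forward under x -> (t, x) moves the dependence on t from the integrand into
  the measure; for a fixed integrand, measurability in the measure is known.\<close>

lemma integral_K_measurable:
  fixes F :: "real \<Rightarrow> 'a \<Rightarrow> 'b::euclidean_space"
  assumes F: "(\<lambda>(t, x). F t x) \<in> borel_measurable (borel \<Otimes>\<^sub>M borel)"
  shows "(\<lambda>t. \<integral>x. F t x \<partial>K t) \<in> borel_measurable borel"
proof -
  let ?D = "\<lambda>t. distr (K t) (borel \<Otimes>\<^sub>M borel) (Pair t)"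
  have pair: "Pair t \<in> K t \<rightarrow>\<^sub>M borel \<Otimes>\<^sub>M borel" for t
    using measurable_Pair1'[of t borel borel] by (simp cong: measurable_cong_sets)
  have "?D \<in> borel \<rightarrow>\<^sub>M subprob_algebra (borel \<Otimes>\<^sub>M borel)"
    by (rule measurable_distr2[OF _ kernel_sub]) simp
  from measurable_compose[OF this integral_measurable_subprob_algebra[OF F]]
  have "(\<lambda>t. \<integral>p. (\<lambda>(t, x). F t x) p \<partial>?D t) \<in> borel_measurable borel" .
  then show ?thesis
    by (subst (asm) integral_distr[OF pair F]) simp
qed

text \<open>Iterated integrals take the place of a measure K_t dt on the product. Finiteness of the
  iterated integral of the norm gives the inner integral a meaning for almost every t only.\<close>

lemma nested_integrable:
  fixes F :: "real \<Rightarrow> 'a \<Rightarrow> 'b::euclidean_space"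
  assumes F: "(\<lambda>(t, x). F t x) \<in> borel_measurable (borel \<Otimes>\<^sub>M borel)"
    and A: "A \<in> sets borel"
    and fin: "(\<integral>\<^sup>+t\<in>A. (\<integral>\<^sup>+x. ennreal (norm (F t x)) \<partial>K t) \<partial>lborel) < \<infinity>"
  shows "AE t in lborel. t \<in> A \<longrightarrow> integrable (K t) (F t)"
    and "set_integrable lborel A (\<lambda>t. \<integral>x. F t x \<partial>K t)"
proof -
  note [measurable] = F A
  have Fs: "F t \<in> borel_measurable (K t)" for t by (rule measurable_section[OF F])
  have nm: "(\<lambda>t. \<integral>\<^sup>+x. ennreal (norm (F t x)) \<partial>K t) \<in> borel_measurable borel"
    by (rule nn_integral_K_measurable) simp
  then have "AE t in lborel. (\<integral>\<^sup>+x. ennreal (norm (F t x)) \<partial>K t) * indicator A t \<noteq> \<infinity>"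
    using fin by (intro nn_integral_noteq_infinite) auto
  then show ae: "AE t in lborel. t \<in> A \<longrightarrow> integrable (K t) (F t)"
  proof eventually_elim
    case (elim t)
    then show ?case
      using Fs by (auto simp: integrable_iff_bounded less_top)
  qed
  have im: "(\<lambda>t. \<integral>x. F t x \<partial>K t) \<in> borel_measurable borel"
    by (rule integral_K_measurable[OF F])
  show "set_integrable lborel A (\<lambda>t. \<integral>x. F t x \<partial>K t)"
    unfolding set_integrable_def
  proof (rule integrableI_bounded)
    have "(\<integral>\<^sup>+t. ennreal (norm (indicator A t *\<^sub>R (\<integral>x. F t x \<partial>K t))) \<partial>lborel) \<le>
        (\<integral>\<^sup>+t\<in>A. (\<integral>\<^sup>+x. ennreal (norm (F t x)) \<partial>K t) \<partial>lborel)"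
    proof (rule nn_integral_mono_AE)
      show "AE t in lborel. ennreal (norm (indicator A t *\<^sub>R (\<integral>x. F t x \<partial>K t))) \<le>
          (\<integral>\<^sup>+x. ennreal (norm (F t x)) \<partial>K t) * indicator A t"
        using ae by eventually_elim
          (auto simp: indicator_def integral_norm_bound_ennreal)
    qed
    then show "(\<integral>\<^sup>+t. ennreal (norm (indicator A t *\<^sub>R (\<integral>x. F t x \<partial>K t))) \<partial>lborel) < \<infinity>"
      using fin by (rule le_less_trans)
  qed (use im in measurable)
qed

lemma nested_integrable_bound:
  fixes F :: "real \<Rightarrow> 'a \<Rightarrow> 'b::euclidean_space" and G :: "real \<Rightarrow> 'a \<Rightarrow> real"
  assumes F: "(\<lambda>(t, x). F t x) \<in> borel_measurable (borel \<Otimes>\<^sub>M borel)"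
    and A: "A \<in> sets borel"
    and fin: "(\<integral>\<^sup>+t\<in>A. (\<integral>\<^sup>+x. ennreal (G t x) \<partial>K t) \<partial>lborel) < \<infinity>"
    and le: "\<And>t x. t \<in> A \<Longrightarrow> norm (F t x) \<le> G t x"
  shows "AE t in lborel. t \<in> A \<longrightarrow> integrable (K t) (F t)"
    and "set_integrable lborel A (\<lambda>t. \<integral>x. F t x \<partial>K t)"
proof -
  have "(\<integral>\<^sup>+t\<in>A. (\<integral>\<^sup>+x. ennreal (norm (F t x)) \<partial>K t) \<partial>lborel) \<le> (\<integral>\<^sup>+t\<in>A. (\<integral>\<^sup>+x. ennreal (G t x) \<partial>K t) \<partial>lborel)"
    by (intro nn_integral_mono) (auto simp: indicator_def intro!: nn_integral_mono ennreal_leI le)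
  then have "(\<integral>\<^sup>+t\<in>A. (\<integral>\<^sup>+x. ennreal (norm (F t x)) \<partial>K t) \<partial>lborel) < \<infinity>"
    using fin by (rule le_less_trans)
  from nested_integrable[OF F A this]
  show "AE t in lborel. t \<in> A \<longrightarrow> integrable (K t) (F t)"
    and "set_integrable lborel A (\<lambda>t. \<integral>x. F t x \<partial>K t)" .
qed

lemma nested_dominated_convergence:
  fixes F :: "real \<Rightarrow> 'a \<Rightarrow> 'b::euclidean_space" and G :: "real \<Rightarrow> 'a \<Rightarrow> real"
  assumes Fn: "\<And>n. (\<lambda>(t, x). Fn n t x) \<in> borel_measurable (borel \<Otimes>\<^sub>M borel)"
    and F: "(\<lambda>(t, x). F t x) \<in> borel_measurable (borel \<Otimes>\<^sub>M borel)"
    and G: "(\<lambda>(t, x). G t x) \<in> borel_measurable (borel \<Otimes>\<^sub>M borel)"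
    and A: "A \<in> sets borel"
    and fin: "(\<integral>\<^sup>+t\<in>A. (\<integral>\<^sup>+x. ennreal (G t x) \<partial>K t) \<partial>lborel) < \<infinity>"
    and le: "\<And>n t x. t \<in> A \<Longrightarrow> norm (Fn n t x) \<le> G t x"
    and lim: "\<And>t x. t \<in> A \<Longrightarrow> (\<lambda>n. Fn n t x) \<longlonglongrightarrow> F t x"
  shows "(\<lambda>n. LINT t:A|lborel. \<integral>x. Fn n t x \<partial>K t) \<longlonglongrightarrow> (LINT t:A|lborel. \<integral>x. F t x \<partial>K t)"
proof -
  note [measurable] = A
  \<comment> \<open>Off A nothing is assumed about the sign of G, so it is set to 0 there.\<close>
  define G' where "G' t x = (if t \<in> A then G t x else 0)" for t x
  have G'm: "(\<lambda>(t, x). G' t x) \<in> borel_measurable (borel \<Otimes>\<^sub>M borel)"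
    using G unfolding G'_def by measurable
  have G'0: "0 \<le> G' t x" for t x
    using order_trans[OF norm_ge_zero le] by (simp add: G'_def)
  have fin': "(\<integral>\<^sup>+t\<in>A. (\<integral>\<^sup>+x. ennreal (norm (G' t x)) \<partial>K t) \<partial>lborel) < \<infinity>"
  proof -
    have "(\<integral>\<^sup>+t\<in>A. (\<integral>\<^sup>+x. ennreal (norm (G' t x)) \<partial>K t) \<partial>lborel) = (\<integral>\<^sup>+t\<in>A. (\<integral>\<^sup>+x. ennreal (G t x) \<partial>K t) \<partial>lborel)"
      using G'0 by (intro nn_integral_cong) (auto simp: indicator_def G'_def intro!: nn_integral_cong)
    then show ?thesis using fin by simp
  qed
  note G'i = nested_integrable[OF G'm A fin']
  show ?thesis
    unfolding set_lebesgue_integral_def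
  proof (rule integral_dominated_convergence[where w="\<lambda>t. indicator A t *\<^sub>R (\<integral>x. G' t x \<partial>K t)"])
    show "integrable lborel (\<lambda>t. indicator A t *\<^sub>R (\<integral>x. G' t x \<partial>K t))"
      using G'i(2) by (simp add: set_integrable_def)
    show "(\<lambda>t. indicat_real A t *\<^sub>R (\<integral>x. F t x \<partial>K t)) \<in> borel_measurable lborel"
      using integral_K_measurable[OF F] by measurable
    show "(\<lambda>t. indicat_real A t *\<^sub>R (\<integral>x. Fn n t x \<partial>K t)) \<in> borel_measurable lborel" for n
      using integral_K_measurable[OF Fn[of n]] by measurable
    show "AE t in lborel. (\<lambda>n. indicat_real A t *\<^sub>R (\<integral>x. Fn n t x \<partial>K t)) \<longlonglongrightarrow> indicat_real A t *\<^sub>R (\<integral>x. F t x \<partial>K t)"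
      using G'i(1)
    proof eventually_elim
      case (elim t)
      show ?case
      proof (cases "t \<in> A")
        case True
        have "(\<lambda>n. \<integral>x. Fn n t x \<partial>K t) \<longlonglongrightarrow> (\<integral>x. F t x \<partial>K t)"
        proof (rule integral_dominated_convergence[where w="G' t"])
          show "integrable (K t) (G' t)" using elim True by simp
        qed (use measurable_section[OF F] measurable_section[OF Fn] lim le True in \<open>auto simp: G'_def\<close>)
        then show ?thesis by (intro tendsto_intros)
      qed simp
    qed
    show "AE t in lborel. norm (indicat_real A t *\<^sub>R (\<integral>x. Fn n t x \<partial>K t)) \<le> indicat_real A t *\<^sub>R (\<integral>x. G' t x \<partial>K t)" for n
      using G'i(1)
    proof eventually_elim
      case (elim t)
      show ?case
      proof (cases "t \<in> A")
        case True
        have "norm (\<integral>x. Fn n t x \<partial>K t) \<le> (\<integral>x. norm (Fn n t x) \<partial>K t)"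
          by (rule integral_norm_bound)
        also have "\<dots> \<le> (\<integral>x. G' t x \<partial>K t)"
        proof (rule integral_mono')
          show "integrable (K t) (G' t)" using elim True by simp
          show "norm (Fn n t x) \<le> G' t x" for x using le True by (simp add: G'_def)
          show "0 \<le> G' t x" for x by (rule G'0)
        qed
        finally show ?thesis using True by simp
      qed simp
    qed
  qed
qed

end

section \<open>From weak continuity to measurability, and test functions of product form\<close>

lemma infdist_bump_le_1: "\<bar>max 0 (1 - real n * infdist x C)\<bar> \<le> 1"
  using mult_nonneg_nonneg[OF of_nat_0_le_iff infdist_nonneg, of n x C] by (simp add: max_def)

text \<open>The bumps are bounded and continuous, so weak continuity controls their integrals, and
  they converge to the indicator because a point off the closed set C has positive distance from
  it.\<close>

lemma measurable_closed_approx: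
  fixes C :: "'a::euclidean_space set"
  assumes "closed C" "C \<noteq> {}" "prob_space M" "sets M = sets borel"
  shows "(\<lambda>n. \<integral>x. max 0 (1 - real n * infdist x C) \<partial>M) \<longlonglongrightarrow> measure M C"
proof -
  interpret prob_space M by fact
  have C: "C \<in> sets M" using assms by simp
  have cont: "continuous_on UNIV (\<lambda>x. max 0 (1 - real n * infdist x C))" for n
    by (intro continuous_intros)
  have "(\<lambda>n. \<integral>x. max 0 (1 - real n * infdist x C) \<partial>M) \<longlonglongrightarrow> (\<integral>x. indicator C x \<partial>M)"
  proof (rule integral_dominated_convergence[where w="\<lambda>_. 1"])
    show "(\<lambda>x. max 0 (1 - real n * infdist x C)) \<in> borel_measurable M" for n
      using borel_measurable_continuous_onI[OF cont[of n]] assms(4) by (simp cong: measurable_cong_sets)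
    show "AE x in M. (\<lambda>n. max 0 (1 - real n * infdist x C)) \<longlonglongrightarrow> indicator C x"
    proof (rule AE_I2)
      fix x
      show "(\<lambda>n. max 0 (1 - real n * infdist x C)) \<longlonglongrightarrow> indicator C x"
      proof (cases "x \<in> C")
        case False
        then have d: "infdist x C > 0"
          using in_closed_iff_infdist_zero[OF assms(1,2), of x] infdist_nonneg[of x C] by linarith
        have "\<forall>\<^sub>F n in sequentially. max 0 (1 - real n * infdist x C) = 0"
          using eventually_ge_at_top[of "nat \<lceil>1 / infdist x C\<rceil>"]
        proof eventually_elim
          case (elim n)
          then have "1 / infdist x C \<le> real n" by linarith
          then have "1 \<le> real n * infdist x C" using d by (simp add: field_simps)
          then show ?case by simp
        qed
        then show ?thesis using False by (simp add: tendsto_eventually)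
      qed simp
    qed
    show "AE x in M. norm (max 0 (1 - real n * infdist x C)) \<le> 1" for n
      using infdist_bump_le_1 by (intro AE_I2) simp
  qed (use C in auto)
  then show ?thesis using C by simp
qed

lemma P2D:
  assumes "\<mu> \<in> P2"
  shows "prob_space \<mu>" "sets \<mu> = sets borel" "space \<mu> = UNIV" "integrable \<mu> (\<lambda>x. (norm x)\<^sup>2)"
  using assms sets_eq_imp_space_eq[of \<mu> borel] by (auto simp: P2_def)

text \<open>Closed sets generate the Borel sets and are stable under intersection, and the mass of a
  closed set is a pointwise limit of functions continuous in t.\<close>

lemma kernel_of_weakly_continuous:
  fixes \<mu> :: "real \<Rightarrow> 'a::euclidean_space measure"
  assumes P: "\<And>t. prob_space (\<mu> t)" "\<And>t. sets (\<mu> t) = sets borel"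
    and weak: "\<And>f :: 'a \<Rightarrow> real. continuous_on UNIV f \<Longrightarrow> bounded (range f) \<Longrightarrow> continuous_on UNIV (\<lambda>t. \<integral>x. f x \<partial>\<mu> t)"
  shows "\<mu> \<in> borel \<rightarrow>\<^sub>M prob_algebra borel"
proof (rule measurable_prob_algebra_generated[where \<Omega>=UNIV and G="Collect closed"])
  show "sets borel = sigma_sets UNIV (Collect closed)" by (simp add: borel_eq_closed)
  show "Int_stable (Collect closed)" by (auto simp: Int_stable_def)
  fix C :: "'a set" assume "C \<in> Collect closed"
  then have C: "closed C" by simp
  have "(\<lambda>t. measure (\<mu> t) C) \<in> borel_measurable borel"
  proof (cases "C = {}")
    case False
    show ?thesis
    proof (rule borel_measurable_LIMSEQ_real)
      show "(\<lambda>n. \<integral>x. max 0 (1 - real n * infdist x C) \<partial>\<mu> t) \<longlonglongrightarrow> measure (\<mu> t) C" for t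
        by (rule measurable_closed_approx[OF C False P])
      have "bounded (range (\<lambda>x. max 0 (1 - real n * infdist x C)))" for n
        unfolding bounded_iff using infdist_bump_le_1 by (intro exI[of _ 1]) auto
      moreover have "continuous_on UNIV (\<lambda>x. max 0 (1 - real n * infdist x C))" for n
        by (intro continuous_intros)
      ultimately show "(\<lambda>t. \<integral>x. max 0 (1 - real n * infdist x C) \<partial>\<mu> t) \<in> borel_measurable borel" for n
        by (intro borel_measurable_continuous_onI weak)
    qed
  qed simp
  moreover have "emeasure (\<mu> t) C = ennreal (measure (\<mu> t) C)" for t
    using finite_measure.emeasure_eq_measure[OF prob_space.finite_measure[OF P(1)]] by blast
  ultimately show "(\<lambda>t. emeasure (\<mu> t) C) \<in> borel_measurable borel" by simp
qed (use P in auto)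

lemma test_functions_tensor:
  fixes \<eta> :: "'a::euclidean_space \<Rightarrow> real" and \<xi> :: "real \<Rightarrow> real"
  assumes \<xi>: "smooth \<xi>" "\<And>r. r \<notin> {s..t} \<Longrightarrow> \<xi> r = 0" "0 < s" "t < 1"
    and \<eta>: "smooth \<eta>" "compact (closure {x. \<eta> x \<noteq> 0})"
  shows "(\<lambda>(r, x). \<xi> r * \<eta> x) \<in> test_functions"
proof -
  let ?\<phi> = "\<lambda>p::real \<times> 'a. \<xi> (0 + fst p) * \<eta> (0 + snd p)"
  have sm: "smooth ?\<phi>"
    using \<xi>(1) \<eta>(1)
    by (intro smooth_mult smooth_compose_affine bounded_linear_fst bounded_linear_snd)
  have eq: "?\<phi> = (\<lambda>(r, x). \<xi> r * \<eta> x)" by auto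
  have sub: "closure {p. ?\<phi> p \<noteq> 0} \<subseteq> {s..t} \<times> closure {x. \<eta> x \<noteq> 0}"
  proof (rule closure_minimal)
    show "{p. ?\<phi> p \<noteq> 0} \<subseteq> {s..t} \<times> closure {x. \<eta> x \<noteq> 0}"
    proof
      fix p assume "p \<in> {p. ?\<phi> p \<noteq> 0}"
      then have "\<xi> (fst p) \<noteq> 0" "\<eta> (snd p) \<noteq> 0" by auto
      then have "fst p \<in> {s..t}" "snd p \<in> closure {x. \<eta> x \<noteq> 0}"
        using \<xi>(2) closure_subset[of "{x. \<eta> x \<noteq> 0}"] by blast+
      then show "p \<in> {s..t} \<times> closure {x. \<eta> x \<noteq> 0}" by (cases p) simp
    qed
  qed (auto intro: closed_Times)
  then have "compact (closure {p. ?\<phi> p \<noteq> 0})"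
    using compact_Int_closed[OF compact_Times[OF compact_Icc \<eta>(2)] closed_closure, of s t "{p. ?\<phi> p \<noteq> 0}"]
    by (simp only: Int_absorb1[OF sub])
  moreover have "closure {p. ?\<phi> p \<noteq> 0} \<subseteq> {0<..<1} \<times> UNIV"
  proof
    fix p assume "p \<in> closure {p. ?\<phi> p \<noteq> 0}"
    then have "fst p \<in> {s..t}" using sub by auto
    then show "p \<in> {0<..<1} \<times> UNIV" using \<xi>(3,4) by (cases p) auto
  qed
  ultimately have "?\<phi> \<in> test_functions"
    using sm unfolding test_functions_def smooth_def by simp
  then show ?thesis unfolding eq .
qed

lemma tensor_derivative:
  fixes \<eta> :: "'a::euclidean_space \<Rightarrow> real"
  assumes "(\<xi> has_real_derivative \<xi>') (at r)" "\<eta> differentiable (at x)"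
  shows "frechet_derivative (\<lambda>(r, x). \<xi> r * \<eta> x) (at (r, x)) (1, v) = \<xi>' * \<eta> x + \<xi> r * frechet_derivative \<eta> (at x) v"
proof -
  have "((\<lambda>p. \<xi> (fst p)) has_derivative (\<lambda>w. \<xi>' * fst w)) (at (r, x))"
    using has_derivative_compose[OF has_derivative_fst[OF has_derivative_ident], of \<xi> "(*) \<xi>'" "(r, x)" UNIV] assms(1)
    by (simp add: has_field_derivative_def)
  moreover have "((\<lambda>p. \<eta> (snd p)) has_derivative (\<lambda>w. frechet_derivative \<eta> (at x) (snd w))) (at (r, x))"
    using has_derivative_compose[OF has_derivative_snd[OF has_derivative_ident], of \<eta> _ "(r, x)" UNIV] assms(2)
    by (simp add: frechet_derivative_works)
  ultimately have "((\<lambda>p. \<xi> (fst p) * \<eta> (snd p)) has_derivative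
      (\<lambda>w. \<xi> r * frechet_derivative \<eta> (at x) (snd w) + \<xi>' * fst w * \<eta> x)) (at (r, x))"
    using has_derivative_mult by fastforce
  from fun_cong[OF frechet_derivative_at[OF this], of "(1, v)"]
  show ?thesis by (simp add: case_prod_beta')
qed

text \<open>Concentration is expressed by supports that shrink to c inside [s, t], so c may be an
  endpoint and the kernels one-sided.\<close>

lemma approximate_identity_tendsto:
  fixes w :: "nat \<Rightarrow> real \<Rightarrow> real" and h :: "real \<Rightarrow> real"
  assumes h: "continuous_on UNIV h"
    and w0: "\<And>n r. 0 \<le> w n r" and supp: "\<And>n r. r \<notin> {a n..b n} \<Longrightarrow> w n r = 0"
    and ab: "\<And>n. s \<le> a n" "\<And>n. b n \<le> t" "a \<longlonglongrightarrow> c" "b \<longlonglongrightarrow> c"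
    and wi: "\<And>n. continuous_on UNIV (w n)" "\<And>n. (LINT r:{s..t}|lborel. w n r) = 1"
  shows "(\<lambda>n. LINT r:{s..t}|lborel. w n r * h r) \<longlonglongrightarrow> h c"
proof (rule LIMSEQ_I)
  fix e :: real assume e: "e > 0"
  have ci: "set_integrable lborel {s..t} f" if "continuous_on UNIV f" for f :: "real \<Rightarrow> real"
    unfolding set_integrable_def using that by (intro borel_integrable_compact) (auto intro: continuous_on_subset)
  obtain d where d: "d > 0" "\<And>r. \<bar>r - c\<bar> < d \<Longrightarrow> \<bar>h r - h c\<bar> < e / 2"
    using h e unfolding continuous_on_iff dist_real_def by (metis UNIV_I half_gt_zero)
  have "\<forall>\<^sub>F n in sequentially. \<bar>a n - c\<bar> < d \<and> \<bar>b n - c\<bar> < d"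
    using tendstoD[OF ab(3) d(1)] tendstoD[OF ab(4) d(1)] by eventually_elim (simp add: dist_real_def)
  then obtain N where N: "\<And>n. n \<ge> N \<Longrightarrow> \<bar>a n - c\<bar> < d \<and> \<bar>b n - c\<bar> < d"
    unfolding eventually_sequentially by blast
  show "\<exists>N. \<forall>n\<ge>N. norm ((LINT r:{s..t}|lborel. w n r * h r) - h c) < e"
  proof (intro exI[of _ N] allI impI)
    fix n assume n: "n \<ge> N"
    have i1: "set_integrable lborel {s..t} (\<lambda>r. w n r * h r)" and i2: "set_integrable lborel {s..t} (\<lambda>r. w n r * h c)"
      and i3: "set_integrable lborel {s..t} (\<lambda>r. w n r * (e / 2))" and i4: "set_integrable lborel {s..t} (\<lambda>r. w n r * h r - w n r * h c)"
      using wi(1) h by (auto intro!: ci continuous_intros)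
    have "(LINT r:{s..t}|lborel. w n r * h r) - h c = (LINT r:{s..t}|lborel. w n r * h r) - (LINT r:{s..t}|lborel. w n r * h c)"
      using wi(2)[of n] by simp
    also have "\<dots> = (LINT r:{s..t}|lborel. w n r * h r - w n r * h c)"
      using i1 i2 by (rule set_integral_diff(2)[symmetric])
    finally have eq: "(LINT r:{s..t}|lborel. w n r * h r) - h c = (LINT r:{s..t}|lborel. w n r * h r - w n r * h c)" .
    have "norm (LINT r:{s..t}|lborel. w n r * h r - w n r * h c) \<le> (LINT r:{s..t}|lborel. norm (w n r * h r - w n r * h c))"
      by (rule set_integral_norm_bound[OF i4])
    also have "\<dots> \<le> (LINT r:{s..t}|lborel. w n r * (e / 2))"
    proof (rule set_integral_mono[OF set_integrable_norm[OF i4] i3])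
      fix r
      show "norm (w n r * h r - w n r * h c) \<le> w n r * (e / 2)"
      proof (cases "r \<in> {a n..b n}")
        case True
        then have "\<bar>r - c\<bar> < d" using N[OF n] by (auto simp: abs_less_iff)
        then have "\<bar>h r - h c\<bar> \<le> e / 2" using d(2) by (simp add: less_imp_le)
        then have "w n r * \<bar>h r - h c\<bar> \<le> w n r * (e / 2)" using w0 by (intro mult_left_mono) auto
        then show ?thesis using w0[of n r] by (simp add: right_diff_distrib[symmetric] abs_mult)
      qed (simp add: supp)
    qed
    also have "\<dots> = e / 2" using wi(2)[of n] by simp
    finally show "norm ((LINT r:{s..t}|lborel. w n r * h r) - h c) < e" using e eq by simp
  qed
qed

text \<open>Solutions live on the whole time line, so that kernels and continuity statements carry
  no restriction to [0, 1]. Curves taken from \<open>CE\<close> are extended constantly beyond the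
  ends by \<open>clamp01\<close>.\<close>

locale ce_curve =
  fixes \<mu> :: "real \<Rightarrow> 'a::euclidean_space measure" and V :: "real \<Rightarrow> 'a \<Rightarrow> 'a"
  assumes P2: "\<mu> t \<in> P2"
    and weak: "\<And>f :: 'a \<Rightarrow> real. continuous_on UNIV f \<Longrightarrow> bounded (range f) \<Longrightarrow> continuous_on UNIV (\<lambda>t. \<integral>x. f x \<partial>\<mu> t)"
    and V_measurable: "(\<lambda>(t, x). V t x) \<in> borel_measurable (borel \<Otimes>\<^sub>M borel)"
    and distributional: "\<And>\<phi>. \<phi> \<in> test_functions \<Longrightarrow>
      (LINT t:{0..1}|lborel. (\<integral>x. frechet_derivative \<phi> (at (t, x)) (1, V t x) \<partial>\<mu> t)) = 0"
begin

sublocale kernel \<mu>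
  by standard (rule kernel_of_weakly_continuous[OF P2D(1,2)[OF P2] weak])

lemma V_measurable' [measurable]: "(\<lambda>p. V (fst p) (snd p)) \<in> borel_measurable (borel \<Otimes>\<^sub>M borel)"
  using V_measurable by (simp add: case_prod_beta')

lemma derivative_V_measurable:
  assumes "smooth \<eta>"
  shows "(\<lambda>(t, x). frechet_derivative \<eta> (at x) (V t x)) \<in> borel_measurable (borel \<Otimes>\<^sub>M borel)"
  unfolding case_prod_beta' by (rule smooth_derivative_measurable[OF assms]) measurable

lemma smooth_compact_bounded:
  fixes \<eta> :: "'a \<Rightarrow> real"
  assumes "smooth \<eta>" "compact (closure {x. \<eta> x \<noteq> 0})"
  shows "continuous_on UNIV \<eta>" "bounded (range \<eta>)"
proof -
  show "continuous_on UNIV \<eta>" by (rule smooth_continuous_on[OF assms(1)])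
  obtain B where B: "\<And>x. x \<in> closure {x. \<eta> x \<noteq> 0} \<Longrightarrow> \<bar>\<eta> x\<bar> \<le> B"
    using compact_continuous_bound[OF assms(2) smooth_continuous_on[OF assms(1)]] by metis
  have "\<bar>\<eta> x\<bar> \<le> max B 0" for x
    using B[of x] closure_subset[of "{x. \<eta> x \<noteq> 0}"] by (cases "\<eta> x = 0") auto
  then show "bounded (range \<eta>)" unfolding bounded_iff by auto
qed

text \<open>Test with a product of eta and a smooth approximation of the indicator of [s, t]. The
  time derivative of the latter is the difference of two approximate identities, at s and at t, and
  weak continuity turns these into evaluations.\<close>

lemma evolution_open:
  assumes \<eta>: "smooth \<eta>" "compact (closure {x. \<eta> x \<noteq> 0})"
    and st: "0 < s" "s < t" "t < 1"
    and fin: "(\<integral>\<^sup>+r\<in>{s..t}. (\<integral>\<^sup>+x. ennreal (norm (V r x)) \<partial>\<mu> r) \<partial>lborel) < \<infinity>"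
  shows "(\<integral>x. \<eta> x \<partial>\<mu> t) - (\<integral>x. \<eta> x \<partial>\<mu> s) =
    (LINT r:{s..t}|lborel. \<integral>x. frechet_derivative \<eta> (at x) (V r x) \<partial>\<mu> r)"
proof -
  obtain H \<rho> :: "real \<Rightarrow> real" where
    H: "\<And>x. (H has_real_derivative \<rho> x) (at x)" "smooth H" "continuous_on UNIV \<rho>"
    "\<And>x. \<rho> x \<ge> 0" "\<And>x. x \<notin> {0<..<1} \<Longrightarrow> \<rho> x = 0"
    "\<And>x. x \<le> 0 \<Longrightarrow> H x = 0" "\<And>x. x \<ge> 1 \<Longrightarrow> H x = 1"
    using smooth_step_exists by metis
  have Hmono: "H x \<le> H y" if "x \<le> y" for x y
    using that H(1,4) by (intro DERIV_nonneg_imp_nondecreasing[of x y H]) blast+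
  have H01: "0 \<le> H x" "H x \<le> 1" for x
    using Hmono[of "min x 0" x] H(6)[of "min x 0"] Hmono[of x "max x 1"] H(7)[of "max x 1"] by auto
  define h where "h r = (\<integral>x. \<eta> x \<partial>\<mu> r)" for r
  define q where "q r = (\<integral>x. frechet_derivative \<eta> (at x) (V r x) \<partial>\<mu> r)" for r
  have hc: "continuous_on UNIV h"
    unfolding h_def by (rule weak[OF smooth_compact_bounded[OF \<eta>]])
  obtain C where C: "C \<ge> 0" "\<And>x v. \<bar>frechet_derivative \<eta> (at x) v\<bar> \<le> C * norm v"
    by (rule smooth_derivative_bound[OF \<eta>]) (rule that)
  have fin': "(\<integral>\<^sup>+r\<in>{s..t}. (\<integral>\<^sup>+x. ennreal (C * norm (V r x)) \<partial>\<mu> r) \<partial>lborel) < \<infinity>"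
  proof -
    have [measurable]: "V r \<in> borel_measurable (\<mu> r)" for r by (rule measurable_section[OF V_measurable])
    have [measurable]: "(\<lambda>r. \<integral>\<^sup>+x. ennreal (norm (V r x)) \<partial>\<mu> r) \<in> borel_measurable borel"
      by (rule nn_integral_K_measurable) measurable
    have "(\<integral>\<^sup>+r\<in>{s..t}. (\<integral>\<^sup>+x. ennreal (C * norm (V r x)) \<partial>\<mu> r) \<partial>lborel) =
        (\<integral>\<^sup>+r. ennreal C * ((\<integral>\<^sup>+x. ennreal (norm (V r x)) \<partial>\<mu> r) * indicator {s..t} r) \<partial>lborel)"
      using C(1) by (simp add: ennreal_mult nn_integral_cmult mult.assoc)
    also have "\<dots> = ennreal C * (\<integral>\<^sup>+r\<in>{s..t}. (\<integral>\<^sup>+x. ennreal (norm (V r x)) \<partial>\<mu> r) \<partial>lborel)"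
      by (rule nn_integral_cmult) measurable
    also have "\<dots> < \<infinity>" using fin by (simp add: ennreal_mult_less_top)
    finally show ?thesis .
  qed
  have bound: "norm (frechet_derivative \<eta> (at x) (V r x)) \<le> C * norm (V r x)" for r x
    using C(2) by simp
  note qi = nested_integrable_bound[OF derivative_V_measurable[OF \<eta>(1)] _ fin' bound, simplified]
  have q_int: "set_integrable lborel {s..t} q" using qi(2) by (simp add: q_def[abs_def])
  \<comment> \<open>The width of the two ramps; the summand 2 keeps it below t - s, so that both
    ramps lie in [s, t].\<close>
  define e where "e n = (t - s) / (real n + 2)" for n :: nat
  have e: "e n > 0" "e n < t - s" for n
  proof -
    have "(t - s) * 1 < (t - s) * (real n + 2)" using st by (intro mult_strict_left_mono) auto
    then show "e n < t - s" by (simp add: e_def divide_less_eq)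
  qed (use st in \<open>simp add: e_def\<close>)
  have e0: "e \<longlonglongrightarrow> 0"
    using tendsto_mult_right_zero[OF LIMSEQ_Suc[OF LIMSEQ_inverse_real_of_nat], of "t - s"]
    by (simp add: e_def[abs_def] divide_inverse add_ac)
  define w1 where "w1 n r = \<rho> ((r - s) / e n) / e n" for n r
  define w2 where "w2 n r = \<rho> ((r - t) / e n + 1) / e n" for n r
  \<comment> \<open>The first term rises on [s, s + e n], the second on [t - e n, t]; their
    difference is supported in [s, t] and tends to 1 in the interior.\<close>
  define \<xi> where "\<xi> n r = H ((r - s) / e n) - H ((r - t) / e n + 1)" for n r
  have d1: "((\<lambda>r. H ((r - s) / e n)) has_real_derivative w1 n r) (at r)" for n r
  proof -
    have "((\<lambda>r. (r - s) / e n) has_real_derivative 1 / e n) (at r)"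
      using e(1)[of n] by (auto intro!: derivative_eq_intros)
    from DERIV_chain2[OF H(1) this] show ?thesis by (simp add: w1_def)
  qed
  have d2: "((\<lambda>r. H ((r - t) / e n + 1)) has_real_derivative w2 n r) (at r)" for n r
  proof -
    have "((\<lambda>r. (r - t) / e n + 1) has_real_derivative 1 / e n) (at r)"
      using e(1)[of n] by (auto intro!: derivative_eq_intros)
    from DERIV_chain2[OF H(1) this] show ?thesis by (simp add: w2_def)
  qed
  have d\<xi>: "(\<xi> n has_real_derivative w1 n r - w2 n r) (at r)" for n r
    unfolding \<xi>_def[abs_def] by (rule DERIV_diff[OF d1 d2])
  have wc: "continuous_on UNIV (w1 n)" "continuous_on UNIV (w2 n)" for n
    unfolding w1_def[abs_def] w2_def[abs_def] using e(1)[of n]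
    by (auto intro!: continuous_intros continuous_on_compose2[OF H(3)])
  have w0: "0 \<le> w1 n r" "0 \<le> w2 n r" for n r
    using H(4) e(1)[of n] by (auto simp: w1_def w2_def)
  have ws1: "w1 n r = 0" if "r \<notin> {s..s + e n}" for n r
    unfolding w1_def using that e(1)[of n] by (subst H(5)) (auto simp: field_simps)
  have ws2: "w2 n r = 0" if "r \<notin> {t - e n..t}" for n r
    unfolding w2_def using that e(1)[of n] by (subst H(5)) (auto simp: field_simps)
  have \<xi>s: "\<xi> n r = 0" if r: "r \<notin> {s..t}" for n r
  proof -
    consider "r < s" | "r > t" using r by force
    then show ?thesis
    proof cases
      case 1
      then have "(r - s) / e n \<le> 0" "(r - t) / e n + 1 \<le> 0"
        using e[of n] by (auto simp: field_simps)
      then show ?thesis by (simp add: \<xi>_def H(6))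
    next
      case 2
      then have "(r - s) / e n \<ge> 1" "(r - t) / e n + 1 \<ge> 1"
        using e[of n] by (auto simp: field_simps)
      then show ?thesis by (simp add: \<xi>_def H(7))
    qed
  qed
  have \<xi>b: "\<bar>\<xi> n r\<bar> \<le> 1" for n r
    unfolding \<xi>_def using H01[of "(r - s) / e n"] H01[of "(r - t) / e n + 1"] by linarith
  have wi1: "(LINT r:{s..t}|lborel. w1 n r) = 1" for n
  proof -
    have "(LINT r:{s..t}|lborel. w1 n r) = H ((t - s) / e n) - H ((s - s) / e n)"
      unfolding set_lebesgue_integral_def
      using st d1 continuous_on_subset[OF wc(1) subset_UNIV] by (intro integral_FTC_Icc)
        (auto simp: has_real_derivative_iff_has_vector_derivative[symmetric] intro: DERIV_subset continuous_on_subset)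
    moreover have "(t - s) / e n \<ge> 1" using e[of n] by (simp add: field_simps)
    ultimately show ?thesis by (simp add: H(6,7))
  qed
  have wi2: "(LINT r:{s..t}|lborel. w2 n r) = 1" for n
  proof -
    have "(LINT r:{s..t}|lborel. w2 n r) = H ((t - t) / e n + 1) - H ((s - t) / e n + 1)"
      unfolding set_lebesgue_integral_def
      using st d2 continuous_on_subset[OF wc(2) subset_UNIV] by (intro integral_FTC_Icc)
        (auto simp: has_real_derivative_iff_has_vector_derivative[symmetric] intro: DERIV_subset continuous_on_subset)
    moreover have "(s - t) / e n + 1 \<le> 0" using e[of n] by (simp add: field_simps)
    ultimately show ?thesis by (simp add: H(6,7))
  qed
  have s\<xi>: "smooth (\<xi> n)" for n
  proof -
    have "smooth (\<lambda>r. H (- s / e n + (1 / e n) * r) - H (1 - t / e n + (1 / e n) * r))"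
      by (intro smooth_diff smooth_compose_affine bounded_linear_mult_right H(2))
    moreover have "\<xi> n = (\<lambda>r. H (- s / e n + (1 / e n) * r) - H (1 - t / e n + (1 / e n) * r))"
      unfolding \<xi>_def by (simp add: fun_eq_iff diff_divide_distrib algebra_simps)
    ultimately show ?thesis by simp
  qed
  have ci: "set_integrable lborel {s..t} f" if "continuous_on UNIV f" for f :: "real \<Rightarrow> real"
    unfolding set_integrable_def using that by (intro borel_integrable_compact) (auto intro: continuous_on_subset)
  have zero: "(LINT r:{s..t}|lborel. w1 n r * h r) - (LINT r:{s..t}|lborel. w2 n r * h r) + (LINT r:{s..t}|lborel. \<xi> n r * q r) = 0" for n
  proof -
    have \<xi>q: "set_integrable lborel {s..t} (\<lambda>r. \<xi> n r * q r)"
      unfolding set_integrable_def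
    proof (rule Bochner_Integration.integrable_bound)
      show "integrable lborel (\<lambda>r. indicator {s..t} r *\<^sub>R q r)" using q_int by (simp add: set_integrable_def)
      have [measurable]: "q \<in> borel_measurable borel"
        unfolding q_def by (rule integral_K_measurable[OF derivative_V_measurable[OF \<eta>(1)]])
      have [measurable]: "\<xi> n \<in> borel_measurable borel"
        by (rule borel_measurable_continuous_onI[OF smooth_continuous_on[OF s\<xi>]])
      show "(\<lambda>x. indicat_real {s..t} x *\<^sub>R (\<xi> n x * q x)) \<in> borel_measurable lborel" by measurable
      show "AE x in lborel. norm (indicat_real {s..t} x *\<^sub>R (\<xi> n x * q x)) \<le> norm (indicat_real {s..t} x *\<^sub>R q x)"
        using \<xi>b by (intro AE_I2) (auto simp: indicator_def abs_mult intro!: mult_left_le_one_le)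
    qed
    have i1: "set_integrable lborel {s..t} (\<lambda>r. w1 n r * h r)" "set_integrable lborel {s..t} (\<lambda>r. w2 n r * h r)"
      using wc hc by (auto intro!: ci continuous_intros)
    have "0 = (LINT r:{0..1}|lborel. (\<integral>x. frechet_derivative (\<lambda>(r, x). \<xi> n r * \<eta> x) (at (r, x)) (1, V r x) \<partial>\<mu> r))"
      by (rule distributional[symmetric], rule test_functions_tensor[OF s\<xi> \<xi>s st(1,3) \<eta>])
    also have "\<dots> = (LINT r:{0..1}|lborel. (\<integral>x. (w1 n r - w2 n r) * \<eta> x + \<xi> n r * frechet_derivative \<eta> (at x) (V r x) \<partial>\<mu> r))"
      by (simp only: tensor_derivative[OF d\<xi> smooth_differentiable[OF \<eta>(1)]])
    also have "\<dots> = (LINT r:{s..t}|lborel. w1 n r * h r - w2 n r * h r + \<xi> n r * q r)"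
      unfolding set_lebesgue_integral_def
    proof (rule integral_cong_AE)
      have F: "(\<lambda>(r, x). (w1 n r - w2 n r) * \<eta> x + \<xi> n r * frechet_derivative \<eta> (at x) (V r x)) \<in> borel_measurable (borel \<Otimes>\<^sub>M borel)"
      proof -
        have [measurable]: "w1 n \<in> borel_measurable borel" "w2 n \<in> borel_measurable borel" "\<eta> \<in> borel_measurable borel"
          "\<xi> n \<in> borel_measurable borel"
          using wc smooth_continuous_on[OF s\<xi>] smooth_continuous_on[OF \<eta>(1)] by (auto intro: borel_measurable_continuous_onI)
        have [measurable]: "(\<lambda>p. frechet_derivative \<eta> (at (snd p)) (V (fst p) (snd p))) \<in> borel_measurable (borel \<Otimes>\<^sub>M borel)"
          using derivative_V_measurable[OF \<eta>(1)] by (simp add: case_prod_beta')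
        show ?thesis unfolding case_prod_beta' by measurable
      qed
      show "(\<lambda>r. indicat_real {0..1} r *\<^sub>R (\<integral>x. (w1 n r - w2 n r) * \<eta> x + \<xi> n r * frechet_derivative \<eta> (at x) (V r x) \<partial>\<mu> r)) \<in> borel_measurable lborel"
        using integral_K_measurable[OF F] by measurable
      have "set_integrable lborel {s..t} (\<lambda>r. w1 n r * h r - w2 n r * h r + \<xi> n r * q r)"
        using i1 \<xi>q by (intro set_integral_add(1) set_integral_diff(1))
      then show "(\<lambda>r. indicat_real {s..t} r *\<^sub>R (w1 n r * h r - w2 n r * h r + \<xi> n r * q r)) \<in> borel_measurable lborel"
        unfolding set_integrable_def by (rule borel_measurable_integrable)
      show "AE r in lborel. indicat_real {0..1} r *\<^sub>R (\<integral>x. (w1 n r - w2 n r) * \<eta> x + \<xi> n r * frechet_derivative \<eta> (at x) (V r x) \<partial>\<mu> r) =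
          indicat_real {s..t} r *\<^sub>R (w1 n r * h r - w2 n r * h r + \<xi> n r * q r)"
        using qi(1)
      proof eventually_elim
        case (elim r)
        show ?case
        proof (cases "r \<in> {s..t}")
          case True
          then have i: "integrable (\<mu> r) (\<lambda>x. frechet_derivative \<eta> (at x) (V r x))" using elim by simp
          interpret prob_space "\<mu> r" by (rule prob_K)
          obtain B where "\<And>x. norm (\<eta> x) \<le> B"
            using smooth_compact_bounded(2)[OF \<eta>] unfolding bounded_iff by auto
          then have j: "integrable (\<mu> r) \<eta>"
            using borel_measurable_continuous_onI[OF smooth_compact_bounded(1)[OF \<eta>]]
            by (intro integrable_const_bound[of _ B]) (auto cong: measurable_cong_sets)
          have "(\<integral>x. (w1 n r - w2 n r) * \<eta> x + \<xi> n r * frechet_derivative \<eta> (at x) (V r x) \<partial>\<mu> r) = (w1 n r - w2 n r) * h r + \<xi> n r * q r"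
            using i j by (simp add: h_def q_def)
          then show ?thesis using True st by (simp add: algebra_simps)
        next
          case False
          have "w1 n r = 0" using False e[of n] by (intro ws1) auto
          moreover have "w2 n r = 0" using False e[of n] by (intro ws2) auto
          ultimately show ?thesis using False \<xi>s by simp
        qed
      qed
    qed
    also have "\<dots> = (LINT r:{s..t}|lborel. w1 n r * h r - w2 n r * h r) + (LINT r:{s..t}|lborel. \<xi> n r * q r)"
      using i1 \<xi>q by (intro set_integral_add(2) set_integral_diff(1))
    also have "(LINT r:{s..t}|lborel. w1 n r * h r - w2 n r * h r) = (LINT r:{s..t}|lborel. w1 n r * h r) - (LINT r:{s..t}|lborel. w2 n r * h r)"
      using i1 by (rule set_integral_diff(2))
    finally show ?thesis by simp
  qed
  have e': "(\<lambda>n. s + e n) \<longlonglongrightarrow> s" "(\<lambda>n. t - e n) \<longlonglongrightarrow> t"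
    using tendsto_add[OF tendsto_const e0, of s] tendsto_diff[OF tendsto_const e0, of t] by simp_all
  have l1: "(\<lambda>n. LINT r:{s..t}|lborel. w1 n r * h r) \<longlonglongrightarrow> h s"
    by (rule approximate_identity_tendsto[OF hc w0(1) ws1 _ _ tendsto_const e'(1) wc(1) wi1]) (use e in \<open>auto intro: less_imp_le simp: field_simps\<close>)
  have l2: "(\<lambda>n. LINT r:{s..t}|lborel. w2 n r * h r) \<longlonglongrightarrow> h t"
    by (rule approximate_identity_tendsto[OF hc w0(2) ws2 _ _ e'(2) tendsto_const wc(2) wi2]) (use e in \<open>auto intro: less_imp_le simp: field_simps\<close>)
  have l3: "(\<lambda>n. LINT r:{s..t}|lborel. \<xi> n r * q r) \<longlonglongrightarrow> (LINT r:{s..t}|lborel. q r)"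
    unfolding set_lebesgue_integral_def
  proof (rule integral_dominated_convergence[where w="\<lambda>r. norm (indicator {s..t} r *\<^sub>R q r)"])
    have [measurable]: "q \<in> borel_measurable borel"
      unfolding q_def by (rule integral_K_measurable[OF derivative_V_measurable[OF \<eta>(1)]])
    have [measurable]: "\<xi> n \<in> borel_measurable borel" for n
      by (rule borel_measurable_continuous_onI[OF smooth_continuous_on[OF s\<xi>]])
    show "(\<lambda>r. indicat_real {s..t} r *\<^sub>R q r) \<in> borel_measurable lborel" by measurable
    show "(\<lambda>r. indicat_real {s..t} r *\<^sub>R (\<xi> n r * q r)) \<in> borel_measurable lborel" for n by measurable
    show "integrable lborel (\<lambda>r. norm (indicat_real {s..t} r *\<^sub>R q r))"
      using q_int unfolding set_integrable_def by (rule integrable_norm)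
    show "AE r in lborel. (\<lambda>n. indicat_real {s..t} r *\<^sub>R (\<xi> n r * q r)) \<longlonglongrightarrow> indicat_real {s..t} r *\<^sub>R q r"
      using AE_lborel_singleton[of s] AE_lborel_singleton[of t]
    proof eventually_elim
      case (elim r)
      show ?case
      proof (cases "r \<in> {s<..<t}")
        case True
        have "\<forall>\<^sub>F n in sequentially. e n < r - s" "\<forall>\<^sub>F n in sequentially. e n < t - r"
          using order_tendstoD(2)[OF e0] True by auto
        then have "\<forall>\<^sub>F n in sequentially. indicat_real {s..t} r *\<^sub>R (\<xi> n r * q r) = indicat_real {s..t} r *\<^sub>R q r"
        proof eventually_elim
          case (elim n)
          have "1 \<le> (r - s) / e n" "(r - t) / e n + 1 \<le> 0"
            using elim e(1)[of n] by (auto simp: field_simps)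
          then show ?case by (simp add: \<xi>_def H(6,7))
        qed
        then show ?thesis by (rule tendsto_eventually)
      next
        case False
        then show ?thesis using elim by (auto simp: indicator_def)
      qed
    qed
    show "AE r in lborel. norm (indicat_real {s..t} r *\<^sub>R (\<xi> n r * q r)) \<le> norm (indicat_real {s..t} r *\<^sub>R q r)" for n
      using \<xi>b by (intro AE_I2) (auto simp: indicator_def abs_mult intro!: mult_left_le_one_le)
  qed
  have "(\<lambda>n. 0::real) \<longlonglongrightarrow> h s - h t + (LINT r:{s..t}|lborel. q r)"
    using tendsto_add[OF tendsto_diff[OF l1 l2] l3] by (simp add: zero)
  then have "h s - h t + (LINT r:{s..t}|lborel. q r) = 0"
    using LIMSEQ_unique tendsto_const by blast
  then show ?thesis by (simp add: h_def q_def)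
qed

end

section \<open>Evolution of integrals of functions of quadratic growth\<close>

context ce_curve
begin

definition m2 :: "real \<Rightarrow> real" where "m2 t = (\<integral>x. (norm x)\<^sup>2 \<partial>\<mu> t)"

lemma integrable_norm_power2 [simp]: "integrable (\<mu> t) (\<lambda>x. (norm x)\<^sup>2)"
  by (rule P2D(4)[OF P2])

lemma borel_measurable_mu: "f \<in> borel_measurable borel \<Longrightarrow> f \<in> borel_measurable (\<mu> t)"
  by (simp cong: measurable_cong_sets)

lemma integrable_quadratic_growth:
  fixes f :: "'a \<Rightarrow> 'b::euclidean_space"
  assumes "f \<in> borel_measurable borel" "\<And>x. norm (f x) \<le> C * (1 + (norm x)\<^sup>2)"
  shows "integrable (\<mu> t) f"
proof -
  interpret prob_space "\<mu> t" by (rule prob_K)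
  show ?thesis
  proof (rule Bochner_Integration.integrable_bound)
    show "integrable (\<mu> t) (\<lambda>x. C * (1 + (norm x)\<^sup>2))" by simp
    show "AE x in \<mu> t. norm (f x) \<le> norm (C * (1 + (norm x)\<^sup>2))"
      using assms(2) by (intro AE_I2) (auto intro: order_trans[OF _ abs_ge_self])
  qed (rule borel_measurable_mu[OF assms(1)])
qed

lemma quadratic_finite:
  assumes B: "\<And>t. t \<in> {u..v} \<Longrightarrow> m2 t \<le> B" and C: "0 \<le> C" and "u \<le> v"
    and fin: "(\<integral>\<^sup>+t\<in>{u..v}. (\<integral>\<^sup>+x. ennreal ((norm (V t x))\<^sup>2) \<partial>\<mu> t) \<partial>lborel) < \<infinity>"
  shows "(\<integral>\<^sup>+t\<in>{u..v}. (\<integral>\<^sup>+x. ennreal (C * (1 + (norm x)\<^sup>2 + (norm (V t x))\<^sup>2)) \<partial>\<mu> t) \<partial>lborel) < \<infinity>"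
proof -
  let ?N = "\<lambda>t. \<integral>\<^sup>+x. ennreal ((norm (V t x))\<^sup>2) \<partial>\<mu> t"
  have Vm [measurable]: "V t \<in> borel_measurable (\<mu> t)" for t by (rule measurable_section[OF V_measurable])
  have [measurable]: "?N \<in> borel_measurable borel"
    by (rule nn_integral_K_measurable) measurable
  have n2: "(\<lambda>x. norm x) \<in> borel_measurable (\<mu> t)" for t by (rule borel_measurable_mu) simp
  have "(\<integral>\<^sup>+x. ennreal (C * (1 + (norm x)\<^sup>2 + (norm (V t x))\<^sup>2)) \<partial>\<mu> t) \<le> ennreal C * (ennreal (1 + B) + ?N t)"
    if t: "t \<in> {u..v}" for t
  proof -
    interpret prob_space "\<mu> t" by (rule prob_K)
    have "(\<integral>\<^sup>+x. ennreal (C * (1 + (norm x)\<^sup>2 + (norm (V t x))\<^sup>2)) \<partial>\<mu> t) =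
        (\<integral>\<^sup>+x. ennreal C * (ennreal (1 + (norm x)\<^sup>2) + ennreal ((norm (V t x))\<^sup>2)) \<partial>\<mu> t)"
      using C by (intro nn_integral_cong) (simp add: ennreal_mult ennreal_plus[symmetric] del: ennreal_plus)
    also have "\<dots> = ennreal C * ((\<integral>\<^sup>+x. ennreal (1 + (norm x)\<^sup>2) \<partial>\<mu> t) + ?N t)"
      using n2[of t] by (subst nn_integral_cmult) (auto simp: nn_integral_add)
    also have "(\<integral>\<^sup>+x. ennreal (1 + (norm x)\<^sup>2) \<partial>\<mu> t) = ennreal (\<integral>x. 1 + (norm x)\<^sup>2 \<partial>\<mu> t)"
      by (rule nn_integral_eq_integral) auto
    also have "(\<integral>x. 1 + (norm x)\<^sup>2 \<partial>\<mu> t) = 1 + m2 t"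
      by (simp add: m2_def prob_space[simplified])
    also have "ennreal C * (ennreal (1 + m2 t) + ?N t) \<le> ennreal C * (ennreal (1 + B) + ?N t)"
      using B[OF t] by (intro mult_left_mono add_right_mono ennreal_leI) auto
    finally show ?thesis .
  qed
  then have "(\<integral>\<^sup>+t\<in>{u..v}. (\<integral>\<^sup>+x. ennreal (C * (1 + (norm x)\<^sup>2 + (norm (V t x))\<^sup>2)) \<partial>\<mu> t) \<partial>lborel)
      \<le> (\<integral>\<^sup>+t. ennreal C * (ennreal (1 + B) * indicator {u..v} t + ?N t * indicator {u..v} t) \<partial>lborel)"
    by (intro nn_integral_mono) (auto simp: indicator_def)
  also have "\<dots> = ennreal C * (ennreal (1 + B) * emeasure lborel {u..v} + (\<integral>\<^sup>+t\<in>{u..v}. ?N t \<partial>lborel))"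
    by (subst nn_integral_cmult, simp, subst nn_integral_add) (auto simp: nn_integral_cmult)
  also have "\<dots> < \<infinity>"
    using fin \<open>u \<le> v\<close> by (simp add: ennreal_mult_less_top)
  finally show ?thesis .
qed

text \<open>By Young's inequality (1 + |x|) |V| is at most 1 + |x|^2 + |V|^2. The weight 1 + |x| is
  what the gradient of a function of quadratic growth calls for.\<close>

lemma weighted_speed_finite:
  assumes B: "\<And>t. t \<in> {u..v} \<Longrightarrow> m2 t \<le> B" and "u \<le> v"
    and fin: "(\<integral>\<^sup>+t\<in>{u..v}. (\<integral>\<^sup>+x. ennreal ((norm (V t x))\<^sup>2) \<partial>\<mu> t) \<partial>lborel) < \<infinity>"
  shows "(\<integral>\<^sup>+t\<in>{u..v}. (\<integral>\<^sup>+x. ennreal ((1 + norm x) * norm (V t x)) \<partial>\<mu> t) \<partial>lborel) < \<infinity>"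
proof -
  have le: "(1 + norm x) * norm (V t x) \<le> 1 + (norm x)\<^sup>2 + (norm (V t x))\<^sup>2" for t x
  proof -
    have "2 * (norm x * norm (V t x)) \<le> (norm x)\<^sup>2 + (norm (V t x))\<^sup>2"
      using sum_squares_bound[of "norm x" "norm (V t x)"] by (simp only: mult.assoc)
    moreover have "2 * norm (V t x) \<le> (norm (V t x))\<^sup>2 + 1"
      using sum_squares_bound[of "norm (V t x)" 1] by simp
    moreover have "(1 + norm x) * norm (V t x) = norm (V t x) + norm x * norm (V t x)"
      by (simp add: algebra_simps)
    ultimately show ?thesis
      using zero_le_power2[of "norm x"] zero_le_power2[of "norm (V t x)"] by linarith
  qed
  have "(\<integral>\<^sup>+t\<in>{u..v}. (\<integral>\<^sup>+x. ennreal ((1 + norm x) * norm (V t x)) \<partial>\<mu> t) \<partial>lborel)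
     \<le> (\<integral>\<^sup>+t\<in>{u..v}. (\<integral>\<^sup>+x. ennreal (1 * (1 + (norm x)\<^sup>2 + (norm (V t x))\<^sup>2)) \<partial>\<mu> t) \<partial>lborel)"
    by (intro nn_integral_mono mult_right_mono ennreal_leI) (auto simp: le)
  then show ?thesis using quadratic_finite[OF B _ \<open>u \<le> v\<close> fin, of 1] by (simp add: le_less_trans)
qed

lemma speed_finite:
  assumes fin: "(\<integral>\<^sup>+t\<in>A. (\<integral>\<^sup>+x. ennreal ((1 + norm x) * norm (V t x)) \<partial>\<mu> t) \<partial>lborel) < \<infinity>"
  shows "(\<integral>\<^sup>+t\<in>A. (\<integral>\<^sup>+x. ennreal (norm (V t x)) \<partial>\<mu> t) \<partial>lborel) < \<infinity>"
proof -
  have "(\<integral>\<^sup>+t\<in>A. (\<integral>\<^sup>+x. ennreal (norm (V t x)) \<partial>\<mu> t) \<partial>lborel)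
     \<le> (\<integral>\<^sup>+t\<in>A. (\<integral>\<^sup>+x. ennreal ((1 + norm x) * norm (V t x)) \<partial>\<mu> t) \<partial>lborel)"
    by (intro nn_integral_mono mult_right_mono ennreal_leI) (auto simp: algebra_simps)
  then show ?thesis using fin by (rule le_less_trans)
qed

text \<open>Test functions vanish near the times 0 and 1, so an interval touching them is approached
  by shrinking it from both ends; weak continuity takes care of the boundary values.\<close>

lemma evolution_compact:
  assumes \<eta>: "smooth \<eta>" "compact (closure {x. \<eta> x \<noteq> 0})"
    and st: "0 \<le> s" "s \<le> t" "t \<le> 1"
    and fin: "(\<integral>\<^sup>+r\<in>{s..t}. (\<integral>\<^sup>+x. ennreal (norm (V r x)) \<partial>\<mu> r) \<partial>lborel) < \<infinity>"
  shows "(\<integral>x. \<eta> x \<partial>\<mu> t) - (\<integral>x. \<eta> x \<partial>\<mu> s) =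
    (LINT r:{s..t}|lborel. \<integral>x. frechet_derivative \<eta> (at x) (V r x) \<partial>\<mu> r)"
proof (cases "s = t")
  case True
  have "(LINT r:{t..t}|lborel. \<integral>x. frechet_derivative \<eta> (at x) (V r x) \<partial>\<mu> r) = (LINT r::real|lborel. (0::real))"
    unfolding set_lebesgue_integral_def
  proof (rule integral_cong_AE)
    show "(\<lambda>r. indicat_real {t..t} r *\<^sub>R (\<integral>x. frechet_derivative \<eta> (at x) (V r x) \<partial>\<mu> r)) \<in> borel_measurable lborel"
      using integral_K_measurable[OF derivative_V_measurable[OF \<eta>(1)]] by measurable
    show "AE r in lborel. indicat_real {t..t} r *\<^sub>R (\<integral>x. frechet_derivative \<eta> (at x) (V r x) \<partial>\<mu> r) = 0"
      using AE_lborel_singleton[of t] by eventually_elim auto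
  qed simp
  then show ?thesis using True by simp
next
  case False
  then have st': "s < t" using st by simp
  define h where "h r = (\<integral>x. \<eta> x \<partial>\<mu> r)" for r
  define q where "q r = (\<integral>x. frechet_derivative \<eta> (at x) (V r x) \<partial>\<mu> r)" for r
  have hc: "continuous_on UNIV h"
    unfolding h_def[abs_def] by (rule weak[OF smooth_compact_bounded[OF \<eta>]])
  have qm [measurable]: "q \<in> borel_measurable borel"
    unfolding q_def[abs_def] by (rule integral_K_measurable[OF derivative_V_measurable[OF \<eta>(1)]])
  obtain C where C: "C \<ge> 0" "\<And>x v. \<bar>frechet_derivative \<eta> (at x) v\<bar> \<le> C * norm v"
    by (rule smooth_derivative_bound[OF \<eta>]) (rule that)
  have [measurable]: "V r \<in> borel_measurable (\<mu> r)" for r by (rule measurable_section[OF V_measurable])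
  have [measurable]: "(\<lambda>r. \<integral>\<^sup>+x. ennreal (norm (V r x)) \<partial>\<mu> r) \<in> borel_measurable borel"
    by (rule nn_integral_K_measurable) measurable
  have "(\<integral>\<^sup>+r\<in>{s..t}. (\<integral>\<^sup>+x. ennreal (C * norm (V r x)) \<partial>\<mu> r) \<partial>lborel) =
        (\<integral>\<^sup>+r. ennreal C * ((\<integral>\<^sup>+x. ennreal (norm (V r x)) \<partial>\<mu> r) * indicator {s..t} r) \<partial>lborel)"
    using C(1) by (simp add: ennreal_mult nn_integral_cmult mult.assoc)
  also have "\<dots> = ennreal C * (\<integral>\<^sup>+r\<in>{s..t}. (\<integral>\<^sup>+x. ennreal (norm (V r x)) \<partial>\<mu> r) \<partial>lborel)"
    by (rule nn_integral_cmult) measurable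
  also have "\<dots> < \<infinity>" using fin by (simp add: ennreal_mult_less_top)
  finally have fin': "(\<integral>\<^sup>+r\<in>{s..t}. (\<integral>\<^sup>+x. ennreal (C * norm (V r x)) \<partial>\<mu> r) \<partial>lborel) < \<infinity>" .
  have q_int: "set_integrable lborel {s..t} q"
    unfolding q_def[abs_def]
    by (rule nested_integrable_bound(2)[OF derivative_V_measurable[OF \<eta>(1)] _ fin']) (use C(2) in auto)
  \<comment> \<open>With the summand 3, twice the margin is less than t - s, so the shrunken
    interval is nondegenerate.\<close>
  define e where "e n = (t - s) / (real n + 3)" for n :: nat
  have e: "e n > 0" "2 * e n < t - s" for n
  proof -
    have "(t - s) * 2 < (t - s) * (real n + 3)" using st' by (intro mult_strict_left_mono) auto
    then show "2 * e n < t - s" by (simp add: e_def divide_less_eq mult.commute)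
  qed (use st' in \<open>simp add: e_def\<close>)
  have e0: "e \<longlonglongrightarrow> 0"
    using tendsto_mult_right_zero[OF LIMSEQ_Suc[OF LIMSEQ_Suc[OF LIMSEQ_inverse_real_of_nat]], of "t - s"]
    by (simp add: e_def[abs_def] divide_inverse add_ac)
  have eq: "h (t - e n) - h (s + e n) = (LINT r:{s + e n..t - e n}|lborel. q r)" for n
    unfolding h_def q_def
  proof (rule evolution_open[OF \<eta>])
    have "(\<integral>\<^sup>+r\<in>{s + e n..t - e n}. (\<integral>\<^sup>+x. ennreal (norm (V r x)) \<partial>\<mu> r) \<partial>lborel)
      \<le> (\<integral>\<^sup>+r\<in>{s..t}. (\<integral>\<^sup>+x. ennreal (norm (V r x)) \<partial>\<mu> r) \<partial>lborel)"
      using e[of n] by (intro nn_integral_mono mult_left_mono) (auto simp: indicator_def)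
    then show "(\<integral>\<^sup>+r\<in>{s + e n..t - e n}. (\<integral>\<^sup>+x. ennreal (norm (V r x)) \<partial>\<mu> r) \<partial>lborel) < \<infinity>"
      using fin by (rule le_less_trans)
  qed (use e[of n] st in auto)
  have l: "(\<lambda>n. s + e n) \<longlonglongrightarrow> s" "(\<lambda>n. t - e n) \<longlonglongrightarrow> t"
    using tendsto_add[OF tendsto_const e0, of s] tendsto_diff[OF tendsto_const e0, of t] by simp_all
  have "isCont h r" for r using hc by (simp add: continuous_on_eq_continuous_at)
  then have "(\<lambda>n. h (t - e n) - h (s + e n)) \<longlonglongrightarrow> h t - h s"
    using l by (intro tendsto_diff isCont_tendsto_compose[of _ h])
  moreover have "(\<lambda>n. LINT r:{s + e n..t - e n}|lborel. q r) \<longlonglongrightarrow> (LINT r:{s..t}|lborel. q r)"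
    unfolding set_lebesgue_integral_def
  proof (rule integral_dominated_convergence[where w="\<lambda>r. norm (indicator {s..t} r *\<^sub>R q r)"])
    show "integrable lborel (\<lambda>r. norm (indicat_real {s..t} r *\<^sub>R q r))"
      using q_int unfolding set_integrable_def by (rule integrable_norm)
    show "AE r in lborel. (\<lambda>n. indicat_real {s + e n..t - e n} r *\<^sub>R q r) \<longlonglongrightarrow> indicat_real {s..t} r *\<^sub>R q r"
      using AE_lborel_singleton[of s] AE_lborel_singleton[of t]
    proof eventually_elim
      case (elim r)
      show ?case
      proof (cases "r \<in> {s<..<t}")
        case True
        have "\<forall>\<^sub>F n in sequentially. e n < r - s" "\<forall>\<^sub>F n in sequentially. e n < t - r"
          using order_tendstoD(2)[OF e0] True by auto
        then have "\<forall>\<^sub>F n in sequentially. indicat_real {s + e n..t - e n} r *\<^sub>R q r = indicat_real {s..t} r *\<^sub>R q r"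
          by eventually_elim (use True in \<open>auto simp: indicator_def\<close>)
        then show ?thesis by (rule tendsto_eventually)
      next
        case False
        then have "r \<notin> {s..t}" using elim by auto
        moreover have "r \<notin> {s + e n..t - e n}" for n using calculation e(1)[of n] by auto
        ultimately show ?thesis by simp
      qed
    qed
    show "AE r in lborel. norm (indicat_real {s + e n..t - e n} r *\<^sub>R q r) \<le> norm (indicat_real {s..t} r *\<^sub>R q r)" for n
      using e(1)[of n] by (intro AE_I2) (auto simp: indicator_def)
  qed measurable
  ultimately have "h t - h s = (LINT r:{s..t}|lborel. q r)"
    unfolding eq by (rule LIMSEQ_unique)
  then show ?thesis by (simp add: h_def q_def)
qed

text \<open>Multiply eta by the cutoffs and let R tend to infinity. The derivative of the cutoff
  meets eta only where |x| \<ge> R, and its decay keeps the product below a multiple of (1 + |x|)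
  |V| uniformly in R.\<close>

lemma evolution:
  assumes \<eta>: "smooth \<eta>" and g1: "\<And>x. \<bar>\<eta> x\<bar> \<le> C * (1 + (norm x)\<^sup>2)"
    and g2: "\<And>x v. \<bar>frechet_derivative \<eta> (at x) v\<bar> \<le> C * (1 + norm x) * norm v"
    and st: "0 \<le> s" "s \<le> t" "t \<le> 1"
    and fin: "(\<integral>\<^sup>+r\<in>{s..t}. (\<integral>\<^sup>+x. ennreal ((1 + norm x) * norm (V r x)) \<partial>\<mu> r) \<partial>lborel) < \<infinity>"
  shows "(\<integral>x. \<eta> x \<partial>\<mu> t) - (\<integral>x. \<eta> x \<partial>\<mu> s) =
      (LINT r:{s..t}|lborel. \<integral>x. frechet_derivative \<eta> (at x) (V r x) \<partial>\<mu> r)"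
    and "set_integrable lborel {s..t} (\<lambda>r. \<integral>x. frechet_derivative \<eta> (at x) (V r x) \<partial>\<mu> r)"
    and "AE r in lborel. r \<in> {s..t} \<longrightarrow> integrable (\<mu> r) (\<lambda>x. frechet_derivative \<eta> (at x) (V r x))"
proof -
  have C0: "0 \<le> C" using order_trans[OF abs_ge_zero g1[of 0]] by simp
  obtain \<kappa> :: "real \<Rightarrow> 'a \<Rightarrow> real" and Ck where
    \<kappa>: "\<And>R. R > 0 \<Longrightarrow> smooth (\<kappa> R)" "\<And>R. R > 0 \<Longrightarrow> compact (closure {x. \<kappa> R x \<noteq> 0})"
    "\<And>R x. \<bar>\<kappa> R x\<bar> \<le> 1" "\<And>R x. R > 0 \<Longrightarrow> norm x \<le> R \<Longrightarrow> \<kappa> R x = 1"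
    "\<And>R x v. R > 0 \<Longrightarrow> norm x < R \<Longrightarrow> frechet_derivative (\<kappa> R) (at x) v = 0"
    "\<And>R x v. R > 0 \<Longrightarrow> norm x * \<bar>frechet_derivative (\<kappa> R) (at x) v\<bar> \<le> Ck * norm v" "Ck \<ge> 0"
    by (rule cutoff_exists) (rule that)
  define R where "R n = real n + 1" for n
  have R: "R n \<ge> 1" "R n > 0" for n by (auto simp: R_def)
  \<comment> \<open>C accounts for the derivative of eta, and 2 C Ck for the derivative of the
    cutoff: radii are at least 1, so 1 + |x|^2 is at most 2 |x|^2 where that derivative does not
    vanish.\<close>
  define D where "D = C + 2 * C * Ck"
  have D0: "0 \<le> D" using C0 \<kappa>(7) by (simp add: D_def)
  define G where "G r x = D * ((1 + norm x) * norm (V r x))" for r x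
  have Gm: "(\<lambda>(t, x). G t x) \<in> borel_measurable (borel \<Otimes>\<^sub>M borel)"
    unfolding G_def case_prod_beta' by measurable
  have Gfin: "(\<integral>\<^sup>+r\<in>{s..t}. (\<integral>\<^sup>+x. ennreal (G r x) \<partial>\<mu> r) \<partial>lborel) < \<infinity>"
  proof -
    have [measurable]: "V r \<in> borel_measurable (\<mu> r)" "(\<lambda>x. norm x) \<in> borel_measurable (\<mu> r)" for r
      by (rule measurable_section[OF V_measurable]) (rule borel_measurable_mu, simp)
    have [measurable]: "(\<lambda>r. \<integral>\<^sup>+x. ennreal ((1 + norm x) * norm (V r x)) \<partial>\<mu> r) \<in> borel_measurable borel"
      by (rule nn_integral_K_measurable) measurable
    have "(\<integral>\<^sup>+r\<in>{s..t}. (\<integral>\<^sup>+x. ennreal (G r x) \<partial>\<mu> r) \<partial>lborel) =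
        (\<integral>\<^sup>+r. ennreal D * ((\<integral>\<^sup>+x. ennreal ((1 + norm x) * norm (V r x)) \<partial>\<mu> r) * indicator {s..t} r) \<partial>lborel)"
      unfolding G_def ennreal_mult'[OF D0] by (subst nn_integral_cmult) (auto simp: mult.assoc)
    also have "\<dots> = ennreal D * (\<integral>\<^sup>+r\<in>{s..t}. (\<integral>\<^sup>+x. ennreal ((1 + norm x) * norm (V r x)) \<partial>\<mu> r) \<partial>lborel)"
      by (rule nn_integral_cmult) measurable
    also have "\<dots> < \<infinity>" using fin by (simp add: ennreal_mult_less_top)
    finally show ?thesis .
  qed
  have Dle: "norm (frechet_derivative \<eta> (at x) (V r x)) \<le> G r x" for r x
  proof -
    have "C * (1 + norm x) * norm (V r x) \<le> D * ((1 + norm x) * norm (V r x))"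
      unfolding mult.assoc using C0 \<kappa>(7) by (intro mult_right_mono) (auto simp: D_def)
    then show ?thesis using g2[of x "V r x"] by (simp add: G_def)
  qed
  note i = nested_integrable_bound[OF derivative_V_measurable[OF \<eta>] _ Gfin Dle, simplified]
  then show "set_integrable lborel {s..t} (\<lambda>r. \<integral>x. frechet_derivative \<eta> (at x) (V r x) \<partial>\<mu> r)"
    "AE r in lborel. r \<in> {s..t} \<longrightarrow> integrable (\<mu> r) (\<lambda>x. frechet_derivative \<eta> (at x) (V r x))"
    by simp_all
  define \<eta>n where "\<eta>n n x = \<kappa> (R n) x * \<eta> x" for n x
  have sm: "smooth (\<eta>n n)" for n
    unfolding \<eta>n_def[abs_def] by (rule smooth_mult[OF \<kappa>(1)[OF R(2)] \<eta>])
  have cp: "compact (closure {x. \<eta>n n x \<noteq> 0})" for n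
  proof -
    have "closure {x. \<eta>n n x \<noteq> 0} \<subseteq> closure {x. \<kappa> (R n) x \<noteq> 0}"
      by (rule closure_mono) (auto simp: \<eta>n_def)
    then show ?thesis
      using compact_Int_closed[OF \<kappa>(2)[OF R(2)[of n]] closed_closure, of "{x. \<eta>n n x \<noteq> 0}"]
      by (simp only: Int_absorb1)
  qed
  have der: "frechet_derivative (\<eta>n n) (at x) w = \<kappa> (R n) x * frechet_derivative \<eta> (at x) w + frechet_derivative (\<kappa> (R n)) (at x) w * \<eta> x" for n x w
  proof -
    have "(\<eta>n n has_derivative (\<lambda>w. \<kappa> (R n) x * frechet_derivative \<eta> (at x) w + frechet_derivative (\<kappa> (R n)) (at x) w * \<eta> x)) (at x)"
      unfolding \<eta>n_def[abs_def]
      by (rule has_derivative_mult[OF smooth_has_derivative[OF \<kappa>(1)[OF R(2)]] smooth_has_derivative[OF \<eta>]])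
    from fun_cong[OF frechet_derivative_at[OF this], of w] show ?thesis by simp
  qed
  have derle: "norm (frechet_derivative (\<eta>n n) (at x) (V r x)) \<le> G r x" for n r x
  proof -
    let ?w = "V r x"
    have 1: "\<bar>\<kappa> (R n) x * frechet_derivative \<eta> (at x) ?w\<bar> \<le> 1 * (C * (1 + norm x) * norm ?w)"
      unfolding abs_mult by (intro mult_mono \<kappa>(3) g2) auto
    have 2: "\<bar>frechet_derivative (\<kappa> (R n)) (at x) ?w * \<eta> x\<bar> \<le> 2 * C * Ck * ((1 + norm x) * norm ?w)"
    proof (cases "norm x < R n")
      case True
      then show ?thesis using \<kappa>(5)[OF R(2) True] C0 \<kappa>(7) by simp
    next
      case False
      then have x1: "norm x \<ge> 1" using R(1)[of n] by linarith
      have "\<bar>frechet_derivative (\<kappa> (R n)) (at x) ?w * \<eta> x\<bar> \<le> \<bar>frechet_derivative (\<kappa> (R n)) (at x) ?w\<bar> * (C * (1 + (norm x)\<^sup>2))"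
        unfolding abs_mult by (rule mult_left_mono[OF g1]) simp
      also have "\<dots> \<le> \<bar>frechet_derivative (\<kappa> (R n)) (at x) ?w\<bar> * (C * (2 * (norm x)\<^sup>2))"
        using x1 C0 by (intro mult_left_mono) (auto simp: one_le_power)
      also have "\<dots> = 2 * C * norm x * (norm x * \<bar>frechet_derivative (\<kappa> (R n)) (at x) ?w\<bar>)"
        by (simp add: power2_eq_square)
      also have "\<dots> \<le> 2 * C * norm x * (Ck * norm ?w)"
        using C0 by (intro mult_left_mono \<kappa>(6) R(2)) auto
      also have "\<dots> = 2 * C * Ck * (norm x * norm ?w)" by simp
      also have "\<dots> \<le> 2 * C * Ck * ((1 + norm x) * norm ?w)"
        using C0 \<kappa>(7) by (intro mult_left_mono mult_right_mono) auto
      finally show ?thesis .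
    qed
    have "norm (frechet_derivative (\<eta>n n) (at x) ?w) \<le> D * ((1 + norm x) * norm ?w)"
      unfolding der D_def using 1 2 by (simp add: algebra_simps)
    then show ?thesis by (simp add: G_def)
  qed
  have spf: "(\<integral>\<^sup>+r\<in>{s..t}. (\<integral>\<^sup>+x. ennreal (norm (V r x)) \<partial>\<mu> r) \<partial>lborel) < \<infinity>"
    by (rule speed_finite[OF fin])
  have eq: "(\<integral>x. \<eta>n n x \<partial>\<mu> t) - (\<integral>x. \<eta>n n x \<partial>\<mu> s) =
      (LINT r:{s..t}|lborel. \<integral>x. frechet_derivative (\<eta>n n) (at x) (V r x) \<partial>\<mu> r)" for n
    by (rule evolution_compact[OF sm cp st spf])
  have ev: "\<forall>\<^sub>F n in sequentially. norm x < R n" for x :: 'a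
    using eventually_ge_at_top[of "nat \<lceil>norm x\<rceil>"] by eventually_elim (unfold R_def, linarith)
  have "(\<lambda>n. LINT r:{s..t}|lborel. \<integral>x. frechet_derivative (\<eta>n n) (at x) (V r x) \<partial>\<mu> r)
      \<longlonglongrightarrow> (LINT r:{s..t}|lborel. \<integral>x. frechet_derivative \<eta> (at x) (V r x) \<partial>\<mu> r)"
  proof (rule nested_dominated_convergence[OF derivative_V_measurable[OF sm] derivative_V_measurable[OF \<eta>] Gm _ Gfin derle])
    fix r x
    have "\<forall>\<^sub>F n in sequentially. frechet_derivative (\<eta>n n) (at x) (V r x) = frechet_derivative \<eta> (at x) (V r x)"
      using ev[of x] by eventually_elim (simp add: der \<kappa>(4)[OF R(2)] \<kappa>(5)[OF R(2)] less_imp_le)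
    then show "(\<lambda>n. frechet_derivative (\<eta>n n) (at x) (V r x)) \<longlonglongrightarrow> frechet_derivative \<eta> (at x) (V r x)"
      by (rule tendsto_eventually)
  qed simp
  moreover have "(\<lambda>n. \<integral>x. \<eta>n n x \<partial>\<mu> r) \<longlonglongrightarrow> (\<integral>x. \<eta> x \<partial>\<mu> r)" for r
  proof (rule integral_dominated_convergence[where w="\<lambda>x. C * (1 + (norm x)\<^sup>2)"])
    interpret prob_space "\<mu> r" by (rule prob_K)
    show "integrable (\<mu> r) (\<lambda>x. C * (1 + (norm x)\<^sup>2))" by simp
    show "\<eta> \<in> borel_measurable (\<mu> r)" "\<eta>n n \<in> borel_measurable (\<mu> r)" for n
      by (intro borel_measurable_mu borel_measurable_continuous_onI smooth_continuous_on \<eta> sm)+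
    show "AE x in \<mu> r. (\<lambda>n. \<eta>n n x) \<longlonglongrightarrow> \<eta> x"
    proof (rule AE_I2)
      fix x
      have "\<forall>\<^sub>F n in sequentially. \<eta>n n x = \<eta> x"
        using ev[of x] by eventually_elim (simp add: \<eta>n_def \<kappa>(4)[OF R(2)] less_imp_le)
      then show "(\<lambda>n. \<eta>n n x) \<longlonglongrightarrow> \<eta> x" by (rule tendsto_eventually)
    qed
    show "AE x in \<mu> r. norm (\<eta>n n x) \<le> C * (1 + (norm x)\<^sup>2)" for n
    proof (rule AE_I2)
      fix x
      have "norm (\<eta>n n x) \<le> 1 * (C * (1 + (norm x)\<^sup>2))"
        unfolding \<eta>n_def norm_mult by (intro mult_mono) (use \<kappa>(3) g1 in auto)
      then show "norm (\<eta>n n x) \<le> C * (1 + (norm x)\<^sup>2)" by simp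
    qed
  qed
  then have "(\<lambda>n. (\<integral>x. \<eta>n n x \<partial>\<mu> t) - (\<integral>x. \<eta>n n x \<partial>\<mu> s)) \<longlonglongrightarrow> (\<integral>x. \<eta> x \<partial>\<mu> t) - (\<integral>x. \<eta> x \<partial>\<mu> s)"
    by (intro tendsto_diff)
  ultimately show "(\<integral>x. \<eta> x \<partial>\<mu> t) - (\<integral>x. \<eta> x \<partial>\<mu> s) =
      (LINT r:{s..t}|lborel. \<integral>x. frechet_derivative \<eta> (at x) (V r x) \<partial>\<mu> r)"
    unfolding eq using LIMSEQ_unique by blast
qed

end

section \<open>A priori bounds on the moments\<close>

lemma integrable_short_interval:
  fixes k :: "real \<Rightarrow> real"
  assumes k: "integrable lborel k" "\<And>r. 0 \<le> k r" and "\<epsilon> > 0"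
  obtains \<delta> where "\<delta> > 0" "\<And>s t. 0 \<le> s \<Longrightarrow> s \<le> t \<Longrightarrow> t \<le> 1 \<Longrightarrow> t - s < \<delta> \<Longrightarrow> (LINT r:{s..t}|lborel. k r) < \<epsilon>"
proof -
  obtain \<delta> where \<delta>: "\<delta> > 0" "\<And>(I::nat set) u v. interval_family 0 1 I u v \<Longrightarrow>
    (\<Sum>i\<in>I. v i - u i) < \<delta> \<Longrightarrow> (\<Sum>i\<in>I. LINT r:{u i..v i}|lborel. k r) < \<epsilon>"
    using integrable_interval_family_small[OF assms] by blast
  show ?thesis
  proof (rule that[OF \<delta>(1)])
    fix s t :: real assume "0 \<le> s" "s \<le> t" "t \<le> 1" "t - s < \<delta>"
    then show "(LINT r:{s..t}|lborel. k r) < \<epsilon>"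
      using \<delta>(2)[of "{0}" "\<lambda>_. s" "\<lambda>_. t"] by (simp add: interval_family_def)
  qed
qed

text \<open>The conclusion of Gronwall's inequality on short intervals, in a form that presupposes only
  local boundedness.\<close>

definition doubling :: "real \<Rightarrow> (real \<Rightarrow> real) \<Rightarrow> bool" where
  "doubling \<delta> f \<longleftrightarrow> (\<forall>u v. 0 \<le> u \<longrightarrow> u \<le> v \<longrightarrow> v \<le> 1 \<longrightarrow> v - u < \<delta> \<longrightarrow> bdd_above (f ` {u..v}) \<longrightarrow>
     (\<forall>s\<in>{u..v}. \<forall>t\<in>{u..v}. f t \<le> 2 * f s))"

lemma doublingD:
  assumes "doubling \<delta> f" "0 \<le> u" "u \<le> v" "v \<le> 1" "v - u < \<delta>" "bdd_above (f ` {u..v})"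
    "s \<in> {u..v}" "t \<in> {u..v}"
  shows "f t \<le> 2 * f s"
  using assms unfolding doubling_def by blast

text \<open>Where the integral of k is below 1/2, the supremum M of f satisfies M \<le> f s + M / 2.
  Boundedness makes M a real number, so that half of it can be absorbed.\<close>

lemma doubling_of_integral_inequality:
  fixes f k :: "real \<Rightarrow> real"
  assumes k: "integrable lborel k" "\<And>r. 0 \<le> k r" and f0: "\<And>r. 0 \<le> f r"
    and le: "\<forall>s t M. 0 \<le> s \<and> s \<le> t \<and> t \<le> 1 \<and> (\<forall>r\<in>{s..t}. f r \<le> M) \<longrightarrow>
      \<bar>f t - f s\<bar> \<le> M * (LINT r:{s..t}|lborel. k r)"
  shows "\<exists>\<delta>>0. doubling \<delta> f"
proof -
  obtain \<delta> where \<delta>: "\<delta> > 0"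
    "\<And>s t. 0 \<le> s \<Longrightarrow> s \<le> t \<Longrightarrow> t \<le> 1 \<Longrightarrow> t - s < \<delta> \<Longrightarrow> (LINT r:{s..t}|lborel. k r) < 1 / 2"
    by (rule integrable_short_interval[OF k, of "1 / 2"]) (auto intro: that)
  have "doubling \<delta> f"
    unfolding doubling_def
  proof (intro allI impI ballI)
    fix u v s t :: real
    assume uv: "0 \<le> u" "u \<le> v" "v \<le> 1" "v - u < \<delta>" and bdd: "bdd_above (f ` {u..v})"
      and st: "s \<in> {u..v}" "t \<in> {u..v}"
    define M where "M = Sup (f ` {u..v})"
    have M: "f r \<le> M" if "r \<in> {u..v}" for r
      unfolding M_def using that bdd by (intro cSup_upper) auto
    have M0: "0 \<le> M" using M[OF st(1)] f0[of s] by linarith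
    have inc: "\<bar>f y - f x\<bar> \<le> M / 2" if "x \<in> {u..v}" "y \<in> {u..v}" "x \<le> y" for x y
    proof -
      have "\<bar>f y - f x\<bar> \<le> M * (LINT r:{x..y}|lborel. k r)"
        using that uv M by (intro le[rule_format]) auto
      also have "\<dots> \<le> M * (1 / 2)"
        using \<delta>(2)[of x y] that uv M0 by (intro mult_left_mono) auto
      finally show ?thesis by simp
    qed
    have "f y \<le> f s + M / 2" if "y \<in> {u..v}" for y
    proof -
      have "\<bar>f y - f s\<bar> \<le> M / 2"
        using inc[of s y] inc[of y s] that st by (cases "s \<le> y") (auto simp: abs_minus_commute)
      then show ?thesis by linarith
    qed
    then have "M \<le> f s + M / 2"
      unfolding M_def using uv by (intro cSup_least) auto
    then show "f t \<le> 2 * f s" using M[OF st(2)] by linarith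
  qed
  with \<delta>(1) show ?thesis by blast
qed

text \<open>Time reversal reduces an approach from the left to one from the right.\<close>

lemma doubling_reflect:
  assumes "doubling \<delta> f"
  shows "doubling \<delta> (\<lambda>t. f (1 - t))"
  unfolding doubling_def
proof (intro allI impI ballI)
  fix u v s t :: real
  assume uv: "0 \<le> u" "u \<le> v" "v \<le> 1" "v - u < \<delta>" and bdd: "bdd_above ((\<lambda>t. f (1 - t)) ` {u..v})"
    and st: "s \<in> {u..v}" "t \<in> {u..v}"
  have "f ` {1 - v..1 - u} \<subseteq> (\<lambda>t. f (1 - t)) ` {u..v}"
  proof
    fix y assume "y \<in> f ` {1 - v..1 - u}"
    then obtain r where "r \<in> {1 - v..1 - u}" "y = f r" by blast
    then show "y \<in> (\<lambda>t. f (1 - t)) ` {u..v}" by (intro image_eqI[of _ _ "1 - r"]) auto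
  qed
  from bdd_above_mono[OF bdd this]
  show "f (1 - t) \<le> 2 * f (1 - s)"
    using uv st by (intro doublingD[OF assms, of "1 - v" "1 - u"]) auto
qed

text \<open>A zero forces zeros at all points closer than delta, because f t \<le> 2 * 0 there;
  steps of length delta / 2 then reach all of [0, 1].\<close>

lemma doubling_zero:
  assumes d: "doubling \<delta> f" "\<delta> > 0" and f0: "\<And>r. 0 \<le> f r" and bdd: "bdd_above (f ` {0..1})"
    and s: "s \<in> {0..1}" "f s = 0" and t: "t \<in> {0..1}"
  shows "f t = 0"
proof -
  have step: "f y = 0" if "x \<in> {0..1}" "y \<in> {0..1}" "\<bar>y - x\<bar> < \<delta>" "f x = 0" for x y
  proof -
    have "bdd_above (f ` {min x y..max x y})"
      by (rule bdd_above_mono[OF bdd image_mono]) (use that in auto)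
    then have "f y \<le> 2 * f x"
      using that by (intro doublingD[OF d(1), of "min x y" "max x y"]) auto
    then show ?thesis using f0[of y] that by simp
  qed
  have "\<forall>t\<in>{0..1}. \<bar>t - s\<bar> \<le> real n * (\<delta> / 2) \<longrightarrow> f t = 0" for n
  proof (induction n)
    case 0
    then show ?case using s by auto
  next
    case (Suc n)
    show ?case
    proof (intro ballI impI)
      fix t :: real assume t: "t \<in> {0..1}" "\<bar>t - s\<bar> \<le> real (Suc n) * (\<delta> / 2)"
      define c where "c = real n * (\<delta> / 2)"
      \<comment> \<open>The point of [s - c, s + c] nearest to t, hence one already settled by the
        induction hypothesis.\<close>
      define x where "x = max (s - c) (min (s + c) t)"
      have c: "0 \<le> c" "\<bar>t - s\<bar> \<le> c + \<delta> / 2" using d(2) t(2) by (auto simp: c_def algebra_simps)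
      have "\<bar>x - s\<bar> \<le> c" using c by (auto simp: x_def max_def min_def abs_le_iff)
      moreover have x: "\<bar>t - x\<bar> < \<delta>" "x \<in> {0..1}"
        using t(1) s(1) c d(2) by (auto simp: x_def max_def min_def abs_if split: if_splits)
      ultimately have "x \<in> {0..1}" "\<bar>x - s\<bar> \<le> real n * (\<delta> / 2)" by (simp_all add: c_def)
      then have "f x = 0" using Suc by blast
      then show "f t = 0" using step[OF x(2) t(1) x(1)] by simp
    qed
  qed
  moreover obtain n :: nat where "\<bar>t - s\<bar> \<le> real n * (\<delta> / 2)"
    using ex_less_of_nat_mult[of "\<delta> / 2" "\<bar>t - s\<bar>"] d(2) by (auto intro: less_imp_le)
  ultimately show ?thesis using t by blast
qed

definition locally_bdd_above_at :: "(real \<Rightarrow> real) \<Rightarrow> real \<Rightarrow> bool" where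
  "locally_bdd_above_at f x \<longleftrightarrow> (\<exists>\<epsilon>>0. \<exists>B. \<forall>y\<in>{0..1}. \<bar>y - x\<bar> < \<epsilon> \<longrightarrow> f y \<le> B)"

text \<open>Compactness of [a, b], applied in the form of bisection.\<close>

lemma locally_bdd_above_imp_bdd_above:
  assumes "a \<le> b" "0 \<le> a" "b \<le> 1" and loc: "\<And>x. x \<in> {a..b} \<Longrightarrow> locally_bdd_above_at f x"
  shows "bdd_above (f ` {a..b})"
proof -
  have "bdd_above (f ` ({a..b} \<inter> {0..1}))"
    using \<open>a \<le> b\<close>
  proof (induction rule: Bolzano)
    case (trans u w v)
    then have "{u..v} \<inter> {0..1} = ({u..w} \<inter> {0..1}) \<union> ({w..v} \<inter> {0..1})" by auto
    then show ?case using trans by (simp add: image_Un)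
  next
    case (local x)
    then have "locally_bdd_above_at f x" by (intro loc) simp
    then obtain \<epsilon> B where e: "\<epsilon> > 0" "\<forall>y\<in>{0..1}. \<bar>y - x\<bar> < \<epsilon> \<longrightarrow> f y \<le> B"
      unfolding locally_bdd_above_at_def by blast
    have "bdd_above (f ` ({u..v} \<inter> {0..1}))" if "u \<le> x" "x \<le> v" "v - u < \<epsilon>" for u v
      by (rule bdd_aboveI2[of _ _ B]) (use that e(2) in auto)
    then show ?case using e(1) by (intro exI[of _ \<epsilon>]) simp
  qed
  moreover have eq: "{a..b} \<inter> {0..1} = {a..b}" using assms by auto
  ultimately show ?thesis by (simp only: eq)
qed

lemma locally_bdd_above_at_reflect:
  assumes "locally_bdd_above_at f (1 - x)"
  shows "locally_bdd_above_at (\<lambda>t. f (1 - t)) x"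
proof -
  obtain \<epsilon> B where e: "\<epsilon> > 0" "\<And>y. y \<in> {0..1} \<Longrightarrow> \<bar>y - (1 - x)\<bar> < \<epsilon> \<Longrightarrow> f y \<le> B"
    using assms unfolding locally_bdd_above_at_def by blast
  have "f (1 - y) \<le> B" if "y \<in> {0..1}" "\<bar>y - x\<bar> < \<epsilon>" for y
    using e(2)[of "1 - y"] that by (simp add: abs_minus_commute)
  with e(1) show ?thesis unfolding locally_bdd_above_at_def by blast
qed

text \<open>At a, only the value f a is available, not a bound nearby. Doubling on [r, b] for r > a
  gives f r \<le> 2 f b; together with the value f a this bounds f on all of [a, b], where doubling
  then applies.\<close>

lemma doubling_half_open:
  assumes d: "doubling \<delta> f" and ab: "0 \<le> a" "a < b" "b \<le> 1" "b - a < \<delta>"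
    and loc: "\<And>x. x \<in> {a<..b} \<Longrightarrow> locally_bdd_above_at f x"
  shows "f b \<le> 2 * f a"
proof -
  have le: "f r \<le> 2 * f b" if r: "r \<in> {a<..b}" for r
  proof -
    have "bdd_above (f ` {r..b})"
      using r ab by (intro locally_bdd_above_imp_bdd_above loc) auto
    then show ?thesis
      using r ab by (intro doublingD[OF d, of r b]) auto
  qed
  have "bdd_above (f ` {a..b})"
  proof (rule bdd_aboveI2)
    fix r assume "r \<in> {a..b}"
    then show "f r \<le> max (f a) (2 * f b)"
      using le[of r] by (cases "r = a") auto
  qed
  then show ?thesis
    using ab by (intro doublingD[OF d, of a b]) auto
qed

text \<open>Closed sublevel sets express lower semicontinuity. F consists of the points without a
  local bound. If it were nonempty, Baire would give a relatively open piece of F on which f is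
  bounded, and doubling would carry that bound to the nearby points off F, against the choice of
  F.\<close>

lemma bdd_above_of_doubling:
  assumes closed: "\<And>n::nat. closed {t. f t \<le> real n}" and f0: "\<And>t. 0 \<le> f t"
    and d: "doubling \<delta> f" "\<delta> > 0"
  shows "bdd_above (f ` {0..1})"
proof -
  define F where "F = {0..1} \<inter> - {t. locally_bdd_above_at f t}"
  have "open {t. locally_bdd_above_at f t}"
    unfolding open_dist
  proof (intro ballI)
    fix x assume "x \<in> {t. locally_bdd_above_at f t}"
    then obtain \<epsilon> B where e: "\<epsilon> > 0" "\<And>y. y \<in> {0..1} \<Longrightarrow> \<bar>y - x\<bar> < \<epsilon> \<Longrightarrow> f y \<le> B"
      unfolding locally_bdd_above_at_def by blast
    have "locally_bdd_above_at f z" if "dist z x < \<epsilon> / 2" for z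
      unfolding locally_bdd_above_at_def
    proof (rule exI[of _ "\<epsilon> / 2"], rule conjI, use e(1) in simp, rule exI[of _ B], intro ballI impI)
      fix y :: real assume "y \<in> {0..1}" "\<bar>y - z\<bar> < \<epsilon> / 2"
      then have "\<bar>y - x\<bar> < \<epsilon>" using that unfolding dist_real_def by linarith
      then show "f y \<le> B" using \<open>y \<in> {0..1}\<close> by (intro e(2))
    qed
    then show "\<exists>e>0. \<forall>y. dist y x < e \<longrightarrow> y \<in> {t. locally_bdd_above_at f t}"
      using e(1) by (intro exI[of _ "\<epsilon> / 2"]) auto
  qed
  then have Fc: "closed F" unfolding F_def by (intro closed_Int) auto
  have "F = {}"
  proof (rule ccontr)
    assume ne: "F \<noteq> {}"
    let ?G = "range (\<lambda>n::nat. F \<inter> - {t. f t \<le> real n})"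
    have inter: "\<Inter>?G = {}"
    proof -
      have "\<exists>n::nat. f t \<le> real n" for t by (rule real_arch_simple)
      then show ?thesis by auto
    qed
    have ope: "openin (top_of_set F) (F \<inter> - {t. f t \<le> real n})" for n
      using closed[of n] by (intro openin_open_Int open_Compl)
    \<comment> \<open>Baire's theorem in its open form: the relatively open sets where f > n have
      empty intersection, so one of them is not dense in F.\<close>
    have "\<exists>n::nat. \<not> F \<subseteq> closure (F \<inter> - {t. f t \<le> real n})"
    proof (rule ccontr)
      assume "\<not> ?thesis"
      then have "F \<subseteq> closure (\<Inter>?G)"
        using ope by (intro Baire[OF Fc]) auto
      then show False using inter ne by simp
    qed
    then obtain n :: nat and t0 where t0: "t0 \<in> F" "t0 \<notin> closure (F \<inter> - {t. f t \<le> real n})" by blast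
    then obtain \<epsilon> where e1: "\<epsilon> > 0" "\<forall>t\<in>F \<inter> - {t. f t \<le> real n}. \<not> \<bar>t - t0\<bar> < \<epsilon>"
      unfolding closure_approachable dist_real_def by blast
    have e: "\<epsilon> > 0" "\<And>t. t \<in> F \<Longrightarrow> \<bar>t - t0\<bar> < \<epsilon> \<Longrightarrow> f t \<le> real n"
      using e1 by blast+
    have t01: "t0 \<in> {0..1}" using t0(1) by (simp add: F_def)
    have loc: "locally_bdd_above_at f t" if "t \<in> {0..1}" "t \<notin> F" for t using that by (simp add: F_def)
    have "f t \<le> 2 * real n" if t: "t \<in> {0..1}" "\<bar>t - t0\<bar> < min \<epsilon> \<delta>" for t
    proof (cases "t \<in> F")
      case True
      then show ?thesis using e(2)[of t] t f0[of t] by simp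
    next
      case False
      then have "t \<noteq> t0" using t0 by auto
      then consider "t0 < t" | "t < t0" by linarith
      then show ?thesis
      proof cases
        case 1
        \<comment> \<open>The last point a of F before t exists by compactness; f is locally bounded
          on (a, t] and at most n at a.\<close>
        have "compact (F \<inter> {t0..t})" by (intro closed_Int_compact Fc) auto
        moreover have "F \<inter> {t0..t} \<noteq> {}" using t0 1 by auto
        ultimately have "\<exists>a\<in>F \<inter> {t0..t}. \<forall>r\<in>F \<inter> {t0..t}. r \<le> a"
          by (rule compact_attains_sup)
        then obtain a where a: "a \<in> F \<inter> {t0..t}" "\<forall>r\<in>F \<inter> {t0..t}. r \<le> a" by blast
        have "a < t" using a(1) False by (cases "a = t") auto
        have "f t \<le> 2 * f a"
        proof (rule doubling_half_open[OF d(1)])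
          fix x assume x: "x \<in> {a<..t}"
          then have "x \<notin> F" using a(1) bspec[OF a(2), of x] t01 by auto
          then show "locally_bdd_above_at f x" using x a(1) t t01 by (intro loc) auto
        next
          show "0 \<le> a" "t \<le> 1" "t - a < \<delta>" using a(1) t t01 by auto
        qed (rule \<open>a < t\<close>)
        also have "f a \<le> real n" using a(1) t 1 by (intro e(2)) auto
        finally show ?thesis by simp
      next
        case 2
        have "compact (F \<inter> {t..t0})" by (intro closed_Int_compact Fc) auto
        moreover have "F \<inter> {t..t0} \<noteq> {}" using t0 2 by auto
        ultimately have "\<exists>a\<in>F \<inter> {t..t0}. \<forall>r\<in>F \<inter> {t..t0}. a \<le> r"
          by (rule compact_attains_inf)
        then obtain a where a: "a \<in> F \<inter> {t..t0}" "\<forall>r\<in>F \<inter> {t..t0}. a \<le> r" by blast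
        have "t < a" using a(1) False by (cases "a = t") auto
        have "f (1 - (1 - t)) \<le> 2 * f (1 - (1 - a))"
        proof (rule doubling_half_open[OF doubling_reflect[OF d(1)]])
          fix x assume x: "x \<in> {1 - a<..1 - t}"
          then have "1 - x \<notin> F" using a(1) bspec[OF a(2), of "1 - x"] t01 by auto
          then show "locally_bdd_above_at (\<lambda>t. f (1 - t)) x"
            using x a(1) t t01 by (intro locally_bdd_above_at_reflect loc) auto
        next
          show "0 \<le> 1 - a" "1 - t \<le> 1" "(1 - t) - (1 - a) < \<delta>" "1 - a < 1 - t"
            using a(1) t t01 \<open>t < a\<close> by auto
        qed
        moreover have "f a \<le> real n" using a(1) t 2 by (intro e(2)) auto
        ultimately show ?thesis by simp
      qed
    qed
    then have "locally_bdd_above_at f t0"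
      unfolding locally_bdd_above_at_def
      by (intro exI[where x="min \<epsilon> \<delta>"], intro conjI, use e(1) d(2) in simp, intro exI[where x="2 * real n"]) blast
    then show False using t0(1) by (simp add: F_def)
  qed
  then have "locally_bdd_above_at f x" if "x \<in> {0..1}" for x using that by (auto simp: F_def)
  then show ?thesis by (intro locally_bdd_above_imp_bdd_above) auto
qed

section \<open>Moments of measures, and curves with bounded second moment\<close>

lemma norm_le_1_plus_power2: "norm x \<le> 1 + (norm x)\<^sup>2"
proof -
  have "2 * norm x \<le> (norm x)\<^sup>2 + 1" using sum_squares_bound[of "norm x" 1] by simp
  then show ?thesis using zero_le_power2[of "norm x"] by linarith
qed

lemma P2_norm_diff_integrable:
  assumes "\<mu> \<in> P2"
  shows "integrable \<mu> (\<lambda>x. (norm (x - p))\<^sup>2)" "integrable \<mu> (\<lambda>x. x)"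
proof -
  note P = P2D[OF assms]
  interpret prob_space \<mu> by (rule P(1))
  have m: "f \<in> borel_measurable \<mu>" if "f \<in> borel_measurable borel" for f :: "'a \<Rightarrow> 'b::topological_space"
    using that P(2) by (simp cong: measurable_cong_sets)
  have i: "integrable \<mu> (\<lambda>x. 1 + (norm x)\<^sup>2)" using P(4) by simp
  show id: "integrable \<mu> (\<lambda>x. x)"
  proof (rule Bochner_Integration.integrable_bound[OF i])
    show "AE x in \<mu>. norm x \<le> norm (1 + (norm x)\<^sup>2)"
      by (intro AE_I2) (simp add: norm_le_1_plus_power2)
  qed (rule m, simp)
  have "(norm (x - p))\<^sup>2 = (norm x)\<^sup>2 - 2 * (x \<bullet> p) + (norm p)\<^sup>2" for x
    by (simp add: power2_norm_eq_inner inner_diff inner_commute algebra_simps)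
  then show "integrable \<mu> (\<lambda>x. (norm (x - p))\<^sup>2)"
    using P(4) id by simp
qed

text \<open>The mixed term integrates to 0 since x minus the barycenter has mean 0. With p = 0 this
  relates the variance to the second moment; for general p it shows that the variance is the least
  mean square distance from a point.\<close>

lemma integral_norm_diff_power2:
  assumes "\<mu> \<in> P2"
  shows "(\<integral>x. (norm (x - p))\<^sup>2 \<partial>\<mu>) = var \<mu> + (norm (barycenter \<mu> - p))\<^sup>2"
proof -
  interpret prob_space \<mu> by (rule P2D(1)[OF assms])
  let ?b = "barycenter \<mu>"
  note i = P2_norm_diff_integrable[OF assms]
  have eq: "(norm (x - p))\<^sup>2 = (norm (x - ?b))\<^sup>2 + 2 * ((x - ?b) \<bullet> (?b - p)) + (norm (?b - p))\<^sup>2" for x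
    by (simp add: power2_norm_eq_inner inner_diff inner_commute algebra_simps)
  have "(\<integral>x. (x - ?b) \<bullet> (?b - p) \<partial>\<mu>) = (\<integral>x. x - ?b \<partial>\<mu>) \<bullet> (?b - p)"
    using i(2) by (intro integral_inner_left) simp
  also have "(\<integral>x. x - ?b \<partial>\<mu>) = 0"
    using i(2) by (simp add: barycenter_def prob_space)
  finally have z: "(\<integral>x. (x - ?b) \<bullet> (?b - p) \<partial>\<mu>) = 0" by simp
  have "(\<integral>x. (norm (x - p))\<^sup>2 \<partial>\<mu>) = (\<integral>x. (norm (x - ?b))\<^sup>2 \<partial>\<mu>) + 2 * (\<integral>x. (x - ?b) \<bullet> (?b - p) \<partial>\<mu>) + (norm (?b - p))\<^sup>2"
  proof -
    have "(\<integral>x. (norm (x - p))\<^sup>2 \<partial>\<mu>) = (\<integral>x. (norm (x - ?b))\<^sup>2 + 2 * ((x - ?b) \<bullet> (?b - p)) + (norm (?b - p))\<^sup>2 \<partial>\<mu>)"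
      by (rule Bochner_Integration.integral_cong[OF refl eq])
    then show ?thesis using i(1)[of ?b] i(2) by (simp add: prob_space)
  qed
  then show ?thesis by (simp only: z var_def mult_zero_right add_0_right)
qed

lemma var_nonneg: "0 \<le> var \<mu>"
  by (simp add: var_def)

lemma AC_componentwise:
  fixes f :: "real \<Rightarrow> 'b::euclidean_space"
  assumes "\<And>b. b \<in> Basis \<Longrightarrow> absolutely_continuous_on_unit (\<lambda>t. f t \<bullet> b)"
  shows "absolutely_continuous_on_unit f"
proof -
  have const: "absolutely_continuous_on_unit (\<lambda>_. 0::'b)"
    by (rule absolutely_continuous_on_unitI) (auto intro!: exI[of _ 1])
  have "absolutely_continuous_on_unit (\<lambda>t. \<Sum>b\<in>S. (f t \<bullet> b) *\<^sub>R b)" if "finite S" "S \<subseteq> Basis" for S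
    using that
  proof (induction S rule: finite_induct)
    case empty
    then show ?case using const by simp
  next
    case (insert b S)
    have "absolutely_continuous_on_unit (\<lambda>t. f t \<bullet> b)" "absolutely_continuous_on_unit (\<lambda>t. \<Sum>b\<in>S. (f t \<bullet> b) *\<^sub>R b)"
      using insert assms by auto
    then show ?case
    proof (rule AC_increments_le[where C=1])
      fix s t :: real
      have "(\<Sum>b\<in>insert b S. (f t \<bullet> b) *\<^sub>R b) - (\<Sum>b\<in>insert b S. (f s \<bullet> b) *\<^sub>R b) =
          (f t \<bullet> b - f s \<bullet> b) *\<^sub>R b + ((\<Sum>b\<in>S. (f t \<bullet> b) *\<^sub>R b) - (\<Sum>b\<in>S. (f s \<bullet> b) *\<^sub>R b))"
        using insert.hyps by (simp add: algebra_simps)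
      also have "norm \<dots> \<le> norm ((f t \<bullet> b - f s \<bullet> b) *\<^sub>R b) + norm ((\<Sum>b\<in>S. (f t \<bullet> b) *\<^sub>R b) - (\<Sum>b\<in>S. (f s \<bullet> b) *\<^sub>R b))"
        by (rule norm_triangle_ineq)
      also have "norm ((f t \<bullet> b - f s \<bullet> b) *\<^sub>R b) = norm (f t \<bullet> b - f s \<bullet> b)"
        using insert.prems by simp
      finally show "norm ((\<Sum>b\<in>insert b S. (f t \<bullet> b) *\<^sub>R b) - (\<Sum>b\<in>insert b S. (f s \<bullet> b) *\<^sub>R b)) \<le>
          1 * (norm (f t \<bullet> b - f s \<bullet> b) + norm ((\<Sum>b\<in>S. (f t \<bullet> b) *\<^sub>R b) - (\<Sum>b\<in>S. (f s \<bullet> b) *\<^sub>R b)))"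
        by simp
    qed
  qed
  from this[of Basis] show ?thesis by (simp add: euclidean_representation)
qed

lemma ac_density_constant_zero:
  assumes "ac_density (\<lambda>_. c) g"
  shows "AE r in lborel. r \<in> {0..1} \<longrightarrow> g r = 0"
  using ac_density_has_vector_derivative[OF assms] AE_lborel_singleton[of 0] AE_lborel_singleton[of 1]
proof eventually_elim
  case (elim r)
  show ?case
  proof
    assume "r \<in> {0..1}"
    then have "r \<in> {0<..<1}" using elim by auto
    then have "((\<lambda>_. c) has_vector_derivative g r) (at r)" using elim by simp
    then show "g r = 0" using vector_derivative_unique_at[OF has_vector_derivative_const] by metis
  qed
qed

text \<open>The integrability that permits testing with functions of quadratic growth on all of
  [0, 1]. Both normalized curves of finite energy and curves of finite cost turn out to be
  instances.\<close>

locale moment_curve = ce_curve +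
  fixes B :: real
  assumes m2_le: "\<And>t. t \<in> {0..1} \<Longrightarrow> m2 t \<le> B"
    and weighted_speed: "(\<integral>\<^sup>+t\<in>{0..1}. (\<integral>\<^sup>+x. ennreal ((1 + norm x) * norm (V t x)) \<partial>\<mu> t) \<partial>lborel) < \<infinity>"
begin

lemma weighted_speed_subinterval:
  assumes "0 \<le> s" "t \<le> 1"
  shows "(\<integral>\<^sup>+r\<in>{s..t}. (\<integral>\<^sup>+x. ennreal ((1 + norm x) * norm (V r x)) \<partial>\<mu> r) \<partial>lborel) < \<infinity>"
proof -
  have "(\<integral>\<^sup>+r\<in>{s..t}. (\<integral>\<^sup>+x. ennreal ((1 + norm x) * norm (V r x)) \<partial>\<mu> r) \<partial>lborel)
    \<le> (\<integral>\<^sup>+r\<in>{0..1}. (\<integral>\<^sup>+x. ennreal ((1 + norm x) * norm (V r x)) \<partial>\<mu> r) \<partial>lborel)"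
    using assms by (intro nn_integral_mono mult_left_mono) (auto simp: indicator_def)
  then show ?thesis using weighted_speed by (rule le_less_trans)
qed

lemma evolution_density:
  assumes \<eta>: "smooth \<eta>" and g1: "\<And>x. \<bar>\<eta> x\<bar> \<le> C * (1 + (norm x)\<^sup>2)"
    and g2: "\<And>x v. \<bar>frechet_derivative \<eta> (at x) v\<bar> \<le> C * (1 + norm x) * norm v"
  shows "ac_density (\<lambda>t. \<integral>x. \<eta> x \<partial>\<mu> t) (\<lambda>r. indicator {0..1} r *\<^sub>R (\<integral>x. frechet_derivative \<eta> (at x) (V r x) \<partial>\<mu> r))"
  unfolding ac_density_def
proof (intro conjI ballI)
  show "integrable lborel (\<lambda>r. indicat_real {0..1} r *\<^sub>R (\<integral>x. frechet_derivative \<eta> (at x) (V r x) \<partial>\<mu> r))"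
    using evolution(2)[OF \<eta> g1 g2 _ _ _ weighted_speed] by (simp add: set_integrable_def)
  fix t :: real assume t: "t \<in> {0..1}"
  have "(\<integral>x. \<eta> x \<partial>\<mu> t) - (\<integral>x. \<eta> x \<partial>\<mu> 0) = (LINT r:{0..t}|lborel. \<integral>x. frechet_derivative \<eta> (at x) (V r x) \<partial>\<mu> r)"
    using t by (intro evolution(1)[OF \<eta> g1 g2] weighted_speed_subinterval) auto
  also have "\<dots> = (LINT r:{0..t}|lborel. indicat_real {0..1} r *\<^sub>R (\<integral>x. frechet_derivative \<eta> (at x) (V r x) \<partial>\<mu> r))"
    unfolding set_lebesgue_integral_def
    using t by (intro Bochner_Integration.integral_cong) (auto simp: indicator_def)
  finally show "(\<integral>x. \<eta> x \<partial>\<mu> t) - (\<integral>x. \<eta> x \<partial>\<mu> 0) =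
      (LINT r:{0..t}|lborel. indicat_real {0..1} r *\<^sub>R (\<integral>x. frechet_derivative \<eta> (at x) (V r x) \<partial>\<mu> r))" .
qed

end

lemma frechet_derivative_inner: "frechet_derivative (\<lambda>x. x \<bullet> b) (at x) v = v \<bullet> b"
  using frechet_derivative_at[OF bounded_linear_imp_has_derivative[OF bounded_linear_inner_left], of b x]
  by metis

lemma frechet_derivative_norm_diff_power2:
  fixes p :: "'a::euclidean_space"
  shows "frechet_derivative (\<lambda>x. (norm (x - p))\<^sup>2) (at x) v = 2 * ((x - p) \<bullet> v)"
proof -
  have "((\<lambda>x. (x - p) \<bullet> (x - p)) has_derivative (\<lambda>v. 2 * ((x - p) \<bullet> v))) (at x)"
    by (auto intro!: derivative_eq_intros simp: inner_commute)
  from fun_cong[OF frechet_derivative_at[OF this], of v] show ?thesis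
    by (simp add: power2_norm_eq_inner)
qed

lemma smooth_norm_diff_power2: "smooth (\<lambda>x::'a::euclidean_space. (norm (x - p))\<^sup>2)"
  using smooth_compose_affine[OF bounded_linear_ident smooth_norm_power2, of "- p"] by simp

lemma inner_growth:
  fixes b :: "'a::euclidean_space"
  assumes "b \<in> Basis"
  shows "\<bar>x \<bullet> b\<bar> \<le> 1 * (1 + (norm x)\<^sup>2)"
    "\<bar>frechet_derivative (\<lambda>x. x \<bullet> b) (at x) v\<bar> \<le> 1 * (1 + norm x) * norm v"
proof -
  show "\<bar>x \<bullet> b\<bar> \<le> 1 * (1 + (norm x)\<^sup>2)"
    using order_trans[OF Basis_le_norm[OF assms, of x] norm_le_1_plus_power2[of x]] by simp
  have "norm v \<le> (1 + norm x) * norm v" by (simp add: algebra_simps)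
  then show "\<bar>frechet_derivative (\<lambda>x. x \<bullet> b) (at x) v\<bar> \<le> 1 * (1 + norm x) * norm v"
    using Basis_le_norm[OF assms, of v] by (simp add: frechet_derivative_inner)
qed

text \<open>One constant, 2 + 2 |p|^2, serves the two growth conditions of \<open>evolution\<close>
  at once.\<close>

lemma norm_diff_power2_growth:
  fixes p :: "'a::euclidean_space"
  shows "\<bar>(norm (x - p))\<^sup>2\<bar> \<le> (2 + 2 * (norm p)\<^sup>2) * (1 + (norm x)\<^sup>2)"
    "\<bar>frechet_derivative (\<lambda>x. (norm (x - p))\<^sup>2) (at x) v\<bar> \<le> (2 + 2 * (norm p)\<^sup>2) * (1 + norm x) * norm v"
proof -
  have "(norm (x - p))\<^sup>2 \<le> (norm x + norm p)\<^sup>2"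
    by (intro power_mono norm_triangle_ineq4) simp
  also have "\<dots> \<le> 2 * (norm x)\<^sup>2 + 2 * (norm p)\<^sup>2"
    using sum_squares_bound[of "norm x" "norm p"] by (simp add: power2_sum)
  also have "\<dots> \<le> (2 + 2 * (norm p)\<^sup>2) * (1 + (norm x)\<^sup>2)"
    by (simp add: algebra_simps)
  finally show "\<bar>(norm (x - p))\<^sup>2\<bar> \<le> (2 + 2 * (norm p)\<^sup>2) * (1 + (norm x)\<^sup>2)" by simp
  have p: "2 * norm p \<le> 2 + 2 * (norm p)\<^sup>2"
    using norm_le_1_plus_power2[of p] by simp
  have "\<bar>2 * ((x - p) \<bullet> v)\<bar> \<le> 2 * (norm (x - p) * norm v)"
    using Cauchy_Schwarz_ineq2[of "x - p" v] by (simp add: abs_mult)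
  also have "\<dots> \<le> 2 * ((norm x + norm p) * norm v)"
    by (intro mult_left_mono mult_right_mono norm_triangle_ineq4) auto
  also have "\<dots> = (2 * norm x + 2 * norm p) * norm v" by (simp add: algebra_simps)
  also have "\<dots> \<le> ((2 + 2 * (norm p)\<^sup>2) * (1 + norm x)) * norm v"
  proof (rule mult_right_mono)
    show "2 * norm x + 2 * norm p \<le> (2 + 2 * (norm p)\<^sup>2) * (1 + norm x)"
    proof -
      have "(2 + 2 * (norm p)\<^sup>2) * (1 + norm x) = 2 + 2 * (norm p)\<^sup>2 + 2 * norm x + 2 * (norm x * (norm p)\<^sup>2)"
        by (simp add: algebra_simps)
      then show ?thesis
        using p mult_nonneg_nonneg[OF norm_ge_zero[of x] zero_le_power2[of "norm p"]] by linarith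
    qed
  qed simp
  finally show "\<bar>frechet_derivative (\<lambda>x. (norm (x - p))\<^sup>2) (at x) v\<bar> \<le> (2 + 2 * (norm p)\<^sup>2) * (1 + norm x) * norm v"
    by (simp add: frechet_derivative_norm_diff_power2)
qed

context moment_curve
begin

lemma first_moment_density:
  assumes "b \<in> Basis"
  shows "ac_density (\<lambda>t. barycenter (\<mu> t) \<bullet> b) (\<lambda>r. indicator {0..1} r *\<^sub>R (\<integral>x. V r x \<bullet> b \<partial>\<mu> r))"
proof -
  have "(\<integral>x. x \<bullet> b \<partial>\<mu> t) = barycenter (\<mu> t) \<bullet> b" for t
    unfolding barycenter_def using P2_norm_diff_integrable(2)[OF P2] by (intro integral_inner_left)
  then show ?thesis
    using evolution_density[OF smooth_inner inner_growth[OF assms]] by (simp add: frechet_derivative_inner)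
qed

lemma second_moment_density:
  "ac_density (\<lambda>t. \<integral>x. (norm (x - p))\<^sup>2 \<partial>\<mu> t) (\<lambda>r. indicator {0..1} r *\<^sub>R (\<integral>x. 2 * ((x - p) \<bullet> V r x) \<partial>\<mu> r))"
  using evolution_density[OF smooth_norm_diff_power2 norm_diff_power2_growth, of p]
  by (simp add: frechet_derivative_norm_diff_power2)

lemma AC_barycenter: "absolutely_continuous_on_unit (\<lambda>t. barycenter (\<mu> t))"
  by (rule AC_componentwise) (rule ac_density_imp_AC[OF first_moment_density])

lemma AC_m2: "absolutely_continuous_on_unit m2"
  using ac_density_imp_AC[OF second_moment_density[of 0]] by (simp add: m2_def[abs_def])

lemma integrable_V:
  "AE t in lborel. t \<in> {0..1} \<longrightarrow> integrable (\<mu> t) (V t)"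
  by (rule nested_integrable(1)[OF V_measurable]) (use speed_finite[OF weighted_speed] in auto)

text \<open>Mean and second moment are constant in time, so their densities, which are the integrals
  of V and of 2 x . V, vanish almost everywhere.\<close>

lemma normalized_velocity:
  assumes "\<And>t. t \<in> {0..1} \<Longrightarrow> barycenter (\<mu> t) = 0" "\<And>t. t \<in> {0..1} \<Longrightarrow> var (\<mu> t) = 1"
  shows "AE t in lborel. t \<in> {0..1} \<longrightarrow> (\<integral>x. V t x \<partial>\<mu> t) = 0 \<and> (\<integral>x. x \<bullet> V t x \<partial>\<mu> t) = 0"
proof -
  have cong: "ac_density (\<lambda>_. c) g" if "ac_density f g" "\<And>t. t \<in> {0..1} \<Longrightarrow> f t = c" for f :: "real \<Rightarrow> real" and g c
    using that unfolding ac_density_def by simp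
  have "AE t in lborel. t \<in> {0..1} \<longrightarrow> (\<integral>x. V t x \<bullet> b \<partial>\<mu> t) = 0" if "b \<in> Basis" for b
    using ac_density_constant_zero[OF cong[OF first_moment_density[OF that], of 0]] assms(1) by simp
  then have 1: "AE t in lborel. \<forall>b\<in>Basis. t \<in> {0..1} \<longrightarrow> (\<integral>x. V t x \<bullet> b \<partial>\<mu> t) = 0"
    by (intro AE_finite_allI) auto
  have "(\<integral>x. (norm (x - 0))\<^sup>2 \<partial>\<mu> t) = 1" if "t \<in> {0..1}" for t
    using integral_norm_diff_power2[OF P2, of t 0] assms that by simp
  from ac_density_constant_zero[OF cong[OF second_moment_density[of 0] this]]
  have 2: "AE t in lborel. t \<in> {0..1} \<longrightarrow> (\<integral>x. x \<bullet> V t x \<partial>\<mu> t) = 0"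
    by simp
  show ?thesis
    using 1 2 integrable_V
  proof eventually_elim
    case (elim t)
    show ?case
    proof
      assume t: "t \<in> {0..1}"
      have "(\<integral>x. V t x \<partial>\<mu> t) \<bullet> b = 0" if "b \<in> Basis" for b
        using elim t that integral_inner_left[where M="\<mu> t" and f="V t" and c=b] by simp
      then have "(\<integral>x. V t x \<partial>\<mu> t) = 0" using euclidean_all_zero_iff by blast
      then show "(\<integral>x. V t x \<partial>\<mu> t) = 0 \<and> (\<integral>x. x \<bullet> V t x \<partial>\<mu> t) = 0" using elim t by simp
    qed
  qed
qed

end

section \<open>Curves of finite cost\<close>

lemma ennreal_enn2real_le: "ennreal (enn2real x) \<le> x"
  by (cases x) auto

text \<open>In \<open>ennreal\<close>, a finite quotient with denominator 0 forces the numerator to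
  be 0, so the identity survives at v = 0.\<close>

lemma ennreal_divide_cancel:
  assumes "x / ennreal v \<noteq> \<infinity>" "0 \<le> v"
  shows "x = ennreal (enn2real (x / ennreal v) * v)"
proof (cases "v = 0")
  case True
  then have "x = 0" using assms(1) by (cases "x = 0") (auto simp: ennreal_divide_zero divide_ennreal_def ennreal_mult_top)
  then show ?thesis using True by simp
next
  case False
  then have v: "v > 0" using assms by simp
  have "x \<noteq> \<infinity>"
    using assms(1) v by (auto simp: ennreal_top_divide)
  then obtain a where a: "x = ennreal a" "a \<ge> 0" by (cases x) auto
  then show ?thesis using v by (simp add: divide_ennreal)
qed

lemma set_integral_abs_le:
  fixes g h :: "real \<Rightarrow> real"
  assumes "set_integrable lborel {s..t} g" "set_integrable lborel {s..t} h"
    and "AE r in lborel. r \<in> {s..t} \<longrightarrow> \<bar>g r\<bar> \<le> h r"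
  shows "\<bar>LINT r:{s..t}|lborel. g r\<bar> \<le> (LINT r:{s..t}|lborel. h r)"
proof -
  have "\<bar>LINT r:{s..t}|lborel. g r\<bar> \<le> (LINT r|lborel. norm (indicator {s..t} r *\<^sub>R g r))"
    unfolding set_lebesgue_integral_def using integral_norm_bound[of lborel "\<lambda>r. indicat_real {s..t} r *\<^sub>R g r"] by simp
  also have "\<dots> \<le> (LINT r:{s..t}|lborel. h r)"
    unfolding set_lebesgue_integral_def
  proof (rule integral_mono_AE)
    show "AE r in lborel. norm (indicat_real {s..t} r *\<^sub>R g r) \<le> indicat_real {s..t} r *\<^sub>R h r"
      using assms(3) by eventually_elim (auto simp: indicator_def)
  qed (use assms(1,2) in \<open>auto simp: set_integrable_def intro!: integrable_norm\<close>)
  finally show ?thesis .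
qed

text \<open>A bound |f'| \<le> c f with integrable c is what the doubling argument asks for, and by
  \<open>doubling_zero\<close> a zero at time t would spread back to time 0.\<close>

lemma AC_positive_of_log_derivative:
  fixes f c :: "real \<Rightarrow> real"
  assumes f: "ac_density f g" and f0: "\<And>t. t \<in> {0..1} \<Longrightarrow> 0 \<le> f t" and pos: "f 0 > 0"
    and c: "integrable lborel c" "\<And>r. 0 \<le> c r"
    and le: "AE r in lborel. r \<in> {0..1} \<longrightarrow> \<bar>g r\<bar> \<le> c r * f r"
    and t: "t \<in> {0..1}"
  shows "f t > 0"
proof (rule ccontr)
  assume "\<not> f t > 0"
  then have ft: "f t = 0" using f0[OF t] by simp
  define h where "h r = f (max 0 (min 1 r))" for r
  have h: "h r = f r" if "r \<in> {0..1}" for r using that by (simp add: h_def)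
  have h0: "0 \<le> h r" for r unfolding h_def by (rule f0) auto
  have incr: "\<forall>s t M. 0 \<le> s \<and> s \<le> t \<and> t \<le> 1 \<and> (\<forall>r\<in>{s..t}. h r \<le> M) \<longrightarrow>
      \<bar>h t - h s\<bar> \<le> M * (LINT r:{s..t}|lborel. c r)"
  proof (intro allI impI, elim conjE)
    fix s t M assume st: "0 \<le> s" "s \<le> t" "t \<le> 1" and M': "\<forall>r\<in>{s..t}. h r \<le> M"
    have M: "h r \<le> M" if "r \<in> {s..t}" for r using M' that by blast
    have "h t - h s = (LINT r:{s..t}|lborel. g r)"
      using ac_densityD(3)[OF f st] h st by simp
    also have "\<bar>\<dots>\<bar> \<le> (LINT r:{s..t}|lborel. M * c r)"
    proof (rule set_integral_abs_le)
      show "AE r in lborel. r \<in> {s..t} \<longrightarrow> \<bar>g r\<bar> \<le> M * c r"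
        using le
      proof eventually_elim
        case (elim r)
        show ?case
        proof
          assume r: "r \<in> {s..t}"
          then have "\<bar>g r\<bar> \<le> c r * f r" using elim st by simp
          also have "\<dots> \<le> c r * M" using M[OF r] h[of r] r st c(2) by (intro mult_left_mono) auto
          finally show "\<bar>g r\<bar> \<le> M * c r" by (simp add: mult.commute)
        qed
      qed
    qed (use set_integrable_integrable[OF c(1)] set_integrable_integrable[OF ac_densityD(1)[OF f]] in auto)
    finally show "\<bar>h t - h s\<bar> \<le> M * (LINT r:{s..t}|lborel. c r)" by simp
  qed
  obtain \<delta> where \<delta>: "\<delta> > 0" "doubling \<delta> h"
    using doubling_of_integral_inequality[OF c h0 incr] by blast
  have "continuous_on {0..1} f" by (rule AC_imp_continuous_on[OF ac_density_imp_AC[OF f]])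
  then have "bdd_above (f ` {0..1})"
    by (intro bounded_imp_bdd_above compact_imp_bounded compact_continuous_image) auto
  then have "bdd_above (h ` {0..1})" using h by (simp add: image_def)
  from doubling_zero[OF \<delta>(2,1) h0 this t _, of 0] have "h 0 = 0"
    using h[OF t] ft by simp
  then show False using pos h[of 0] by simp
qed

locale finite_cost_curve = ce_curve +
  assumes cost: "(\<integral>\<^sup>+t\<in>{0..1}. (\<integral>\<^sup>+x. ennreal ((norm (V t x))\<^sup>2) \<partial>\<mu> t) / ennreal (2 * var (\<mu> t)) \<partial>lborel) < \<infinity>"
    and var_0: "var (\<mu> 0) > 0"
begin

definition N :: "real \<Rightarrow> ennreal" where "N t = (\<integral>\<^sup>+x. ennreal ((norm (V t x))\<^sup>2) \<partial>\<mu> t)"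

text \<open>The integrand of the cost as a real function on [0, 1]. Since the cost is finite,
  \<open>enn2real\<close> changes it only on a null set.\<close>

definition c :: "real \<Rightarrow> real" where "c t = enn2real (N t / ennreal (2 * var (\<mu> t))) * indicator {0..1} t"

lemma N_measurable [measurable]: "N \<in> borel_measurable borel"
  unfolding N_def[abs_def] by (rule nn_integral_K_measurable) measurable

lemma m2_eq: "m2 t = var (\<mu> t) + (norm (barycenter (\<mu> t)))\<^sup>2"
  using integral_norm_diff_power2[OF P2, of t 0] by (simp add: m2_def)

lemma var_measurable [measurable]: "(\<lambda>t. var (\<mu> t)) \<in> borel_measurable borel"
proof -
  have "m2 \<in> borel_measurable borel" "(\<lambda>t. barycenter (\<mu> t)) \<in> borel_measurable borel"
    unfolding m2_def[abs_def] barycenter_def by (rule integral_K_measurable, measurable)+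
  then have "(\<lambda>t. m2 t - (norm (barycenter (\<mu> t)))\<^sup>2) \<in> borel_measurable borel" by measurable
  then show ?thesis by (simp add: m2_eq)
qed

lemma c_nonneg: "0 \<le> c t" by (simp add: c_def)

lemma c_integrable: "integrable lborel c"
proof (rule integrableI_nonneg)
  show "c \<in> borel_measurable lborel" unfolding c_def[abs_def] by measurable
  have "(\<integral>\<^sup>+t. ennreal (c t) \<partial>lborel) \<le> (\<integral>\<^sup>+t\<in>{0..1}. N t / ennreal (2 * var (\<mu> t)) \<partial>lborel)"
    by (intro nn_integral_mono) (auto simp: c_def indicator_def ennreal_enn2real_le)
  then show "(\<integral>\<^sup>+t. ennreal (c t) \<partial>lborel) < \<infinity>"
    using cost unfolding N_def by (rule le_less_trans)
qed (simp add: c_nonneg)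

lemma N_eq: "AE t in lborel. t \<in> {0..1} \<longrightarrow> N t = ennreal (c t * (2 * var (\<mu> t)))"
proof -
  have "AE t in lborel. N t / ennreal (2 * var (\<mu> t)) * indicator {0..1} t \<noteq> \<infinity>"
    using cost unfolding N_def[symmetric] by (intro nn_integral_noteq_infinite) auto
  then show ?thesis
  proof eventually_elim
    case (elim t)
    show ?case
    proof
      assume t: "t \<in> {0..1}"
      then show "N t = ennreal (c t * (2 * var (\<mu> t)))"
        using ennreal_divide_cancel[of "N t" "2 * var (\<mu> t)"] elim var_nonneg[of "\<mu> t"] by (simp add: c_def)
    qed
  qed
qed

lemma var_le_m2: "var (\<mu> t) \<le> m2 t" by (simp add: m2_eq)

text \<open>For almost every r the integral of |V|^2 equals 2 c r var (\<mu> r), and the variance is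
  at most the second moment; a bound on the latter thus removes the weight from the cost.\<close>

lemma energy_of_bounded:
  assumes B: "\<And>r. r \<in> {s..t} \<Longrightarrow> m2 r \<le> B" and st: "0 \<le> s" "s \<le> t" "t \<le> 1"
  shows "(\<integral>\<^sup>+r\<in>{s..t}. (\<integral>\<^sup>+x. ennreal ((norm (V r x))\<^sup>2) \<partial>\<mu> r) \<partial>lborel) < \<infinity>"
proof -
  have B0: "0 \<le> B" using B[of s] st order_trans[OF var_nonneg var_le_m2, of s] by fastforce
  have "(\<integral>\<^sup>+r\<in>{s..t}. N r \<partial>lborel) \<le> (\<integral>\<^sup>+r. ennreal (c r * (2 * B)) \<partial>lborel)"
  proof (rule nn_integral_mono_AE)
    show "AE r in lborel. N r * indicator {s..t} r \<le> ennreal (c r * (2 * B))"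
      using N_eq
    proof eventually_elim
      case (elim r)
      show ?case
      proof (cases "r \<in> {s..t}")
        case True
        then have "N r = ennreal (c r * (2 * var (\<mu> r)))" using elim st by simp
        also have "\<dots> \<le> ennreal (c r * (2 * B))"
          using B[OF True] var_le_m2[of r] c_nonneg by (intro ennreal_leI mult_left_mono) auto
        finally show ?thesis using True by simp
      qed simp
    qed
  qed
  also have "\<dots> = ennreal (LINT r|lborel. c r * (2 * B))"
    using c_integrable c_nonneg B0 by (intro nn_integral_eq_integral) auto
  finally show ?thesis by (simp add: N_def le_less_trans)
qed

text \<open>The rate in Gronwall's inequality for the mean square distance from p. By Young, 2 |(x -
  p) . V| is at most |x - p|^2 + |V|^2: the first term gives the rate 1, the second the rate 2
  c.\<close>

definition k :: "real \<Rightarrow> real" where "k r = indicator {0..1} r + 2 * c r"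

lemma k: "integrable lborel k" "0 \<le> k r"
proof -
  have "integrable lborel (indicat_real {0..1::real})" by (rule integrable_real_indicator) auto
  then show "integrable lborel k" unfolding k_def[abs_def] using c_integrable by simp
  show "0 \<le> k r" using c_nonneg by (simp add: k_def)
qed

text \<open>B only licenses testing with |x - p|^2; the estimate itself depends on M and
  \<open>k\<close>, and \<open>k\<close> not on p. The integral of |V|^2 is 2 c times the variance,
  which is at most the mean square distance from p whatever p is.\<close>

lemma square_distance_increment:
  assumes st: "0 \<le> s" "s \<le> t" "t \<le> 1" and B: "\<And>r. r \<in> {s..t} \<Longrightarrow> m2 r \<le> B"
    and M: "\<And>r. r \<in> {s..t} \<Longrightarrow> (\<integral>x. (norm (x - p))\<^sup>2 \<partial>\<mu> r) \<le> M"
  shows "\<bar>(\<integral>x. (norm (x - p))\<^sup>2 \<partial>\<mu> t) - (\<integral>x. (norm (x - p))\<^sup>2 \<partial>\<mu> s)\<bar> \<le> M * (LINT r:{s..t}|lborel. k r)"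
proof -
  note ev = evolution[OF smooth_norm_diff_power2 norm_diff_power2_growth st
      weighted_speed_finite[OF B st(2) energy_of_bounded[OF B st]], of p,
      unfolded frechet_derivative_norm_diff_power2]
  have "(\<integral>x. (norm (x - p))\<^sup>2 \<partial>\<mu> t) - (\<integral>x. (norm (x - p))\<^sup>2 \<partial>\<mu> s) =
      (LINT r:{s..t}|lborel. \<integral>x. 2 * ((x - p) \<bullet> V r x) \<partial>\<mu> r)"
    using ev(1) by simp
  also have "\<bar>\<dots>\<bar> \<le> (LINT r:{s..t}|lborel. M * k r)"
  proof (rule set_integral_abs_le)
    show "AE r in lborel. r \<in> {s..t} \<longrightarrow> \<bar>\<integral>x. 2 * ((x - p) \<bullet> V r x) \<partial>\<mu> r\<bar> \<le> M * k r"
      using N_eq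
    proof eventually_elim
      case (elim r)
      show ?case
      proof
        assume r: "r \<in> {s..t}"
        then have r01: "r \<in> {0..1}" using st by auto
        have N: "(\<integral>\<^sup>+x. ennreal ((norm (V r x))\<^sup>2) \<partial>\<mu> r) = ennreal (c r * (2 * var (\<mu> r)))"
          using elim r01 by (simp add: N_def)
        have Vm: "(\<lambda>x. (norm (V r x))\<^sup>2) \<in> borel_measurable (\<mu> r)"
          using measurable_section[OF V_measurable, of r] by measurable
        have iV: "integrable (\<mu> r) (\<lambda>x. (norm (V r x))\<^sup>2)"
          using N Vm by (intro integrableI_nonneg) auto
        have VV: "(\<integral>x. (norm (V r x))\<^sup>2 \<partial>\<mu> r) = c r * (2 * var (\<mu> r))"
          using N c_nonneg[of r] var_nonneg[of "\<mu> r"] by (intro integral_eq_nn_integral[THEN trans] Vm) auto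
        have iP: "integrable (\<mu> r) (\<lambda>x. (norm (x - p))\<^sup>2)" by (rule P2_norm_diff_integrable[OF P2])
        have "\<bar>\<integral>x. 2 * ((x - p) \<bullet> V r x) \<partial>\<mu> r\<bar> \<le> (\<integral>x. \<bar>2 * ((x - p) \<bullet> V r x)\<bar> \<partial>\<mu> r)"
          by (rule integral_abs_bound)
        also have "\<dots> \<le> (\<integral>x. (norm (x - p))\<^sup>2 + (norm (V r x))\<^sup>2 \<partial>\<mu> r)"
        proof (rule integral_mono')
          show "integrable (\<mu> r) (\<lambda>x. (norm (x - p))\<^sup>2 + (norm (V r x))\<^sup>2)" using iV iP by simp
          show "\<bar>2 * ((x - p) \<bullet> V r x)\<bar> \<le> (norm (x - p))\<^sup>2 + (norm (V r x))\<^sup>2" for x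
            using Cauchy_Schwarz_ineq2[of "x - p" "V r x"] sum_squares_bound[of "norm (x - p)" "norm (V r x)"]
            by (simp add: abs_mult)
        qed simp
        also have "\<dots> = (\<integral>x. (norm (x - p))\<^sup>2 \<partial>\<mu> r) + c r * (2 * var (\<mu> r))"
          using iV iP VV by simp
        also have "\<dots> \<le> (\<integral>x. (norm (x - p))\<^sup>2 \<partial>\<mu> r) + c r * (2 * (\<integral>x. (norm (x - p))\<^sup>2 \<partial>\<mu> r))"
          using c_nonneg[of r] integral_norm_diff_power2[OF P2, of r p] by (intro add_left_mono mult_left_mono) auto
        also have "\<dots> = (\<integral>x. (norm (x - p))\<^sup>2 \<partial>\<mu> r) * k r"
          using r01 by (simp add: k_def algebra_simps)
        also have "\<dots> \<le> M * k r" using M[OF r] k(2) by (intro mult_right_mono) auto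
        finally show "\<bar>\<integral>x. 2 * ((x - p) \<bullet> V r x) \<partial>\<mu> r\<bar> \<le> M * k r" .
      qed
    qed
  qed (use ev(2) set_integrable_integrable[OF k(1)] in auto)
  finally show ?thesis by simp
qed

text \<open>The second moment is the supremum over R of the integrals of min (|x|^2) R, each
  continuous in t by weak continuity; hence it is lower semicontinuous.\<close>

lemma closed_m2_le: "closed {t. m2 t \<le> real n}"
proof -
  let ?g = "\<lambda>R (x::'a). min ((norm x)\<^sup>2) (real R)"
  have cont: "continuous_on UNIV (\<lambda>t. \<integral>x. ?g R x \<partial>\<mu> t)" for R
  proof (rule weak)
    show "continuous_on UNIV (?g R)" by (intro continuous_intros)
    show "bounded (range (?g R))" unfolding bounded_iff by (intro exI[of _ "real R"]) auto
  qed
  have "{t. m2 t \<le> real n} = (\<Inter>R. {t. (\<integral>x. ?g R x \<partial>\<mu> t) \<le> real n})"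
  proof (intro equalityI subsetI)
    fix t assume "t \<in> {t. m2 t \<le> real n}"
    moreover have "(\<integral>x. ?g R x \<partial>\<mu> t) \<le> m2 t" for R
      unfolding m2_def by (rule integral_mono') auto
    ultimately show "t \<in> (\<Inter>R. {t. (\<integral>x. ?g R x \<partial>\<mu> t) \<le> real n})" by (auto intro: order_trans)
  next
    fix t assume t: "t \<in> (\<Inter>R. {t. (\<integral>x. ?g R x \<partial>\<mu> t) \<le> real n})"
    have "(\<lambda>R. \<integral>x. ?g R x \<partial>\<mu> t) \<longlonglongrightarrow> (\<integral>x. (norm x)\<^sup>2 \<partial>\<mu> t)"
    proof (rule integral_dominated_convergence[where w="\<lambda>x. (norm x)\<^sup>2"])
      show "AE x in \<mu> t. (\<lambda>R. ?g R x) \<longlonglongrightarrow> (norm x)\<^sup>2"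
      proof (rule AE_I2)
        fix x
        have "\<forall>\<^sub>F R in sequentially. ?g R x = (norm x)\<^sup>2"
          using eventually_ge_at_top[of "nat \<lceil>(norm x)\<^sup>2\<rceil>"] by eventually_elim linarith
        then show "(\<lambda>R. ?g R x) \<longlonglongrightarrow> (norm x)\<^sup>2" by (rule tendsto_eventually)
      qed
    qed (auto intro!: borel_measurable_mu)
    then show "t \<in> {t. m2 t \<le> real n}"
      using t unfolding m2_def by (auto intro: LIMSEQ_le_const2)
  qed
  then show ?thesis using cont by (auto intro!: closed_INT closed_Collect_le)
qed

lemma m2_bounded: "\<exists>B. \<forall>t\<in>{0..1}. m2 t \<le> B"
proof -
  have m0: "0 \<le> m2 r" for r by (simp add: m2_def)
  have incr: "\<forall>s t M. 0 \<le> s \<and> s \<le> t \<and> t \<le> 1 \<and> (\<forall>r\<in>{s..t}. m2 r \<le> M) \<longrightarrow>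
      \<bar>m2 t - m2 s\<bar> \<le> M * (LINT r:{s..t}|lborel. k r)"
  proof (intro allI impI, elim conjE)
    fix s t M assume st: "0 \<le> s" "s \<le> t" "t \<le> 1" and M: "\<forall>r\<in>{s..t}. m2 r \<le> M"
    then show "\<bar>m2 t - m2 s\<bar> \<le> M * (LINT r:{s..t}|lborel. k r)"
      using square_distance_increment[OF st, of M 0 M] by (simp add: m2_def)
  qed
  obtain \<delta> where "\<delta> > 0" "doubling \<delta> m2"
    using doubling_of_integral_inequality[OF k m0 incr] by blast
  then have "bdd_above (m2 ` {0..1})"
    using closed_m2_le m0 by (intro bdd_above_of_doubling)
  then show ?thesis by (auto simp: bdd_above_def)
qed

text \<open>Let p be the barycenter at a supposed time t of collapse. The mean square distance from
  p then vanishes at t, hence at time 0, where it is at least the positive variance.\<close>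

lemma var_pos:
  assumes t: "t \<in> {0..1}"
  shows "var (\<mu> t) > 0"
proof (rule ccontr)
  assume "\<not> ?thesis"
  then have v0: "var (\<mu> t) = 0" using var_nonneg[of "\<mu> t"] by simp
  define p where "p = barycenter (\<mu> t)"
  define f where "f r = (\<integral>x. (norm (x - p))\<^sup>2 \<partial>\<mu> (max 0 (min 1 r)))" for r
  obtain B where B: "\<And>t. t \<in> {0..1} \<Longrightarrow> m2 t \<le> B" using m2_bounded by blast
  have f: "f r = (\<integral>x. (norm (x - p))\<^sup>2 \<partial>\<mu> r)" if "r \<in> {0..1}" for r using that by (simp add: f_def)
  have f0: "0 \<le> f r" for r by (simp add: f_def)
  have incr: "\<forall>s t M. 0 \<le> s \<and> s \<le> t \<and> t \<le> 1 \<and> (\<forall>r\<in>{s..t}. f r \<le> M) \<longrightarrow>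
      \<bar>f t - f s\<bar> \<le> M * (LINT r:{s..t}|lborel. k r)"
  proof (intro allI impI, elim conjE)
    fix s t M assume st: "0 \<le> s" "s \<le> t" "t \<le> 1" and M: "\<forall>r\<in>{s..t}. f r \<le> M"
    have "f t = (\<integral>x. (norm (x - p))\<^sup>2 \<partial>\<mu> t)" "f s = (\<integral>x. (norm (x - p))\<^sup>2 \<partial>\<mu> s)" using f st by auto
    moreover have "(\<integral>x. (norm (x - p))\<^sup>2 \<partial>\<mu> r) \<le> M" if "r \<in> {s..t}" for r
      using bspec[OF M that] f[of r] that st by simp
    ultimately show "\<bar>f t - f s\<bar> \<le> M * (LINT r:{s..t}|lborel. k r)"
      using square_distance_increment[OF st, of B p M] B st by simp
  qed
  obtain \<delta> where \<delta>: "\<delta> > 0" "doubling \<delta> f"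
    using doubling_of_integral_inequality[OF k f0 incr] by blast
  have bdd: "bdd_above (f ` {0..1})"
  proof (rule bdd_aboveI2)
    fix r :: real assume r: "r \<in> {0..1}"
    interpret prob_space "\<mu> r" by (rule prob_K)
    have "f r \<le> (\<integral>x. (2 + 2 * (norm p)\<^sup>2) * (1 + (norm x)\<^sup>2) \<partial>\<mu> r)"
      unfolding f[OF r] using norm_diff_power2_growth(1)[of _ p] by (intro integral_mono') (auto simp: abs_le_iff)
    also have "\<dots> = (2 + 2 * (norm p)\<^sup>2) * (1 + m2 r)"
      by (simp add: m2_def prob_space[simplified])
    also have "\<dots> \<le> (2 + 2 * (norm p)\<^sup>2) * (1 + B)" using B[OF r] by (intro mult_left_mono) auto
    finally show "f r \<le> (2 + 2 * (norm p)\<^sup>2) * (1 + B)" .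
  qed
  have "f t = 0" using v0 integral_norm_diff_power2[OF P2, of t p] f[OF t] by (simp add: p_def)
  then have "f 0 = 0" using doubling_zero[OF \<delta>(2,1) f0 bdd t, of 0] by simp
  then show False
    using integral_norm_diff_power2[OF P2, of 0 p] f[of 0] var_0 zero_le_power2[of "norm (barycenter (\<mu> 0) - p)"] by simp
qed

end

section \<open>Affine push-forwards of a curve\<close>

lemma affine_push_forward:
  fixes a :: "'a::euclidean_space"
  assumes "\<mu> \<in> P2"
  shows "distr \<mu> borel (\<lambda>x. a + l *\<^sub>R x) \<in> P2"
    and "barycenter (distr \<mu> borel (\<lambda>x. a + l *\<^sub>R x)) = a + l *\<^sub>R barycenter \<mu>"
    and "var (distr \<mu> borel (\<lambda>x. a + l *\<^sub>R x)) = l\<^sup>2 * var \<mu>"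
proof -
  note P = P2D[OF assms]
  interpret prob_space \<mu> by (rule P(1))
  let ?T = "\<lambda>x. a + l *\<^sub>R x"
  have T [measurable]: "?T \<in> \<mu> \<rightarrow>\<^sub>M borel"
    using P(2) by (simp cong: measurable_cong_sets)
  note i = P2_norm_diff_integrable[OF assms]
  show bary: "barycenter (distr \<mu> borel ?T) = a + l *\<^sub>R barycenter \<mu>"
  proof -
    have "(\<integral>x. x \<partial>distr \<mu> borel ?T) = (\<integral>x. ?T x \<partial>\<mu>)"
      by (rule integral_distr[OF T]) simp
    also have "\<dots> = (\<integral>x. a \<partial>\<mu>) + (\<integral>x. l *\<^sub>R x \<partial>\<mu>)"
      using i(2) by (intro Bochner_Integration.integral_add integrable_const integrable_scaleR_right)
    also have "\<dots> = a + l *\<^sub>R (\<integral>x. x \<partial>\<mu>)" by (simp add: prob_space)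
    finally show ?thesis unfolding barycenter_def .
  qed
  show "var (distr \<mu> borel ?T) = l\<^sup>2 * var \<mu>"
    unfolding var_def bary
    by (subst integral_distr) (auto simp: scaleR_diff_right[symmetric] power_mult_distrib)
  have "integrable \<mu> (\<lambda>x. (norm (?T x))\<^sup>2)"
  proof (rule Bochner_Integration.integrable_bound)
    show "integrable \<mu> (\<lambda>x. 2 * (norm a)\<^sup>2 + 2 * (l\<^sup>2 * (norm x)\<^sup>2))" using P(4) by simp
    have "(norm (?T x))\<^sup>2 \<le> 2 * (norm a)\<^sup>2 + 2 * (l\<^sup>2 * (norm x)\<^sup>2)" for x
    proof -
      have "(norm (?T x))\<^sup>2 \<le> (norm a + norm (l *\<^sub>R x))\<^sup>2"
        by (intro power_mono norm_triangle_ineq) simp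
      also have "\<dots> \<le> 2 * (norm a)\<^sup>2 + 2 * (norm (l *\<^sub>R x))\<^sup>2"
        using sum_squares_bound[of "norm a" "norm (l *\<^sub>R x)"] by (simp add: power2_sum)
      also have "(norm (l *\<^sub>R x))\<^sup>2 = l\<^sup>2 * (norm x)\<^sup>2" by (simp add: power_mult_distrib)
      finally show ?thesis .
    qed
    then show "AE x in \<mu>. norm ((norm (?T x))\<^sup>2) \<le> norm (2 * (norm a)\<^sup>2 + 2 * (l\<^sup>2 * (norm x)\<^sup>2))"
      by (intro AE_I2) simp
  qed measurable
  then have "integrable (distr \<mu> borel ?T) (\<lambda>x. (norm x)\<^sup>2)"
    by (subst integrable_distr_eq) auto
  then show "distr \<mu> borel ?T \<in> P2"
    unfolding P2_def using prob_space_distr[OF T] by simp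
qed

text \<open>Serves both directions: a = m, l = sigma to leave the normalized curves, and a = -m /
  sigma, l = 1 / sigma to enter them.\<close>

locale affine_push = moment_curve +
  fixes a a' :: "real \<Rightarrow> 'a" and l l' :: "real \<Rightarrow> real"
  assumes a: "ac_density a a'" and l: "ac_density l l'"
    and a_cont: "continuous_on UNIV a" and l_cont: "continuous_on UNIV l"
    and l_pos: "\<And>t. l t > 0" and m2_le': "\<And>t. m2 t \<le> B"
begin

definition A :: "real \<Rightarrow> 'a \<Rightarrow> 'a" where "A t x = a t + l t *\<^sub>R x"

definition \<nu> :: "real \<Rightarrow> 'a measure" where "\<nu> t = distr (\<mu> t) borel (A t)"

text \<open>The Eulerian velocity of the moved particles: differentiate a t + l t x along a motion
  with x' = V, then substitute x = (y - a t) / l t.\<close>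

definition U :: "real \<Rightarrow> 'a \<Rightarrow> 'a" where
  "U t y = a' t + (l' t / l t) *\<^sub>R (y - a t) + l t *\<^sub>R V t ((1 / l t) *\<^sub>R (y - a t))"

lemma U_A: "U t (A t x) = a' t + l' t *\<^sub>R x + l t *\<^sub>R V t x"
  using l_pos[of t] by (simp add: U_def A_def)

lemma measurable_coefficients [measurable]:
  "a \<in> borel_measurable borel" "l \<in> borel_measurable borel" "a' \<in> borel_measurable borel" "l' \<in> borel_measurable borel"
  using a_cont l_cont ac_densityD(2)[OF a] ac_densityD(2)[OF l]
  by (auto intro: borel_measurable_continuous_onI)

lemma A_measurable [measurable]: "A t \<in> borel_measurable (\<mu> t)"
  unfolding A_def[abs_def] by (rule borel_measurable_mu) measurable

lemma A_measurable2 [measurable]: "(\<lambda>p. A (fst p) (snd p)) \<in> borel_measurable (borel \<Otimes>\<^sub>M borel)"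
  unfolding A_def by measurable

lemma U_measurable: "(\<lambda>(t, x). U t x) \<in> borel_measurable (borel \<Otimes>\<^sub>M borel)"
proof -
  have "(\<lambda>p::real \<times> 'a. (\<lambda>(t, x). V t x) (fst p, (1 / l (fst p)) *\<^sub>R (snd p - a (fst p)))) \<in> borel_measurable (borel \<Otimes>\<^sub>M borel)"
    by (rule measurable_compose[OF _ V_measurable]) measurable
  then have [measurable]: "(\<lambda>p::real \<times> 'a. V (fst p) ((1 / l (fst p)) *\<^sub>R (snd p - a (fst p)))) \<in> borel_measurable (borel \<Otimes>\<^sub>M borel)"
    by simp
  show ?thesis unfolding U_def case_prod_beta' by measurable
qed

lemma nn_integral_\<nu>: "f \<in> borel_measurable borel \<Longrightarrow> (\<integral>\<^sup>+y. f y \<partial>\<nu> t) = (\<integral>\<^sup>+x. f (A t x) \<partial>\<mu> t)"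
  unfolding \<nu>_def by (rule nn_integral_distr) auto

lemma integral_\<nu>:
  fixes f :: "'a \<Rightarrow> 'c::{banach, second_countable_topology}"
  shows "f \<in> borel_measurable borel \<Longrightarrow> (\<integral>y. f y \<partial>\<nu> t) = (\<integral>x. f (A t x) \<partial>\<mu> t)"
  unfolding \<nu>_def by (rule integral_distr) auto

lemma \<nu>_P2: "\<nu> t \<in> P2"
  unfolding \<nu>_def A_def[abs_def] by (rule affine_push_forward(1)[OF P2])

text \<open>Both the integrand f o A_t and the measure vary with t. On a ball the integrands are
  uniformly close, and outside it the bounded second moments make the tails uniformly small.\<close>

lemma \<nu>_weak:
  fixes f :: "'a \<Rightarrow> real"
  assumes f: "continuous_on UNIV f" "bounded (range f)"
  shows "continuous_on UNIV (\<lambda>t. \<integral>x. f x \<partial>\<nu> t)"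
proof -
  have fm: "f \<in> borel_measurable borel" using f(1) by (rule borel_measurable_continuous_onI)
  obtain M where M: "M > 0" "\<And>x. \<bar>f x\<bar> \<le> M"
    using f(2) unfolding bounded_pos by auto
  have B0: "0 \<le> B" using m2_le'[of 0] order_trans[of 0 "m2 0" B] by (simp add: m2_def)
  have fA: "continuous_on S (\<lambda>p. f (A (fst p) (snd p)))" for S
    unfolding A_def
    by (intro continuous_on_compose2[OF f(1)] continuous_intros
        continuous_on_compose2[OF a_cont] continuous_on_compose2[OF l_cont]) auto
  have fAi: "integrable (\<mu> s) (\<lambda>x. f (A t x))" for s t
  proof (rule integrable_quadratic_growth[where C=M])
    have "(\<lambda>x. f (A t x)) \<in> borel_measurable borel"
      using fm unfolding A_def by measurable
    then show "(\<lambda>x. f (A t x)) \<in> borel_measurable borel" .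
    fix x :: 'a
    have "M * 1 \<le> M * (1 + (norm x)\<^sup>2)" using M(1) by (intro mult_left_mono) auto
    then show "norm (f (A t x)) \<le> M * (1 + (norm x)\<^sup>2)" using M(2)[of "A t x"] by simp
  qed
  show ?thesis
    unfolding continuous_on_iff
  proof (intro ballI allI impI)
    fix t0 e :: real assume e: "e > 0"
    \<comment> \<open>The tail contributes at most 2 M B / R^2, as 1 \<le> |x|^2 / R^2 there. A
      quarter of e each is spent on the tail, on the modulus of continuity in the ball and on weak
      continuity at t0.\<close>
    obtain R where R: "R > 0" "2 * M * B / R\<^sup>2 < e / 4"
    proof
      have pos: "0 < 8 * M * B / e + 1" using M(1) B0 e by (simp add: add_nonneg_pos)
      show "sqrt (8 * M * B / e + 1) > 0" using pos by simp
      have "8 * M * B < e * (8 * M * B / e + 1)" using e by (simp add: field_simps)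
      then show "2 * M * B / (sqrt (8 * M * B / e + 1))\<^sup>2 < e / 4"
        using pos by (simp add: divide_less_eq algebra_simps)
    qed
    have "uniformly_continuous_on ({t0 - 1..t0 + 1} \<times> cball 0 R) (\<lambda>p. f (A (fst p) (snd p)))"
      by (intro compact_uniformly_continuous fA compact_Times) auto
    then obtain d1 where d1: "d1 > 0" "\<And>p q. p \<in> {t0 - 1..t0 + 1} \<times> cball 0 R \<Longrightarrow> q \<in> {t0 - 1..t0 + 1} \<times> cball 0 R \<Longrightarrow>
        dist q p < d1 \<Longrightarrow> dist (f (A (fst q) (snd q))) (f (A (fst p) (snd p))) < e / 4"
      unfolding uniformly_continuous_on_def using e by (metis zero_less_divide_iff zero_less_numeral)
    have "continuous_on UNIV (\<lambda>t. \<integral>x. f (A t0 x) \<partial>\<mu> t)"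
    proof (rule weak)
      have "continuous_on UNIV (\<lambda>x. (\<lambda>p. f (A (fst p) (snd p))) (t0, x))"
        by (rule continuous_on_compose2[OF fA[of UNIV]]) (auto intro!: continuous_intros)
      then show "continuous_on UNIV (\<lambda>x. f (A t0 x))" by simp
      show "bounded (range (\<lambda>x. f (A t0 x)))" unfolding bounded_iff using M(2) by auto
    qed
    then obtain d2 where d2: "d2 > 0" "\<And>t. dist t t0 < d2 \<Longrightarrow> dist (\<integral>x. f (A t0 x) \<partial>\<mu> t) (\<integral>x. f (A t0 x) \<partial>\<mu> t0) < e / 4"
      unfolding continuous_on_iff using e by (metis UNIV_I zero_less_divide_iff zero_less_numeral)
    show "\<exists>d>0. \<forall>t\<in>UNIV. dist t t0 < d \<longrightarrow> dist (\<integral>x. f x \<partial>\<nu> t) (\<integral>x. f x \<partial>\<nu> t0) < e"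
    proof (intro exI[of _ "min 1 (min d1 d2)"] conjI ballI impI)
      show "min 1 (min d1 d2) > 0" using d1 d2 by simp
      fix t assume t: "dist t t0 < min 1 (min d1 d2)"
      interpret prob_space "\<mu> t" by (rule prob_K)
      have pt: "\<bar>f (A t x) - f (A t0 x)\<bar> \<le> e / 4 + 2 * M / R\<^sup>2 * (norm x)\<^sup>2" for x
      proof (cases "norm x \<le> R")
        case True
        have "t \<in> {t0 - 1..t0 + 1}" using t by (auto simp: dist_real_def abs_less_iff)
        then have "dist (f (A t x)) (f (A t0 x)) < e / 4"
          using d1(2)[of "(t0, x)" "(t, x)"] True t by (auto simp: dist_Pair_Pair)
        moreover have "0 \<le> 2 * M / R\<^sup>2 * (norm x)\<^sup>2" using M(1) by simp
        ultimately show ?thesis by (simp add: dist_real_def)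
      next
        case False
        then have "R\<^sup>2 \<le> (norm x)\<^sup>2" using R(1) by (intro power_mono) auto
        then have "2 * M * R\<^sup>2 \<le> 2 * M * (norm x)\<^sup>2" using M(1) by (intro mult_left_mono) auto
        then have "2 * M \<le> 2 * M / R\<^sup>2 * (norm x)\<^sup>2" using R(1) by (simp add: field_simps)
        then show ?thesis using M(2)[of "A t x"] M(2)[of "A t0 x"] e by linarith
      qed
      have "\<bar>(\<integral>x. f (A t x) \<partial>\<mu> t) - (\<integral>x. f (A t0 x) \<partial>\<mu> t)\<bar> = \<bar>\<integral>x. f (A t x) - f (A t0 x) \<partial>\<mu> t\<bar>"
        using fAi by simp
      also have "\<dots> \<le> (\<integral>x. \<bar>f (A t x) - f (A t0 x)\<bar> \<partial>\<mu> t)" by (rule integral_abs_bound)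
      also have "\<dots> \<le> (\<integral>x. e / 4 + 2 * M / R\<^sup>2 * (norm x)\<^sup>2 \<partial>\<mu> t)"
        using pt by (intro integral_mono) (auto intro!: Bochner_Integration.integrable_diff fAi)
      also have "\<dots> = e / 4 + 2 * M / R\<^sup>2 * m2 t"
        by (simp add: m2_def prob_space[simplified])
      also have "\<dots> \<le> e / 4 + 2 * M / R\<^sup>2 * B"
        using M(1) m2_le'[of t] by (intro add_left_mono mult_left_mono) auto
      also have "\<dots> < e / 4 + e / 4" using R(2) by simp
      finally have "\<bar>(\<integral>x. f (A t x) \<partial>\<mu> t) - (\<integral>x. f (A t0 x) \<partial>\<mu> t)\<bar> < e / 2" by simp
      moreover have "\<bar>(\<integral>x. f (A t0 x) \<partial>\<mu> t) - (\<integral>x. f (A t0 x) \<partial>\<mu> t0)\<bar> < e / 4"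
        using d2(2)[of t] t by (simp add: dist_real_def)
      ultimately show "dist (\<integral>x. f x \<partial>\<nu> t) (\<integral>x. f x \<partial>\<nu> t0) < e"
        unfolding integral_\<nu>[OF fm] dist_real_def using e by linarith
    qed
  qed
qed

lemma coefficient_bound:
  obtains L where "L \<ge> 0" "\<And>t. t \<in> {0..1} \<Longrightarrow> norm (a t) \<le> L" "\<And>t. t \<in> {0..1} \<Longrightarrow> l t \<le> L"
proof -
  obtain L1 where L1: "\<And>t. t \<in> {0..1} \<Longrightarrow> \<bar>norm (a t)\<bar> \<le> L1"
    using compact_continuous_bound[of "{0..1::real}" "\<lambda>t. norm (a t)"] continuous_on_norm[OF continuous_on_subset[OF a_cont subset_UNIV]]
    by auto
  obtain L2 where L2: "\<And>t. t \<in> {0..1} \<Longrightarrow> \<bar>l t\<bar> \<le> L2"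
    using compact_continuous_bound[of "{0..1::real}" l] continuous_on_subset[OF l_cont subset_UNIV] by auto
  show ?thesis
  proof (rule that[of "max L1 L2"])
    show "0 \<le> max L1 L2" using order_trans[OF abs_ge_zero L1[of 0]] by (simp add: le_max_iff_disj)
    show "norm (a t) \<le> max L1 L2" if "t \<in> {0..1}" for t using L1[OF that] by simp
    show "l t \<le> max L1 L2" if "t \<in> {0..1}" for t using L2[OF that] by simp
  qed
qed

text \<open>|A x| grows linearly in x, and |U (A x)| is at most (|a'| + |l'|) (1 + |x|) + L |V|. The
  first term is integrable through the second moment and the integrability of a' and l'; the second
  leads back to the weighted speed of the original curve.\<close>

lemma \<nu>_weighted_speed:
  "(\<integral>\<^sup>+t\<in>{0..1}. (\<integral>\<^sup>+y. ennreal ((1 + norm y) * norm (U t y)) \<partial>\<nu> t) \<partial>lborel) < \<infinity>"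
proof -
  obtain L where L: "L \<ge> 0" "\<And>t. t \<in> {0..1} \<Longrightarrow> norm (a t) \<le> L" "\<And>t. t \<in> {0..1} \<Longrightarrow> l t \<le> L"
    using coefficient_bound by metis
  have Um: "(\<lambda>y. ennreal ((1 + norm y) * norm (U t y))) \<in> borel_measurable borel" for t
  proof -
    have [measurable]: "U t \<in> borel_measurable borel"
      using measurable_compose[OF measurable_Pair1' U_measurable, of t] by simp
    show ?thesis by measurable
  qed
  define W where "W t = (\<integral>\<^sup>+x. ennreal ((1 + norm x) * norm (V t x)) \<partial>\<mu> t)" for t
  have [measurable]: "W \<in> borel_measurable borel"
    unfolding W_def[abs_def] by (rule nn_integral_K_measurable) measurable
  have le: "(\<integral>\<^sup>+y. ennreal ((1 + norm y) * norm (U t y)) \<partial>\<nu> t) \<le>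
      ennreal ((1 + L) * (2 + 2 * B) * (norm (a' t) + \<bar>l' t\<bar>)) + ennreal ((1 + L) * L) * W t"
    if t: "t \<in> {0..1}" for t
  proof -
    interpret prob_space "\<mu> t" by (rule prob_K)
    have Vm: "V t \<in> borel_measurable (\<mu> t)" by (rule measurable_section[OF V_measurable])
    have nm: "(\<lambda>x. norm x) \<in> borel_measurable (\<mu> t)" by (rule borel_measurable_mu) simp
    have pt: "(1 + norm (A t x)) * norm (U t (A t x)) \<le>
        (1 + L) * (2 + 2 * (norm x)\<^sup>2) * (norm (a' t) + \<bar>l' t\<bar>) + ((1 + L) * L) * ((1 + norm x) * norm (V t x))" for x
    proof -
      have "norm (A t x) \<le> L + L * norm x"
        unfolding A_def using L(2,3)[OF t] l_pos[of t] by (intro norm_triangle_le add_mono) (auto intro: mult_right_mono)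
      moreover have "(1 + L) * (1 + norm x) = 1 + norm x + L + L * norm x" by (simp add: algebra_simps)
      ultimately have 1: "1 + norm (A t x) \<le> (1 + L) * (1 + norm x)"
        using norm_ge_zero[of x] by linarith
      have "norm (U t (A t x)) \<le> norm (a' t) + \<bar>l' t\<bar> * norm x + l t * norm (V t x)"
        unfolding U_A using l_pos[of t] by (intro norm_triangle_le add_mono) auto
      also have "\<dots> \<le> (norm (a' t) + \<bar>l' t\<bar>) * (1 + norm x) + L * norm (V t x)"
      proof -
        have "(norm (a' t) + \<bar>l' t\<bar>) * (1 + norm x) = norm (a' t) + \<bar>l' t\<bar> + norm (a' t) * norm x + \<bar>l' t\<bar> * norm x"
          by (simp add: algebra_simps)
        then show ?thesis
          using mult_right_mono[OF L(3)[OF t] norm_ge_zero[of "V t x"]]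
            mult_nonneg_nonneg[OF norm_ge_zero[of "a' t"] norm_ge_zero[of x]] abs_ge_zero[of "l' t"] by linarith
      qed
      finally have "(1 + norm (A t x)) * norm (U t (A t x)) \<le>
          ((1 + L) * (1 + norm x)) * ((norm (a' t) + \<bar>l' t\<bar>) * (1 + norm x) + L * norm (V t x))"
        using 1 L(1) by (intro mult_mono) auto
      also have "\<dots> = (1 + L) * (norm (a' t) + \<bar>l' t\<bar>) * (1 + norm x)\<^sup>2 + ((1 + L) * L) * ((1 + norm x) * norm (V t x))"
        by (simp add: power2_eq_square algebra_simps)
      also have "(1 + norm x)\<^sup>2 \<le> 2 + 2 * (norm x)\<^sup>2"
        using sum_squares_bound[of "norm x" 1] by (simp add: power2_sum)
      then have "(1 + L) * (norm (a' t) + \<bar>l' t\<bar>) * (1 + norm x)\<^sup>2 \<le> (1 + L) * (norm (a' t) + \<bar>l' t\<bar>) * (2 + 2 * (norm x)\<^sup>2)"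
        using L(1) by (intro mult_left_mono) auto
      finally show ?thesis by (simp add: mult_ac)
    qed
    have "(\<integral>\<^sup>+y. ennreal ((1 + norm y) * norm (U t y)) \<partial>\<nu> t) = (\<integral>\<^sup>+x. ennreal ((1 + norm (A t x)) * norm (U t (A t x))) \<partial>\<mu> t)"
      by (rule nn_integral_\<nu>[OF Um])
    also have "\<dots> \<le> (\<integral>\<^sup>+x. ennreal ((1 + L) * (2 + 2 * (norm x)\<^sup>2) * (norm (a' t) + \<bar>l' t\<bar>)) + ennreal ((1 + L) * L) * ennreal ((1 + norm x) * norm (V t x)) \<partial>\<mu> t)"
      using pt L(1) by (intro nn_integral_mono) (simp add: ennreal_mult[symmetric] ennreal_plus[symmetric] ennreal_leI del: ennreal_plus)
    also have "\<dots> = (\<integral>\<^sup>+x. ennreal ((1 + L) * (2 + 2 * (norm x)\<^sup>2) * (norm (a' t) + \<bar>l' t\<bar>)) \<partial>\<mu> t) + ennreal ((1 + L) * L) * W t"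
      unfolding W_def using nm Vm by (subst nn_integral_add) (auto simp: nn_integral_cmult)
    also have "(\<integral>\<^sup>+x. ennreal ((1 + L) * (2 + 2 * (norm x)\<^sup>2) * (norm (a' t) + \<bar>l' t\<bar>)) \<partial>\<mu> t) =
        ennreal (\<integral>x. (1 + L) * (2 + 2 * (norm x)\<^sup>2) * (norm (a' t) + \<bar>l' t\<bar>) \<partial>\<mu> t)"
      using L(1) by (intro nn_integral_eq_integral) auto
    also have "(\<integral>x. (1 + L) * (2 + 2 * (norm x)\<^sup>2) * (norm (a' t) + \<bar>l' t\<bar>) \<partial>\<mu> t) = (1 + L) * (2 + 2 * m2 t) * (norm (a' t) + \<bar>l' t\<bar>)"
      by (simp add: m2_def prob_space[simplified])
    also have "ennreal \<dots> \<le> ennreal ((1 + L) * (2 + 2 * B) * (norm (a' t) + \<bar>l' t\<bar>))"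
      using L(1) m2_le'[of t] by (intro ennreal_leI mult_right_mono mult_left_mono) auto
    finally show ?thesis by (simp add: add_right_mono)
  qed
  have "(\<integral>\<^sup>+t\<in>{0..1}. (\<integral>\<^sup>+y. ennreal ((1 + norm y) * norm (U t y)) \<partial>\<nu> t) \<partial>lborel) \<le>
      (\<integral>\<^sup>+t. ennreal ((1 + L) * (2 + 2 * B) * (norm (a' t) + \<bar>l' t\<bar>)) + ennreal ((1 + L) * L) * (W t * indicator {0..1} t) \<partial>lborel)"
    using le by (intro nn_integral_mono) (auto simp: indicator_def)
  also have "\<dots> = (\<integral>\<^sup>+t. ennreal ((1 + L) * (2 + 2 * B) * (norm (a' t) + \<bar>l' t\<bar>)) \<partial>lborel) + ennreal ((1 + L) * L) * (\<integral>\<^sup>+t\<in>{0..1}. W t \<partial>lborel)"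
    by (subst nn_integral_add) (auto simp: nn_integral_cmult)
  also have "\<dots> < \<infinity>"
  proof -
    have "0 \<le> B" using m2_le'[of 0] order_trans[of 0 "m2 0" B] by (simp add: m2_def)
    then have "(\<integral>\<^sup>+t. ennreal ((1 + L) * (2 + 2 * B) * (norm (a' t) + \<bar>l' t\<bar>)) \<partial>lborel) =
        ennreal (LINT t|lborel. (1 + L) * (2 + 2 * B) * (norm (a' t) + \<bar>l' t\<bar>))"
      using ac_densityD(1)[OF a] ac_densityD(1)[OF l] L(1) by (intro nn_integral_eq_integral) auto
    moreover have "(\<integral>\<^sup>+t\<in>{0..1}. W t \<partial>lborel) < \<infinity>" unfolding W_def by (rule weighted_speed)
    ultimately show ?thesis by (simp add: ennreal_mult_less_top)
  qed
  finally show ?thesis .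
qed

end

section \<open>Lipschitz test functions and the uniform time grid\<close>

lemma smooth_lipschitz:
  fixes \<phi> :: "'b::euclidean_space \<Rightarrow> real"
  assumes \<phi>: "smooth \<phi>" and C: "\<And>x v. \<bar>frechet_derivative \<phi> (at x) v\<bar> \<le> C * norm v"
  shows "\<bar>\<phi> y - \<phi> x\<bar> \<le> C * norm (y - x)"
proof -
  have "norm (\<phi> y - \<phi> x) \<le> C * norm (y - x)"
  proof (rule differentiable_bound[of UNIV \<phi> "\<lambda>x. frechet_derivative \<phi> (at x)"])
    fix x
    show "(\<phi> has_derivative frechet_derivative \<phi> (at x)) (at x within UNIV)"
      using smooth_has_derivative[OF \<phi>] by simp
    show "onorm (frechet_derivative \<phi> (at x)) \<le> C"
      using C by (intro onorm_le) simp
  qed auto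
  then show ?thesis by simp
qed

lemma AC_compose_lipschitz:
  fixes f :: "real \<Rightarrow> 'b::real_normed_vector" and \<phi> :: "'b \<Rightarrow> real"
  assumes "absolutely_continuous_on_unit f" and "\<And>x y. \<bar>\<phi> y - \<phi> x\<bar> \<le> C * norm (y - x)" and "0 \<le> C"
  shows "absolutely_continuous_on_unit (\<lambda>t. \<phi> (f t))"
proof (rule AC_increments_le[OF assms(1,1)])
  fix s t
  have "\<bar>\<phi> (f t) - \<phi> (f s)\<bar> \<le> C * norm (f t - f s)" by (rule assms(2))
  also have "\<dots> \<le> C * (norm (f t - f s) + norm (f t - f s))"
    using \<open>0 \<le> C\<close> by (intro mult_left_mono) auto
  finally show "norm (\<phi> (f t) - \<phi> (f s)) \<le> C * (norm (f t - f s) + norm (f t - f s))" by simp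
qed

lemma set_integral_sum_partition:
  fixes f :: "real \<Rightarrow> real"
  assumes f: "set_integrable lborel {0..1} f" and "N > 0" and "m \<le> N"
  shows "(\<Sum>i<m. LINT r:{real i / real N..real (Suc i) / real N}|lborel. f r) = (LINT r:{0..real m / real N}|lborel. f r)"
  using \<open>m \<le> N\<close>
proof (induction m)
  case 0
  have "(LINT r:{0..0::real}|lborel. f r) = (LINT r::real|lborel. (0::real))"
    unfolding set_lebesgue_integral_def
  proof (rule integral_cong_AE)
    have "set_integrable lborel {0..0::real} f" by (rule set_integrable_subset[OF f]) auto
    then show "(\<lambda>r. indicat_real {0..0} r *\<^sub>R f r) \<in> borel_measurable lborel"
      unfolding set_integrable_def by (rule borel_measurable_integrable)
    show "AE r in lborel. indicat_real {0..0} r *\<^sub>R f r = 0"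
      using AE_lborel_singleton[of 0] by eventually_elim auto
  qed simp
  then show ?case by simp
next
  case (Suc m)
  have b: "0 \<le> real m / real N" "real m / real N \<le> real (Suc m) / real N" "real (Suc m) / real N \<le> 1"
    using Suc.prems \<open>N > 0\<close> by (auto simp: divide_right_mono)
  have "(LINT r:{0..real (Suc m) / real N}|lborel. f r) =
      (LINT r:{0..real m / real N}|lborel. f r) + (LINT r:{real m / real N..real (Suc m) / real N}|lborel. f r)"
    using b by (intro set_integral_Icc_split set_integrable_subset[OF f]) auto
  then show ?case using Suc by simp
qed

text \<open>The ends of the grid cell are written as functions of r, so that the maps and measures
  frozen on the N cells form one measurable function of time. At a grid point the cell to the right
  is meant.\<close>

definition grid_left :: "nat \<Rightarrow> real \<Rightarrow> real" where "grid_left N r = real_of_int \<lfloor>r * real N\<rfloor> / real N"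

definition grid_right :: "nat \<Rightarrow> real \<Rightarrow> real" where "grid_right N r = (real_of_int \<lfloor>r * real N\<rfloor> + 1) / real N"

lemma grid_eq:
  assumes "N > 0" "real i / real N < r" "r < real (Suc i) / real N"
  shows "grid_left N r = real i / real N" "grid_right N r = real (Suc i) / real N"
proof -
  have "\<lfloor>r * real N\<rfloor> = int i"
    using assms by (intro floor_unique) (auto simp: field_simps)
  then show "grid_left N r = real i / real N" "grid_right N r = real (Suc i) / real N"
    by (simp_all add: grid_left_def grid_right_def add.commute)
qed

lemma grid_measurable [measurable]:
  "grid_left N \<in> borel_measurable borel" "grid_right N \<in> borel_measurable borel"
  unfolding grid_left_def[abs_def] grid_right_def[abs_def] by measurable

lemma grid_dist:
  assumes "N > 0"
  shows "\<bar>grid_left N r - r\<bar> \<le> 1 / real N" "\<bar>grid_right N r - r\<bar> \<le> 1 / real N"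
proof -
  have f: "real_of_int \<lfloor>r * real N\<rfloor> \<le> r * real N" "r * real N < real_of_int \<lfloor>r * real N\<rfloor> + 1"
    by linarith+
  have "grid_left N r \<le> r" using f(1) assms by (simp add: grid_left_def divide_le_eq)
  moreover have "r \<le> grid_right N r" using f(2) assms by (simp add: grid_right_def le_divide_eq)
  moreover have "grid_right N r = grid_left N r + 1 / real N" by (simp add: grid_left_def grid_right_def add_divide_distrib)
  ultimately show "\<bar>grid_left N r - r\<bar> \<le> 1 / real N" "\<bar>grid_right N r - r\<bar> \<le> 1 / real N" by linarith+
qed

lemma grid_tendsto: "(\<lambda>n. grid_left (Suc n) r) \<longlonglongrightarrow> r" "(\<lambda>n. grid_right (Suc n) r) \<longlonglongrightarrow> r"
proof -
  have 0: "(\<lambda>n. 1 / real (Suc n)) \<longlonglongrightarrow> 0" using LIMSEQ_inverse_real_of_nat by (simp add: inverse_eq_divide)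
  have "norm (grid_left (Suc n) r - r) \<le> 1 / real (Suc n)" for n
    using grid_dist(1)[of "Suc n" r] by simp
  then show "(\<lambda>n. grid_left (Suc n) r) \<longlonglongrightarrow> r"
    by (intro LIM_zero_cancel[OF Lim_null_comparison[OF _ 0]] always_eventually allI)
  have "norm (grid_right (Suc n) r - r) \<le> 1 / real (Suc n)" for n
    using grid_dist(2)[of "Suc n" r] by simp
  then show "(\<lambda>n. grid_right (Suc n) r) \<longlonglongrightarrow> r"
    by (intro LIM_zero_cancel[OF Lim_null_comparison[OF _ 0]] always_eventually allI)
qed

lemma grid_left_range: "r \<in> {0..1} \<Longrightarrow> N > 0 \<Longrightarrow> grid_left N r \<in> {0..1}"
  using mult_right_mono[of r 1 "real N"] floor_mono[of "r * real N" "real N"] zero_le_floor[of "r * real N"]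
  by (auto simp: grid_left_def divide_le_eq)

section \<open>Test functions composed with the affine maps\<close>

context affine_push
begin

context
  fixes \<phi> :: "real \<times> 'a \<Rightarrow> real"
  assumes \<phi>: "\<phi> \<in> test_functions"
begin

lemma \<phi>_smooth: "smooth \<phi>" and \<phi>_compact: "compact (closure {p. \<phi> p \<noteq> 0})"
  and \<phi>_support: "closure {p. \<phi> p \<noteq> 0} \<subseteq> {0<..<1} \<times> UNIV"
  using \<phi> by (auto simp: test_functions_def smooth_def)

definition D :: "real \<Rightarrow> 'a \<Rightarrow> real \<times> 'a \<Rightarrow> real" where
  "D t x w = frechet_derivative \<phi> (at (t, A t x)) w"

lemma D_bound: obtains C where "C \<ge> 0" "\<And>x v. \<bar>frechet_derivative \<phi> (at x) v\<bar> \<le> C * norm v"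
  by (rule smooth_derivative_bound[OF \<phi>_smooth \<phi>_compact]) (rule that)

lemma D_add: "D t x (v + w) = D t x v + D t x w"
proof -
  interpret bounded_linear "frechet_derivative \<phi> (at (t, A t x))"
    by (rule has_derivative_bounded_linear[OF smooth_has_derivative[OF \<phi>_smooth]])
  show ?thesis by (simp add: D_def add)
qed

lemma D_measurable:
  assumes [measurable]: "u \<in> borel_measurable M" "v \<in> borel_measurable M" "w \<in> borel_measurable M"
  shows "(\<lambda>s. D (u s) (v s) (w s)) \<in> borel_measurable M"
  unfolding D_def
proof (rule smooth_derivative_measurable[OF \<phi>_smooth])
  show "(\<lambda>s. (u s, A (u s) (v s))) \<in> borel_measurable M"
    unfolding borel_prod[symmetric] A_def by measurable
qed simp

text \<open>For fixed x, t -> \<phi> (t, A t x) is a Lipschitz function of an absolutely continuous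
  curve, hence absolutely continuous; its density comes from the chain rule at the times where a and
  l are differentiable.\<close>

lemma increment_in_time:
  assumes st: "0 \<le> s" "s \<le> t" "t \<le> 1"
  shows "\<phi> (t, A t x) - \<phi> (s, A s x) = (LINT r:{s..t}|lborel. D r x (1, a' r + l' r *\<^sub>R x))"
proof -
  obtain C where C: "C \<ge> 0" "\<And>x v. \<bar>frechet_derivative \<phi> (at x) v\<bar> \<le> C * norm v" using D_bound by metis
  have AC1: "absolutely_continuous_on_unit (\<lambda>t. A t x)"
  proof (rule AC_increments_le[OF ac_density_imp_AC[OF a] ac_density_imp_AC[OF l]])
    fix s t
    have "norm (A t x - A s x) = norm ((a t - a s) + (l t - l s) *\<^sub>R x)" by (simp add: A_def algebra_simps)
    also have "\<dots> \<le> norm (a t - a s) + \<bar>l t - l s\<bar> * norm x" using norm_triangle_ineq by (metis norm_scaleR)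
    also have "\<dots> \<le> (1 + norm x) * norm (a t - a s) + (1 + norm x) * \<bar>l t - l s\<bar>"
      by (simp add: algebra_simps)
    finally show "norm (A t x - A s x) \<le> (1 + norm x) * (norm (a t - a s) + norm (l t - l s))"
      by (simp add: algebra_simps)
  qed
  have ACid: "absolutely_continuous_on_unit (\<lambda>t::real. t)"
  proof (rule absolutely_continuous_on_unitI)
    fix \<epsilon> :: real assume "\<epsilon> > 0"
    have "(\<Sum>i<n. norm (v i - u i)) = (\<Sum>i<n. v i - u i)" if "interval_family 0 1 {..<n} u v" for n :: nat and u v
      using interval_familyD(3)[OF that] by (intro sum.cong) auto
    with \<open>\<epsilon> > 0\<close> show "\<exists>\<delta>>0. \<forall>(n::nat) u v. interval_family 0 1 {..<n} u v \<longrightarrow>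
      (\<Sum>i<n. v i - u i) < \<delta> \<longrightarrow> (\<Sum>i<n. norm (v i - u i)) < \<epsilon>"
      by (intro exI[of _ \<epsilon>]) simp
  qed
  have AC2: "absolutely_continuous_on_unit (\<lambda>t. (t, A t x))"
  proof (rule AC_increments_le[OF ACid AC1, of _ 1])
    fix s t
    show "norm ((t, A t x) - (s, A s x)) \<le> 1 * (norm (t - s) + norm (A t x - A s x))"
      using norm_Pair_le[of "t - s" "A t x - A s x"] by simp
  qed
  have AC: "absolutely_continuous_on_unit (\<lambda>t. \<phi> (t, A t x))"
    by (rule AC_compose_lipschitz[OF AC2 smooth_lipschitz[OF \<phi>_smooth C(2)] C(1)])
  define g where "g r = indicator {0..1} r * D r x (1, a' r + l' r *\<^sub>R x)" for r
  have "ac_density (\<lambda>t. \<phi> (t, A t x)) g"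
  proof (rule ac_densityI_AE[OF AC])
    show "g \<in> borel_measurable borel"
      unfolding g_def[abs_def]
      by (intro borel_measurable_times D_measurable) (simp_all add: borel_prod[symmetric])
    show "AE r in lborel. r \<in> {0<..<1} \<longrightarrow> ((\<lambda>t. \<phi> (t, A t x)) has_vector_derivative g r) (at r)"
      using ac_density_has_vector_derivative[OF a] ac_density_has_vector_derivative[OF l]
    proof eventually_elim
      case (elim r)
      show ?case
      proof
        assume r: "r \<in> {0<..<1}"
        have "(a has_derivative (\<lambda>h. h *\<^sub>R a' r)) (at r)" "(l has_derivative (\<lambda>h. h *\<^sub>R l' r)) (at r)"
          using elim r by (auto simp: has_vector_derivative_def)
        then have "((\<lambda>t. (t, A t x)) has_derivative (\<lambda>h. (h, h *\<^sub>R a' r + (h *\<^sub>R l' r) *\<^sub>R x))) (at r)"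
          unfolding A_def by (intro has_derivative_Pair has_derivative_ident has_derivative_add has_derivative_scaleR_left)
        from has_derivative_compose[OF this, of \<phi> "frechet_derivative \<phi> (at (r, A r x))"]
        have "((\<lambda>t. \<phi> (t, A t x)) has_derivative (\<lambda>h. frechet_derivative \<phi> (at (r, A r x)) (h, h *\<^sub>R a' r + (h *\<^sub>R l' r) *\<^sub>R x))) (at r)"
          using smooth_has_derivative[OF \<phi>_smooth] by simp
        moreover have "frechet_derivative \<phi> (at (r, A r x)) (h, h *\<^sub>R a' r + (h *\<^sub>R l' r) *\<^sub>R x) =
            h *\<^sub>R frechet_derivative \<phi> (at (r, A r x)) (1, a' r + l' r *\<^sub>R x)" for h
        proof -
          have pe: "(h, h *\<^sub>R a' r + (h *\<^sub>R l' r) *\<^sub>R x) = h *\<^sub>R (1, a' r + l' r *\<^sub>R x)"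
            by (simp add: scaleR_add_right)
          show ?thesis
            unfolding pe
            by (rule linear_cmul[OF bounded_linear.linear[OF has_derivative_bounded_linear[OF smooth_has_derivative[OF \<phi>_smooth]]]])
        qed
        ultimately show "((\<lambda>t. \<phi> (t, A t x)) has_vector_derivative g r) (at r)"
          using r by (simp only: has_vector_derivative_def g_def D_def) simp
      qed
    qed
  qed (simp add: g_def)
  from ac_densityD(3)[OF this st]
  have "\<phi> (t, A t x) - \<phi> (s, A s x) = (LINT r:{s..t}|lborel. g r)" .
  also have "\<dots> = (LINT r:{s..t}|lborel. D r x (1, a' r + l' r *\<^sub>R x))"
    using st by (intro set_lebesgue_integral_cong) (auto simp: g_def)
  finally show ?thesis .
qed

lemma D_time_bound:
  assumes C: "C \<ge> 0" "\<And>x v. \<bar>frechet_derivative \<phi> (at x) v\<bar> \<le> C * norm v"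
  shows "\<bar>D r x (1, a' r + l' r *\<^sub>R x)\<bar> \<le> C * (1 + norm (a' r) + \<bar>l' r\<bar>) * (1 + (norm x)\<^sup>2)"
proof -
  have "\<bar>D r x (1, a' r + l' r *\<^sub>R x)\<bar> \<le> C * norm (1::real, a' r + l' r *\<^sub>R x)" unfolding D_def by (rule C(2))
  also have "norm (1::real, a' r + l' r *\<^sub>R x) \<le> 1 + (norm (a' r) + \<bar>l' r\<bar> * norm x)"
    by (rule order_trans[OF norm_Pair_le]) (auto intro: norm_triangle_le)
  also have "\<dots> \<le> 1 + (norm (a' r) + \<bar>l' r\<bar> * (1 + (norm x)\<^sup>2))"
    by (intro add_left_mono mult_left_mono norm_le_1_plus_power2) simp
  also have "\<dots> \<le> (1 + norm (a' r) + \<bar>l' r\<bar>) * (1 + (norm x)\<^sup>2)"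
    using mult_nonneg_nonneg[OF norm_ge_zero[of "a' r"] zero_le_power2[of "norm x"]] by (simp add: algebra_simps)
  finally show ?thesis using C(1) by (simp add: mult.assoc mult_left_mono)
qed

lemma D_time_integral_bound:
  assumes C: "C \<ge> 0" "\<And>x v. \<bar>frechet_derivative \<phi> (at x) v\<bar> \<le> C * norm v"
  shows "integrable (\<mu> s) (\<lambda>x. D r x (1, a' r + l' r *\<^sub>R x))"
    "(\<integral>x. \<bar>D r x (1, a' r + l' r *\<^sub>R x)\<bar> \<partial>\<mu> s) \<le> C * (1 + norm (a' r) + \<bar>l' r\<bar>) * (1 + B)"
proof -
  interpret prob_space "\<mu> s" by (rule prob_K)
  have "(\<lambda>x. D r x (1, a' r + l' r *\<^sub>R x)) \<in> borel_measurable borel"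
    by (intro D_measurable) (simp_all add: borel_prod[symmetric])
  then show "integrable (\<mu> s) (\<lambda>x. D r x (1, a' r + l' r *\<^sub>R x))"
    using D_time_bound[OF C] by (intro integrable_quadratic_growth) auto
  have "(\<integral>x. \<bar>D r x (1, a' r + l' r *\<^sub>R x)\<bar> \<partial>\<mu> s) \<le> (\<integral>x. C * (1 + norm (a' r) + \<bar>l' r\<bar>) * (1 + (norm x)\<^sup>2) \<partial>\<mu> s)"
    using D_time_bound[OF C] order_trans[OF abs_ge_zero D_time_bound[OF C]] by (intro integral_mono') auto
  also have "\<dots> = C * (1 + norm (a' r) + \<bar>l' r\<bar>) * (1 + m2 s)"
    by (simp add: m2_def prob_space[simplified])
  also have "\<dots> \<le> C * (1 + norm (a' r) + \<bar>l' r\<bar>) * (1 + B)"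
    using m2_le'[of s] C(1) by (intro mult_left_mono) auto
  finally show "(\<integral>x. \<bar>D r x (1, a' r + l' r *\<^sub>R x)\<bar> \<partial>\<mu> s) \<le> C * (1 + norm (a' r) + \<bar>l' r\<bar>) * (1 + B)" .
qed

lemma time_bound_integrable: "set_integrable lborel {0..1} (\<lambda>r. C * (1 + norm (a' r) + \<bar>l' r\<bar>) * E)"
proof -
  have "set_integrable lborel {0..1} (\<lambda>r::real. 1::real)"
    unfolding set_integrable_def by (intro borel_integrable_compact) auto
  moreover have "set_integrable lborel {0..1} (\<lambda>r. norm (a' r))" "set_integrable lborel {0..1} (\<lambda>r. \<bar>l' r\<bar>)"
    using ac_densityD(1)[OF a] ac_densityD(1)[OF l] by (auto intro!: set_integrable_integrable)
  ultimately show ?thesis by (intro set_integrable_mult_left set_integrable_mult_right set_integral_add(1))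
qed

text \<open>Fubini with the measure frozen at time q: the density is at most an integrable function
  of time multiplied by 1 + |x|^2.\<close>

lemma mean_increment_in_time:
  assumes st: "0 \<le> s" "s \<le> t" "t \<le> 1"
  shows "(\<integral>x. \<phi> (t, A t x) - \<phi> (s, A s x) \<partial>\<mu> q) =
    (LINT r:{s..t}|lborel. \<integral>x. D r x (1, a' r + l' r *\<^sub>R x) \<partial>\<mu> q)"
proof -
  obtain C where C: "C \<ge> 0" "\<And>x v. \<bar>frechet_derivative \<phi> (at x) v\<bar> \<le> C * norm v" using D_bound by metis
  interpret P: prob_space "\<mu> q" by (rule prob_K)
  interpret pair_sigma_finite lborel "\<mu> q" ..
  let ?f = "\<lambda>p. indicator {s..t} (fst p) *\<^sub>R D (fst p) (snd p) (1, a' (fst p) + l' (fst p) *\<^sub>R snd p)"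
  have sets: "sets (lborel \<Otimes>\<^sub>M \<mu> q) = sets (borel \<Otimes>\<^sub>M borel)"
    by (rule sets_pair_measure_cong) auto
  have fm0: "?f \<in> borel_measurable (borel \<Otimes>\<^sub>M borel)"
    by (intro borel_measurable_scaleR borel_measurable_indicator' D_measurable) (simp_all add: borel_prod[symmetric])
  then have fm: "?f \<in> borel_measurable (lborel \<Otimes>\<^sub>M \<mu> q)"
    by (simp cong: measurable_cong_sets add: sets)
  have fi: "integrable (lborel \<Otimes>\<^sub>M \<mu> q) ?f"
  proof (rule Fubini_integrable[OF fm])
    show "AE r in lborel. integrable (\<mu> q) (\<lambda>x. ?f (r, x))"
      using D_time_integral_bound(1)[OF C] by simp
    have bi: "integrable lborel (\<lambda>r. indicator {0..1} r *\<^sub>R (C * (1 + norm (a' r) + \<bar>l' r\<bar>) * (1 + B)))"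
      using time_bound_integrable by (simp add: set_integrable_def)
    show "integrable lborel (\<lambda>r. \<integral>x. norm (?f (r, x)) \<partial>\<mu> q)"
    proof (rule Bochner_Integration.integrable_bound[OF bi])
      show "(\<lambda>r. \<integral>x. norm (?f (r, x)) \<partial>\<mu> q) \<in> borel_measurable lborel"
      proof -
        interpret G: kernel "\<lambda>r::real. \<mu> q"
          by standard (rule measurable_compose[OF _ kernel], measurable)
        have "(\<lambda>p. norm (?f p)) \<in> borel_measurable (borel \<Otimes>\<^sub>M borel)"
          using fm0 by (rule measurable_compose) simp
        then have "(\<lambda>(r, x). norm (?f (r, x))) \<in> borel_measurable (borel \<Otimes>\<^sub>M borel)" by (simp add: case_prod_beta')
        from G.integral_K_measurable[OF this] show ?thesis by simp
      qed
      show "AE r in lborel. norm (\<integral>x. norm (?f (r, x)) \<partial>\<mu> q) \<le>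
          norm (indicator {0..1} r *\<^sub>R (C * (1 + norm (a' r) + \<bar>l' r\<bar>) * (1 + B)))"
      proof (rule AE_I2)
        fix r
        show "norm (\<integral>x. norm (?f (r, x)) \<partial>\<mu> q) \<le> norm (indicator {0..1} r *\<^sub>R (C * (1 + norm (a' r) + \<bar>l' r\<bar>) * (1 + B)))"
          using D_time_integral_bound(2)[OF C, of q r] st by (auto simp: indicator_def)
      qed
    qed
  qed
  have "(\<integral>x. \<phi> (t, A t x) - \<phi> (s, A s x) \<partial>\<mu> q) = (\<integral>x. (\<integral>r. ?f (r, x) \<partial>lborel) \<partial>\<mu> q)"
    by (simp add: increment_in_time[OF st] set_lebesgue_integral_def)
  also have "\<dots> = (\<integral>r. (\<integral>x. ?f (r, x) \<partial>\<mu> q) \<partial>lborel)"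
    using Fubini_integral[of "\<lambda>r x. ?f (r, x)"] fi by (simp add: case_prod_beta')
  also have "\<dots> = (LINT r:{s..t}|lborel. \<integral>x. D r x (1, a' r + l' r *\<^sub>R x) \<partial>\<mu> q)"
    by (simp add: set_lebesgue_integral_def)
  finally show ?thesis .
qed

end

end

context affine_push
begin

context
  fixes \<phi> :: "real \<times> 'a \<Rightarrow> real"
  assumes \<phi>: "\<phi> \<in> test_functions"
begin

abbreviation "D' \<equiv> D \<phi>"

lemma \<phi>_eq_0: "t \<notin> {0<..<1} \<Longrightarrow> \<phi> (t, x) = 0"
  using \<phi>_support[OF \<phi>] closure_subset[of "{p. \<phi> p \<noteq> 0}"] by auto

text \<open>As l t > 0, the map A t is invertible and its inverse takes the compact support of
  \<phi> to a compact set.\<close>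

lemma slice_support:
  obtains S :: "'a set" where "compact S" "\<And>x. (t, A t x) \<in> closure {p. \<phi> p \<noteq> 0} \<Longrightarrow> x \<in> S"
proof -
  let ?S = "(\<lambda>p. (1 / l t) *\<^sub>R (snd p - a t)) ` closure {p. \<phi> p \<noteq> 0}"
  show ?thesis
  proof (rule that[of ?S])
    show "compact ?S"
      by (intro compact_continuous_image \<phi>_compact[OF \<phi>] continuous_intros)
    fix x assume "(t, A t x) \<in> closure {p. \<phi> p \<noteq> 0}"
    moreover have "x = (1 / l t) *\<^sub>R (snd (t, A t x) - a t)" using l_pos[of t] by (simp add: A_def)
    ultimately show "x \<in> ?S" by (rule rev_image_eqI)
  qed
qed

lemma slice_smooth: "smooth (\<lambda>x. \<phi> (s, A t x))"
proof -
  have "bounded_linear (\<lambda>x::'a. (0::real, l t *\<^sub>R x))"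
    by (intro bounded_linear_Pair bounded_linear_zero bounded_linear_scaleR_right)
  from smooth_compose_affine[OF this \<phi>_smooth[OF \<phi>], of "(s, a t)"]
  show ?thesis by (simp add: A_def)
qed

lemma slice_compact: "compact (closure {x. \<phi> (t, A t x) \<noteq> 0})"
proof -
  obtain S :: "'a set" where S: "compact S" "\<And>x. (t, A t x) \<in> closure {p. \<phi> p \<noteq> 0} \<Longrightarrow> x \<in> S"
    by (rule slice_support) (rule that)
  have "{x. \<phi> (t, A t x) \<noteq> 0} \<subseteq> S"
    using S(2) closure_subset[of "{p. \<phi> p \<noteq> 0}"] by blast
  then have "closure {x. \<phi> (t, A t x) \<noteq> 0} \<subseteq> S"
    using S(1) by (intro closure_minimal compact_imp_closed)
  then show ?thesis
    using compact_Int_closed[OF S(1) closed_closure, of "{x. \<phi> (t, A t x) \<noteq> 0}"] by (simp only: Int_absorb1)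
qed

lemma slice_derivative:
  "frechet_derivative (\<lambda>x. \<phi> (t, A t x)) (at x) v = D' t x (0, l t *\<^sub>R v)"
proof -
  have "((\<lambda>x. (t, A t x)) has_derivative (\<lambda>v. (0, l t *\<^sub>R v))) (at x)"
    unfolding A_def by (auto intro!: derivative_eq_intros)
  from has_derivative_compose[OF this, of \<phi> "frechet_derivative \<phi> (at (t, A t x))"]
  have "((\<lambda>x. \<phi> (t, A t x)) has_derivative (\<lambda>v. frechet_derivative \<phi> (at (t, A t x)) (0, l t *\<^sub>R v))) (at x)"
    using smooth_has_derivative[OF \<phi>_smooth[OF \<phi>]] by simp
  from fun_cong[OF frechet_derivative_at[OF this], of v] show ?thesis by (simp add: D_def[OF \<phi>])
qed

lemma slice_integrable: "integrable (\<mu> s) (\<lambda>x. \<phi> (t, A t x))"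
proof -
  interpret prob_space "\<mu> s" by (rule prob_K)
  obtain M where "\<And>x. \<bar>\<phi> (t, A t x)\<bar> \<le> M"
    using smooth_compact_bounded(2)[OF slice_smooth slice_compact] unfolding bounded_iff by auto
  then show ?thesis
    using borel_measurable_continuous_onI[OF smooth_compact_bounded(1)[OF slice_smooth slice_compact]]
    by (intro integrable_const_bound[of _ M] borel_measurable_mu) auto
qed

text \<open>The increment of g over a grid cell [s, t] is split in two: the maps move while the
  measure is frozen at t (\<open>F1\<close>), then the measure moves while the maps are frozen at s
  (\<open>F2\<close>). Only the second part uses the equation for \<mu>, with a test function of x
  alone. The increments telescope to g 1 - g 0 = 0, and in the limit the two parts add up to the
  derivative of \<phi> along (1, U).\<close>

lemma \<nu>_distributional:
  "(LINT t:{0..1}|lborel. (\<integral>y. frechet_derivative \<phi> (at (t, y)) (1, U t y) \<partial>\<nu> t)) = 0"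
proof -
  obtain C where C: "C \<ge> 0" "\<And>x v. \<bar>frechet_derivative \<phi> (at x) v\<bar> \<le> C * norm v"
    using D_bound[OF \<phi>] by metis
  obtain L where L: "L \<ge> 0" "\<And>t. t \<in> {0..1} \<Longrightarrow> norm (a t) \<le> L" "\<And>t. t \<in> {0..1} \<Longrightarrow> l t \<le> L"
    using coefficient_bound by metis
  define F1 where "F1 N r = (\<integral>x. D' r x (1, a' r + l' r *\<^sub>R x) \<partial>\<mu> (grid_right N r))" for N r
  define F2 where "F2 N r = (\<integral>x. D' (grid_left N r) x (0, l (grid_left N r) *\<^sub>R V r x) \<partial>\<mu> r)" for N r
  define E where "E r = C * (1 + norm (a' r) + \<bar>l' r\<bar>) * (1 + B)" for r
  have E: "set_integrable lborel {0..1} E" unfolding E_def by (rule time_bound_integrable[OF \<phi>])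
  have D1m: "(\<lambda>(r, x). D' r x (1, a' r + l' r *\<^sub>R x)) \<in> borel_measurable (borel \<Otimes>\<^sub>M borel)"
    unfolding case_prod_beta' by (intro D_measurable[OF \<phi>]) (simp_all add: borel_prod[symmetric])
  have D2m: "(\<lambda>(r, x). D' (h r) x (0, l (h r) *\<^sub>R V r x)) \<in> borel_measurable (borel \<Otimes>\<^sub>M borel)"
    if [measurable]: "h \<in> borel_measurable borel" for h
    unfolding case_prod_beta' by (intro D_measurable[OF \<phi>]) (simp_all add: borel_prod[symmetric])
  have F1m: "F1 N \<in> borel_measurable borel" for N
  proof -
    interpret G: kernel "\<lambda>r. \<mu> (grid_right N r)"
      by standard (rule measurable_compose[OF _ kernel], measurable)
    show ?thesis unfolding F1_def[abs_def] by (rule G.integral_K_measurable[OF D1m])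
  qed
  have F1E: "\<bar>F1 N r\<bar> \<le> E r" for N r
    using order_trans[OF integral_abs_bound D_time_integral_bound(2)[OF \<phi> C]] unfolding F1_def E_def .
  have F1i: "set_integrable lborel {0..1} (F1 N)" for N
    unfolding set_integrable_def
  proof (rule Bochner_Integration.integrable_bound)
    show "integrable lborel (\<lambda>r. indicator {0..1} r *\<^sub>R E r)" using E by (simp add: set_integrable_def)
    show "(\<lambda>r. indicator {0..1} r *\<^sub>R F1 N r) \<in> borel_measurable lborel" using F1m[of N] by measurable
    show "AE r in lborel. norm (indicat_real {0..1} r *\<^sub>R F1 N r) \<le> norm (indicat_real {0..1} r *\<^sub>R E r)"
      using F1E by (intro AE_I2) (auto simp: indicator_def intro: order_trans[OF _ abs_ge_self])
  qed
  have spd: "(\<integral>\<^sup>+r\<in>{0..1}. (\<integral>\<^sup>+x. ennreal (C * L * norm (V r x)) \<partial>\<mu> r) \<partial>lborel) < \<infinity>"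
  proof -
    have [measurable]: "V r \<in> borel_measurable (\<mu> r)" for r by (rule measurable_section[OF V_measurable])
    have [measurable]: "(\<lambda>r. \<integral>\<^sup>+x. ennreal (norm (V r x)) \<partial>\<mu> r) \<in> borel_measurable borel"
      by (rule nn_integral_K_measurable) measurable
    have CL: "0 \<le> C * L" using C L by simp
    have "(\<integral>\<^sup>+r\<in>{0..1}. (\<integral>\<^sup>+x. ennreal (C * L * norm (V r x)) \<partial>\<mu> r) \<partial>lborel) =
        (\<integral>\<^sup>+r. ennreal (C * L) * ((\<integral>\<^sup>+x. ennreal (norm (V r x)) \<partial>\<mu> r) * indicator {0..1} r) \<partial>lborel)"
      unfolding ennreal_mult'[OF CL] by (subst nn_integral_cmult) (auto simp: mult.assoc)
    also have "\<dots> = ennreal (C * L) * (\<integral>\<^sup>+r\<in>{0..1}. (\<integral>\<^sup>+x. ennreal (norm (V r x)) \<partial>\<mu> r) \<partial>lborel)"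
      by (rule nn_integral_cmult) measurable
    also have "\<dots> < \<infinity>" using speed_finite[OF weighted_speed] by (simp add: ennreal_mult_less_top)
    finally show ?thesis .
  qed
  have D2le: "norm (D' s x (0, l s *\<^sub>R v)) \<le> C * L * norm v" if "s \<in> {0..1}" for s x v
  proof -
    have "norm (D' s x (0, l s *\<^sub>R v)) \<le> C * (l s * norm v)"
      using C(2)[of "(s, A s x)" "(0, l s *\<^sub>R v)"] l_pos[of s] by (simp add: D_def[OF \<phi>] norm_Pair)
    also have "\<dots> \<le> C * (L * norm v)"
      using L(3)[OF that] C(1) by (intro mult_left_mono mult_right_mono) auto
    finally show ?thesis by (simp add: mult.assoc)
  qed
  have Gm: "(\<lambda>(r, x). C * L * norm (V r x)) \<in> borel_measurable (borel \<Otimes>\<^sub>M borel)"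
    unfolding case_prod_beta' by measurable
  have F2i: "set_integrable lborel {0..1} (F2 N)" if "N > 0" for N
    unfolding F2_def[abs_def]
    by (rule nested_integrable_bound(2)[OF D2m[of "grid_left N"] _ spd]) (use D2le grid_left_range[OF _ that] in auto)
  define g where "g t = (\<integral>x. \<phi> (t, A t x) \<partial>\<mu> t)" for t
  have step: "g (real (Suc i) / real N) - g (real i / real N) =
      (LINT r:{real i / real N..real (Suc i) / real N}|lborel. F1 N r) +
      (LINT r:{real i / real N..real (Suc i) / real N}|lborel. F2 N r)" if iN: "i < N" for i N
  proof -
    define s where "s = real i / real N"
    define t where "t = real (Suc i) / real N"
    have st: "0 \<le> s" "s \<le> t" "t \<le> 1" using iN by (auto simp: s_def t_def divide_right_mono)
    have N0: "N > 0" using iN by simp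
    have grid: "AE r in lborel. r \<in> {s..t} \<longrightarrow> grid_left N r = s \<and> grid_right N r = t"
      using AE_lborel_singleton[of s] AE_lborel_singleton[of t]
    proof eventually_elim
      case (elim r)
      then show ?case using grid_eq[OF N0, of i r] by (auto simp: s_def t_def)
    qed
    have "(\<integral>x. \<phi> (t, A t x) - \<phi> (s, A s x) \<partial>\<mu> t) = (LINT r:{s..t}|lborel. \<integral>x. D' r x (1, a' r + l' r *\<^sub>R x) \<partial>\<mu> t)"
      by (rule mean_increment_in_time[OF \<phi> st])
    also have "\<dots> = (LINT r:{s..t}|lborel. F1 N r)"
    proof (rule set_lebesgue_integral_cong_AE)
      interpret G: kernel "\<lambda>r::real. \<mu> t"
        by standard (rule measurable_compose[OF _ kernel], measurable)
      show "(\<lambda>r. \<integral>x. D' r x (1, a' r + l' r *\<^sub>R x) \<partial>\<mu> t) \<in> borel_measurable lborel"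
        using G.integral_K_measurable[OF D1m] by simp
      show "AE r\<in>{s..t} in lborel. (\<integral>x. D' r x (1, a' r + l' r *\<^sub>R x) \<partial>\<mu> t) = F1 N r"
        using grid by eventually_elim (simp add: F1_def)
    qed (use F1m in auto)
    finally have 1: "(\<integral>x. \<phi> (t, A t x) - \<phi> (s, A s x) \<partial>\<mu> t) = (LINT r:{s..t}|lborel. F1 N r)" .
    have fin: "(\<integral>\<^sup>+r\<in>{s..t}. (\<integral>\<^sup>+x. ennreal (norm (V r x)) \<partial>\<mu> r) \<partial>lborel) < \<infinity>"
      by (rule speed_finite[OF weighted_speed_subinterval[OF st(1,3)]])
    have "(\<integral>x. \<phi> (s, A s x) \<partial>\<mu> t) - (\<integral>x. \<phi> (s, A s x) \<partial>\<mu> s) =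
        (LINT r:{s..t}|lborel. \<integral>x. D' s x (0, l s *\<^sub>R V r x) \<partial>\<mu> r)"
      using evolution_compact[OF slice_smooth slice_compact st fin, of s] by (simp add: slice_derivative)
    also have "\<dots> = (LINT r:{s..t}|lborel. F2 N r)"
    proof (rule set_lebesgue_integral_cong_AE)
      show "(\<lambda>r. \<integral>x. D' s x (0, l s *\<^sub>R V r x) \<partial>\<mu> r) \<in> borel_measurable lborel"
        using integral_K_measurable[OF D2m[of "\<lambda>_. s"]] by simp
      show "F2 N \<in> borel_measurable lborel"
        using integral_K_measurable[OF D2m[of "grid_left N"]] by (simp add: F2_def[abs_def])
      show "AE r\<in>{s..t} in lborel. (\<integral>x. D' s x (0, l s *\<^sub>R V r x) \<partial>\<mu> r) = F2 N r"
        using grid by eventually_elim (simp add: F2_def)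
    qed auto
    finally have 2: "(\<integral>x. \<phi> (s, A s x) \<partial>\<mu> t) - (\<integral>x. \<phi> (s, A s x) \<partial>\<mu> s) = (LINT r:{s..t}|lborel. F2 N r)" .
    have "g t - g s = (\<integral>x. \<phi> (t, A t x) - \<phi> (s, A s x) \<partial>\<mu> t) + ((\<integral>x. \<phi> (s, A s x) \<partial>\<mu> t) - (\<integral>x. \<phi> (s, A s x) \<partial>\<mu> s))"
      using slice_integrable by (simp add: g_def)
    then show ?thesis unfolding 1 2 by (simp add: s_def t_def)
  qed
  have zero: "(LINT r:{0..1}|lborel. F1 (Suc n) r) + (LINT r:{0..1}|lborel. F2 (Suc n) r) = 0" for n
  proof -
    let ?N = "Suc n"
    have "(\<Sum>i<?N. g (real (Suc i) / real ?N) - g (real i / real ?N)) = g (real ?N / real ?N) - g (real 0 / real ?N)"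
      by (rule sum_lessThan_telescope)
    also have "\<dots> = 0" by (simp add: g_def \<phi>_eq_0)
    also have "(\<Sum>i<?N. g (real (Suc i) / real ?N) - g (real i / real ?N)) =
      (\<Sum>i<?N. LINT r:{real i / real ?N..real (Suc i) / real ?N}|lborel. F1 ?N r) +
      (\<Sum>i<?N. LINT r:{real i / real ?N..real (Suc i) / real ?N}|lborel. F2 ?N r)"
      unfolding sum.distrib[symmetric] by (intro sum.cong refl step) simp
    also have "(\<Sum>i<?N. LINT r:{real i / real ?N..real (Suc i) / real ?N}|lborel. F1 ?N r) = (LINT r:{0..real ?N / real ?N}|lborel. F1 ?N r)"
      by (rule set_integral_sum_partition[OF F1i]) auto
    also have "(\<Sum>i<?N. LINT r:{real i / real ?N..real (Suc i) / real ?N}|lborel. F2 ?N r) = (LINT r:{0..real ?N / real ?N}|lborel. F2 ?N r)"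
      by (rule set_integral_sum_partition[OF F2i]) auto
    finally show ?thesis by simp
  qed
  define G1 where "G1 r = (\<integral>x. D' r x (1, a' r + l' r *\<^sub>R x) \<partial>\<mu> r)" for r
  define G2 where "G2 r = (\<integral>x. D' r x (0, l r *\<^sub>R V r x) \<partial>\<mu> r)" for r
  have G1m: "G1 \<in> borel_measurable borel" unfolding G1_def[abs_def] by (rule integral_K_measurable[OF D1m])
  \<comment> \<open>Here the maps are already at time r and only the measure is late; for fixed r
    the integrand is bounded and continuous in x, so weak continuity gives the limit.\<close>
  have "(\<lambda>n. LINT r:{0..1}|lborel. F1 (Suc n) r) \<longlonglongrightarrow> (LINT r:{0..1}|lborel. G1 r)"
    unfolding set_lebesgue_integral_def
  proof (rule integral_dominated_convergence[where w="\<lambda>r. indicator {0..1} r *\<^sub>R E r"])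
    show "integrable lborel (\<lambda>r. indicat_real {0..1} r *\<^sub>R E r)" using E by (simp add: set_integrable_def)
    show "(\<lambda>r. indicat_real {0..1} r *\<^sub>R G1 r) \<in> borel_measurable lborel" using G1m by measurable
    show "(\<lambda>r. indicat_real {0..1} r *\<^sub>R F1 (Suc n) r) \<in> borel_measurable lborel" for n using F1m[of "Suc n"] by measurable
    show "AE r in lborel. norm (indicat_real {0..1} r *\<^sub>R F1 (Suc n) r) \<le> indicat_real {0..1} r *\<^sub>R E r" for n
      using F1E by (intro AE_I2) (auto simp: indicator_def)
    show "AE r in lborel. (\<lambda>n. indicat_real {0..1} r *\<^sub>R F1 (Suc n) r) \<longlonglongrightarrow> indicat_real {0..1} r *\<^sub>R G1 r"
    proof (intro AE_I2 tendsto_scaleR tendsto_const)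
      fix r
      let ?q = "\<lambda>x. D' r x (1, a' r + l' r *\<^sub>R x)"
      have qc: "continuous_on S ?q" for S
        unfolding D_def[OF \<phi>] A_def
        by (intro smooth_derivative_continuous_on[OF \<phi>_smooth[OF \<phi>]] continuous_intros)
      have "bounded (range ?q)"
      proof -
        obtain S :: "'a set" where S: "compact S" "\<And>x. (r, A r x) \<in> closure {p. \<phi> p \<noteq> 0} \<Longrightarrow> x \<in> S"
          by (rule slice_support) (rule that)
        obtain M where M: "\<And>x. x \<in> S \<Longrightarrow> \<bar>?q x\<bar> \<le> M"
          using compact_continuous_bound[OF S(1) qc] by metis
        have "\<bar>?q x\<bar> \<le> max M 0" for x
        proof (cases "x \<in> S")
          case True
          then show ?thesis using M[OF True] by simp
        next
          case False
          then have "(r, A r x) \<notin> closure {p. \<phi> p \<noteq> 0}" using S(2) by blast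
          then have "?q x = 0"
            unfolding D_def[OF \<phi>] by (rule smooth_derivative_zero_outside[OF smooth_differentiable[OF \<phi>_smooth[OF \<phi>]]])
          then show ?thesis by simp
        qed
        then show ?thesis unfolding bounded_iff by auto
      qed
      from weak[OF qc this] have "isCont (\<lambda>t. \<integral>x. ?q x \<partial>\<mu> t) r" by (simp add: continuous_on_eq_continuous_at)
      from isCont_tendsto_compose[OF this grid_tendsto(2)]
      show "(\<lambda>n. F1 (Suc n) r) \<longlonglongrightarrow> G1 r" by (simp add: F1_def G1_def)
    qed
  qed
  \<comment> \<open>Here the measure is already at time r; the maps converge by continuity of a and
    l, and L bounds l on the grid.\<close>
  moreover have "(\<lambda>n. LINT r:{0..1}|lborel. F2 (Suc n) r) \<longlonglongrightarrow> (LINT r:{0..1}|lborel. G2 r)"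
    unfolding F2_def G2_def
  proof (rule nested_dominated_convergence[OF D2m D2m[of "\<lambda>r. r"] Gm _ spd])
    fix n r x assume r: "r \<in> {0..1::real}"
    show "norm (D' (grid_left (Suc n) r) x (0, l (grid_left (Suc n) r) *\<^sub>R V r x)) \<le> C * L * norm (V r x)"
      using r by (intro D2le grid_left_range) auto
  next
    fix r x
    have "continuous_on UNIV (\<lambda>s. D' s x (0, l s *\<^sub>R V r x))"
      unfolding D_def[OF \<phi>] A_def
      by (intro smooth_derivative_continuous_on[OF \<phi>_smooth[OF \<phi>]] continuous_intros a_cont l_cont)
    then have "isCont (\<lambda>s. D' s x (0, l s *\<^sub>R V r x)) r" by (simp add: continuous_on_eq_continuous_at)
    from isCont_tendsto_compose[OF this grid_tendsto(1)]
    show "(\<lambda>n. D' (grid_left (Suc n) r) x (0, l (grid_left (Suc n) r) *\<^sub>R V r x)) \<longlonglongrightarrow> D' r x (0, l r *\<^sub>R V r x)" .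
  qed auto
  ultimately have "(\<lambda>n. (LINT r:{0..1}|lborel. F1 (Suc n) r) + (LINT r:{0..1}|lborel. F2 (Suc n) r)) \<longlonglongrightarrow>
      (LINT r:{0..1}|lborel. G1 r) + (LINT r:{0..1}|lborel. G2 r)"
    by (rule tendsto_add)
  then have sum0: "(LINT r:{0..1}|lborel. G1 r) + (LINT r:{0..1}|lborel. G2 r) = 0"
    unfolding zero using LIMSEQ_unique tendsto_const by blast
  have G2a: "AE r in lborel. r \<in> {0..1} \<longrightarrow> integrable (\<mu> r) (\<lambda>x. D' r x (0, l r *\<^sub>R V r x))"
    by (rule nested_integrable_bound(1)[OF D2m[of "\<lambda>r. r"] _ spd]) (use D2le in auto)
  have G2i: "set_integrable lborel {0..1} G2"
    unfolding G2_def[abs_def] by (rule nested_integrable_bound(2)[OF D2m[of "\<lambda>r. r"] _ spd]) (use D2le in auto)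
  have G1i: "set_integrable lborel {0..1} G1"
    unfolding set_integrable_def
  proof (rule Bochner_Integration.integrable_bound)
    show "integrable lborel (\<lambda>r. indicator {0..1} r *\<^sub>R E r)" using E by (simp add: set_integrable_def)
    show "(\<lambda>r. indicator {0..1} r *\<^sub>R G1 r) \<in> borel_measurable lborel" using G1m by measurable
    have "\<bar>G1 r\<bar> \<le> E r" for r
      using order_trans[OF integral_abs_bound D_time_integral_bound(2)[OF \<phi> C]] unfolding G1_def E_def .
    then show "AE r in lborel. norm (indicat_real {0..1} r *\<^sub>R G1 r) \<le> norm (indicat_real {0..1} r *\<^sub>R E r)"
      by (intro AE_I2) (auto simp: indicator_def intro: order_trans[OF _ abs_ge_self])
  qed
  have [measurable]: "U t \<in> borel_measurable borel" for t
    using measurable_compose[OF measurable_Pair1' U_measurable, of t] by simp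
  have Um: "(\<lambda>(t, x). frechet_derivative \<phi> (at (t, x)) (1, U t x)) \<in> borel_measurable (borel \<Otimes>\<^sub>M borel)"
  proof -
    have [measurable]: "(\<lambda>p. U (fst p) (snd p)) \<in> borel_measurable (borel \<Otimes>\<^sub>M borel)"
      using U_measurable by (simp add: case_prod_beta')
    show ?thesis
      unfolding case_prod_beta' by (intro smooth_derivative_measurable[OF \<phi>_smooth[OF \<phi>]]) (simp_all add: borel_prod[symmetric])
  qed
  have UAm: "(\<lambda>(t, x). frechet_derivative \<phi> (at (t, A t x)) (1, U t (A t x))) \<in> borel_measurable (borel \<Otimes>\<^sub>M borel)"
  proof -
    have "(\<lambda>p. (\<lambda>(t, x). frechet_derivative \<phi> (at (t, x)) (1, U t x)) (fst p, A (fst p) (snd p))) \<in> borel_measurable (borel \<Otimes>\<^sub>M borel)"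
      by (rule measurable_compose[OF _ Um]) measurable
    then show ?thesis by (simp add: case_prod_beta')
  qed
  have "(LINT t:{0..1}|lborel. (\<integral>y. frechet_derivative \<phi> (at (t, y)) (1, U t y) \<partial>\<nu> t)) =
      (LINT t:{0..1}|lborel. (\<integral>x. frechet_derivative \<phi> (at (t, A t x)) (1, U t (A t x)) \<partial>\<mu> t))"
  proof -
    have "(\<lambda>y. frechet_derivative \<phi> (at (t, y)) (1, U t y)) \<in> borel_measurable borel" for t
      using measurable_compose[OF measurable_Pair1' Um, of t] by simp
    from integral_\<nu>[OF this] show ?thesis by simp
  qed
  also have "\<dots> = (LINT t:{0..1}|lborel. G1 t + G2 t)"
  proof (rule set_lebesgue_integral_cong_AE)
    show "(\<lambda>t. \<integral>x. frechet_derivative \<phi> (at (t, A t x)) (1, U t (A t x)) \<partial>\<mu> t) \<in> borel_measurable lborel"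
      using integral_K_measurable[OF UAm] by simp
    have "G2 \<in> borel_measurable borel" unfolding G2_def[abs_def] by (rule integral_K_measurable[OF D2m]) simp
    then show "(\<lambda>t. G1 t + G2 t) \<in> borel_measurable lborel" using G1m by measurable
    show "AE t\<in>{0..1} in lborel. (\<integral>x. frechet_derivative \<phi> (at (t, A t x)) (1, U t (A t x)) \<partial>\<mu> t) = G1 t + G2 t"
      using G2a
    proof eventually_elim
      case (elim t)
      show ?case
      proof
        assume t: "t \<in> {0..1}"
        have "frechet_derivative \<phi> (at (t, A t x)) (1, U t (A t x)) =
            D' t x (1, a' t + l' t *\<^sub>R x) + D' t x (0, l t *\<^sub>R V t x)" for x
          unfolding D_add[OF \<phi>, symmetric] by (simp add: D_def[OF \<phi>] U_A)
        then show "(\<integral>x. frechet_derivative \<phi> (at (t, A t x)) (1, U t (A t x)) \<partial>\<mu> t) = G1 t + G2 t"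
          using elim t D_time_integral_bound(1)[OF \<phi> C] by (simp add: G1_def G2_def)
      qed
    qed
  qed auto
  also have "\<dots> = 0" using sum0 G1i G2i by (simp add: set_integral_add)
  finally show ?thesis .
qed

end

theorem ce_curve_\<nu>: "ce_curve \<nu> U"
  by standard (fact \<nu>_P2 \<nu>_weak U_measurable \<nu>_distributional)+

end

section \<open>From \<open>CE\<close> to curves on the whole time line and back\<close>

definition clamp01 :: "real \<Rightarrow> real" where "clamp01 t = max 0 (min 1 t)"

lemma clamp01_range [simp]: "0 \<le> clamp01 t" "clamp01 t \<le> 1"
  by (auto simp: clamp01_def)

lemma clamp01_eq: "t \<in> {0..1} \<Longrightarrow> clamp01 t = t"
  by (auto simp: clamp01_def)

lemma continuous_on_clamp01: "continuous_on S clamp01"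
  unfolding clamp01_def[abs_def] by (intro continuous_intros)

lemma continuous_on_compose_clamp01:
  fixes f :: "real \<Rightarrow> 'b::topological_space"
  assumes "continuous_on {0..1} f"
  shows "continuous_on UNIV (\<lambda>t. f (clamp01 t))"
  by (rule continuous_on_compose2[OF assms continuous_on_clamp01]) auto

lemma measurable_clamp01: "clamp01 \<in> borel \<rightarrow>\<^sub>M restrict_space borel {0..1}"
  by (intro measurable_restrict_space2 borel_measurable_continuous_onI continuous_on_clamp01) auto

lemma ac_density_cong:
  assumes "ac_density f g" "\<And>t. t \<in> {0..1} \<Longrightarrow> h t = f t"
  shows "ac_density h g"
  using assms unfolding ac_density_def by simp

lemma CE_imp_ce_curve:
  assumes "(\<mu>, V) \<in> CE \<mu>\<^sub>0 \<mu>\<^sub>1"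
  shows "ce_curve (\<lambda>t. \<mu> (clamp01 t)) (\<lambda>t. V (clamp01 t))"
proof
  have CE: "\<And>t. t \<in> {0..1} \<Longrightarrow> \<mu> t \<in> P2" "weakly_continuous_curve \<mu>"
    "(\<lambda>(t, x). V t x) \<in> borel_measurable (restrict_space borel {0..1} \<Otimes>\<^sub>M borel)" "continuity_equation \<mu> V"
    using assms by (auto simp: CE_def)
  show "\<mu> (clamp01 t) \<in> P2" for t by (rule CE(1)) simp
  show "continuous_on UNIV (\<lambda>t. \<integral>x. f x \<partial>\<mu> (clamp01 t))"
    if "continuous_on UNIV f" "bounded (range f)" for f :: "'a \<Rightarrow> real"
    using CE(2) that by (intro continuous_on_compose_clamp01) (simp add: weakly_continuous_curve_def)
  have "(\<lambda>p. (clamp01 (fst p), snd p)) \<in> borel \<Otimes>\<^sub>M borel \<rightarrow>\<^sub>M restrict_space borel {0..1} \<Otimes>\<^sub>M (borel :: 'a measure)"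
    by (intro measurable_Pair measurable_compose[OF measurable_fst measurable_clamp01] measurable_snd)
  from measurable_compose[OF this CE(3)]
  show "(\<lambda>(t, x). V (clamp01 t) x) \<in> borel_measurable (borel \<Otimes>\<^sub>M borel)" by (simp add: case_prod_beta')
  fix \<phi> :: "real \<times> 'a \<Rightarrow> real" assume "\<phi> \<in> test_functions"
  then have "(LINT t:{0..1}|lborel. (\<integral>x. frechet_derivative \<phi> (at (t, x)) (1, V t x) \<partial>\<mu> t)) = 0"
    using CE(4) by (simp add: continuity_equation_def)
  moreover have "(LINT t:{0..1}|lborel. (\<integral>x. frechet_derivative \<phi> (at (t, x)) (1, V (clamp01 t) x) \<partial>\<mu> (clamp01 t))) =
      (LINT t:{0..1}|lborel. (\<integral>x. frechet_derivative \<phi> (at (t, x)) (1, V t x) \<partial>\<mu> t))"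
    by (intro set_lebesgue_integral_cong) (auto simp: clamp01_eq)
  ultimately show "(LINT t:{0..1}|lborel. (\<integral>x. frechet_derivative \<phi> (at (t, x)) (1, V (clamp01 t) x) \<partial>\<mu> (clamp01 t))) = 0"
    by simp
qed

text \<open>Finite total speed bounds the speed over every compact set K.\<close>

lemma (in ce_curve) CE_of_ce_curve:
  assumes speed: "(\<integral>\<^sup>+t\<in>{0..1}. (\<integral>\<^sup>+x. ennreal (norm (V t x)) \<partial>\<mu> t) \<partial>lborel) < \<infinity>"
  shows "(\<mu>, V) \<in> CE (\<mu> 0) (\<mu> 1)"
proof -
  have "weakly_continuous_curve \<mu>"
    unfolding weakly_continuous_curve_def using weak by (auto intro: continuous_on_subset)
  moreover have "(\<lambda>(t, x). V t x) \<in> borel_measurable (restrict_space borel {0..1} \<Otimes>\<^sub>M borel)"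
  proof -
    have "(\<lambda>t. t) \<in> restrict_space borel {0..1} \<rightarrow>\<^sub>M (borel :: real measure)"
      by (intro measurable_restrict_space1) simp
    then have "(\<lambda>p. (fst p, snd p)) \<in> restrict_space borel {0..1} \<Otimes>\<^sub>M borel \<rightarrow>\<^sub>M (borel :: real measure) \<Otimes>\<^sub>M (borel :: 'a measure)"
      by (intro measurable_Pair measurable_compose[OF measurable_fst] measurable_snd)
    from measurable_compose[OF this V_measurable] show ?thesis by (simp add: case_prod_beta')
  qed
  moreover have "continuity_equation \<mu> V"
    unfolding continuity_equation_def
  proof (intro conjI allI impI ballI distributional)
    fix K :: "(real \<times> 'a) set"
    have "(\<integral>\<^sup>+t\<in>{0..1}. (\<integral>\<^sup>+x. ennreal (norm (V t x)) * indicator K (t, x) \<partial>\<mu> t) \<partial>lborel) \<le>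
        (\<integral>\<^sup>+t\<in>{0..1}. (\<integral>\<^sup>+x. ennreal (norm (V t x)) \<partial>\<mu> t) \<partial>lborel)"
      by (intro nn_integral_mono mult_right_mono) (auto simp: indicator_def)
    then show "(\<integral>\<^sup>+t\<in>{0..1}. (\<integral>\<^sup>+x. ennreal (norm (V t x)) * indicator K (t, x) \<partial>\<mu> t) \<partial>lborel) < \<infinity>"
      using speed by (rule le_less_trans)
  qed
  ultimately show ?thesis using P2 by (simp add: CE_def)
qed

lemma var_eq:
  assumes "\<mu> \<in> P2"
  shows "var \<mu> = (\<integral>x. (norm x)\<^sup>2 \<partial>\<mu>) - (norm (barycenter \<mu>))\<^sup>2"
  using integral_norm_diff_power2[OF assms, of 0] by simp

lemma norm_diff_diff_power2_le:
  fixes u v w :: "'a::real_normed_vector"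
  shows "(norm (u - v - w))\<^sup>2 \<le> 3 * ((norm u)\<^sup>2 + (norm v)\<^sup>2 + (norm w)\<^sup>2)"
proof -
  have "norm (u - v - w) \<le> norm u + norm v + norm w"
    using norm_triangle_ineq4[of "u - v" w] norm_triangle_ineq4[of u v] by linarith
  then have "(norm (u - v - w))\<^sup>2 \<le> (norm u + norm v + norm w)\<^sup>2"
    by (rule power_mono) simp
  also have "\<dots> \<le> 3 * ((norm u)\<^sup>2 + (norm v)\<^sup>2 + (norm w)\<^sup>2)"
  proof -
    have "0 \<le> (norm u - norm v)\<^sup>2 + (norm u - norm w)\<^sup>2 + (norm v - norm w)\<^sup>2" by simp
    then show ?thesis by (simp add: power2_eq_square algebra_simps)
  qed
  finally show ?thesis .
qed

text \<open>
  The orthogonality relations hold for the velocity of a normalized curve. If \<open>W\<close> is not square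
  integrable, both sides are infinite.
\<close>

lemma affine_energy:
  fixes p :: "'a::euclidean_space" and W :: "'a \<Rightarrow> 'a"
  assumes \<rho>: "\<rho> \<in> P2" and normalized: "barycenter \<rho> = 0" "var \<rho> = 1"
    and W: "W \<in> borel_measurable borel" and orth: "(\<integral>y. W y \<partial>\<rho>) = 0" "(\<integral>y. y \<bullet> W y \<partial>\<rho>) = 0"
    and c: "c \<noteq> 0"
  shows "(\<integral>\<^sup>+y. ennreal ((norm (p + q *\<^sub>R y + c *\<^sub>R W y))\<^sup>2) \<partial>\<rho>) / ennreal (2 * c\<^sup>2) =
    ennreal ((norm p)\<^sup>2 + \<bar>q\<bar>\<^sup>2) / ennreal (2 * c\<^sup>2) + (\<integral>\<^sup>+y. ennreal ((norm (W y))\<^sup>2 / 2) \<partial>\<rho>)"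
proof -
  note P = P2D[OF \<rho>]
  interpret prob_space \<rho> by (rule P(1))
  have Wm [measurable]: "W \<in> borel_measurable \<rho>" and idm [measurable]: "(\<lambda>y. y) \<in> borel_measurable \<rho>"
    using W P(2) by (simp_all cong: measurable_cong_sets)
  have c2: "c\<^sup>2 > 0" using c by simp
  let ?X = "\<lambda>y. p + q *\<^sub>R y + c *\<^sub>R W y"
  have iy: "integrable \<rho> (\<lambda>y. y)" by (rule P2_norm_diff_integrable[OF \<rho>])
  have y0: "(\<integral>y. y \<partial>\<rho>) = 0" using normalized(1) by (simp add: barycenter_def)
  have yy: "(\<integral>y. (norm y)\<^sup>2 \<partial>\<rho>) = 1" using var_eq[OF \<rho>] normalized by simp
  have half: "(\<integral>\<^sup>+y. ennreal ((norm (W y))\<^sup>2 / 2) \<partial>\<rho>) = (\<integral>\<^sup>+y. ennreal ((norm (W y))\<^sup>2) \<partial>\<rho>) / 2"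
  proof -
    have "ennreal ((norm (W y))\<^sup>2 / 2) = ennreal ((norm (W y))\<^sup>2) / 2" for y
      using divide_ennreal[of "(norm (W y))\<^sup>2" 2] by simp
    then show ?thesis by (simp add: nn_integral_divide)
  qed
  show ?thesis
  proof (cases "integrable \<rho> (\<lambda>y. (norm (W y))\<^sup>2)")
    case True
    have iW: "integrable \<rho> W"
    proof (rule Bochner_Integration.integrable_bound)
      show "integrable \<rho> (\<lambda>y. 1 + (norm (W y))\<^sup>2)" using True by simp
      show "AE y in \<rho>. norm (W y) \<le> norm (1 + (norm (W y))\<^sup>2)"
        by (intro AE_I2) (simp add: norm_le_1_plus_power2)
    qed measurable
    have iyW: "integrable \<rho> (\<lambda>y. y \<bullet> W y)"
    proof (rule Bochner_Integration.integrable_bound)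
      show "integrable \<rho> (\<lambda>y. (norm y)\<^sup>2 + (norm (W y))\<^sup>2)" using True P(4) by simp
      have "\<bar>y \<bullet> W y\<bar> \<le> (norm y)\<^sup>2 + (norm (W y))\<^sup>2" for y
        using Cauchy_Schwarz_ineq2[of y "W y"] sum_squares_bound[of "norm y" "norm (W y)"]
          mult_nonneg_nonneg[OF norm_ge_zero[of y] norm_ge_zero[of "W y"]] by linarith
      then show "AE y in \<rho>. norm (y \<bullet> W y) \<le> norm ((norm y)\<^sup>2 + (norm (W y))\<^sup>2)"
        by (intro AE_I2) simp
    qed measurable
    \<comment> \<open>The three mixed terms integrate to 0: y is centred, W has mean 0, and y . W
      has mean 0.\<close>
    have eq: "(norm (?X y))\<^sup>2 = (norm p)\<^sup>2 + q\<^sup>2 * (norm y)\<^sup>2 + c\<^sup>2 * (norm (W y))\<^sup>2 +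
        2 * q * (y \<bullet> p) + 2 * c * (W y \<bullet> p) + 2 * q * c * (y \<bullet> W y)" for y
      unfolding power2_norm_eq_inner
      by (simp add: inner_add_left inner_add_right inner_commute power2_eq_square algebra_simps)
    have yp: "(\<integral>y. y \<bullet> p \<partial>\<rho>) = 0" using integral_inner_left[OF iy, of p] y0 by simp
    have Wp: "(\<integral>y. W y \<bullet> p \<partial>\<rho>) = 0" using integral_inner_left[OF iW, of p] orth(1) by simp
    have iX: "integrable \<rho> (\<lambda>y. (norm (?X y))\<^sup>2)"
      unfolding eq using True P(4) iy iW iyW by simp
    have "(\<integral>y. (norm (?X y))\<^sup>2 \<partial>\<rho>) = (norm p)\<^sup>2 + q\<^sup>2 + c\<^sup>2 * (\<integral>y. (norm (W y))\<^sup>2 \<partial>\<rho>)"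
      unfolding eq using True P(4) iy iW iyW yp Wp yy orth(2) by (simp add: prob_space)
    moreover define I where "I = (\<integral>y. (norm (W y))\<^sup>2 \<partial>\<rho>)"
    ultimately have X: "(\<integral>\<^sup>+y. ennreal ((norm (?X y))\<^sup>2) \<partial>\<rho>) = ennreal ((norm p)\<^sup>2 + q\<^sup>2 + c\<^sup>2 * I)"
      using nn_integral_eq_integral[OF iX] by simp
    have I: "(\<integral>\<^sup>+y. ennreal ((norm (W y))\<^sup>2) \<partial>\<rho>) = ennreal I" "0 \<le> I"
      using nn_integral_eq_integral[OF True] by (simp_all add: I_def)
    have "ennreal ((norm p)\<^sup>2 + q\<^sup>2 + c\<^sup>2 * I) / ennreal (2 * c\<^sup>2) = ennreal (((norm p)\<^sup>2 + q\<^sup>2 + c\<^sup>2 * I) / (2 * c\<^sup>2))"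
      using c2 I(2) by (intro divide_ennreal) auto
    also have "((norm p)\<^sup>2 + q\<^sup>2 + c\<^sup>2 * I) / (2 * c\<^sup>2) = ((norm p)\<^sup>2 + q\<^sup>2) / (2 * c\<^sup>2) + I / 2"
      using c by (simp add: add_divide_distrib)
    also have "ennreal (((norm p)\<^sup>2 + q\<^sup>2) / (2 * c\<^sup>2) + I / 2) =
        ennreal ((norm p)\<^sup>2 + q\<^sup>2) / ennreal (2 * c\<^sup>2) + ennreal I / 2"
      using divide_ennreal[of "(norm p)\<^sup>2 + q\<^sup>2" "2 * c\<^sup>2"] divide_ennreal[OF I(2), of 2] c2 I(2)
      by (subst ennreal_plus) auto
    finally show ?thesis unfolding half X I(1) power2_abs .
  next
    case False
    have square_integrable: "integrable \<rho> (\<lambda>y. (norm (f y))\<^sup>2)"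
      if "(\<integral>\<^sup>+y. ennreal ((norm (f y))\<^sup>2) \<partial>\<rho>) \<noteq> \<infinity>" "f \<in> borel_measurable \<rho>" for f :: "'a \<Rightarrow> 'a"
    proof (rule integrableI_nonneg)
      show "(\<lambda>y. (norm (f y))\<^sup>2) \<in> borel_measurable \<rho>" using that(2) by measurable
      show "(\<integral>\<^sup>+y. ennreal ((norm (f y))\<^sup>2) \<partial>\<rho>) < \<infinity>" using that(1) unfolding infinity_ennreal_def less_top .
    qed (intro AE_I2 zero_le_power2)
    have W_top: "(\<integral>\<^sup>+y. ennreal ((norm (W y))\<^sup>2) \<partial>\<rho>) = \<infinity>"
      using False square_integrable[OF _ Wm] by metis
    \<comment> \<open>W is the transported field minus square integrable terms, divided by c; so if
      W is not square integrable, neither is that field.\<close>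
    have le: "(norm (W y))\<^sup>2 \<le> (3 / c\<^sup>2) * ((norm (?X y))\<^sup>2 + (norm p)\<^sup>2 + q\<^sup>2 * (norm y)\<^sup>2)" for y
    proof -
      have "(norm (c *\<^sub>R W y))\<^sup>2 = (norm (?X y - p - q *\<^sub>R y))\<^sup>2" by (rule arg_cong[where f="\<lambda>v. (norm v)\<^sup>2"]) simp
      also have "\<dots> \<le> 3 * ((norm (?X y))\<^sup>2 + (norm p)\<^sup>2 + (norm (q *\<^sub>R y))\<^sup>2)"
        by (rule norm_diff_diff_power2_le)
      finally have "c\<^sup>2 * (norm (W y))\<^sup>2 \<le> 3 * ((norm (?X y))\<^sup>2 + (norm p)\<^sup>2 + q\<^sup>2 * (norm y)\<^sup>2)"
        by (simp only: norm_scaleR power_mult_distrib power2_abs)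
      then have "(norm (W y))\<^sup>2 \<le> 3 * ((norm (?X y))\<^sup>2 + (norm p)\<^sup>2 + q\<^sup>2 * (norm y)\<^sup>2) / c\<^sup>2"
        by (simp only: pos_le_divide_eq[OF c2] mult.commute)
      then show ?thesis by (simp only: times_divide_eq_left)
    qed
    have "(\<integral>\<^sup>+y. ennreal ((norm (?X y))\<^sup>2) \<partial>\<rho>) = \<infinity>"
    proof (rule ccontr)
      assume "(\<integral>\<^sup>+y. ennreal ((norm (?X y))\<^sup>2) \<partial>\<rho>) \<noteq> \<infinity>"
      then have "integrable \<rho> (\<lambda>y. (norm (?X y))\<^sup>2)"
        by (rule square_integrable) measurable
      then have "integrable \<rho> (\<lambda>y. (3 / c\<^sup>2) * ((norm (?X y))\<^sup>2 + (norm p)\<^sup>2 + q\<^sup>2 * (norm y)\<^sup>2))"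
        using P(4) by (intro integrable_mult_right Bochner_Integration.integrable_add integrable_const)
      then have "integrable \<rho> (\<lambda>y. (norm (W y))\<^sup>2)"
      proof (rule Bochner_Integration.integrable_bound)
        show "(\<lambda>y. (norm (W y))\<^sup>2) \<in> borel_measurable \<rho>" by measurable
        show "AE y in \<rho>. norm ((norm (W y))\<^sup>2) \<le> norm ((3 / c\<^sup>2) * ((norm (?X y))\<^sup>2 + (norm p)\<^sup>2 + q\<^sup>2 * (norm y)\<^sup>2))"
          unfolding real_norm_def abs_power2 by (intro AE_I2 order_trans[OF le abs_ge_self])
      qed
      with False show False ..
    qed
    then show ?thesis unfolding half W_top using ennreal_top_divide by (simp add: divide_ennreal_def ennreal_top_mult)
  qed
qed

section \<open>Finiteness of the cost\<close>

text \<open>h is the density of the law of Y under f Q with respect to its law under Q, that is, the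
  conditional expectation of f given Y as a function of the value of Y. Nonnegativity of f makes f Q
  a measure.\<close>

lemma RN_factor:
  fixes f :: "'c \<Rightarrow> real"
  assumes "prob_space Q" and Y: "Y \<in> Q \<rightarrow>\<^sub>M N" and f: "integrable Q f" "\<And>\<omega>. 0 \<le> f \<omega>"
  obtains h where "h \<in> borel_measurable N" "integrable (distr Q N Y) h"
    "\<And>g :: 'b \<Rightarrow> real. g \<in> borel_measurable N \<Longrightarrow> (\<integral>\<omega>. g (Y \<omega>) * f \<omega> \<partial>Q) = (\<integral>p. g p * h p \<partial>distr Q N Y)"
proof -
  interpret Q: prob_space Q by fact
  let ?\<eta> = "distr Q N Y" let ?L = "distr (density Q (\<lambda>\<omega>. ennreal (f \<omega>))) N Y"
  interpret \<eta>: prob_space ?\<eta> by (rule Q.prob_space_distr[OF Y])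
  have fm [measurable]: "f \<in> borel_measurable Q" using f(1) by simp
  have Y' [measurable]: "Y \<in> density Q (\<lambda>\<omega>. ennreal (f \<omega>)) \<rightarrow>\<^sub>M N" using Y by simp
  have "finite_measure (density Q (\<lambda>\<omega>. ennreal (f \<omega>)))"
    using f by (intro finite_measureI) (simp add: emeasure_density nn_integral_eq_integral cong: nn_integral_cong)
  then have fin: "finite_measure ?L" by (rule finite_measure.finite_measure_distr[OF _ Y'])
  have ac: "absolutely_continuous ?\<eta> ?L"
    unfolding absolutely_continuous_def
  proof
    fix S assume "S \<in> null_sets ?\<eta>"
    then have S: "S \<in> sets N" "emeasure Q (Y -` S \<inter> space Q) = 0"
      using Y by (auto simp: null_sets_def emeasure_distr)
    then have "Y -` S \<inter> space Q \<in> null_sets Q" using Y by (auto intro: measurable_sets)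
    then have "AE \<omega> in Q. \<omega> \<notin> Y -` S \<inter> space Q" by (rule AE_not_in)
    then have "(\<integral>\<^sup>+\<omega>. ennreal (f \<omega>) * indicator (Y -` S \<inter> space Q) \<omega> \<partial>Q) = (\<integral>\<^sup>+\<omega>. 0 \<partial>Q)"
      by (intro nn_integral_cong_AE) (auto simp: indicator_def)
    then show "S \<in> null_sets ?L"
      using S(1) measurable_sets[OF Y S(1)] by (auto simp: null_sets_def emeasure_distr[OF Y'] emeasure_density)
  qed
  have sets: "sets ?L = sets ?\<eta>" by simp
  obtain D where D: "D \<in> borel_measurable ?\<eta>" "AE x in ?\<eta>. RN_deriv ?\<eta> ?L x = ennreal (D x)"
    "AE x in ?L. 0 < D x" "\<And>x. 0 \<le> D x"
    by (rule \<eta>.real_RN_deriv[OF fin ac sets]) (rule that)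
  have Dm [measurable]: "D \<in> borel_measurable N" using D(1) by simp
  have "density ?\<eta> (\<lambda>x. ennreal (D x)) = density ?\<eta> (RN_deriv ?\<eta> ?L)"
    using D by (intro density_cong) auto
  also have "\<dots> = ?L" using ac by (intro \<eta>.density_RN_deriv) auto
  finally have dens: "density ?\<eta> (\<lambda>x. ennreal (D x)) = ?L" .
  show ?thesis
  proof (rule that[OF Dm])
    have "(\<integral>\<^sup>+x. ennreal (D x) \<partial>?\<eta>) = emeasure (density ?\<eta> (\<lambda>x. ennreal (D x))) (space N)"
      by (subst emeasure_density) (auto intro!: nn_integral_cong)
    also have "\<dots> < \<infinity>" unfolding dens using finite_measure.emeasure_finite[OF fin] by (simp add: less_top)
    finally show "integrable ?\<eta> D" using D by (intro integrableI_nonneg) auto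
    fix g :: "'b \<Rightarrow> real" assume g [measurable]: "g \<in> borel_measurable N"
    have "(\<integral>p. g p * D p \<partial>?\<eta>) = (\<integral>p. g p \<partial>density ?\<eta> (\<lambda>x. ennreal (D x)))"
      using D by (subst integral_density) (auto simp: mult.commute)
    also have "\<dots> = (\<integral>\<omega>. g (Y \<omega>) \<partial>density Q (\<lambda>\<omega>. ennreal (f \<omega>)))"
      unfolding dens by (rule integral_distr[OF Y' g])
    also have "\<dots> = (\<integral>\<omega>. g (Y \<omega>) * f \<omega> \<partial>Q)"
      using f Y by (subst integral_density) (auto simp: mult.commute intro!: measurable_compose[OF Y g])
    finally show "(\<integral>\<omega>. g (Y \<omega>) * f \<omega> \<partial>Q) = (\<integral>p. g p * D p \<partial>?\<eta>)" by simp
  qed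
qed

lemma integrable_bounded_mult:
  fixes f g :: "'c \<Rightarrow> real"
  assumes "integrable M f" "g \<in> borel_measurable M" "\<And>x. \<bar>g x\<bar> \<le> C"
  shows "integrable M (\<lambda>x. g x * f x)"
proof (rule Bochner_Integration.integrable_bound)
  show "integrable M (\<lambda>x. C * f x)" using assms(1) by simp
  show "(\<lambda>x. g x * f x) \<in> borel_measurable M" using assms by measurable
  show "AE x in M. norm (g x * f x) \<le> norm (C * f x)"
    using assms(3) by (intro AE_I2) (auto simp: abs_mult intro!: mult_right_mono order_trans[OF assms(3) abs_ge_self])
qed

text \<open>Positive and negative parts are treated separately; boundedness of g makes both
  integrals finite, so that they may be subtracted.\<close>

lemma conditional_expectation_factor:
  fixes f :: "'c \<Rightarrow> real"
  assumes Q: "prob_space Q" and Y: "Y \<in> Q \<rightarrow>\<^sub>M N" and f: "integrable Q f"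
  shows "\<exists>h. h \<in> borel_measurable N \<and> integrable (distr Q N Y) h \<and>
    (\<forall>(g :: 'b \<Rightarrow> real) C. g \<in> borel_measurable N \<longrightarrow> (\<forall>p. \<bar>g p\<bar> \<le> C) \<longrightarrow>
      (\<integral>\<omega>. g (Y \<omega>) * f \<omega> \<partial>Q) = (\<integral>p. g p * h p \<partial>distr Q N Y))"
proof -
  have fp: "integrable Q (\<lambda>\<omega>. max 0 (f \<omega>))" "integrable Q (\<lambda>\<omega>. max 0 (- f \<omega>))"
    using f by (auto intro!: Bochner_Integration.integrable_max)
  obtain h1 where h1: "h1 \<in> borel_measurable N" "integrable (distr Q N Y) h1"
    "\<And>g :: 'b \<Rightarrow> real. g \<in> borel_measurable N \<Longrightarrow> (\<integral>\<omega>. g (Y \<omega>) * max 0 (f \<omega>) \<partial>Q) = (\<integral>p. g p * h1 p \<partial>distr Q N Y)"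
    by (rule RN_factor[OF Q Y fp(1)]) (auto intro: that)
  obtain h2 where h2: "h2 \<in> borel_measurable N" "integrable (distr Q N Y) h2"
    "\<And>g :: 'b \<Rightarrow> real. g \<in> borel_measurable N \<Longrightarrow> (\<integral>\<omega>. g (Y \<omega>) * max 0 (- f \<omega>) \<partial>Q) = (\<integral>p. g p * h2 p \<partial>distr Q N Y)"
    by (rule RN_factor[OF Q Y fp(2)]) (auto intro: that)
  show ?thesis
  proof (intro exI[of _ "\<lambda>p. h1 p - h2 p"] conjI allI impI)
    fix g :: "'b \<Rightarrow> real" and C assume g: "g \<in> borel_measurable N" and "\<forall>p. \<bar>g p\<bar> \<le> C"
    then have C: "\<And>p. \<bar>g p\<bar> \<le> C" by simp
    have gY: "(\<lambda>\<omega>. g (Y \<omega>)) \<in> borel_measurable Q" by (rule measurable_compose[OF Y g])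
    have gd: "g \<in> borel_measurable (distr Q N Y)" using g by simp
    have "(\<integral>\<omega>. g (Y \<omega>) * f \<omega> \<partial>Q) = (\<integral>\<omega>. g (Y \<omega>) * max 0 (f \<omega>) - g (Y \<omega>) * max 0 (- f \<omega>) \<partial>Q)"
      by (intro Bochner_Integration.integral_cong) (auto simp: max_def)
    also have "\<dots> = (\<integral>\<omega>. g (Y \<omega>) * max 0 (f \<omega>) \<partial>Q) - (\<integral>\<omega>. g (Y \<omega>) * max 0 (- f \<omega>) \<partial>Q)"
      by (intro Bochner_Integration.integral_diff integrable_bounded_mult[OF fp(1) gY C] integrable_bounded_mult[OF fp(2) gY C])
    also have "\<dots> = (\<integral>p. g p * h1 p \<partial>distr Q N Y) - (\<integral>p. g p * h2 p \<partial>distr Q N Y)"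
      using h1(3)[OF g] h2(3)[OF g] by simp
    also have "\<dots> = (\<integral>p. g p * h1 p - g p * h2 p \<partial>distr Q N Y)"
      by (intro Bochner_Integration.integral_diff[symmetric] integrable_bounded_mult[OF h1(2) gd C] integrable_bounded_mult[OF h2(2) gd C])
    finally show "(\<integral>\<omega>. g (Y \<omega>) * f \<omega> \<partial>Q) = (\<integral>p. g p * (h1 p - h2 p) \<partial>distr Q N Y)"
      by (simp add: right_diff_distrib)
  qed (use h1(1,2) h2(1,2) in auto)
qed

text \<open>
  \<open>V\<close> is the conditional expectation of \<open>\<Delta>\<close> given \<open>Y\<close>, as a function of the value of \<open>Y\<close>.
\<close>

lemma conditional_velocity:
  fixes \<Delta> :: "'c \<Rightarrow> 'a::euclidean_space"
  assumes Q: "prob_space Q" and Y: "Y \<in> Q \<rightarrow>\<^sub>M N"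
    and \<Delta>m: "\<Delta> \<in> borel_measurable Q" and \<Delta>: "integrable Q (\<lambda>\<omega>. (norm (\<Delta> \<omega>))\<^sup>2)"
  obtains V :: "'b \<Rightarrow> 'a" where "V \<in> borel_measurable N" "integrable (distr Q N Y) V"
    "(\<integral>\<^sup>+p. ennreal ((norm (V p))\<^sup>2) \<partial>distr Q N Y) \<le> ennreal (\<integral>\<omega>. (norm (\<Delta> \<omega>))\<^sup>2 \<partial>Q)"
    "\<forall>g C. g \<in> borel_measurable N \<longrightarrow> (\<forall>p. norm (g p) \<le> C) \<longrightarrow>
      (\<integral>\<omega>. g (Y \<omega>) \<bullet> \<Delta> \<omega> \<partial>Q) = (\<integral>p. g p \<bullet> V p \<partial>distr Q N Y)"
proof -
  interpret prob_space Q by fact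
  let ?\<eta> = "distr Q N Y"
  note [measurable] = Y \<Delta>m
  have i\<Delta>: "integrable Q \<Delta>"
  proof (rule Bochner_Integration.integrable_bound)
    show "integrable Q (\<lambda>\<omega>. 1 + (norm (\<Delta> \<omega>))\<^sup>2)" using \<Delta> by simp
    show "AE \<omega> in Q. norm (\<Delta> \<omega>) \<le> norm (1 + (norm (\<Delta> \<omega>))\<^sup>2)" by (intro AE_I2) (simp add: norm_le_1_plus_power2)
  qed measurable
  have "\<exists>h. h \<in> borel_measurable N \<and> integrable ?\<eta> h \<and> (\<forall>(g :: 'b \<Rightarrow> real) C. g \<in> borel_measurable N \<longrightarrow> (\<forall>p. \<bar>g p\<bar> \<le> C) \<longrightarrow>
      (\<integral>\<omega>. g (Y \<omega>) * (\<Delta> \<omega> \<bullet> b) \<partial>Q) = (\<integral>p. g p * h p \<partial>?\<eta>))" for b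
  proof -
    have f: "integrable Q (\<lambda>\<omega>. \<Delta> \<omega> \<bullet> b)" using i\<Delta> by simp
    show ?thesis by (rule conditional_expectation_factor[OF Q Y f])
  qed
  then obtain h where h': "\<And>b. h b \<in> borel_measurable N \<and> integrable ?\<eta> (h b) \<and> (\<forall>(g :: 'b \<Rightarrow> real) C. g \<in> borel_measurable N \<longrightarrow> (\<forall>p. \<bar>g p\<bar> \<le> C) \<longrightarrow>
      (\<integral>\<omega>. g (Y \<omega>) * (\<Delta> \<omega> \<bullet> b) \<partial>Q) = (\<integral>p. g p * h b p \<partial>?\<eta>))"
    by metis
  have h: "h b \<in> borel_measurable N" "integrable ?\<eta> (h b)" for b using h' by auto
  have h3: "(\<integral>\<omega>. g (Y \<omega>) * (\<Delta> \<omega> \<bullet> b) \<partial>Q) = (\<integral>p. g p * h b p \<partial>?\<eta>)"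
    if "g \<in> borel_measurable N" "\<And>p. \<bar>g p\<bar> \<le> C" for g :: "'b \<Rightarrow> real" and C b
    using h'[of b] that by blast
  define V where "V p = (\<Sum>b\<in>Basis. h b p *\<^sub>R b)" for p
  have Vm [measurable]: "V \<in> borel_measurable N" unfolding V_def[abs_def] using h(1) by measurable
  have Vb: "V p \<bullet> b = h b p" if "b \<in> Basis" for p b
    using that by (simp add: V_def inner_sum_left inner_Basis if_distrib sum.delta cong: if_cong)
  have Vi: "integrable ?\<eta> V" unfolding V_def[abs_def] using h(2) by simp
  have gi: "integrable Q (\<lambda>\<omega>. g (Y \<omega>) \<bullet> \<Delta> \<omega>)" "integrable ?\<eta> (\<lambda>p. g p \<bullet> V p)"
      "(\<integral>\<omega>. g (Y \<omega>) \<bullet> \<Delta> \<omega> \<partial>Q) = (\<integral>p. g p \<bullet> V p \<partial>?\<eta>)"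
    if gm [measurable]: "g \<in> borel_measurable N" and C: "\<And>p. norm (g p) \<le> C" for g :: "'b \<Rightarrow> 'a" and C
  proof -
    have gb: "\<bar>g p \<bullet> b\<bar> \<le> C" if "b \<in> Basis" for p b
      using Basis_le_norm[OF that, of "g p"] C[of p] by simp
    have 1: "integrable Q (\<lambda>\<omega>. (g (Y \<omega>) \<bullet> b) * (\<Delta> \<omega> \<bullet> b))" if "b \<in> Basis" for b
      using i\<Delta> gb[OF that] by (intro integrable_bounded_mult[where C=C]) auto
    have 2: "integrable ?\<eta> (\<lambda>p. (g p \<bullet> b) * h b p)" if "b \<in> Basis" for b
      using h(2) gb[OF that] by (intro integrable_bounded_mult[where C=C]) auto
    have e1: "g (Y \<omega>) \<bullet> \<Delta> \<omega> = (\<Sum>b\<in>Basis. (g (Y \<omega>) \<bullet> b) * (\<Delta> \<omega> \<bullet> b))" for \<omega>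
      by (rule euclidean_inner)
    have e2: "g p \<bullet> V p = (\<Sum>b\<in>Basis. (g p \<bullet> b) * h b p)" for p
      by (subst euclidean_inner) (auto simp: Vb intro!: sum.cong)
    show "integrable Q (\<lambda>\<omega>. g (Y \<omega>) \<bullet> \<Delta> \<omega>)" "integrable ?\<eta> (\<lambda>p. g p \<bullet> V p)"
      unfolding e1 e2 using 1 2 by auto
    have "(\<integral>\<omega>. (g (Y \<omega>) \<bullet> b) * (\<Delta> \<omega> \<bullet> b) \<partial>Q) = (\<integral>p. (g p \<bullet> b) * h b p \<partial>?\<eta>)" if "b \<in> Basis" for b
      by (rule h3[OF _ gb[OF that]]) measurable
    then show "(\<integral>\<omega>. g (Y \<omega>) \<bullet> \<Delta> \<omega> \<partial>Q) = (\<integral>p. g p \<bullet> V p \<partial>?\<eta>)"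
      unfolding e1 e2 using 1 2 by simp
  qed
  define E where "E = (\<integral>\<omega>. (norm (\<Delta> \<omega>))\<^sup>2 \<partial>Q)"
  \<comment> \<open>Truncated where its norm exceeds n, V is itself a bounded test field. Testing
    with it bounds the truncated energy by that of \<Delta>, and Fatou's lemma removes the
    truncation.\<close>
  define G where "G n p = (if norm (V p) \<le> real n then V p else 0)" for n p
  have Gm [measurable]: "G n \<in> borel_measurable N" for n unfolding G_def[abs_def] by measurable
  have GC: "norm (G n p) \<le> real n" for n p by (simp add: G_def)
  have Gle: "(\<integral>\<^sup>+p. ennreal ((norm (G n p))\<^sup>2) \<partial>?\<eta>) \<le> ennreal E" for n
  proof -
    have GV: "G n p \<bullet> V p = (norm (G n p))\<^sup>2" for p by (simp add: G_def power2_norm_eq_inner)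
    have iG: "integrable ?\<eta> (\<lambda>p. (norm (G n p))\<^sup>2)" using gi(2)[OF Gm GC, of n] by (simp add: GV)
    have iGY: "integrable Q (\<lambda>\<omega>. (norm (G n (Y \<omega>)))\<^sup>2)" using integrable_distr[OF Y iG] .
    have "(\<integral>p. (norm (G n p))\<^sup>2 \<partial>?\<eta>) = (\<integral>\<omega>. G n (Y \<omega>) \<bullet> \<Delta> \<omega> \<partial>Q)"
      using gi(3)[OF Gm GC, of n] by (simp add: GV)
    \<comment> \<open>Young's inequality; the half that involves G is absorbed on the left, as both
      integrals of |G|^2 agree by the change of variables.\<close>
    also have "\<dots> \<le> (\<integral>\<omega>. (norm (G n (Y \<omega>)))\<^sup>2 / 2 + (norm (\<Delta> \<omega>))\<^sup>2 / 2 \<partial>Q)"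
    proof (rule integral_mono[OF gi(1)[OF Gm GC]])
      show "integrable Q (\<lambda>\<omega>. (norm (G n (Y \<omega>)))\<^sup>2 / 2 + (norm (\<Delta> \<omega>))\<^sup>2 / 2)" using iGY \<Delta> by simp
      show "G n (Y \<omega>) \<bullet> \<Delta> \<omega> \<le> (norm (G n (Y \<omega>)))\<^sup>2 / 2 + (norm (\<Delta> \<omega>))\<^sup>2 / 2" for \<omega>
        using norm_cauchy_schwarz[of "G n (Y \<omega>)" "\<Delta> \<omega>"] sum_squares_bound[of "norm (G n (Y \<omega>))" "norm (\<Delta> \<omega>)"] by linarith
    qed
    also have "\<dots> = (\<integral>\<omega>. (norm (G n (Y \<omega>)))\<^sup>2 \<partial>Q) / 2 + E / 2" using iGY \<Delta> by (simp add: E_def)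
    also have "(\<integral>\<omega>. (norm (G n (Y \<omega>)))\<^sup>2 \<partial>Q) = (\<integral>p. (norm (G n p))\<^sup>2 \<partial>?\<eta>)"
      by (rule integral_distr[OF Y, symmetric]) measurable
    finally have "(\<integral>p. (norm (G n p))\<^sup>2 \<partial>?\<eta>) \<le> E" by simp
    then show ?thesis using nn_integral_eq_integral[OF iG] by (simp add: ennreal_leI)
  qed
  have "(\<integral>\<^sup>+p. ennreal ((norm (V p))\<^sup>2) \<partial>?\<eta>) = (\<integral>\<^sup>+p. liminf (\<lambda>n. ennreal ((norm (G n p))\<^sup>2)) \<partial>?\<eta>)"
  proof (rule nn_integral_cong)
    fix p
    have "\<forall>\<^sub>F n in sequentially. ennreal ((norm (G n p))\<^sup>2) = ennreal ((norm (V p))\<^sup>2)"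
      using eventually_ge_at_top[of "nat \<lceil>norm (V p)\<rceil>"]
    proof eventually_elim
      case (elim n)
      then have "norm (V p) \<le> real n" by linarith
      then show ?case by (simp add: G_def)
    qed
    then show "ennreal ((norm (V p))\<^sup>2) = liminf (\<lambda>n. ennreal ((norm (G n p))\<^sup>2))"
      by (intro lim_imp_Liminf[symmetric] tendsto_eventually) auto
  qed
  also have "\<dots> \<le> liminf (\<lambda>n. \<integral>\<^sup>+p. ennreal ((norm (G n p))\<^sup>2) \<partial>?\<eta>)"
    by (rule nn_integral_liminf) measurable
  also have "\<dots> \<le> liminf (\<lambda>n. ennreal E)" by (intro Liminf_mono always_eventually allI Gle)
  also have "\<dots> = ennreal E" by (simp add: Liminf_const)
  finally have "(\<integral>\<^sup>+p. ennreal ((norm (V p))\<^sup>2) \<partial>?\<eta>) \<le> ennreal E" .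
  from that[OF Vm Vi this[unfolded E_def]] gi(3) show ?thesis by blast
qed

section \<open>The independent coupling and its linear interpolation\<close>

lemma integrable_pair_component:
  fixes f :: "'b \<Rightarrow> real"
  assumes "prob_space M" "prob_space N" and f: "integrable M f" "\<And>x. 0 \<le> f x"
  shows "integrable (M \<Otimes>\<^sub>M N) (\<lambda>\<omega>. f (fst \<omega>))" "integrable (N \<Otimes>\<^sub>M M) (\<lambda>\<omega>. f (snd \<omega>))"
proof -
  interpret M: prob_space M by fact
  interpret N: prob_space N by fact
  have fin: "(\<integral>\<^sup>+x. ennreal (f x) \<partial>M) < \<infinity>" using f by (simp add: nn_integral_eq_integral)
  show "integrable (M \<Otimes>\<^sub>M N) (\<lambda>\<omega>. f (fst \<omega>))"
  proof (rule integrableI_nonneg)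
    show m [measurable]: "(\<lambda>\<omega>. f (fst \<omega>)) \<in> borel_measurable (M \<Otimes>\<^sub>M N)" using f(1) by measurable
    have "(\<integral>\<^sup>+\<omega>. ennreal (f (fst \<omega>)) \<partial>(M \<Otimes>\<^sub>M N)) = (\<integral>\<^sup>+x. (\<integral>\<^sup>+y. ennreal (f x) \<partial>N) \<partial>M)"
      by (subst N.nn_integral_fst[symmetric]) auto
    then show "(\<integral>\<^sup>+\<omega>. ennreal (f (fst \<omega>)) \<partial>(M \<Otimes>\<^sub>M N)) < \<infinity>" using fin by (simp add: N.emeasure_space_1)
  qed (simp add: f)
  show "integrable (N \<Otimes>\<^sub>M M) (\<lambda>\<omega>. f (snd \<omega>))"
  proof (rule integrableI_nonneg)
    show m [measurable]: "(\<lambda>\<omega>. f (snd \<omega>)) \<in> borel_measurable (N \<Otimes>\<^sub>M M)" using f(1) by measurable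
    have "(\<integral>\<^sup>+\<omega>. ennreal (f (snd \<omega>)) \<partial>(N \<Otimes>\<^sub>M M)) = (\<integral>\<^sup>+y. (\<integral>\<^sup>+x. ennreal (f x) \<partial>M) \<partial>N)"
      by (subst M.nn_integral_fst[symmetric]) auto
    then show "(\<integral>\<^sup>+\<omega>. ennreal (f (snd \<omega>)) \<partial>(N \<Otimes>\<^sub>M M)) < \<infinity>" using fin by (simp add: N.emeasure_space_1)
  qed (simp add: f)
qed

lemma distr_pair_snd:
  assumes "prob_space M" "prob_space N"
  shows "distr (M \<Otimes>\<^sub>M N) N snd = N"
proof (rule measure_eqI)
  interpret M: prob_space M by fact
  interpret N: prob_space N by fact
  fix A assume "A \<in> sets (distr (M \<Otimes>\<^sub>M N) N snd)"
  then have A: "A \<in> sets N" by simp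
  have "snd -` A \<inter> space (M \<Otimes>\<^sub>M N) = space M \<times> A"
    using sets.sets_into_space[OF A] by (auto simp: space_pair_measure)
  then show "emeasure (distr (M \<Otimes>\<^sub>M N) N snd) A = emeasure N A"
    using A by (simp add: emeasure_distr N.emeasure_pair_measure_Times M.emeasure_space_1)
qed simp

locale independent_coupling =
  fixes \<mu>\<^sub>0 \<mu>\<^sub>1 :: "'a::euclidean_space measure"
  assumes \<mu>\<^sub>0: "\<mu>\<^sub>0 \<in> P2" and \<mu>\<^sub>1: "\<mu>\<^sub>1 \<in> P2"
begin

abbreviation "\<pi> \<equiv> \<mu>\<^sub>0 \<Otimes>\<^sub>M \<mu>\<^sub>1"

definition X :: "real \<Rightarrow> 'a \<times> 'a \<Rightarrow> 'a" where "X t \<omega> = (1 - t) *\<^sub>R fst \<omega> + t *\<^sub>R snd \<omega>"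

definition \<rho> :: "real \<Rightarrow> 'a measure" where "\<rho> t = distr \<pi> borel (X t)"

sublocale M0: prob_space \<mu>\<^sub>0 by (rule P2D(1)[OF \<mu>\<^sub>0])
sublocale M1: prob_space \<mu>\<^sub>1 by (rule P2D(1)[OF \<mu>\<^sub>1])
sublocale pair_prob_space \<mu>\<^sub>0 \<mu>\<^sub>1 ..

lemma sets_\<pi> [measurable_cong]: "sets \<pi> = sets (borel \<Otimes>\<^sub>M borel)"
  by (intro sets_pair_measure_cong P2D(2) \<mu>\<^sub>0 \<mu>\<^sub>1)

lemma X_measurable [measurable]: "X t \<in> borel_measurable \<pi>"
  unfolding X_def[abs_def] by measurable

lemma square_integrable: "integrable \<pi> (\<lambda>\<omega>. (norm (fst \<omega>))\<^sup>2)" "integrable \<pi> (\<lambda>\<omega>. (norm (snd \<omega>))\<^sup>2)"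
  by (intro integrable_pair_component M0.prob_space_axioms M1.prob_space_axioms P2D(4) \<mu>\<^sub>0 \<mu>\<^sub>1 zero_le_power2)+

lemma norm_combination_power2:
  fixes x y p :: 'a
  shows "(norm (a *\<^sub>R x + b *\<^sub>R y - p))\<^sup>2 \<le> 3 * (a\<^sup>2 * (norm x)\<^sup>2 + b\<^sup>2 * (norm y)\<^sup>2 + (norm p)\<^sup>2)"
  using norm_diff_diff_power2_le[of "a *\<^sub>R x" "- b *\<^sub>R y" p] by (simp add: power_mult_distrib)

lemma X_square_integrable: "integrable \<pi> (\<lambda>\<omega>. (norm (X t \<omega> - p))\<^sup>2)"
proof (rule Bochner_Integration.integrable_bound)
  show "integrable \<pi> (\<lambda>\<omega>. 3 * ((1 - t)\<^sup>2 * (norm (fst \<omega>))\<^sup>2 + t\<^sup>2 * (norm (snd \<omega>))\<^sup>2 + (norm p)\<^sup>2))"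
    using square_integrable by simp
  show "AE \<omega> in \<pi>. norm ((norm (X t \<omega> - p))\<^sup>2) \<le> norm (3 * ((1 - t)\<^sup>2 * (norm (fst \<omega>))\<^sup>2 + t\<^sup>2 * (norm (snd \<omega>))\<^sup>2 + (norm p)\<^sup>2))"
    unfolding real_norm_def abs_power2 X_def by (intro AE_I2 order_trans[OF norm_combination_power2 abs_ge_self])
qed measurable

lemma \<rho>_P2: "\<rho> t \<in> P2"
proof -
  have "integrable (\<rho> t) (\<lambda>x. (norm x)\<^sup>2)"
    unfolding \<rho>_def using X_square_integrable[of t 0] by (subst integrable_distr_eq) auto
  then show ?thesis unfolding P2_def \<rho>_def using prob_space_distr[OF X_measurable] by simp
qed

lemma \<rho>_endpoints: "\<rho> 0 = \<mu>\<^sub>0" "\<rho> 1 = \<mu>\<^sub>1"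
proof -
  have "distr \<pi> borel fst = distr \<pi> \<mu>\<^sub>0 fst" "distr \<pi> borel snd = distr \<pi> \<mu>\<^sub>1 snd"
    using P2D(2)[OF \<mu>\<^sub>0] P2D(2)[OF \<mu>\<^sub>1] by (intro distr_cong; simp)+
  moreover have "X 0 = fst" "X 1 = snd" by (auto simp: X_def)
  ultimately show "\<rho> 0 = \<mu>\<^sub>0" "\<rho> 1 = \<mu>\<^sub>1"
    using M1.distr_pair_fst distr_pair_snd[OF M0.prob_space_axioms M1.prob_space_axioms] by (simp_all add: \<rho>_def)
qed

lemma \<rho>_weak:
  fixes f :: "'a \<Rightarrow> real"
  assumes f: "continuous_on UNIV f" "bounded (range f)"
  shows "continuous_on UNIV (\<lambda>t. \<integral>x. f x \<partial>\<rho> t)"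
proof (rule continuous_on_sequentiallyI)
  fix u :: "nat \<Rightarrow> real" and s assume u: "u \<longlonglongrightarrow> s"
  have fm [measurable]: "f \<in> borel_measurable borel" using f(1) by (rule borel_measurable_continuous_onI)
  obtain C where C: "\<And>x. \<bar>f x\<bar> \<le> C" using f(2) unfolding bounded_iff by auto
  have eq: "(\<integral>x. f x \<partial>\<rho> t) = (\<integral>\<omega>. f (X t \<omega>) \<partial>\<pi>)" for t
    unfolding \<rho>_def by (rule integral_distr) measurable
  show "(\<lambda>n. \<integral>x. f x \<partial>\<rho> (u n)) \<longlonglongrightarrow> (\<integral>x. f x \<partial>\<rho> s)"
    unfolding eq
  proof (rule integral_dominated_convergence[where w="\<lambda>_. C"])
    show "AE \<omega> in \<pi>. (\<lambda>n. f (X (u n) \<omega>)) \<longlonglongrightarrow> f (X s \<omega>)"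
    proof (rule AE_I2)
      fix \<omega>
      have "isCont f (X s \<omega>)" using f(1) by (simp add: continuous_on_eq_continuous_at)
      moreover have "(\<lambda>n. X (u n) \<omega>) \<longlonglongrightarrow> X s \<omega>" unfolding X_def by (intro tendsto_intros u)
      ultimately show "(\<lambda>n. f (X (u n) \<omega>)) \<longlonglongrightarrow> f (X s \<omega>)" by (rule isCont_tendsto_compose)
    qed
  qed (use C in auto)
qed

text \<open>For fixed x the interpolant is an affine image of y with factor t, and by independence y
  still has law \<open>\<mu>\<^sub>1\<close>; its mean square distance from any p is at least t^2
  times the variance. Integration over x with p the barycenter of the interpolated measure gives the
  first bound, and exchanging the roles the second.\<close>

lemma var_\<rho>_ge: "t\<^sup>2 * var \<mu>\<^sub>1 \<le> var (\<rho> t)" "(1 - t)\<^sup>2 * var \<mu>\<^sub>0 \<le> var (\<rho> t)"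
proof -
  define p where "p = barycenter (\<rho> t)"
  have slice: "l\<^sup>2 * var \<mu> \<le> (\<integral>y. (norm (a + l *\<^sub>R y - p))\<^sup>2 \<partial>\<mu>)" if \<mu>: "\<mu> \<in> P2" for \<mu> and a :: 'a and l
  proof -
    have m [measurable]: "(\<lambda>y. a + l *\<^sub>R y) \<in> borel_measurable \<mu>" using P2D(2)[OF \<mu>] by (simp cong: measurable_cong_sets)
    have "(\<integral>y. (norm (a + l *\<^sub>R y - p))\<^sup>2 \<partial>\<mu>) = (\<integral>z. (norm (z - p))\<^sup>2 \<partial>distr \<mu> borel (\<lambda>y. a + l *\<^sub>R y))"
      by (rule integral_distr[symmetric]) measurable
    then show ?thesis
      using integral_norm_diff_power2[OF affine_push_forward(1)[OF \<mu>], of a l p] affine_push_forward(3)[OF \<mu>, of a l]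
      by simp
  qed
  have v: "var (\<rho> t) = (\<integral>\<omega>. (norm (X t \<omega> - p))\<^sup>2 \<partial>\<pi>)"
  proof -
    have "(\<integral>x. (norm (x - p))\<^sup>2 \<partial>\<rho> t) = (\<integral>\<omega>. (norm (X t \<omega> - p))\<^sup>2 \<partial>\<pi>)"
      unfolding \<rho>_def by (rule integral_distr) measurable
    then show ?thesis by (simp only: var_def p_def)
  qed
  have i: "integrable \<pi> (\<lambda>\<omega>. (norm (X t \<omega> - p))\<^sup>2)" by (rule X_square_integrable)
  then have i': "integrable \<pi> (\<lambda>(x, y). (norm (X t (x, y) - p))\<^sup>2)" by (simp add: case_prod_beta')
  have "t\<^sup>2 * var \<mu>\<^sub>1 \<le> (\<integral>x. (\<integral>y. (norm (X t (x, y) - p))\<^sup>2 \<partial>\<mu>\<^sub>1) \<partial>\<mu>\<^sub>0)"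
    by (rule M0.integral_ge_const[OF integrable_fst'[OF i]], rule AE_I2)
      (use slice[OF \<mu>\<^sub>1, of t] in \<open>simp add: X_def\<close>)
  also have "\<dots> = var (\<rho> t)" unfolding v by (rule integral_fst'[OF i])
  finally show "t\<^sup>2 * var \<mu>\<^sub>1 \<le> var (\<rho> t)" .
  have "(1 - t)\<^sup>2 * var \<mu>\<^sub>0 \<le> (\<integral>y. (\<integral>x. (norm (X t (x, y) - p))\<^sup>2 \<partial>\<mu>\<^sub>0) \<partial>\<mu>\<^sub>1)"
    by (rule M1.integral_ge_const[OF integrable_snd[OF i']], rule AE_I2)
      (use slice[OF \<mu>\<^sub>0, of "1 - t"] in \<open>simp add: X_def add.commute\<close>)
  also have "\<dots> = var (\<rho> t)" unfolding v using integral_snd[OF i'] by (simp add: case_prod_beta')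
  finally show "(1 - t)\<^sup>2 * var \<mu>\<^sub>0 \<le> var (\<rho> t)" .
qed

abbreviation "unit_time \<equiv> density lborel (indicator {0..1::real} :: real \<Rightarrow> ennreal)"

lemma prob_space_unit_time: "prob_space unit_time"
  by (rule prob_spaceI) (simp add: emeasure_density)

abbreviation "Q \<equiv> unit_time \<Otimes>\<^sub>M \<pi>"

text \<open>Time is made a uniform random variable and kept as a component: a single conditional
  expectation given (t, X_t) yields a velocity jointly measurable in t and x.\<close>

definition Y :: "real \<times> 'a \<times> 'a \<Rightarrow> real \<times> 'a" where "Y q = (fst q, X (fst q) (snd q))"

lemma Y_measurable [measurable]: "Y \<in> Q \<rightarrow>\<^sub>M borel \<Otimes>\<^sub>M borel"
  unfolding Y_def[abs_def] X_def by measurable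

abbreviation "\<eta> \<equiv> distr Q (borel \<Otimes>\<^sub>M borel) Y"

lemma section_\<rho>_measurable:
  assumes "F \<in> borel_measurable (borel \<Otimes>\<^sub>M borel)"
  shows "(\<lambda>x. F (t, x)) \<in> borel_measurable borel"
  using measurable_compose[OF measurable_Pair1' assms, of t] by simp

lemma nn_integral_\<eta>:
  assumes F: "F \<in> borel_measurable (borel \<Otimes>\<^sub>M borel)"
  shows "(\<integral>\<^sup>+p. F p \<partial>\<eta>) = (\<integral>\<^sup>+t\<in>{0..1}. (\<integral>\<^sup>+x. F (t, x) \<partial>\<rho> t) \<partial>lborel)"
proof -
  have FY [measurable]: "(\<lambda>q. F (Y q)) \<in> borel_measurable Q" by (rule measurable_compose[OF Y_measurable F])
  have FY': "(\<lambda>q. F (Y q)) \<in> borel_measurable (lborel \<Otimes>\<^sub>M \<pi>)"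
    using FY by (simp cong: measurable_cong_sets sets_pair_measure_cong)
  have "(\<integral>\<^sup>+p. F p \<partial>\<eta>) = (\<integral>\<^sup>+q. F (Y q) \<partial>Q)" by (rule nn_integral_distr[OF Y_measurable]) (use F in simp)
  also have "\<dots> = (\<integral>\<^sup>+t. (\<integral>\<^sup>+\<omega>. F (Y (t, \<omega>)) \<partial>\<pi>) \<partial>unit_time)" by (rule nn_integral_fst[symmetric]) simp
  also have "\<dots> = (\<integral>\<^sup>+t. indicator {0..1} t * (\<integral>\<^sup>+\<omega>. F (Y (t, \<omega>)) \<partial>\<pi>) \<partial>lborel)"
    using borel_measurable_nn_integral_fst[OF FY'] by (intro nn_integral_density) auto
  also have "\<dots> = (\<integral>\<^sup>+t\<in>{0..1}. (\<integral>\<^sup>+x. F (t, x) \<partial>\<rho> t) \<partial>lborel)"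
    unfolding \<rho>_def using section_\<rho>_measurable[OF F]
    by (intro nn_integral_cong) (simp add: nn_integral_distr Y_def mult.commute)
  finally show ?thesis .
qed

lemma integral_\<eta>:
  fixes F :: "real \<times> 'a \<Rightarrow> real"
  assumes F: "F \<in> borel_measurable (borel \<Otimes>\<^sub>M borel)" and i: "integrable \<eta> F"
  shows "(\<integral>p. F p \<partial>\<eta>) = (LINT t:{0..1}|lborel. (\<integral>x. F (t, x) \<partial>\<rho> t))"
proof -
  interpret T: prob_space unit_time by (rule prob_space_unit_time)
  interpret TP: pair_sigma_finite unit_time \<pi> ..
  have FY: "integrable Q (\<lambda>q. F (Y q))" by (rule integrable_distr[OF Y_measurable i])
  have FY': "(\<lambda>q. F (Y q)) \<in> borel_measurable (lborel \<Otimes>\<^sub>M \<pi>)"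
    using borel_measurable_integrable[OF FY] by (simp cong: measurable_cong_sets sets_pair_measure_cong)
  have "(\<integral>p. F p \<partial>\<eta>) = (\<integral>q. F (Y q) \<partial>Q)" by (rule integral_distr[OF Y_measurable F])
  also have "\<dots> = (\<integral>t. (\<integral>\<omega>. F (Y (t, \<omega>)) \<partial>\<pi>) \<partial>unit_time)" by (rule TP.integral_fst'[OF FY, symmetric])
  also have "\<dots> = (\<integral>t. indicator {0..1} t *\<^sub>R (\<integral>\<omega>. F (Y (t, \<omega>)) \<partial>\<pi>) \<partial>lborel)"
  proof -
    have [measurable]: "(\<lambda>t. \<integral>\<omega>. F (Y (t, \<omega>)) \<partial>\<pi>) \<in> borel_measurable lborel"
      using borel_measurable_lebesgue_integral[of "\<lambda>t \<omega>. F (Y (t, \<omega>))" lborel] FY' by (simp add: case_prod_beta')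
    have "unit_time = density lborel (\<lambda>t. ennreal (indicator {0..1} t))"
      by (rule density_cong) (auto simp: indicator_def)
    then show ?thesis by (simp add: integral_density)
  qed
  also have "\<dots> = (LINT t:{0..1}|lborel. (\<integral>x. F (t, x) \<partial>\<rho> t))"
    unfolding \<rho>_def set_lebesgue_integral_def using section_\<rho>_measurable[OF F]
    by (intro Bochner_Integration.integral_cong) (simp_all add: integral_distr Y_def)
  finally show ?thesis .
qed

text \<open>The integrand is the time derivative of \<phi> along a straight line, and \<phi>
  vanishes at the times 0 and 1.\<close>

lemma integral_time_derivative:
  assumes \<phi>: "\<phi> \<in> test_functions"
  shows "(LINT t:{0..1}|lborel. frechet_derivative \<phi> (at (t, X t \<omega>)) (1, snd \<omega> - fst \<omega>)) = 0"
proof -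
  have sm: "smooth \<phi>" and supp: "closure {p. \<phi> p \<noteq> 0} \<subseteq> {0<..<1} \<times> UNIV"
    using \<phi> by (auto simp: test_functions_def smooth_def)
  have zero: "\<phi> (t, x) = 0" if "t \<notin> {0<..<1}" for t x
    using supp closure_subset[of "{p. \<phi> p \<noteq> 0}"] that by auto
  let ?f = "\<lambda>t. frechet_derivative \<phi> (at (t, X t \<omega>)) (1, snd \<omega> - fst \<omega>)"
  have "(\<integral>t. ?f t * indicator {0..1} t \<partial>lborel) = \<phi> (1, X 1 \<omega>) - \<phi> (0, X 0 \<omega>)"
  proof (rule integral_FTC_Icc_real)
    fix t :: real
    have "((\<lambda>t. (t, X t \<omega>)) has_derivative (\<lambda>h. (h, h *\<^sub>R (snd \<omega> - fst \<omega>)))) (at t)"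
      unfolding X_def by (auto intro!: derivative_eq_intros simp: algebra_simps)
    from has_derivative_compose[OF this smooth_has_derivative[OF sm]]
    have "((\<lambda>t. \<phi> (t, X t \<omega>)) has_derivative (\<lambda>h. frechet_derivative \<phi> (at (t, X t \<omega>)) (h, h *\<^sub>R (snd \<omega> - fst \<omega>)))) (at t)" .
    moreover have "frechet_derivative \<phi> (at (t, X t \<omega>)) (h, h *\<^sub>R (snd \<omega> - fst \<omega>)) = ?f t * h" for h
      using linear_scale[OF linear_frechet_derivative[OF smooth_differentiable[OF sm]], of "(t, X t \<omega>)" h "(1, snd \<omega> - fst \<omega>)"]
      by simp
    ultimately show "((\<lambda>t. \<phi> (t, X t \<omega>)) has_real_derivative ?f t) (at t)"
      by (simp add: has_field_derivative_def)
    have "continuous_on UNIV ?f"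
      unfolding X_def by (intro smooth_derivative_continuous_on[OF sm] continuous_intros)
    then show "isCont ?f t" by (simp add: continuous_on_eq_continuous_at)
  qed simp
  then show ?thesis by (simp add: zero set_lebesgue_integral_def mult.commute)
qed

text \<open>Conditioning does not increase the energy, and the derivative of \<phi> has the same
  average along V as along the straight lines, because its spatial gradient at (t, X_t) is a bounded
  test field for the conditional expectation.\<close>

theorem CE_finite_energy:
  obtains V where "(\<rho>, V) \<in> CE \<mu>\<^sub>0 \<mu>\<^sub>1"
    "(\<integral>\<^sup>+t\<in>{0..1}. (\<integral>\<^sup>+x. ennreal ((norm (V t x))\<^sup>2) \<partial>\<rho> t) \<partial>lborel) < \<infinity>"
    "(\<lambda>t. \<integral>\<^sup>+x. ennreal ((norm (V t x))\<^sup>2) \<partial>\<rho> t) \<in> borel_measurable borel"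
proof -
  interpret T: prob_space unit_time by (rule prob_space_unit_time)
  interpret TP: pair_prob_space unit_time \<pi> ..
  let ?\<Delta> = "\<lambda>q::real \<times> 'a \<times> 'a. snd (snd q) - fst (snd q)"
  have \<Delta>: "integrable Q (\<lambda>q. (norm (?\<Delta> q))\<^sup>2)"
  proof (rule integrable_pair_component(2)[OF prob_space_axioms prob_space_unit_time])
    show "integrable \<pi> (\<lambda>\<omega>. (norm (snd \<omega> - fst \<omega>))\<^sup>2)"
    proof (rule Bochner_Integration.integrable_bound)
      show "integrable \<pi> (\<lambda>\<omega>. 3 * ((-1)\<^sup>2 * (norm (fst \<omega>))\<^sup>2 + 1\<^sup>2 * (norm (snd \<omega>))\<^sup>2 + (norm (0::'a))\<^sup>2))"
        using square_integrable by simp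
      have "(norm (snd \<omega> - fst \<omega>))\<^sup>2 \<le> 3 * ((-1)\<^sup>2 * (norm (fst \<omega>))\<^sup>2 + 1\<^sup>2 * (norm (snd \<omega>))\<^sup>2 + (norm (0::'a))\<^sup>2)" for \<omega> :: "'a \<times> 'a"
        using norm_combination_power2[of "-1" "fst \<omega>" 1 "snd \<omega>" 0] by simp
      then show "AE \<omega> in \<pi>. norm ((norm (snd \<omega> - fst \<omega>))\<^sup>2) \<le>
          norm (3 * ((-1)\<^sup>2 * (norm (fst \<omega>))\<^sup>2 + 1\<^sup>2 * (norm (snd \<omega>))\<^sup>2 + (norm (0::'a))\<^sup>2))"
        unfolding real_norm_def abs_power2 by (intro AE_I2 order_trans[OF _ abs_ge_self])
    qed measurable
  qed simp
  have \<Delta>m [measurable]: "?\<Delta> \<in> borel_measurable Q" by measurable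
  obtain W :: "real \<times> 'a \<Rightarrow> 'a" where W: "W \<in> borel_measurable (borel \<Otimes>\<^sub>M borel)" "integrable \<eta> W"
    "(\<integral>\<^sup>+p. ennreal ((norm (W p))\<^sup>2) \<partial>\<eta>) \<le> ennreal (\<integral>q. (norm (?\<Delta> q))\<^sup>2 \<partial>Q)"
    "\<forall>g C. g \<in> borel_measurable (borel \<Otimes>\<^sub>M borel) \<longrightarrow> (\<forall>p. norm (g p) \<le> C) \<longrightarrow>
      (\<integral>q. g (Y q) \<bullet> ?\<Delta> q \<partial>Q) = (\<integral>p. g p \<bullet> W p \<partial>\<eta>)"
    by (rule conditional_velocity[OF TP.prob_space_axioms Y_measurable \<Delta>m \<Delta>]) (rule that)
  note [measurable] = W(1)
  have i\<Delta>: "integrable Q ?\<Delta>"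
  proof (rule Bochner_Integration.integrable_bound)
    show "integrable Q (\<lambda>q. 1 + (norm (?\<Delta> q))\<^sup>2)" using \<Delta> by simp
    show "AE q in Q. norm (?\<Delta> q) \<le> norm (1 + (norm (?\<Delta> q))\<^sup>2)" by (intro AE_I2) (simp add: norm_le_1_plus_power2)
  qed measurable
  define V where "V t x = W (t, x)" for t x
  interpret R: ce_curve \<rho> V
  proof
    show "(\<lambda>(t, x). V t x) \<in> borel_measurable (borel \<Otimes>\<^sub>M borel)" by (simp add: V_def)
    fix \<phi> :: "real \<times> 'a \<Rightarrow> real" assume \<phi>: "\<phi> \<in> test_functions"
    have sm: "smooth \<phi>" and cpt: "compact (closure {p. \<phi> p \<noteq> 0})"
      using \<phi> by (auto simp: test_functions_def smooth_def)
    obtain C where C: "C \<ge> 0" "\<And>x v. \<bar>frechet_derivative \<phi> (at x) v\<bar> \<le> C * norm v"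
      by (rule smooth_derivative_bound[OF sm cpt]) (rule that)
    define d where "d p = frechet_derivative \<phi> (at p) (1, 0)" for p
    \<comment> \<open>The spatial gradient as a vector, so that its pairing with the velocity has
      the form in which the conditional expectation can be exchanged for \<Delta>.\<close>
    define g where "g p = (\<Sum>b\<in>Basis. frechet_derivative \<phi> (at p) (0, b) *\<^sub>R b)" for p
    have lin: "linear (frechet_derivative \<phi> (at p))" for p
      by (rule linear_frechet_derivative[OF smooth_differentiable[OF sm]])
    have split: "frechet_derivative \<phi> (at p) (1, v) = d p + g p \<bullet> v" for p v
    proof -
      have "(1::real, v) = (1, 0) + (\<Sum>b\<in>Basis. (v \<bullet> b) *\<^sub>R (0, b))"
        by (simp add: prod_eq_iff fst_sum snd_sum euclidean_representation)
      then have "frechet_derivative \<phi> (at p) (1, v) = frechet_derivative \<phi> (at p) ((1, 0) + (\<Sum>b\<in>Basis. (v \<bullet> b) *\<^sub>R (0, b)))"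
        by (rule arg_cong)
      also have "\<dots> = d p + (\<Sum>b\<in>Basis. (v \<bullet> b) * frechet_derivative \<phi> (at p) (0, b))"
        unfolding linear_add[OF lin] linear_sum[OF lin] linear_scale[OF lin] d_def by simp
      also have "(\<Sum>b\<in>Basis. (v \<bullet> b) * frechet_derivative \<phi> (at p) (0, b)) = g p \<bullet> v"
        by (simp add: g_def inner_commute[of _ v] inner_sum_right mult.commute)
      finally show ?thesis .
    qed
    have m: "(\<lambda>p. frechet_derivative \<phi> (at p) w) \<in> borel_measurable (borel \<Otimes>\<^sub>M borel)" for w
      by (rule smooth_derivative_measurable[OF sm]) (simp_all add: borel_prod)
    have dm [measurable]: "d \<in> borel_measurable (borel \<Otimes>\<^sub>M borel)" unfolding d_def[abs_def] by (rule m)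
    have gm [measurable]: "g \<in> borel_measurable (borel \<Otimes>\<^sub>M borel)"
      unfolding g_def[abs_def] by (intro borel_measurable_sum borel_measurable_scaleR m borel_measurable_const)
    have dC: "\<bar>d p\<bar> \<le> C" for p using C(2)[of p "(1, 0)"] by (simp add: d_def norm_Pair)
    define C' where "C' = real DIM('a) * C"
    have gC: "norm (g p) \<le> C'" for p
    proof -
      have "norm (g p) \<le> (\<Sum>b\<in>Basis. norm (frechet_derivative \<phi> (at p) (0, b) *\<^sub>R b))"
        unfolding g_def by (rule norm_sum)
      also have "\<dots> \<le> (\<Sum>b\<in>(Basis::'a set). C)"
      proof (rule sum_mono)
        fix b :: 'a assume "b \<in> Basis"
        then show "norm (frechet_derivative \<phi> (at p) (0, b) *\<^sub>R b) \<le> C"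
          using C(2)[of p "(0, b)"] by (simp add: norm_Pair)
      qed
      finally show ?thesis by (simp add: C'_def)
    qed
    interpret E: prob_space \<eta> by (rule TP.prob_space_distr[OF Y_measurable])
    have gi: "integrable M (\<lambda>p. h p \<bullet> w p)"
      if "integrable M w" "h \<in> borel_measurable M" "\<And>p. norm (h p) \<le> C'" for M and h w :: "'z \<Rightarrow> 'a"
    proof (rule Bochner_Integration.integrable_bound)
      show "integrable M (\<lambda>p. C' * norm (w p))" using that(1) by simp
      show "(\<lambda>p. h p \<bullet> w p) \<in> borel_measurable M" using that by measurable
      have "\<bar>h p \<bullet> w p\<bar> \<le> C' * norm (w p)" for p
        using order_trans[OF Cauchy_Schwarz_ineq2 mult_right_mono[OF that(3) norm_ge_zero]] .
      then show "AE p in M. norm (h p \<bullet> w p) \<le> norm (C' * norm (w p))"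
        unfolding real_norm_def by (intro AE_I2 order_trans[OF _ abs_ge_self])
    qed
    have di: "integrable \<eta> d" using dC by (intro E.integrable_const_bound[where B=C]) auto
    have dYi: "integrable Q (\<lambda>q. d (Y q))" by (rule integrable_distr[OF Y_measurable di])
    have gWi: "integrable \<eta> (\<lambda>p. g p \<bullet> W p)" by (rule gi[OF W(2) _ gC]) simp
    have gYi: "integrable Q (\<lambda>q. g (Y q) \<bullet> ?\<Delta> q)" by (rule gi[OF i\<Delta> _ gC]) measurable
    have "(LINT t:{0..1}|lborel. (\<integral>x. frechet_derivative \<phi> (at (t, x)) (1, V t x) \<partial>\<rho> t)) = (\<integral>p. d p + g p \<bullet> W p \<partial>\<eta>)"
      using di gWi by (subst integral_\<eta>) (simp_all add: split V_def)
    also have "\<dots> = (\<integral>p. d p \<partial>\<eta>) + (\<integral>p. g p \<bullet> W p \<partial>\<eta>)" using di gWi by simp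
    also have "\<dots> = (\<integral>q. d (Y q) \<partial>Q) + (\<integral>q. g (Y q) \<bullet> ?\<Delta> q \<partial>Q)"
      using W(4)[rule_format, OF gm gC] by (simp only: integral_distr[OF Y_measurable dm])
    also have "\<dots> = (\<integral>q. d (Y q) + g (Y q) \<bullet> ?\<Delta> q \<partial>Q)" using dYi gYi by simp
    also have "\<dots> = (\<integral>\<omega>. (\<integral>t. d (Y (t, \<omega>)) + g (Y (t, \<omega>)) \<bullet> ?\<Delta> (t, \<omega>) \<partial>unit_time) \<partial>\<pi>)"
      using TP.integral_snd[of "\<lambda>t \<omega>. d (Y (t, \<omega>)) + g (Y (t, \<omega>)) \<bullet> ?\<Delta> (t, \<omega>)"] dYi gYi by (simp add: case_prod_beta')
    also have "\<dots> = (\<integral>\<omega>. 0 \<partial>\<pi>)"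
    proof (rule Bochner_Integration.integral_cong[OF refl])
      fix \<omega> :: "'a \<times> 'a"
      let ?f = "\<lambda>t. frechet_derivative \<phi> (at (t, X t \<omega>)) (1, snd \<omega> - fst \<omega>)"
      have "continuous_on UNIV ?f"
        unfolding X_def by (intro smooth_derivative_continuous_on[OF sm] continuous_intros)
      then have [measurable]: "?f \<in> borel_measurable lborel" by (simp add: borel_measurable_continuous_onI)
      have "unit_time = density lborel (\<lambda>t. ennreal (indicator {0..1} t))"
        by (rule density_cong) (auto simp: indicator_def)
      then have "(\<integral>t. ?f t \<partial>unit_time) = (LINT t:{0..1}|lborel. ?f t)"
        by (simp add: integral_density set_lebesgue_integral_def)
      then show "(\<integral>t. d (Y (t, \<omega>)) + g (Y (t, \<omega>)) \<bullet> ?\<Delta> (t, \<omega>) \<partial>unit_time) = 0"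
        using integral_time_derivative[OF \<phi>, of \<omega>] by (simp add: split[symmetric] Y_def)
    qed
    finally show "(LINT t:{0..1}|lborel. (\<integral>x. frechet_derivative \<phi> (at (t, x)) (1, V t x) \<partial>\<rho> t)) = 0" by simp
  qed (use \<rho>_P2 \<rho>_weak in auto)
  have "(\<integral>\<^sup>+t\<in>{0..1}. (\<integral>\<^sup>+x. ennreal (norm (V t x)) \<partial>\<rho> t) \<partial>lborel) = (\<integral>\<^sup>+p. ennreal (norm (W p)) \<partial>\<eta>)"
    by (subst nn_integral_\<eta>) (simp_all add: V_def)
  then have speed: "(\<integral>\<^sup>+t\<in>{0..1}. (\<integral>\<^sup>+x. ennreal (norm (V t x)) \<partial>\<rho> t) \<partial>lborel) < \<infinity>"
    using W(2) by (simp add: integrable_iff_bounded)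
  have "(\<integral>\<^sup>+t\<in>{0..1}. (\<integral>\<^sup>+x. ennreal ((norm (V t x))\<^sup>2) \<partial>\<rho> t) \<partial>lborel) = (\<integral>\<^sup>+p. ennreal ((norm (W p))\<^sup>2) \<partial>\<eta>)"
    by (subst nn_integral_\<eta>) (simp_all add: V_def)
  also have "\<dots> < \<infinity>" using W(3) by (rule le_less_trans) simp
  finally have energy: "(\<integral>\<^sup>+t\<in>{0..1}. (\<integral>\<^sup>+x. ennreal ((norm (V t x))\<^sup>2) \<partial>\<rho> t) \<partial>lborel) < \<infinity>" .
  have "(\<lambda>t. \<integral>\<^sup>+x. ennreal ((norm (V t x))\<^sup>2) \<partial>\<rho> t) \<in> borel_measurable borel"
    by (rule R.nn_integral_K_measurable) measurable
  from that[OF _ energy this] show ?thesis using R.CE_of_ce_curve[OF speed] by (simp add: \<rho>_endpoints)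
qed

end

theorem W_var_finite:
  fixes \<mu>\<^sub>0 \<mu>\<^sub>1 :: "'a::euclidean_space measure"
  assumes "\<mu>\<^sub>0 \<in> P2" "\<mu>\<^sub>1 \<in> P2" "var \<mu>\<^sub>0 > 0" "var \<mu>\<^sub>1 > 0"
  shows "W_var \<mu>\<^sub>0 \<mu>\<^sub>1 < \<infinity>"
proof -
  interpret independent_coupling \<mu>\<^sub>0 \<mu>\<^sub>1 using assms(1,2) by unfold_locales
  obtain V where V: "(\<rho>, V) \<in> CE \<mu>\<^sub>0 \<mu>\<^sub>1"
    "(\<integral>\<^sup>+t\<in>{0..1}. (\<integral>\<^sup>+x. ennreal ((norm (V t x))\<^sup>2) \<partial>\<rho> t) \<partial>lborel) < \<infinity>"
    and [measurable]: "(\<lambda>t. \<integral>\<^sup>+x. ennreal ((norm (V t x))\<^sup>2) \<partial>\<rho> t) \<in> borel_measurable borel"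
    by (rule CE_finite_energy) (rule that)
  \<comment> \<open>At every time t or 1 - t is at least 1/2, and the square of 1/2 is the factor
    1/4.\<close>
  define c where "c = min (var \<mu>\<^sub>0) (var \<mu>\<^sub>1) / 4"
  have c: "c > 0" using assms by (simp add: c_def)
  have var_ge: "c \<le> var (\<rho> t)" for t
  proof -
    have "1 / 4 \<le> t\<^sup>2 \<or> 1 / 4 \<le> (1 - t)\<^sup>2"
    proof (cases "1 / 2 \<le> t")
      case True
      then have "(1 / 2)\<^sup>2 \<le> t\<^sup>2" by (intro power_mono) auto
      then show ?thesis by (simp add: power2_eq_square)
    next
      case False
      then have "(1 / 2)\<^sup>2 \<le> (1 - t)\<^sup>2" by (intro power_mono) auto
      then show ?thesis by (simp add: power2_eq_square)
    qed
    then have "1 / 4 * var \<mu>\<^sub>1 \<le> t\<^sup>2 * var \<mu>\<^sub>1 \<or> 1 / 4 * var \<mu>\<^sub>0 \<le> (1 - t)\<^sup>2 * var \<mu>\<^sub>0"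
      using mult_right_mono[of "1 / 4" "t\<^sup>2" "var \<mu>\<^sub>1"] mult_right_mono[of "1 / 4" "(1 - t)\<^sup>2" "var \<mu>\<^sub>0"] var_nonneg by blast
    then show ?thesis using var_\<rho>_ge[of t] unfolding c_def by linarith
  qed
  let ?N = "\<lambda>t. \<integral>\<^sup>+x. ennreal ((norm (V t x))\<^sup>2) \<partial>\<rho> t"
  let ?cost = "\<integral>\<^sup>+t\<in>{0..1}. ?N t / ennreal (2 * var (\<rho> t)) \<partial>lborel"
  have "?cost \<le> (\<integral>\<^sup>+t. (?N t * indicator {0..1} t) / ennreal (2 * c) \<partial>lborel)"
  proof (rule nn_integral_mono)
    fix t
    have "inverse (ennreal (2 * var (\<rho> t))) \<le> inverse (ennreal (2 * c))"
      using var_ge[of t] c by (simp add: inverse_ennreal ennreal_leI)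
    then have "?N t / ennreal (2 * var (\<rho> t)) \<le> ?N t / ennreal (2 * c)"
      unfolding divide_ennreal_def by (rule mult_left_mono) simp
    then show "?N t / ennreal (2 * var (\<rho> t)) * indicator {0..1} t \<le> (?N t * indicator {0..1} t) / ennreal (2 * c)"
      by (auto simp: indicator_def)
  qed
  also have "\<dots> = (\<integral>\<^sup>+t\<in>{0..1}. ?N t \<partial>lborel) / ennreal (2 * c)"
    by (rule nn_integral_divide) measurable
  also have "\<dots> < \<infinity>" using V(2) c by (cases "\<integral>\<^sup>+t\<in>{0..1}. ?N t \<partial>lborel") (auto simp: divide_ennreal)
  finally have fin: "?cost < \<infinity>" .
  have "(W_var \<mu>\<^sub>0 \<mu>\<^sub>1)\<^sup>2 \<le> ?cost"
    unfolding W_var_def esqrt_power2 by (rule INF_lower2[OF V(1)]) simp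
  then have "(W_var \<mu>\<^sub>0 \<mu>\<^sub>1)\<^sup>2 < \<infinity>" using fin by (rule le_less_trans)
  then show ?thesis by (auto simp: power2_eq_square ennreal_mult_less_top less_top)
qed

section \<open>Splitting of the cost\<close>

abbreviation energy :: "(real \<Rightarrow> 'a::euclidean_space measure) \<Rightarrow> (real \<Rightarrow> 'a \<Rightarrow> 'a) \<Rightarrow> ennreal" where
  "energy \<mu> V \<equiv> \<integral>\<^sup>+t\<in>{0..1}. (\<integral>\<^sup>+x. ennreal ((norm (V t x))\<^sup>2 / 2) \<partial>\<mu> t) \<partial>lborel"

abbreviation variance_cost :: "(real \<Rightarrow> 'a::euclidean_space measure) \<Rightarrow> (real \<Rightarrow> 'a \<Rightarrow> 'a) \<Rightarrow> ennreal" where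
  "variance_cost \<mu> V \<equiv> \<integral>\<^sup>+t\<in>{0..1}. (\<integral>\<^sup>+x. ennreal ((norm (V t x))\<^sup>2) \<partial>\<mu> t) / ennreal (2 * var (\<mu> t)) \<partial>lborel"

abbreviation moment_cost :: "(real \<Rightarrow> 'a::euclidean_space) \<Rightarrow> (real \<Rightarrow> real) \<Rightarrow> ennreal" where
  "moment_cost m \<sigma> \<equiv> \<integral>\<^sup>+t\<in>{0..1}. ennreal ((norm (vector_derivative m (at t within {0..1})))\<^sup>2
      + \<bar>vector_derivative \<sigma> (at t within {0..1})\<bar>\<^sup>2) / ennreal (2 * (\<sigma> t)\<^sup>2) \<partial>lborel"

lemma ac_density_vector_derivative:
  fixes f :: "real \<Rightarrow> 'b::euclidean_space"
  assumes "ac_density f g"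
  shows "AE t in lborel. t \<in> {0..1} \<longrightarrow> vector_derivative f (at t within {0..1}) = g t"
  using ac_density_has_vector_derivative[OF assms] AE_lborel_singleton[of 0] AE_lborel_singleton[of 1]
proof eventually_elim
  case (elim t)
  show ?case
  proof
    assume "t \<in> {0..1}"
    then have "t \<in> {0<..<1}" using elim by auto
    then have "(f has_vector_derivative g t) (at t within {0..1})"
      using elim(1) has_vector_derivative_at_within by blast
    then show "vector_derivative f (at t within {0..1}) = g t"
      using \<open>t \<in> {0..1}\<close> vector_derivative_within_cbox[of 0 1 t f "g t"] by (simp add: cbox_interval)
  qed
qed

lemma moment_cost_eq:
  assumes m: "ac_density m m'" and \<sigma>: "ac_density \<sigma> \<sigma>'"
  shows "moment_cost m \<sigma> = (\<integral>\<^sup>+t\<in>{0..1}. ennreal ((norm (m' t))\<^sup>2 + \<bar>\<sigma>' t\<bar>\<^sup>2) / ennreal (2 * (\<sigma> t)\<^sup>2) \<partial>lborel)"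
proof (rule nn_integral_cong_AE)
  show "AE t in lborel. ennreal ((norm (vector_derivative m (at t within {0..1})))\<^sup>2
      + \<bar>vector_derivative \<sigma> (at t within {0..1})\<bar>\<^sup>2) / ennreal (2 * (\<sigma> t)\<^sup>2) * indicator {0..1} t =
      ennreal ((norm (m' t))\<^sup>2 + \<bar>\<sigma>' t\<bar>\<^sup>2) / ennreal (2 * (\<sigma> t)\<^sup>2) * indicator {0..1} t"
    using ac_density_vector_derivative[OF m] ac_density_vector_derivative[OF \<sigma>]
    by eventually_elim (auto simp: indicator_def)
qed

text \<open>
  The identity behind both inequalities: the cost of a curve splits along
  \<open>V\<^sub>t (m\<^sub>t + \<sigma>\<^sub>t y) = m\<^sub>t' + \<sigma>\<^sub>t' y + \<sigma>\<^sub>t W\<^sub>t y\<close>, where \<open>W\<close> drives a normalized curve.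
\<close>

lemma (in moment_curve) energy_split:
  assumes normalized: "\<And>t. t \<in> {0..1} \<Longrightarrow> barycenter (\<mu> t) = 0" "\<And>t. t \<in> {0..1} \<Longrightarrow> var (\<mu> t) = 1"
    and m: "ac_density m m'" and \<sigma>: "ac_density \<sigma> \<sigma>'"
    and \<sigma>_cont: "continuous_on UNIV \<sigma>" and pos: "\<And>t. \<sigma> t > 0"
    and U: "\<And>t. U t \<in> borel_measurable borel" "\<And>t y. t \<in> {0..1} \<Longrightarrow> U t (m t + \<sigma> t *\<^sub>R y) = m' t + \<sigma>' t *\<^sub>R y + \<sigma> t *\<^sub>R V t y"
  shows "variance_cost (\<lambda>t. distr (\<mu> t) borel (\<lambda>y. m t + \<sigma> t *\<^sub>R y)) U = moment_cost m \<sigma> + energy \<mu> V"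
proof -
  have Vm [measurable]: "V t \<in> borel_measurable borel" for t
    using measurable_compose[OF measurable_Pair1' V_measurable, of t] by simp
  have [measurable]: "\<sigma> \<in> borel_measurable borel" "m' \<in> borel_measurable borel" "\<sigma>' \<in> borel_measurable borel"
    using \<sigma>_cont ac_densityD(2)[OF m] ac_densityD(2)[OF \<sigma>] by (auto intro: borel_measurable_continuous_onI)
  have [measurable]: "(\<lambda>t. \<integral>\<^sup>+y. ennreal ((norm (V t y))\<^sup>2 / 2) \<partial>\<mu> t) \<in> borel_measurable borel"
    by (rule nn_integral_K_measurable) measurable
  have velocity: "AE t in lborel. t \<in> {0..1} \<longrightarrow> (\<integral>x. V t x \<partial>\<mu> t) = 0 \<and> (\<integral>x. x \<bullet> V t x \<partial>\<mu> t) = 0"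
    by (rule normalized_velocity) (use normalized in auto)
  let ?M = "\<lambda>t. ennreal ((norm (m' t))\<^sup>2 + \<bar>\<sigma>' t\<bar>\<^sup>2) / ennreal (2 * (\<sigma> t)\<^sup>2)"
  let ?E = "\<lambda>t. \<integral>\<^sup>+y. ennreal ((norm (V t y))\<^sup>2 / 2) \<partial>\<mu> t"
  have "variance_cost (\<lambda>t. distr (\<mu> t) borel (\<lambda>y. m t + \<sigma> t *\<^sub>R y)) U =
      (\<integral>\<^sup>+t. ?M t * indicator {0..1} t + ?E t * indicator {0..1} t \<partial>lborel)"
  proof (rule nn_integral_cong_AE)
    show "AE t in lborel. (\<integral>\<^sup>+x. ennreal ((norm (U t x))\<^sup>2) \<partial>distr (\<mu> t) borel (\<lambda>y. m t + \<sigma> t *\<^sub>R y)) /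
        ennreal (2 * var (distr (\<mu> t) borel (\<lambda>y. m t + \<sigma> t *\<^sub>R y))) * indicator {0..1} t =
        ?M t * indicator {0..1} t + ?E t * indicator {0..1} t"
      using velocity
    proof eventually_elim
      case (elim t)
      show ?case
      proof (cases "t \<in> {0..1}")
        case True
        note [measurable] = U(1)[of t]
        have [measurable]: "(\<lambda>y. m t + \<sigma> t *\<^sub>R y) \<in> borel_measurable (\<mu> t)" by (rule borel_measurable_mu) measurable
        have "(\<integral>\<^sup>+x. ennreal ((norm (U t x))\<^sup>2) \<partial>distr (\<mu> t) borel (\<lambda>y. m t + \<sigma> t *\<^sub>R y)) =
            (\<integral>\<^sup>+y. ennreal ((norm (m' t + \<sigma>' t *\<^sub>R y + \<sigma> t *\<^sub>R V t y))\<^sup>2) \<partial>\<mu> t)"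
          using U(2)[OF True] by (subst nn_integral_distr) auto
        moreover have "var (distr (\<mu> t) borel (\<lambda>y. m t + \<sigma> t *\<^sub>R y)) = (\<sigma> t)\<^sup>2"
          using affine_push_forward(3)[OF P2] normalized(2)[OF True] by simp
        ultimately show ?thesis
          using affine_energy[OF P2 normalized[OF True] Vm, where c="\<sigma> t" and p="m' t" and q="\<sigma>' t"] elim True pos[of t] by simp
      qed simp
    qed
  qed
  also have "\<dots> = (\<integral>\<^sup>+t\<in>{0..1}. ?M t \<partial>lborel) + energy \<mu> V"
    by (rule nn_integral_add) measurable
  finally show ?thesis unfolding moment_cost_eq[OF m \<sigma>] .
qed

lemma energy_eq_half:
  assumes "(\<lambda>t. \<integral>\<^sup>+x. ennreal ((norm (V t x))\<^sup>2) \<partial>\<mu> t) \<in> borel_measurable borel"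
    and "\<And>t. t \<in> {0..1} \<Longrightarrow> V t \<in> borel_measurable (\<mu> t)"
  shows "energy \<mu> V = (\<integral>\<^sup>+t\<in>{0..1}. (\<integral>\<^sup>+x. ennreal ((norm (V t x))\<^sup>2) \<partial>\<mu> t) \<partial>lborel) / 2"
proof -
  note [measurable] = assms(1)
  have half: "ennreal ((norm v)\<^sup>2 / 2) = ennreal ((norm v)\<^sup>2) / 2" for v :: 'a
    using divide_ennreal[of "(norm v)\<^sup>2" 2] by simp
  have "energy \<mu> V = (\<integral>\<^sup>+t. ((\<integral>\<^sup>+x. ennreal ((norm (V t x))\<^sup>2) \<partial>\<mu> t) * indicator {0..1} t) / 2 \<partial>lborel)"
  proof (rule nn_integral_cong)
    fix t :: real
    have "(\<integral>\<^sup>+x. ennreal ((norm (V t x))\<^sup>2) / 2 \<partial>\<mu> t) = (\<integral>\<^sup>+x. ennreal ((norm (V t x))\<^sup>2) \<partial>\<mu> t) / 2" if "t \<in> {0..1}"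
      using assms(2)[OF that] by (intro nn_integral_divide) measurable
    then show "(\<integral>\<^sup>+x. ennreal ((norm (V t x))\<^sup>2 / 2) \<partial>\<mu> t) * indicator {0..1} t =
        ((\<integral>\<^sup>+x. ennreal ((norm (V t x))\<^sup>2) \<partial>\<mu> t) * indicator {0..1} t) / 2"
      unfolding half by (simp add: indicator_def)
  qed
  also have "\<dots> = (\<integral>\<^sup>+t\<in>{0..1}. (\<integral>\<^sup>+x. ennreal ((norm (V t x))\<^sup>2) \<partial>\<mu> t) \<partial>lborel) / 2"
    by (rule nn_integral_divide) measurable
  finally show ?thesis .
qed

lemma variance_normalization_eq:
  "variance_normalization \<mu> = distr \<mu> borel (\<lambda>x. (- (1 / sqrt (var \<mu>))) *\<^sub>R barycenter \<mu> + (1 / sqrt (var \<mu>)) *\<^sub>R x)"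
  unfolding variance_normalization_def by (simp add: scaleR_diff_right inverse_eq_divide)

lemma distr_affine_inverse:
  fixes \<mu> :: "'a::euclidean_space measure"
  assumes "sets \<mu> = sets borel" "s \<noteq> 0"
  shows "distr (distr \<mu> borel (\<lambda>x. (- (1 / s)) *\<^sub>R b + (1 / s) *\<^sub>R x)) borel (\<lambda>y. b + s *\<^sub>R y) = \<mu>"
proof -
  have "distr (distr \<mu> borel (\<lambda>x. (- (1 / s)) *\<^sub>R b + (1 / s) *\<^sub>R x)) borel (\<lambda>y. b + s *\<^sub>R y) =
      distr \<mu> borel ((\<lambda>y. b + s *\<^sub>R y) \<circ> (\<lambda>x. (- (1 / s)) *\<^sub>R b + (1 / s) *\<^sub>R x))"
    using assms(1) by (intro distr_distr) (simp_all cong: measurable_cong_sets)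
  also have "(\<lambda>y. b + s *\<^sub>R y) \<circ> (\<lambda>x. (- (1 / s)) *\<^sub>R b + (1 / s) *\<^sub>R x) = (\<lambda>x. x)"
    using assms(2) by (auto simp: fun_eq_iff scaleR_diff_right)
  also have "distr \<mu> borel (\<lambda>x. x) = \<mu>" using assms(1)[symmetric] by (rule distr_id2)
  finally show ?thesis .
qed

text \<open>If one of the two costs is infinite, nothing is to be shown. Otherwise the finite moment
  cost keeps sigma positive, so that the maps y -> m t + sigma t y are invertible, and the finite
  energy gives the speed bound that \<open>affine_push\<close> rests on.\<close>

lemma W_var_power2_le:
  assumes \<mu>: "\<mu>\<^sub>0 \<in> P2" "\<mu>\<^sub>1 \<in> P2" "var \<mu>\<^sub>0 > 0" "var \<mu>\<^sub>1 > 0"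
    and CE: "(\<rho>, W) \<in> CE (variance_normalization \<mu>\<^sub>0) (variance_normalization \<mu>\<^sub>1)"
    and normalized: "\<And>t. t \<in> {0..1} \<Longrightarrow> barycenter (\<rho> t) = 0" "\<And>t. t \<in> {0..1} \<Longrightarrow> var (\<rho> t) = 1"
    and AC: "absolutely_continuous_on_unit m" "absolutely_continuous_on_unit \<sigma>" "\<And>t. t \<in> {0..1} \<Longrightarrow> 0 \<le> \<sigma> t"
    and ends: "m 0 = barycenter \<mu>\<^sub>0" "m 1 = barycenter \<mu>\<^sub>1" "(\<sigma> 0)\<^sup>2 = var \<mu>\<^sub>0" "(\<sigma> 1)\<^sup>2 = var \<mu>\<^sub>1"
  shows "(W_var \<mu>\<^sub>0 \<mu>\<^sub>1)\<^sup>2 \<le> moment_cost m \<sigma> + energy \<rho> W"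
proof (cases "moment_cost m \<sigma> = \<infinity> \<or> energy \<rho> W = \<infinity>")
  case False
  obtain m' where m': "ac_density m m'" by (rule AC_density[OF AC(1)])
  obtain \<sigma>' where \<sigma>': "ac_density \<sigma> \<sigma>'" by (rule AC_density[OF AC(2)])
  have pos: "\<sigma> t > 0" if t: "t \<in> {0..1}" for t
  proof -
    define e where "e t = enn2real (ennreal ((norm (m' t))\<^sup>2 + \<bar>\<sigma>' t\<bar>\<^sup>2) / ennreal (2 * (\<sigma> t)\<^sup>2)) * indicator {0..1} t" for t
    have fin: "(\<integral>\<^sup>+t\<in>{0..1}. ennreal ((norm (m' t))\<^sup>2 + \<bar>\<sigma>' t\<bar>\<^sup>2) / ennreal (2 * (\<sigma> t)\<^sup>2) \<partial>lborel) \<noteq> \<infinity>"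
      using False moment_cost_eq[OF m' \<sigma>'] by simp
    have [measurable]: "(\<lambda>t. indicator {0..1} t * \<sigma> t) \<in> borel_measurable borel"
      using borel_measurable_continuous_on_indicator[OF _ AC_imp_continuous_on[OF AC(2)]] by simp
    \<comment> \<open>Continuity, and with it measurability, of \<sigma> is known on [0, 1] only;
      hence the second indicator.\<close>
    have eqi: "ennreal ((norm (m' t))\<^sup>2 + \<bar>\<sigma>' t\<bar>\<^sup>2) / ennreal (2 * (\<sigma> t)\<^sup>2) * indicator {0..1} t =
        ennreal ((norm (m' t))\<^sup>2 + \<bar>\<sigma>' t\<bar>\<^sup>2) / ennreal (2 * (indicator {0..1} t * \<sigma> t)\<^sup>2) * indicator {0..1} t" for t
      by (auto simp: indicator_def)
    note [measurable] = ac_densityD(2)[OF m'] ac_densityD(2)[OF \<sigma>']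
    have meas [measurable]: "(\<lambda>t. ennreal ((norm (m' t))\<^sup>2 + \<bar>\<sigma>' t\<bar>\<^sup>2) / ennreal (2 * (\<sigma> t)\<^sup>2) * indicator {0..1} t) \<in> borel_measurable borel"
      unfolding eqi by measurable
    have e_eq: "e t = enn2real (ennreal ((norm (m' t))\<^sup>2 + \<bar>\<sigma>' t\<bar>\<^sup>2) / ennreal (2 * (\<sigma> t)\<^sup>2) * indicator {0..1} t)" for t
      by (auto simp: e_def indicator_def)
    have e: "integrable lborel e" "0 \<le> e t" for t
    proof -
      show "0 \<le> e t" for t by (simp add: e_def)
      show "integrable lborel e"
      proof (rule integrableI_nonneg)
        show "e \<in> borel_measurable lborel" unfolding e_eq[abs_def] by measurable
        have "(\<integral>\<^sup>+t. ennreal (e t) \<partial>lborel) \<le>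
            (\<integral>\<^sup>+t\<in>{0..1}. ennreal ((norm (m' t))\<^sup>2 + \<bar>\<sigma>' t\<bar>\<^sup>2) / ennreal (2 * (\<sigma> t)\<^sup>2) \<partial>lborel)"
          unfolding e_eq by (intro nn_integral_mono ennreal_enn2real_le)
        also have "\<dots> < \<infinity>" using fin unfolding infinity_ennreal_def less_top .
        finally show "(\<integral>\<^sup>+t. ennreal (e t) \<partial>lborel) < \<infinity>" .
      qed (simp add: e_def)
    qed
    \<comment> \<open>The cost gives \<sigma>'^2 \<le> 2 e \<sigma>^2. As 2 e is at most (1 + 2
      e)^2, taking roots yields |\<sigma>'| \<le> (1 + 2 e) \<sigma> with a factor that is
      integrable on [0, 1].\<close>
    define c where "c t = indicator {0..1} t + 2 * e t" for t
    have i01: "integrable lborel (indicat_real {0..1::real})" by (rule integrable_real_indicator) auto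
    have c: "integrable lborel c" "0 \<le> c t" for t
      unfolding c_def[abs_def] using i01 e by auto
    have le: "AE r in lborel. r \<in> {0..1} \<longrightarrow> \<bar>\<sigma>' r\<bar> \<le> c r * \<sigma> r"
    proof -
      have "AE r in lborel. ennreal ((norm (m' r))\<^sup>2 + \<bar>\<sigma>' r\<bar>\<^sup>2) / ennreal (2 * (\<sigma> r)\<^sup>2) * indicator {0..1} r \<noteq> \<infinity>"
        using fin by (intro nn_integral_noteq_infinite) (use meas in auto)
      then show ?thesis
      proof eventually_elim
        case (elim r)
        show ?case
        proof
          assume r: "r \<in> {0..1}"
          have "ennreal ((norm (m' r))\<^sup>2 + \<bar>\<sigma>' r\<bar>\<^sup>2) = ennreal (e r * (2 * (\<sigma> r)\<^sup>2))"
            using ennreal_divide_cancel[of "ennreal ((norm (m' r))\<^sup>2 + \<bar>\<sigma>' r\<bar>\<^sup>2)" "2 * (\<sigma> r)\<^sup>2"] elim r by (simp add: e_def)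
          then have "(norm (m' r))\<^sup>2 + \<bar>\<sigma>' r\<bar>\<^sup>2 = e r * (2 * (\<sigma> r)\<^sup>2)"
            using e(2)[of r] by (subst (asm) ennreal_inj) auto
          then have "\<bar>\<sigma>' r\<bar>\<^sup>2 \<le> 2 * e r * (\<sigma> r)\<^sup>2" using zero_le_power2[of "norm (m' r)"] by linarith
          also have "\<dots> \<le> (c r * \<sigma> r)\<^sup>2"
          proof -
            have "c r = 1 + 2 * e r" using r by (simp add: c_def)
            then have "(c r)\<^sup>2 = 1 + 4 * e r + (2 * e r)\<^sup>2" by (simp add: power2_eq_square algebra_simps)
            then have "2 * e r \<le> (c r)\<^sup>2" using e(2)[of r] zero_le_power2[of "2 * e r"] by linarith
            from mult_right_mono[OF this zero_le_power2[of "\<sigma> r"]] show ?thesis unfolding power_mult_distrib .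
          qed
          finally show "\<bar>\<sigma>' r\<bar> \<le> c r * \<sigma> r"
            using AC(3)[OF r] c(2)[of r] by - (rule power2_le_imp_le, auto)
        qed
      qed
    qed
    have "\<sigma> 0 > 0" using AC(3)[of 0] ends(3) \<mu>(3) by (cases "\<sigma> 0 = 0") auto
    from AC_positive_of_log_derivative[OF \<sigma>' AC(3) this c le t] show ?thesis .
  qed
  \<comment> \<open>Curve, velocity and coefficients are extended constantly beyond [0, 1], since
    the locales speak of all real times.\<close>
  let ?\<rho> = "\<lambda>t. \<rho> (clamp01 t)" and ?W = "\<lambda>t. W (clamp01 t)"
  let ?m = "\<lambda>t. m (clamp01 t)" and ?\<sigma> = "\<lambda>t. \<sigma> (clamp01 t)"
  interpret R: ce_curve ?\<rho> ?W by (rule CE_imp_ce_curve[OF CE])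
  have Rm2: "R.m2 t \<le> 1" for t
    using var_eq[OF R.P2, of t] normalized[of "clamp01 t"] by (simp add: R.m2_def)
  have Nm: "(\<lambda>t. \<integral>\<^sup>+x. ennreal ((norm (?W t x))\<^sup>2) \<partial>?\<rho> t) \<in> borel_measurable borel"
    by (rule R.nn_integral_K_measurable) measurable
  have energy_clamp: "energy ?\<rho> ?W = energy \<rho> W"
    by (intro nn_integral_cong) (auto simp: indicator_def clamp01_eq)
  have "energy ?\<rho> ?W = (\<integral>\<^sup>+t\<in>{0..1}. (\<integral>\<^sup>+x. ennreal ((norm (?W t x))\<^sup>2) \<partial>?\<rho> t) \<partial>lborel) / 2"
    by (rule energy_eq_half[OF Nm R.measurable_section[OF R.V_measurable]])
  then have half: "energy \<rho> W = (\<integral>\<^sup>+t\<in>{0..1}. (\<integral>\<^sup>+x. ennreal ((norm (?W t x))\<^sup>2) \<partial>?\<rho> t) \<partial>lborel) / 2"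
    unfolding energy_clamp .
  have fin: "(\<integral>\<^sup>+t\<in>{0..1}. (\<integral>\<^sup>+x. ennreal ((norm (?W t x))\<^sup>2) \<partial>?\<rho> t) \<partial>lborel) < \<infinity>" (is "?I < _")
  proof (rule ccontr)
    assume "\<not> ?I < \<infinity>"
    then have "?I = \<top>" using less_top[of ?I] unfolding infinity_ennreal_def by blast
    with half have "energy \<rho> W = \<infinity>" by (simp only: ennreal_top_divide) simp
    with False show False by simp
  qed
  interpret R: moment_curve ?\<rho> ?W 1
  proof
    show "R.m2 t \<le> 1" for t by (rule Rm2)
    show "(\<integral>\<^sup>+t\<in>{0..1}. (\<integral>\<^sup>+x. ennreal ((1 + norm x) * norm (?W t x)) \<partial>?\<rho> t) \<partial>lborel) < \<infinity>"
      by (rule R.weighted_speed_finite[OF Rm2 _ fin]) simp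
  qed
  have m\<^sub>c: "ac_density ?m m'" and \<sigma>\<^sub>c: "ac_density ?\<sigma> \<sigma>'"
    by (rule ac_density_cong[OF m'] ac_density_cong[OF \<sigma>']; simp add: clamp01_eq)+
  have cont: "continuous_on UNIV ?m" "continuous_on UNIV ?\<sigma>"
    by (intro continuous_on_compose_clamp01 AC_imp_continuous_on AC)+
  interpret S: affine_push ?\<rho> ?W 1 ?m m' ?\<sigma> \<sigma>'
    by unfold_locales (use m\<^sub>c \<sigma>\<^sub>c cont pos Rm2 in auto)
  interpret T: ce_curve S.\<nu> S.U by (rule S.ce_curve_\<nu>)
  have \<nu>: "S.\<nu> = (\<lambda>t. distr (?\<rho> t) borel (\<lambda>y. ?m t + ?\<sigma> t *\<^sub>R y))"
    unfolding S.\<nu>_def[abs_def] S.A_def[abs_def] ..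
  have sq: "\<sigma> 0 = sqrt (var \<mu>\<^sub>0)" "\<sigma> 1 = sqrt (var \<mu>\<^sub>1)"
    using ends(3,4) AC(3)[of 0] AC(3)[of 1] by (auto simp: real_sqrt_unique)
  have "\<rho> 0 = variance_normalization \<mu>\<^sub>0" "\<rho> 1 = variance_normalization \<mu>\<^sub>1" using CE by (auto simp: CE_def)
  then have "S.\<nu> 0 = distr (variance_normalization \<mu>\<^sub>0) borel (\<lambda>y. barycenter \<mu>\<^sub>0 + sqrt (var \<mu>\<^sub>0) *\<^sub>R y)"
    "S.\<nu> 1 = distr (variance_normalization \<mu>\<^sub>1) borel (\<lambda>y. barycenter \<mu>\<^sub>1 + sqrt (var \<mu>\<^sub>1) *\<^sub>R y)"
    by (simp_all add: \<nu> clamp01_eq ends(1,2) sq)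
  then have "S.\<nu> 0 = \<mu>\<^sub>0" "S.\<nu> 1 = \<mu>\<^sub>1"
    unfolding variance_normalization_eq
    using \<mu> distr_affine_inverse[OF P2D(2)[OF \<mu>(1)]] distr_affine_inverse[OF P2D(2)[OF \<mu>(2)]] by auto
  then have "(S.\<nu>, S.U) \<in> CE \<mu>\<^sub>0 \<mu>\<^sub>1"
    using T.CE_of_ce_curve[OF T.speed_finite[OF S.\<nu>_weighted_speed]] by simp
  then have "(W_var \<mu>\<^sub>0 \<mu>\<^sub>1)\<^sup>2 \<le> variance_cost S.\<nu> S.U"
    unfolding W_var_def esqrt_power2 by (rule INF_lower2) simp
  also have "\<dots> = moment_cost ?m ?\<sigma> + energy ?\<rho> ?W"
    unfolding \<nu>
  proof (rule R.energy_split[OF _ _ m\<^sub>c \<sigma>\<^sub>c cont(2)])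
    show "S.U t \<in> borel_measurable borel" for t
      using measurable_compose[OF measurable_Pair1' S.U_measurable, of t] by simp
    show "S.U t (?m t + ?\<sigma> t *\<^sub>R y) = m' t + \<sigma>' t *\<^sub>R y + ?\<sigma> t *\<^sub>R ?W t y" for t y
      using S.U_A by (simp add: S.A_def)
  qed (use normalized pos in auto)
  also have "moment_cost ?m ?\<sigma> = moment_cost m \<sigma>"
    unfolding moment_cost_eq[OF m\<^sub>c \<sigma>\<^sub>c] moment_cost_eq[OF m' \<sigma>']
    by (intro nn_integral_cong) (auto simp: indicator_def clamp01_eq)
  finally show ?thesis unfolding energy_clamp .
qed auto

section \<open>Products, roots and reciprocals of absolutely continuous functions\<close>

lemma AC_bounded:
  fixes f :: "real \<Rightarrow> 'b::real_normed_vector"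
  assumes "absolutely_continuous_on_unit f"
  obtains K where "K \<ge> 0" "\<And>t. t \<in> {0..1} \<Longrightarrow> norm (f t) \<le> K"
proof -
  obtain K where K: "\<And>t. t \<in> {0..1} \<Longrightarrow> \<bar>norm (f t)\<bar> \<le> K"
    using compact_continuous_bound[of "{0..1::real}" "\<lambda>t. norm (f t)"] continuous_on_norm[OF AC_imp_continuous_on[OF assms]]
    by auto
  show ?thesis
  proof (rule that[of K])
    show "K \<ge> 0" using order_trans[OF abs_ge_zero K[of 0]] by simp
  qed (use K in auto)
qed

lemma AC_scaleR:
  fixes f :: "real \<Rightarrow> real" and g :: "real \<Rightarrow> 'b::real_normed_vector"
  assumes f: "absolutely_continuous_on_unit f" and g: "absolutely_continuous_on_unit g"
  shows "absolutely_continuous_on_unit (\<lambda>t. f t *\<^sub>R g t)"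
proof -
  obtain K where K: "K \<ge> 0" "\<And>t. t \<in> {0..1} \<Longrightarrow> norm (f t) \<le> K" using AC_bounded[OF f] by metis
  obtain L where L: "L \<ge> 0" "\<And>t. t \<in> {0..1} \<Longrightarrow> norm (g t) \<le> L" using AC_bounded[OF g] by metis
  show ?thesis
  proof (rule AC_increments_le[OF f g])
    fix s t :: real assume st: "0 \<le> s" "s \<le> t" "t \<le> 1"
    have "norm (f t *\<^sub>R g t - f s *\<^sub>R g s) = norm (f t *\<^sub>R (g t - g s) + (f t - f s) *\<^sub>R g s)"
      by (simp add: algebra_simps)
    also have "\<dots> \<le> \<bar>f t\<bar> * norm (g t - g s) + \<bar>f t - f s\<bar> * norm (g s)"
      using norm_triangle_ineq by (metis norm_scaleR)
    also have "\<dots> \<le> (K + L) * norm (g t - g s) + \<bar>f t - f s\<bar> * (K + L)"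
      using K(2)[of t] L(2)[of s] K(1) L(1) st by (intro add_mono mult_left_mono mult_right_mono) auto
    finally show "norm (f t *\<^sub>R g t - f s *\<^sub>R g s) \<le> (K + L) * (norm (f t - f s) + norm (g t - g s))"
      by (simp add: algebra_simps)
  qed
qed

lemma AC_norm_power2:
  fixes g :: "real \<Rightarrow> 'b::real_inner"
  assumes g: "absolutely_continuous_on_unit g"
  shows "absolutely_continuous_on_unit (\<lambda>t. (norm (g t))\<^sup>2)"
proof -
  have "absolutely_continuous_on_unit (\<lambda>t. norm (g t))"
  proof (rule AC_increments_le[OF g g, where C=1])
    fix s t
    show "norm (norm (g t) - norm (g s)) \<le> 1 * (norm (g t - g s) + norm (g t - g s))"
      unfolding real_norm_def mult_1 by (rule order_trans[OF norm_triangle_ineq3]) simp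
  qed
  from AC_scaleR[OF this this] show ?thesis by (simp add: power2_eq_square)
qed

lemma AC_diff:
  fixes f g :: "real \<Rightarrow> 'b::real_normed_vector"
  assumes "absolutely_continuous_on_unit f" "absolutely_continuous_on_unit g"
  shows "absolutely_continuous_on_unit (\<lambda>t. f t - g t)"
proof (rule AC_increments_le[OF assms, where C=1])
  fix s t
  have "norm (f t - g t - (f s - g s)) = norm ((f t - f s) - (g t - g s))" by (simp add: algebra_simps)
  also have "\<dots> \<le> norm (f t - f s) + norm (g t - g s)" by (rule norm_triangle_ineq4)
  finally show "norm (f t - g t - (f s - g s)) \<le> 1 * (norm (f t - f s) + norm (g t - g s))" by simp
qed

text \<open>The continuous f attains a positive minimum on [0, 1], so a Lipschitz bound for h away
  from 0 is enough.\<close>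

lemma AC_compose_positive:
  fixes f h :: "real \<Rightarrow> real"
  assumes f: "absolutely_continuous_on_unit f" and pos: "\<And>t. t \<in> {0..1} \<Longrightarrow> f t > 0"
    and h: "\<And>\<delta>. \<delta> > 0 \<Longrightarrow> \<exists>L\<ge>0. \<forall>x\<ge>\<delta>. \<forall>y\<ge>\<delta>. \<bar>h y - h x\<bar> \<le> L * \<bar>y - x\<bar>"
  shows "absolutely_continuous_on_unit (\<lambda>t. h (f t))"
proof -
  obtain u where u: "u \<in> {0..1}" "\<And>t. t \<in> {0..1} \<Longrightarrow> f u \<le> f t"
    using continuous_attains_inf[of "{0..1::real}" f] AC_imp_continuous_on[OF f] by auto
  obtain L where L: "L \<ge> 0" "\<And>x y. f u \<le> x \<Longrightarrow> f u \<le> y \<Longrightarrow> \<bar>h y - h x\<bar> \<le> L * \<bar>y - x\<bar>"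
    using h[OF pos[OF u(1)]] by blast
  show ?thesis
  proof (rule AC_increments_le[OF f f])
    fix s t :: real assume "0 \<le> s" "s \<le> t" "t \<le> 1"
    then have "\<bar>h (f t) - h (f s)\<bar> \<le> L * \<bar>f t - f s\<bar>" by (intro L(2) u(2)) auto
    also have "\<dots> \<le> L * (\<bar>f t - f s\<bar> + \<bar>f t - f s\<bar>)" using L(1) by (intro mult_left_mono) auto
    finally show "norm (h (f t) - h (f s)) \<le> L * (norm (f t - f s) + norm (f t - f s))" by simp
  qed
qed

lemma AC_sqrt:
  assumes "absolutely_continuous_on_unit f" "\<And>t. t \<in> {0..1} \<Longrightarrow> f t > 0"
  shows "absolutely_continuous_on_unit (\<lambda>t. sqrt (f t))"
proof (rule AC_compose_positive[OF assms])
  fix \<delta> :: real assume \<delta>: "\<delta> > 0"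
  have "\<bar>sqrt y - sqrt x\<bar> \<le> 1 / sqrt \<delta> * \<bar>y - x\<bar>" if x: "x \<ge> \<delta>" and y: "y \<ge> \<delta>" for x y
  proof -
    have s: "sqrt \<delta> \<le> sqrt x" "sqrt \<delta> \<le> sqrt y" "0 < sqrt \<delta>" using x y \<delta> by auto
    have "y - x = (sqrt y - sqrt x) * (sqrt y + sqrt x)"
      using x y \<delta> by (simp add: algebra_simps)
    then have "\<bar>y - x\<bar> = \<bar>sqrt y - sqrt x\<bar> * (sqrt y + sqrt x)" using s by (simp add: abs_mult)
    moreover have "\<bar>sqrt y - sqrt x\<bar> * sqrt \<delta> \<le> \<bar>sqrt y - sqrt x\<bar> * (sqrt y + sqrt x)"
      by (rule mult_left_mono) (use s in linarith, simp)
    ultimately have "\<bar>sqrt y - sqrt x\<bar> * sqrt \<delta> \<le> \<bar>y - x\<bar>" by simp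
    then show ?thesis using s(3) by (simp add: pos_le_divide_eq)
  qed
  then show "\<exists>L\<ge>0. \<forall>x\<ge>\<delta>. \<forall>y\<ge>\<delta>. \<bar>sqrt y - sqrt x\<bar> \<le> L * \<bar>y - x\<bar>"
    using \<delta> by (intro exI[of _ "1 / sqrt \<delta>"]) simp
qed

lemma AC_inverse:
  assumes "absolutely_continuous_on_unit f" "\<And>t. t \<in> {0..1} \<Longrightarrow> f t > (0::real)"
  shows "absolutely_continuous_on_unit (\<lambda>t. 1 / f t)"
proof (rule AC_compose_positive[OF assms, of "\<lambda>x. 1 / x"])
  fix \<delta> :: real assume \<delta>: "\<delta> > 0"
  have "\<bar>1 / y - 1 / x\<bar> \<le> 1 / (\<delta> * \<delta>) * \<bar>y - x\<bar>" if x: "x \<ge> \<delta>" and y: "y \<ge> \<delta>" for x y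
  proof -
    have p: "x > 0" "y > 0" using x y \<delta> by auto
    have "1 / y - 1 / x = (x - y) / (x * y)" using p by (simp add: field_simps)
    then have "\<bar>1 / y - 1 / x\<bar> = \<bar>y - x\<bar> / (x * y)" using p by (simp add: abs_mult abs_minus_commute)
    also have "\<dots> \<le> \<bar>y - x\<bar> / (\<delta> * \<delta>)"
      using x y \<delta> by (intro divide_left_mono mult_mono) auto
    finally show ?thesis by simp
  qed
  then show "\<exists>L\<ge>0. \<forall>x\<ge>\<delta>. \<forall>y\<ge>\<delta>. \<bar>1 / y - 1 / x\<bar> \<le> L * \<bar>y - x\<bar>"
    using \<delta> by (intro exI[of _ "1 / (\<delta> * \<delta>)"]) simp
qed

text \<open>Finite cost gives bounded moments and positive variance, so the mean b and the standard
  deviation s are absolutely continuous and compete in \<open>D_var\<close>, while the normalized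
  curve competes in \<open>W_var01\<close>. Pushing it forward by y -> b t + s t y restores the
  original curve, so \<open>energy_split\<close> evaluates the original cost.\<close>

lemma variance_cost_ge:
  fixes \<mu>\<^sub>0 \<mu>\<^sub>1 :: "'a::euclidean_space measure"
  assumes v0: "var \<mu>\<^sub>0 > 0" and CE: "(\<mu>, V) \<in> CE \<mu>\<^sub>0 \<mu>\<^sub>1" and fin: "variance_cost \<mu> V < \<infinity>"
  shows "(D_var \<mu>\<^sub>0 \<mu>\<^sub>1)\<^sup>2 + (W_var01 (variance_normalization \<mu>\<^sub>0) (variance_normalization \<mu>\<^sub>1))\<^sup>2 \<le> variance_cost \<mu> V"
proof -
  define M where "M t = \<mu> (clamp01 t)" for t
  define Vc where "Vc t = V (clamp01 t)" for t
  have cost_eq: "variance_cost M Vc = variance_cost \<mu> V"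
    by (intro nn_integral_cong) (auto simp: indicator_def clamp01_eq M_def Vc_def)
  have ends: "M 0 = \<mu>\<^sub>0" "M 1 = \<mu>\<^sub>1" using CE by (auto simp: CE_def M_def clamp01_eq)
  have clamp: "M (clamp01 t) = M t" for t by (simp add: M_def clamp01_eq)
  interpret C: ce_curve M Vc unfolding M_def[abs_def] Vc_def[abs_def] by (rule CE_imp_ce_curve[OF CE])
  interpret C: finite_cost_curve M Vc
    by unfold_locales (use fin v0 in \<open>simp_all add: cost_eq ends\<close>)
  obtain B where B: "\<And>t. t \<in> {0..1} \<Longrightarrow> C.m2 t \<le> B" using C.m2_bounded by blast
  have B': "C.m2 t \<le> B" for t
    using B[of "clamp01 t"] by (simp add: C.m2_def clamp)
  interpret C: moment_curve M Vc B
    by unfold_locales (rule B C.weighted_speed_finite[OF B _ C.energy_of_bounded[OF B]]; simp)+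
  define b where "b t = barycenter (M t)" for t
  define s where "s t = sqrt (var (M t))" for t
  have vpos: "var (M t) > 0" for t using C.var_pos[of "clamp01 t"] by (simp add: clamp)
  then have spos: "s t > 0" for t by (simp add: s_def)
  have b_AC: "absolutely_continuous_on_unit b" unfolding b_def[abs_def] by (rule C.AC_barycenter)
  have "absolutely_continuous_on_unit (\<lambda>t. C.m2 t - (norm (b t))\<^sup>2)"
    by (intro AC_diff C.AC_m2 AC_norm_power2 b_AC)
  then have "absolutely_continuous_on_unit (\<lambda>t. var (M t))"
    by (simp add: C.m2_def b_def var_eq[OF C.P2])
  then have s_AC: "absolutely_continuous_on_unit s" unfolding s_def[abs_def] by (rule AC_sqrt[OF _ vpos])
  define l where "l t = 1 / s t" for t
  define a where "a t = (- (1 / s t)) *\<^sub>R b t" for t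
  have l_AC: "absolutely_continuous_on_unit l" unfolding l_def[abs_def] by (rule AC_inverse[OF s_AC spos])
  have l0_AC: "absolutely_continuous_on_unit (\<lambda>t. (-1) *\<^sub>R l t)"
    by (rule AC_scaleR[OF _ l_AC], rule AC_increments_le[OF l_AC l_AC, where C=1]) simp
  have a_AC: "absolutely_continuous_on_unit a"
    using AC_scaleR[OF l0_AC b_AC] by (simp add: a_def[abs_def] l_def)
  obtain b' where b': "ac_density b b'" by (rule AC_density[OF b_AC])
  obtain s' where s': "ac_density s s'" by (rule AC_density[OF s_AC])
  have bc: "b (clamp01 t) = b t" and sc: "s (clamp01 t) = s t" for t by (simp_all add: b_def s_def clamp)
  have b_cont: "continuous_on UNIV b"
    using continuous_on_compose_clamp01[OF AC_imp_continuous_on[OF b_AC]] by (simp add: bc)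
  have s_cont: "continuous_on UNIV s"
    using continuous_on_compose_clamp01[OF AC_imp_continuous_on[OF s_AC]] by (simp add: sc)
  have s0: "s t \<noteq> 0" for t using spos[of t] by simp
  have l_cont: "continuous_on UNIV l" and a_cont: "continuous_on UNIV a"
    unfolding l_def[abs_def] a_def[abs_def] using s0 by (intro continuous_intros s_cont b_cont; simp)+
  have [measurable]: "s \<in> borel_measurable borel" "b \<in> borel_measurable borel" "s' \<in> borel_measurable borel" "b' \<in> borel_measurable borel"
    using s_cont b_cont ac_densityD(2)[OF s'] ac_densityD(2)[OF b'] by (auto intro: borel_measurable_continuous_onI)
  \<comment> \<open>Quotient and product rule; the indicator makes the candidate vanish off [0, 1],
    as \<open>ac_densityI_AE\<close> requires.\<close>
  define l' where "l' t = indicator {0..1} t * (- (s' t / (s t)\<^sup>2))" for t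
  define a' where "a' t = indicator {0..1} t *\<^sub>R ((s' t / (s t)\<^sup>2) *\<^sub>R b t - (1 / s t) *\<^sub>R b' t)" for t
  have l_der: "(l has_vector_derivative - (s' t / (s t)\<^sup>2)) (at t)" if "(s has_vector_derivative s' t) (at t)" for t
  proof -
    have "(s has_real_derivative s' t) (at t)" using that by (simp add: has_real_derivative_iff_has_vector_derivative)
    from DERIV_divide[OF DERIV_const[of 1] this s0]
    have "((\<lambda>t. 1 / s t) has_real_derivative - (s' t / (s t)\<^sup>2)) (at t)" by (simp add: power2_eq_square)
    then show ?thesis unfolding l_def[abs_def] by (simp add: has_real_derivative_iff_has_vector_derivative)
  qed
  have l_dens: "ac_density l l'"
  proof (rule ac_densityI_AE[OF l_AC])
    show "l' \<in> borel_measurable borel" unfolding l'_def[abs_def] by measurable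
    show "AE t in lborel. t \<in> {0<..<1} \<longrightarrow> (l has_vector_derivative l' t) (at t)"
      using ac_density_has_vector_derivative[OF s']
    proof eventually_elim
      case (elim t)
      show ?case
      proof
        assume t: "t \<in> {0<..<1}"
        then have "l' t = - (s' t / (s t)\<^sup>2)" by (simp add: l'_def)
        then show "(l has_vector_derivative l' t) (at t)" using l_der[of t] elim t by (simp only: mp)
      qed
    qed
  qed (simp add: l'_def)
  have a_dens: "ac_density a a'"
  proof (rule ac_densityI_AE[OF a_AC])
    show "a' \<in> borel_measurable borel" unfolding a'_def[abs_def] by measurable
    show "AE t in lborel. t \<in> {0<..<1} \<longrightarrow> (a has_vector_derivative a' t) (at t)"
      using ac_density_has_vector_derivative[OF s'] ac_density_has_vector_derivative[OF b']
    proof eventually_elim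
      case (elim t)
      show ?case
      proof
        assume t: "t \<in> {0<..<1}"
        have ld: "(l has_real_derivative - (s' t / (s t)\<^sup>2)) (at t)"
          using l_der elim(1) t by (simp add: has_real_derivative_iff_has_vector_derivative)
        have bd: "(b has_vector_derivative b' t) (at t)" using elim(2) t by simp
        have "((\<lambda>t. - (l t *\<^sub>R b t)) has_vector_derivative - (l t *\<^sub>R b' t + (- (s' t / (s t)\<^sup>2)) *\<^sub>R b t)) (at t)"
          by (intro has_vector_derivative_minus has_vector_derivative_scaleR ld bd)
        then show "(a has_vector_derivative a' t) (at t)"
          using t by (simp add: a_def[abs_def] a'_def l_def)
      qed
    qed
  qed (simp add: a'_def)
  interpret S: affine_push M Vc B a a' l l'
    by unfold_locales (use a_dens l_dens a_cont l_cont spos B' in \<open>auto simp: l_def\<close>)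
  have \<nu>_eq: "S.\<nu> t = distr (M t) borel (\<lambda>x. (- (1 / s t)) *\<^sub>R b t + (1 / s t) *\<^sub>R x)" for t
    unfolding S.\<nu>_def S.A_def[abs_def] by (simp only: a_def l_def)
  have ss: "(s t)\<^sup>2 = var (M t)" for t by (simp add: s_def var_nonneg)
  have bary: "barycenter (S.\<nu> t) = 0" for t
    unfolding \<nu>_eq affine_push_forward(2)[OF C.P2] by (simp add: b_def)
  have var: "var (S.\<nu> t) = 1" for t
    unfolding \<nu>_eq affine_push_forward(3)[OF C.P2] ss[symmetric] using s0[of t] by (simp add: power_divide)
  interpret T: ce_curve S.\<nu> S.U by (rule S.ce_curve_\<nu>)
  interpret T: moment_curve S.\<nu> S.U 1
  proof
    show "T.m2 t \<le> 1" for t using var_eq[OF T.P2, of t] by (simp add: T.m2_def bary var)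
  qed (rule S.\<nu>_weighted_speed)
  have split: "variance_cost (\<lambda>t. distr (S.\<nu> t) borel (\<lambda>y. b t + s t *\<^sub>R y)) Vc = moment_cost b s + energy S.\<nu> S.U"
  proof (rule T.energy_split[OF bary var b' s' s_cont spos])
    show "Vc t \<in> borel_measurable borel" for t
      using measurable_compose[OF measurable_Pair1' C.V_measurable, of t] by simp
    fix t :: real and y assume t: "t \<in> {0..1}"
    define x where "x = b t + s t *\<^sub>R y"
    have "S.A t x = y" using s0[of t] by (simp add: S.A_def a_def l_def x_def scaleR_add_right)
    then have U: "S.U t y = a' t + l' t *\<^sub>R x + l t *\<^sub>R Vc t x" using S.U_A[of t x] by simp
    have 1: "s t * (s' t / (s t)\<^sup>2) = s' t / s t" "s t * (s' t / (s t)\<^sup>2 * s t) = s' t"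
      using s0[of t] by (simp_all add: power2_eq_square)
    have "s t *\<^sub>R a' t = (s' t / s t) *\<^sub>R b t - b' t"
      using t s0[of t] by (simp add: a'_def scaleR_diff_right power2_eq_square)
    moreover have "s t *\<^sub>R (l' t *\<^sub>R x) = - ((s' t / s t) *\<^sub>R b t) - s' t *\<^sub>R y"
      using t s0[of t] by (simp add: l'_def x_def scaleR_add_right scaleR_diff_right power2_eq_square)
    moreover have "s t *\<^sub>R (l t *\<^sub>R Vc t x) = Vc t x" using s0[of t] by (simp add: l_def)
    \<comment> \<open>The terms in b t cancel; what remains is the decomposition of the velocity,
      solved for its normalized part.\<close>
    ultimately have "s t *\<^sub>R S.U t y = Vc t x - b' t - s' t *\<^sub>R y"
      unfolding U scaleR_add_right by simp
    then show "Vc t (b t + s t *\<^sub>R y) = b' t + s' t *\<^sub>R y + s t *\<^sub>R S.U t y" by (simp add: x_def)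
  qed
  have pushed_back: "distr (S.\<nu> t) borel (\<lambda>y. b t + s t *\<^sub>R y) = M t" for t
    unfolding \<nu>_eq by (rule distr_affine_inverse[OF P2D(2)[OF C.P2] s0])
  have "(D_var \<mu>\<^sub>0 \<mu>\<^sub>1)\<^sup>2 \<le> moment_cost b s"
    unfolding D_var_def esqrt_power2
  proof (rule INF_lower2[of "(b, s)"])
    show "(b, s) \<in> {(m :: real \<Rightarrow> 'a, \<sigma> :: real \<Rightarrow> real). absolutely_continuous_on_unit m \<and> absolutely_continuous_on_unit \<sigma> \<and>
       (\<forall>t\<in>{0..1}. 0 \<le> \<sigma> t) \<and> m 0 = barycenter \<mu>\<^sub>0 \<and> m 1 = barycenter \<mu>\<^sub>1 \<and> (\<sigma> 0)\<^sup>2 = var \<mu>\<^sub>0 \<and> (\<sigma> 1)\<^sup>2 = var \<mu>\<^sub>1}"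
      using b_AC s_AC spos ss ends by (auto simp: b_def less_imp_le)
  qed simp
  moreover have "(W_var01 (variance_normalization \<mu>\<^sub>0) (variance_normalization \<mu>\<^sub>1))\<^sup>2 \<le> energy S.\<nu> S.U"
    unfolding W_var01_def esqrt_power2
  proof (rule INF_lower2[of "(S.\<nu>, S.U)"])
    have "S.\<nu> 0 = variance_normalization \<mu>\<^sub>0" "S.\<nu> 1 = variance_normalization \<mu>\<^sub>1"
      unfolding variance_normalization_eq by (simp_all only: \<nu>_eq s_def b_def ends)
    then show "(S.\<nu>, S.U) \<in> {(\<mu>, V). (\<mu>, V) \<in> CE (variance_normalization \<mu>\<^sub>0) (variance_normalization \<mu>\<^sub>1) \<and>
       (\<forall>t\<in>{0..1}. barycenter (\<mu> t) = 0 \<and> var (\<mu> t) = 1)}"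
      using T.CE_of_ce_curve[OF T.speed_finite[OF S.\<nu>_weighted_speed]] bary var by simp
  qed simp
  ultimately have "(D_var \<mu>\<^sub>0 \<mu>\<^sub>1)\<^sup>2 + (W_var01 (variance_normalization \<mu>\<^sub>0) (variance_normalization \<mu>\<^sub>1))\<^sup>2 \<le> moment_cost b s + energy S.\<nu> S.U"
    by (rule add_mono)
  then show ?thesis using split unfolding pushed_back cost_eq by simp
qed

text \<open>For finite w, w - a \<le> b is equivalent to w \<le> a + b even though subtraction in
  \<open>ennreal\<close> is truncated; so the two infima can be taken one after the other.\<close>

lemma le_INF_add_INF:
  fixes w :: ennreal
  assumes "w \<noteq> \<top>" "\<And>x y. x \<in> S \<Longrightarrow> y \<in> T \<Longrightarrow> w \<le> f x + g y"
  shows "w \<le> (INF x\<in>S. f x) + (INF y\<in>T. g y)"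
proof -
  have "w - (INF y\<in>T. g y) \<le> f x" if "x \<in> S" for x
  proof -
    have "w - f x \<le> (INF y\<in>T. g y)"
      using assms that by (intro INF_greatest) (auto simp: ennreal_minus_le_iff)
    then show ?thesis using assms(1) by (simp add: ennreal_minus_le_iff add.commute)
  qed
  then have "w - (INF y\<in>T. g y) \<le> (INF x\<in>S. f x)" by (rule INF_greatest)
  then show ?thesis using assms(1) by (simp add: ennreal_minus_le_iff add.commute)
qed

theorem theorem1p33:
  fixes \<mu>\<^sub>0 \<mu>\<^sub>1 :: "'a::euclidean_space measure"
  assumes "\<mu>\<^sub>0 \<in> P2" and "\<mu>\<^sub>1 \<in> P2"
    and "var \<mu>\<^sub>0 > 0" and "var \<mu>\<^sub>1 > 0"
  shows "W_var \<mu>\<^sub>0 \<mu>\<^sub>1 < \<infinity> \<and>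
    (W_var \<mu>\<^sub>0 \<mu>\<^sub>1)\<^sup>2 = (D_var \<mu>\<^sub>0 \<mu>\<^sub>1)\<^sup>2 +
      (W_var01 (variance_normalization \<mu>\<^sub>0) (variance_normalization \<mu>\<^sub>1))\<^sup>2"
proof (intro conjI antisym)
  show fin: "W_var \<mu>\<^sub>0 \<mu>\<^sub>1 < \<infinity>" by (rule W_var_finite[OF assms])
  \<comment> \<open>Finiteness of the cost is an ingredient of the identity too: the two infima are
    separated by subtraction.\<close>
  have "(W_var \<mu>\<^sub>0 \<mu>\<^sub>1)\<^sup>2 \<noteq> \<top>" using fin by (simp add: power2_eq_square ennreal_mult_eq_top_iff)
  then show "(W_var \<mu>\<^sub>0 \<mu>\<^sub>1)\<^sup>2 \<le> (D_var \<mu>\<^sub>0 \<mu>\<^sub>1)\<^sup>2 +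
      (W_var01 (variance_normalization \<mu>\<^sub>0) (variance_normalization \<mu>\<^sub>1))\<^sup>2"
    unfolding D_var_def W_var01_def esqrt_power2
  proof (rule le_INF_add_INF)
    fix p q
    assume p: "p \<in> {(m :: real \<Rightarrow> 'a, \<sigma> :: real \<Rightarrow> real). absolutely_continuous_on_unit m \<and> absolutely_continuous_on_unit \<sigma> \<and>
       (\<forall>t\<in>{0..1}. 0 \<le> \<sigma> t) \<and> m 0 = barycenter \<mu>\<^sub>0 \<and> m 1 = barycenter \<mu>\<^sub>1 \<and> (\<sigma> 0)\<^sup>2 = var \<mu>\<^sub>0 \<and> (\<sigma> 1)\<^sup>2 = var \<mu>\<^sub>1}"
      and q: "q \<in> {(\<mu>, V). (\<mu>, V) \<in> CE (variance_normalization \<mu>\<^sub>0) (variance_normalization \<mu>\<^sub>1) \<and>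
       (\<forall>t\<in>{0..1}. barycenter (\<mu> t) = 0 \<and> var (\<mu> t) = 1)}"
    obtain m \<sigma> where p': "p = (m, \<sigma>)" by (cases p)
    obtain \<rho> W where q': "q = (\<rho>, W)" by (cases q)
    show "(W_var \<mu>\<^sub>0 \<mu>\<^sub>1)\<^sup>2 \<le> (case p of (m, \<sigma>) \<Rightarrow> moment_cost m \<sigma>) + (case q of (\<mu>, V) \<Rightarrow> energy \<mu> V)"
    proof -
      from p have P: "absolutely_continuous_on_unit m" "absolutely_continuous_on_unit \<sigma>" "\<And>t. t \<in> {0..1} \<Longrightarrow> 0 \<le> \<sigma> t"
        "m 0 = barycenter \<mu>\<^sub>0" "m 1 = barycenter \<mu>\<^sub>1" "(\<sigma> 0)\<^sup>2 = var \<mu>\<^sub>0" "(\<sigma> 1)\<^sup>2 = var \<mu>\<^sub>1"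
        unfolding p' by blast+
      from q have Q: "(\<rho>, W) \<in> CE (variance_normalization \<mu>\<^sub>0) (variance_normalization \<mu>\<^sub>1)"
        "\<And>t. t \<in> {0..1} \<Longrightarrow> barycenter (\<rho> t) = 0" "\<And>t. t \<in> {0..1} \<Longrightarrow> var (\<rho> t) = 1"
        unfolding q' by blast+
      show ?thesis unfolding p' q' prod.case by (rule W_var_power2_le[OF assms Q P])
    qed
  qed
  show "(D_var \<mu>\<^sub>0 \<mu>\<^sub>1)\<^sup>2 + (W_var01 (variance_normalization \<mu>\<^sub>0) (variance_normalization \<mu>\<^sub>1))\<^sup>2 \<le> (W_var \<mu>\<^sub>0 \<mu>\<^sub>1)\<^sup>2"
    unfolding W_var_def esqrt_power2
  proof (rule INF_greatest)
    fix p assume p: "p \<in> CE \<mu>\<^sub>0 \<mu>\<^sub>1"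
    obtain \<mu> V where p': "p = (\<mu>, V)" by (cases p)
    show "(D_var \<mu>\<^sub>0 \<mu>\<^sub>1)\<^sup>2 + (W_var01 (variance_normalization \<mu>\<^sub>0) (variance_normalization \<mu>\<^sub>1))\<^sup>2 \<le>
        (case p of (\<mu>, V) \<Rightarrow> variance_cost \<mu> V)"
    proof (cases "variance_cost \<mu> V < \<infinity>")
      case True
      then show ?thesis using variance_cost_ge[OF assms(3) _ True] p by (simp add: p')
    next
      case False
      then show ?thesis unfolding p' prod.case infinity_ennreal_def not_less top.extremum_unique by simp
    qed
  qed
qed

end
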